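(* Let $\Omega\subset\mathbb R^3$ be a bounded Lipschitz domain with connected complement $\mathbb R^3\setminus\overline\Omega$ and $\mathbf 0\in\partial\Omega$, and let $h,M>0$ be such that $(B_h\times(-M,M))\cap\Omega=S_h\times(-M,M)$, where $-\pi<\theta_m<\theta_M<\pi$ and $\theta_M-\theta_m\neq\pi$. Let $\omega\in\mathbb R_+$ and let $\mathbf v,\mathbf w\in H^1(\Omega)^3$ satisfy $$\mathcal L\mathbf v+\omega^2\mathbf v=\mathbf 0\ \text{in }\Omega,\qquad \mathcal L\mathbf w+\omega^2(1+V)\mathbf w=\mathbf 0\ \text{in }\Omega,\qquad \mathbf w=\mathbf v,\ \ T_\nu\mathbf v=T_\nu\mathbf w\ \text{on }\Gamma,$$ where $\Gamma\subset\partial\Omega$ is an open subset containing $\Gamma_h^\pm\times(-M,M)$. Let $q:=1+V$ and suppose that for some $0<\alpha<1$, $\mathbf v\in C^\alpha(\overline{S_h}\times[-M,M])^3$, $q\mathbf w\in C^\alpha(\overline{S_h}\times[-M,M])^3$ and $\mathbf v-\mathbf w\in C^{1,\alpha}(\overline{S_h}\times[-M,M])^3$. If $x_3^c\in(-M,M)$ and $V=q-1$ is continuous near the edge point $(\mathbf 0,x_3^c)$ (on $\overline{S_h}\times[-M,M]$) with $V(\mathbf 0,x_3^c)\neq0$, then $$\mathbf v(\mathbf 0,x_3^c)=\mathbf w(\mathbf 0,x_3^c)=\mathbf 0.$$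
   Context: Real constants $\lambda,\mu$ satisfy $\mu>0$ and $3\lambda+2\mu>0$. The Lamé operator is $\mathcal L\mathbf u=\mu\Delta\mathbf u+(\lambda+\mu)\nabla(\nabla\cdot\mathbf u)$. $V\in L^\infty(\Omega)$ is real-valued and nontrivial. $\mathbf v,\mathbf w$ are $\mathbb C^3$-valued; equations hold in the distributional sense and boundary values in the trace sense. With $\nu$ the outward unit normal, $T_\nu\mathbf v=2\mu\,\partial_\nu\mathbf v+\lambda\nu(\nabla\cdot\mathbf v)+\mu\,\nu\times(\nabla\times\mathbf v)$. Write $\mathbf x=(\mathbf x',x_3)$, $\mathbf x'\in\mathbb R^2$. In $\mathbb R^2$: $W=\{\mathbf x'\ne\mathbf 0:\theta_m<\arg(x_1+\mathrm ix_2)<\theta_M\}$, $\Gamma^-=\{\mathbf x'\ne\mathbf 0:\arg(x_1+\mathrm ix_2)=\theta_m\}$, $\Gamma^+=\{\mathbf x'\ne\mathbf 0:\arg(x_1+\mathrm ix_2)=\theta_M\}$, $B_h$ is the open disk of radius $h$ centred at $\mathbf 0\in\mathbb R^2$, $S_h=W\cap B_h$, $\Gamma_h^\pm=\Gamma^\pm\cap B_h$. *)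

theory Defs
  imports "HOL-Analysis.Analysis"
begin

definition pd :: "'n \<Rightarrow> (real^'n \<Rightarrow> 'b::real_normed_vector) \<Rightarrow> real^'n \<Rightarrow> 'b" where
  "pd i f x = frechet_derivative f (at x) (axis i 1)"

primrec Ck :: "nat \<Rightarrow> (real^'n \<Rightarrow> 'b::real_normed_vector) \<Rightarrow> bool" where
  "Ck 0 f \<longleftrightarrow> continuous_on UNIV f"
| "Ck (Suc k) f \<longleftrightarrow> (\<forall>x. f differentiable (at x)) \<and> (\<forall>i. Ck k (pd i f))"

definition smooth :: "(real^'n \<Rightarrow> 'b::real_normed_vector) \<Rightarrow> bool" where
  "smooth f \<longleftrightarrow> (\<forall>k. Ck k f)"

definition supp :: "(real^'n \<Rightarrow> real) \<Rightarrow> (real^'n) set" where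
  "supp \<phi> = closure {x. \<phi> x \<noteq> 0}"

definition test_function :: "(real^'n) set \<Rightarrow> (real^'n \<Rightarrow> real) \<Rightarrow> bool" where
  "test_function \<Omega> \<phi> \<longleftrightarrow> smooth \<phi> \<and> compact (supp \<phi>) \<and> supp \<phi> \<subseteq> \<Omega>"

definition diverg :: "(real^3 \<Rightarrow> complex^3) \<Rightarrow> real^3 \<Rightarrow> complex" where
  "diverg u x = (\<Sum>j\<in>UNIV. pd j u x $ j)"

definition curl :: "(real^3 \<Rightarrow> complex^3) \<Rightarrow> real^3 \<Rightarrow> complex^3" where
  "curl u x = vector [pd 2 u x $ 3 - pd 3 u x $ 2,
                      pd 3 u x $ 1 - pd 1 u x $ 3,
                      pd 1 u x $ 2 - pd 2 u x $ 1]"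

text \<open>The library's \<^const>\<open>cross3\<close> is for real vectors only.\<close>

definition ccross :: "complex^3 \<Rightarrow> complex^3 \<Rightarrow> complex^3" where
  "ccross a b = vector [a$2 * b$3 - a$3 * b$2,
                        a$3 * b$1 - a$1 * b$3,
                        a$1 * b$2 - a$2 * b$1]"

definition cvec :: "real^3 \<Rightarrow> complex^3" where
  "cvec a = (\<chi> i. complex_of_real (a $ i))"

definition lame :: "real \<Rightarrow> real \<Rightarrow> (real^3 \<Rightarrow> complex^3) \<Rightarrow> real^3 \<Rightarrow> complex^3" where
  "lame lam \<mu> u x =
     \<mu> *\<^sub>R (\<Sum>j\<in>UNIV. pd j (pd j u) x) + (lam + \<mu>) *\<^sub>R (\<chi> k. pd k (diverg u) x)"

definition traction :: "real \<Rightarrow> real \<Rightarrow> real^3 \<Rightarrow> (real^3 \<Rightarrow> complex^3) \<Rightarrow> real^3 \<Rightarrow> complex^3" where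
  "traction lam \<mu> n u x =
     (2 * \<mu>) *\<^sub>R (\<Sum>j\<in>UNIV. n $ j *\<^sub>R pd j u x)
     + lam *\<^sub>R (diverg u x *s cvec n)
     + \<mu> *\<^sub>R ccross (cvec n) (curl u x)"

type_synonym ('n, 'b) distr = "(real^'n \<Rightarrow> real) \<Rightarrow> 'b"

definition regular_distr ::
    "(real^'n) set \<Rightarrow> (real^'n \<Rightarrow> 'b::{banach,second_countable_topology}) \<Rightarrow> ('n::finite, 'b) distr" where
  "regular_distr \<Omega> u \<phi> = (LINT x|lebesgue_on \<Omega>. \<phi> x *\<^sub>R u x)"

definition distr_pd :: "'n::finite \<Rightarrow> ('n::finite, 'b::real_vector) distr \<Rightarrow> ('n::finite, 'b) distr" where
  "distr_pd i T \<phi> = - T (pd i \<phi>)"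

definition distr_diverg :: "(3, complex^3) distr \<Rightarrow> (3, complex) distr" where
  "distr_diverg T \<phi> = (\<Sum>j\<in>UNIV. distr_pd j T \<phi> $ j)"

definition distr_lame :: "real \<Rightarrow> real \<Rightarrow> (3, complex^3) distr \<Rightarrow> (3, complex^3) distr" where
  "distr_lame lam \<mu> T \<phi> =
     \<mu> *\<^sub>R (\<Sum>j\<in>UNIV. distr_pd j (distr_pd j T) \<phi>)
     + (lam + \<mu>) *\<^sub>R (\<chi> k. distr_pd k (distr_diverg T) \<phi>)"

definition distr_eq_on :: "(real^'n) set \<Rightarrow> ('n::finite, 'b) distr \<Rightarrow> ('n::finite, 'b) distr \<Rightarrow> bool" where
  "distr_eq_on \<Omega> S T \<longleftrightarrow> (\<forall>\<phi>. test_function \<Omega> \<phi> \<longrightarrow> S \<phi> = T \<phi>)"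

definition L2 :: "'a measure \<Rightarrow> ('a \<Rightarrow> 'b::{banach,second_countable_topology}) \<Rightarrow> bool" where
  "L2 N f \<longleftrightarrow> f \<in> borel_measurable N \<and> integrable N (\<lambda>x. (norm (f x))\<^sup>2)"

definition L2_tendsto ::
    "'a measure \<Rightarrow> (nat \<Rightarrow> 'a \<Rightarrow> 'b::{banach,second_countable_topology}) \<Rightarrow> ('a \<Rightarrow> 'b) \<Rightarrow> bool" where
  "L2_tendsto N U u \<longleftrightarrow>
     (\<lambda>n. \<integral>\<^sup>+ x. ennreal ((norm (U n x - u x))\<^sup>2) \<partial>N) \<longlonglongrightarrow> 0"

definition Linfty :: "'a measure \<Rightarrow> ('a \<Rightarrow> real) \<Rightarrow> bool" where
  "Linfty N f \<longleftrightarrow> f \<in> borel_measurable N \<and> (\<exists>C. AE x in N. \<bar>f x\<bar> \<le> C)"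

definition weak_pd ::
    "(real^'n) set \<Rightarrow> 'n \<Rightarrow> (real^'n \<Rightarrow> 'b::{banach,second_countable_topology}) \<Rightarrow> (real^'n \<Rightarrow> 'b) \<Rightarrow> bool" where
  "weak_pd \<Omega> i u g \<longleftrightarrow> distr_eq_on \<Omega> (distr_pd i (regular_distr \<Omega> u)) (regular_distr \<Omega> g)"

definition H1 :: "(real^'n) set \<Rightarrow> (real^'n \<Rightarrow> 'b::{banach,second_countable_topology}) \<Rightarrow> bool" where
  "H1 \<Omega> u \<longleftrightarrow> L2 (lebesgue_on \<Omega>) u \<and> (\<forall>i. \<exists>g. L2 (lebesgue_on \<Omega>) g \<and> weak_pd \<Omega> i u g)"

text \<open>Convergence in \<open>H\<^sup>1(\<Omega>)\<close> of functions that are smooth on the whole space, so that their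
  weak derivatives are the classical ones.\<close>

definition smooth_H1_tendsto ::
    "(real^'n) set \<Rightarrow> (nat \<Rightarrow> real^'n \<Rightarrow> 'b::{banach,second_countable_topology}) \<Rightarrow> (real^'n \<Rightarrow> 'b) \<Rightarrow> bool" where
  "smooth_H1_tendsto \<Omega> U u \<longleftrightarrow>
     (\<forall>n. smooth (U n)) \<and> L2_tendsto (lebesgue_on \<Omega>) U u \<and>
     (\<forall>i. \<exists>g. L2 (lebesgue_on \<Omega>) g \<and> weak_pd \<Omega> i u g \<and>
              L2_tendsto (lebesgue_on \<Omega>) (\<lambda>n. pd i (U n)) g)"

definition horiz :: "real^3 \<Rightarrow> real^2" where
  "horiz x = vector [x$1, x$2]"

definition lipschitz_domain :: "(real^3) set \<Rightarrow> bool" where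
  "lipschitz_domain \<Omega> \<longleftrightarrow>
     open \<Omega> \<and> connected \<Omega> \<and> \<Omega> \<noteq> {} \<and>
     (\<forall>p\<in>frontier \<Omega>. \<exists>R g r C.
        orthogonal_transformation R \<and> lipschitz_on C UNIV (g :: real^2 \<Rightarrow> real) \<and> r > 0 \<and>
        \<Omega> \<inter> ball p r = {x \<in> ball p r. R (x - p) $ 3 < g (horiz (R (x - p)))})"

text \<open>Two-dimensional Hausdorff (outer) measure, normalised to agree with area on planes. The
  covering sets must be bounded since \<^const>\<open>diameter\<close> is meaningless otherwise.\<close>

definition hausdorff2_outer :: "'a::metric_space set \<Rightarrow> ennreal" where
  "hausdorff2_outer A =
     (SUP \<delta>\<in>{0<..}.
       INF C\<in>{C. A \<subseteq> (\<Union>n. C n) \<and> (\<forall>n. bounded (C n) \<and> diameter (C n) \<le> \<delta>)}.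
         (\<Sum>n. ennreal (pi * (diameter (C n) / 2)\<^sup>2)))"

definition hausdorff2 :: "'a::metric_space measure" where
  "hausdorff2 = measure_of UNIV (sets borel) hausdorff2_outer"

definition surface_measure :: "(real^3) set \<Rightarrow> (real^3) measure" where
  "surface_measure \<Omega> = restrict_space hausdorff2 (frontier \<Omega>)"

text \<open>A unit vector \<open>n\<close> is the outward normal at \<open>x\<close> if, to first order at \<open>x\<close>, the set is the
  half-space \<open>{y. (y - x) \<bullet> n < 0}\<close>. Such an \<open>n\<close> is unique, and on the boundary of a Lipschitz
  domain it exists exactly where the local graph function is differentiable, hence almost
  everywhere.\<close>

definition is_outward_normal :: "(real^3) set \<Rightarrow> real^3 \<Rightarrow> real^3 \<Rightarrow> bool" where
  "is_outward_normal \<Omega> x n \<longleftrightarrow>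
     norm n = 1 \<and>
     (\<forall>\<epsilon>>0. \<exists>r>0. \<forall>y\<in>ball x r.
        ((y - x) \<bullet> n < - \<epsilon> * norm (y - x) \<longrightarrow> y \<in> \<Omega>) \<and>
        ((y - x) \<bullet> n > \<epsilon> * norm (y - x) \<longrightarrow> y \<notin> \<Omega>))"

definition outward_normal :: "(real^3) set \<Rightarrow> real^3 \<Rightarrow> real^3" where
  "outward_normal \<Omega> x = (THE n. is_outward_normal \<Omega> x n)"

text \<open>The trace operator is the continuous extension to \<open>H\<^sup>1(\<Omega>)\<close> of the restriction of smooth
  functions to the boundary.\<close>

definition has_trace :: "(real^3) set \<Rightarrow> (real^3 \<Rightarrow> complex^3) \<Rightarrow> (real^3 \<Rightarrow> complex^3) \<Rightarrow> bool" where
  "has_trace \<Omega> u g \<longleftrightarrow>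
     L2 (surface_measure \<Omega>) g \<and>
     (\<exists>U. smooth_H1_tendsto \<Omega> U u \<and> L2_tendsto (surface_measure \<Omega>) U g)"

definition trace_eq_on ::
    "(real^3) set \<Rightarrow> (real^3) set \<Rightarrow> (real^3 \<Rightarrow> complex^3) \<Rightarrow> (real^3 \<Rightarrow> complex^3) \<Rightarrow> bool" where
  "trace_eq_on \<Omega> \<Gamma> u v \<longleftrightarrow>
     (\<exists>g k. has_trace \<Omega> u g \<and> has_trace \<Omega> v k \<and>
            (AE x in surface_measure \<Omega>. x \<in> \<Gamma> \<longrightarrow> g x = k x))"

text \<open>For a field \<open>u\<close> in \<open>H\<^sup>1(\<Omega>)\<close> whose distributional Lame operator lies in \<open>L\<^sup>2(\<Omega>)\<close>,
  the traction is an element of \<open>H\<^bsup>-1/2\<^esup>(\<partial>\<Omega>)\<close>, given here by its action \<open>t\<close> on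
  (restrictions of) test functions on the whole space. It is the continuous extension of the
  classical traction of smooth fields with respect to the norm of \<open>u\<close> in \<open>H\<^sup>1\<close> plus that of
  its Lame operator in \<open>L\<^sup>2\<close>. By Betti's formula the limit \<open>t\<close> does not depend on the
  approximating sequence.\<close>

definition has_traction ::
    "(real^3) set \<Rightarrow> real \<Rightarrow> real \<Rightarrow> (real^3 \<Rightarrow> complex^3) \<Rightarrow> (3, complex^3) distr \<Rightarrow> bool" where
  "has_traction \<Omega> lam \<mu> u t \<longleftrightarrow>
     (\<exists>U f. smooth_H1_tendsto \<Omega> U u \<and>
        L2 (lebesgue_on \<Omega>) f \<and>
        distr_eq_on \<Omega> (distr_lame lam \<mu> (regular_distr \<Omega> u)) (regular_distr \<Omega> f) \<and>
        L2_tendsto (lebesgue_on \<Omega>) (\<lambda>n. lame lam \<mu> (U n)) f \<and>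
        (\<forall>\<phi>. test_function UNIV \<phi> \<longrightarrow>
           (\<lambda>n. LINT x|surface_measure \<Omega>.
                  \<phi> x *\<^sub>R traction lam \<mu> (outward_normal \<Omega> x) (U n) x) \<longlonglongrightarrow> t \<phi>))"

definition traction_eq_on ::
    "(real^3) set \<Rightarrow> (real^3) set \<Rightarrow> real \<Rightarrow> real \<Rightarrow>
     (real^3 \<Rightarrow> complex^3) \<Rightarrow> (real^3 \<Rightarrow> complex^3) \<Rightarrow> bool" where
  "traction_eq_on \<Omega> \<Gamma> lam \<mu> u v \<longleftrightarrow>
     (\<exists>s t. has_traction \<Omega> lam \<mu> u s \<and> has_traction \<Omega> lam \<mu> v t \<and>
        (\<forall>\<phi>. test_function UNIV \<phi> \<and> supp \<phi> \<inter> frontier \<Omega> \<subseteq> \<Gamma> \<longrightarrow> s \<phi> = t \<phi>))"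

text \<open>The Hoelder conditions are pointwise on \<open>K\<close>, including its boundary: applied to elements of
  \<open>H\<^sup>1\<close> or \<open>L\<^sup>\<infinity>\<close> they refer to the representative that is continuous up to the boundary.\<close>

definition holder :: "real \<Rightarrow> (real^'n) set \<Rightarrow> (real^'n \<Rightarrow> 'b::real_normed_vector) \<Rightarrow> bool" where
  "holder \<alpha> K f \<longleftrightarrow>
     bounded (f ` K) \<and> (\<exists>C. \<forall>x\<in>K. \<forall>y\<in>K. norm (f x - f y) \<le> C * (norm (x - y)) powr \<alpha>)"

text \<open>The space \<open>C\<^bsup>1,\<alpha>\<^esup>(K)\<close> for a set \<open>K\<close> that is the closure of its interior: the first
  derivatives in the interior extend to functions in \<open>C\<^bsup>\<alpha>\<^esup>(K)\<close>.\<close>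

definition holder1 :: "real \<Rightarrow> (real^'n) set \<Rightarrow> (real^'n \<Rightarrow> 'b::real_normed_vector) \<Rightarrow> bool" where
  "holder1 \<alpha> K f \<longleftrightarrow>
     bounded (f ` K) \<and> continuous_on K f \<and>
     (\<forall>x\<in>interior K. f differentiable (at x)) \<and>
     (\<forall>i. \<exists>g. holder \<alpha> K g \<and> (\<forall>x\<in>interior K. pd i f x = g x))"

definition sector :: "real \<Rightarrow> real \<Rightarrow> (real^2) set" where
  "sector a b = {y. y \<noteq> 0 \<and> a < Arg (Complex (y$1) (y$2)) \<and> Arg (Complex (y$1) (y$2)) < b}"

definition ray :: "real \<Rightarrow> (real^2) set" where
  "ray a = {y. y \<noteq> 0 \<and> Arg (Complex (y$1) (y$2)) = a}"

definition cyl :: "(real^2) set \<Rightarrow> real set \<Rightarrow> (real^3) set" where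
  "cyl A I = {x. horiz x \<in> A \<and> x$3 \<in> I}"

end

theory Submission
  imports Defs
begin

text \<open>The difference \<open>u = v - w\<close> has vanishing Cauchy data on the two faces of the wedge, so Betti's formula
  makes it a weak solution of the Lame system with source \<open>F = \<omega>\<^sup>2 ((1 + V) w - v)\<close> against all smooth test
  functions supported near the edge, without boundary terms. Testing the weak first derivatives with
  concentrating horizontal cut-offs shows that \<open>u = 0\<close> on the edge. Testing the curl of the system with
  \<open>X (x\<^sub>1 + i x\<^sub>2 + \<delta>)\<^bsup>-5\<^esup>\<close>, which is harmonic up to derivatives of the cut-off \<open>X\<close>, and letting
  \<open>\<delta>\<close> tend to \<open>0\<close> isolates \<open>(1, i, 0) \<times> F\<close> on the edge; together with the complex conjugate this gives
  \<open>F = 0\<close> there. At the given point, \<open>v = w\<close> and \<open>(1 + V) w = v\<close> with \<open>V \<noteq> 0\<close> force \<open>v = w = 0\<close>.\<close>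


text \<open>The traction condition is known only for test functions whose support meets the boundary
  inside \<open>\<Gamma>\<close>, and \<open>\<Gamma>\<close> is given to contain the open faces,
  not the edge. The gap is closed because a line has zero capacity in three dimensions: cut-offs
  whose gradient has size n on a tube of radius 1/n have gradients bounded in L2 that tend to 0
  against any fixed L2 field. The same estimate removes the weak gradient of \<open>u\<close> from
  the test that yields its edge value. Limits at the edge produce constants, the integrals of a
  kernel over the cross-section of the wedge. They are not computed. Each depends on the kernel
  alone, so it is shown to be nonzero by putting the constant 1 in place of the field: integrating
  along both faces then gives an explicit integral over the edge. This fixes the exponent 5: powers
  of 1/(z + 1) from the fourth on have an integrable majorant on the wedge, and the sixth power is
  the leading term both of a mixed second derivative of a fourth power and of a first derivative of
  a fifth power.\<close>

section \<open>Metric outer measures and the Hausdorff measure\<close>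

text \<open>Caratheodory's criterion. The part of X outside the closed set S is exhausted by the
  sets A n of points at distance at least 1/(n+1) from S, on which f is additive together with the
  part inside S. What A n misses is covered by the shells D k with k at least n. Shells whose
  indices differ by two are separated, so the even and the odd shells each have total size at most f
  X; the series of shells converges and its tails vanish.\<close>

lemma metric_outer_measure_closed_in_lambda_system:
  fixes f :: "'a::metric_space set \<Rightarrow> ennreal"
  assumes f0: "f {} = 0" and mono: "\<And>A B. A \<subseteq> B \<Longrightarrow> f A \<le> f B"
    and csub: "\<And>A :: nat \<Rightarrow> 'a set. f (\<Union>i. A i) \<le> (\<Sum>i. f (A i))"
    and metric: "\<And>A B e. e > 0 \<Longrightarrow> (\<And>x y. x \<in> A \<Longrightarrow> y \<in> B \<Longrightarrow> e \<le> dist x y) \<Longrightarrow> f A + f B \<le> f (A \<union> B)"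
    and S: "closed S"
  shows "S \<in> lambda_system UNIV (Pow UNIV) f"
proof -
  have sub2: "f (A \<union> B) \<le> f A + f B" for A B
  proof -
    define C where "C n = (if n = 0 then A else if n = Suc 0 then B else {})" for n :: nat
    have "f (A \<union> B) = f (\<Union>n. C n)"
      by (rule arg_cong[of _ _ f]) (auto simp: C_def split: if_splits)
    also have "\<dots> \<le> (\<Sum>n. f (C n))" by (rule csub)
    also have "\<dots> = (\<Sum>n\<in>{0, Suc 0}. f (C n))" by (rule suminf_finite) (auto simp: C_def f0)
    also have "\<dots> = f A + f B" by (simp add: C_def)
    finally show ?thesis .
  qed
  have main: "f (S \<inter> X) + f (X - S) \<le> f X" for X
  proof (cases "S = {} \<or> f X = top")
    case True
    then show ?thesis by (auto simp: f0)
  next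
    case False
    then have ne: "S \<noteq> {}" and fin: "f X < top" by (auto simp: less_top)
    define A where "A n = {x \<in> X - S. infdist x S \<ge> 1 / real (Suc n)}" for n
    define D where "D n = A (Suc n) - A n" for n
    have A_mono: "A n \<subseteq> A m" if "n \<le> m" for n m
    proof -
      have "1 / real (Suc m) \<le> 1 / real (Suc n)" using that by (simp add: frac_le)
      then show ?thesis unfolding A_def by force
    qed
    have AS: "f (S \<inter> X) + f (A n) \<le> f X" for n
    proof -
      have "f (S \<inter> X) + f (A n) \<le> f ((S \<inter> X) \<union> A n)"
      proof (rule metric[of "1 / real (Suc n)"])
        fix x y assume "x \<in> S \<inter> X" "y \<in> A n"
        then show "1 / real (Suc n) \<le> dist x y"
          unfolding A_def using infdist_le[of x S y] by (auto simp: dist_commute)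
      qed auto
      also have "\<dots> \<le> f X" by (rule mono) (auto simp: A_def)
      finally show ?thesis .
    qed
    \<comment> \<open>The distance to S is 1-Lipschitz, so a gap between the distance ranges of two
      sets is a lower bound for the distance between the sets.\<close>
    have sep: "f B + f (D m) \<le> f (B \<union> D m)"
      if "B \<subseteq> A (Suc n)" "Suc n < m" for B n m
    proof (rule metric[of "1 / real (Suc (Suc n)) - 1 / real (Suc (Suc (Suc n)))"])
      show "0 < 1 / real (Suc (Suc n)) - 1 / real (Suc (Suc (Suc n)))" by (simp add: frac_less2)
      fix x y assume x: "x \<in> B" and y: "y \<in> D m"
      have "infdist x S \<ge> 1 / real (Suc (Suc n))" using x that by (auto simp: A_def)
      moreover have "infdist y S < 1 / real (Suc m)" using y by (auto simp: A_def D_def)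
      moreover have "1 / real (Suc m) \<le> 1 / real (Suc (Suc (Suc n)))"
        using that by (intro frac_le) auto
      moreover have "infdist x S \<le> infdist y S + dist x y" by (rule infdist_triangle)
      ultimately show "1 / real (Suc (Suc n)) - 1 / real (Suc (Suc (Suc n))) \<le> dist x y" by linarith
    qed
    \<comment> \<open>Here p is a parity, used with the values 0 and 1: neighbouring shells may
      touch, so only every other one is summed at a time.\<close>
    have step: "(\<Sum>k<n. f (D (2*k+p))) \<le> f (\<Union>k<n. D (2*k+p))" for n p
    proof (induction n)
      case (Suc n)
      show ?case
      proof (cases n)
        case 0 then show ?thesis by (simp add: lessThan_Suc)
      next
        case (Suc n')
        have "(\<Sum>k<Suc n. f (D (2*k+p))) \<le> f (\<Union>k<n. D (2*k+p)) + f (D (2*n+p))"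
          using Suc.IH by (simp add: add_right_mono)
        also have "\<dots> \<le> f ((\<Union>k<n. D (2*k+p)) \<union> D (2*n+p))"
        proof (rule sep)
          have "D (2*k+p) \<subseteq> A (Suc (2*n'+p))" if "k < n" for k
          proof -
            have "D (2*k+p) \<subseteq> A (Suc (2*k+p))" by (auto simp: D_def)
            also have "\<dots> \<subseteq> A (Suc (2*n'+p))" using that Suc by (intro A_mono) auto
            finally show ?thesis .
          qed
          then show "(\<Union>k<n. D (2*k+p)) \<subseteq> A (Suc (2*n'+p))" by blast
          show "Suc (2*n'+p) < 2*n+p" using Suc by simp
        qed
        also have "(\<Union>k<n. D (2*k+p)) \<union> D (2*n+p) = (\<Union>k<Suc n. D (2*k+p))"
          by (auto simp: lessThan_Suc)
        finally show ?thesis .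
      qed
    qed (simp add: f0)
    have bound: "(\<Sum>k<n. f (D (2*k+p))) \<le> f X" for n p
      by (rule order_trans[OF step mono]) (auto simp: D_def A_def)
    have sumle: "(\<Sum>k<n. f (D k)) \<le> 2 * f X" for n
    proof -
      have "(\<Sum>k<n. f (D k)) \<le> (\<Sum>k<2*n. f (D k))" by (rule sum_mono2) auto
      also have "\<dots> = (\<Sum>k<n. f (D (2*k+0))) + (\<Sum>k<n. f (D (2*k+1)))"
        by (induction n) (auto simp: algebra_simps)
      also have "\<dots> \<le> f X + f X" by (intro add_mono bound)
      finally show ?thesis by (simp add: mult_2)
    qed
    have "(\<Sum>k. f (D k)) \<le> 2 * f X" by (rule suminf_le_const[OF _ sumle]) simp
    also have "\<dots> < top" using fin by (simp add: ennreal_mult_less_top)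
    finally have fins: "(\<Sum>k. f (D k)) < top" .
    have tail: "f (X - S) \<le> f (A n) + (\<Sum>k. f (D (k + n)))" for n
    proof -
      have "X - S \<subseteq> A n \<union> (\<Union>k. D (k + n))"
      proof
        fix x assume x: "x \<in> X - S"
        then have "infdist x S > 0"
          using S ne by (metis DiffE in_closed_iff_infdist_zero infdist_nonneg less_eq_real_def)
        then obtain m where m: "1 / real (Suc m) < infdist x S"
          using nat_approx_posE by blast
        then have xm: "x \<in> A m" using x by (auto simp: A_def)
        define j where "j = (LEAST j. x \<in> A j)"
        have j: "x \<in> A j" unfolding j_def using xm by (rule LeastI)
        show "x \<in> A n \<union> (\<Union>k. D (k + n))"
        proof (cases "j \<le> n")
          case True then show ?thesis using j A_mono by blast
        next
          case False
          then obtain i where i: "j = Suc i" "n \<le> i" by (cases j) auto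
          have "x \<notin> A i" using i not_less_Least[of i "\<lambda>j. x \<in> A j"] by (auto simp: j_def[symmetric])
          then have "x \<in> D ((i - n) + n)" using j i by (simp add: D_def)
          then show ?thesis by blast
        qed
      qed
      then have "f (X - S) \<le> f (A n \<union> (\<Union>k. D (k + n)))" by (rule mono)
      also have "\<dots> \<le> f (A n) + f (\<Union>k. D (k + n))" by (rule sub2)
      also have "\<dots> \<le> f (A n) + (\<Sum>k. f (D (k + n)))" by (intro add_left_mono csub)
      finally show ?thesis .
    qed
    have lim: "(\<lambda>n. \<Sum>k. f (D (k + n))) \<longlonglongrightarrow> 0"
    proof -
      define d where "d k = enn2real (f (D k))" for k
      have fd: "f (D k) = ennreal (d k)" for k
        unfolding d_def
        by (metis fins ennreal_enn2real ennreal_suminf_lessD)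
      have d0: "d k \<ge> 0" for k by (simp add: d_def)
      have sd: "summable d"
        using fins d0 unfolding fd by (intro summable_suminf_not_top) auto
      have "(\<lambda>n. \<Sum>k. d (k + n)) \<longlonglongrightarrow> 0"
        by (rule suminf_exist_split2[OF sd])
      then have "(\<lambda>n. ennreal (\<Sum>k. d (k + n))) \<longlonglongrightarrow> ennreal 0" by (intro tendsto_ennrealI)
      moreover have "(\<Sum>k. f (D (k + n))) = ennreal (\<Sum>k. d (k + n))" for n
        unfolding fd using d0 sd by (intro suminf_ennreal2) (auto simp: summable_iff_shift)
      ultimately show ?thesis by simp
    qed
    have "f (S \<inter> X) + f (X - S) \<le> f X + (\<Sum>k. f (D (k + n)))" for n
    proof -
      have "f (S \<inter> X) + f (X - S) \<le> f (S \<inter> X) + (f (A n) + (\<Sum>k. f (D (k + n))))"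
        by (intro add_left_mono tail)
      also have "\<dots> = (f (S \<inter> X) + f (A n)) + (\<Sum>k. f (D (k + n)))" by (simp add: add.assoc)
      also have "\<dots> \<le> f X + (\<Sum>k. f (D (k + n)))" by (intro add_right_mono AS)
      finally show ?thesis .
    qed
    moreover have "(\<lambda>n. f X + (\<Sum>k. f (D (k + n)))) \<longlonglongrightarrow> f X + 0"
      by (intro tendsto_add lim tendsto_const)
    ultimately show ?thesis
      using LIMSEQ_le_const[of "\<lambda>n. f X + (\<Sum>k. f (D (k + n)))" "f X + 0"] by auto
  qed
  have "f (S \<inter> X) + f ((UNIV - S) \<inter> X) = f X" for X
  proof (rule antisym)
    have "(UNIV - S) \<inter> X = X - S" by auto
    then show "f (S \<inter> X) + f ((UNIV - S) \<inter> X) \<le> f X" using main by simp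
    have "X = (S \<inter> X) \<union> ((UNIV - S) \<inter> X)" by auto
    then show "f X \<le> f (S \<inter> X) + f ((UNIV - S) \<inter> X)" using sub2 by metis
  qed
  then show ?thesis by (simp add: lambda_system_def)
qed

lemma metric_outer_measure_space:
  fixes f :: "'a::metric_space set \<Rightarrow> ennreal"
  assumes f0: "f {} = 0" and mono: "\<And>A B. A \<subseteq> B \<Longrightarrow> f A \<le> f B"
    and csub: "\<And>A :: nat \<Rightarrow> 'a set. f (\<Union>i. A i) \<le> (\<Sum>i. f (A i))"
    and metric: "\<And>A B e. e > 0 \<Longrightarrow> (\<And>x y. x \<in> A \<Longrightarrow> y \<in> B \<Longrightarrow> e \<le> dist x y) \<Longrightarrow> f A + f B \<le> f (A \<union> B)"
  shows "measure_space UNIV (sets borel) f"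
proof -
  have ms: "measure_space UNIV (lambda_system UNIV (Pow UNIV) f) f"
    by (rule sigma_algebra.caratheodory_lemma[OF sigma_algebra_Pow])
       (auto simp: outer_measure_space_def positive_def increasing_def countably_subadditive_def f0 mono csub)
  then have sa: "sigma_algebra UNIV (lambda_system UNIV (Pow UNIV) f)"
    by (simp add: measure_space_def)
  have "sets borel \<subseteq> lambda_system UNIV (Pow UNIV) f"
  proof -
    have "sets (borel :: 'a measure) = sigma_sets UNIV (Collect closed)"
      by (subst borel_eq_closed) (simp add: sets_measure_of)
    also have "\<dots> \<subseteq> lambda_system UNIV (Pow UNIV) f"
      by (rule sigma_algebra.sigma_sets_subset[OF sa])
         (intro subsetI metric_outer_measure_closed_in_lambda_system[OF f0 mono csub metric]; blast)
    finally show ?thesis .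
  qed
  then show ?thesis
    using measure_down[OF ms sets.sigma_algebra_axioms[of "borel::'a measure", simplified]] by simp
qed

text \<open>The premeasure at mesh \<open>\<delta>\<close> in Hausdorff's construction.
  Subadditivity and additivity on separated sets are proved at a fixed mesh and then passed to the
  supremum.\<close>

definition hausdorff2_size :: "real \<Rightarrow> 'a::metric_space set \<Rightarrow> ennreal" where
  "hausdorff2_size \<delta> A =
     (INF C\<in>{C. A \<subseteq> (\<Union>n. C n) \<and> (\<forall>n. bounded (C n) \<and> diameter (C n) \<le> \<delta>)}.
         (\<Sum>n. ennreal (pi * (diameter (C n) / 2)\<^sup>2)))"

lemma hausdorff2_size_le:
  "A \<subseteq> (\<Union>n. C n) \<Longrightarrow> (\<And>n. bounded (C n)) \<Longrightarrow> (\<And>n. diameter (C n) \<le> \<delta>) \<Longrightarrow>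
   hausdorff2_size \<delta> A \<le> (\<Sum>n. ennreal (pi * (diameter (C n) / 2)\<^sup>2))"
  unfolding hausdorff2_size_def by (rule INF_lower) auto

lemma hausdorff2_size_mono: "A \<subseteq> B \<Longrightarrow> hausdorff2_size \<delta> A \<le> hausdorff2_size \<delta> B"
  unfolding hausdorff2_size_def by (rule INF_superset_mono) auto

lemma hausdorff2_size_antimono: "\<delta> \<le> \<epsilon> \<Longrightarrow> hausdorff2_size \<epsilon> A \<le> hausdorff2_size \<delta> A"
  unfolding hausdorff2_size_def by (rule INF_superset_mono) (auto intro: order_trans)

text \<open>The premeasure increases as the mesh shrinks, so the supremum over all positive meshes
  is that of an increasing sequence, for which suprema of sums split.\<close>

lemma hausdorff2_outer_eq: "hausdorff2_outer A = (SUP n. hausdorff2_size (1 / real (Suc n)) A)"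
proof (rule antisym)
  show "hausdorff2_outer A \<le> (SUP n. hausdorff2_size (1 / real (Suc n)) A)"
    unfolding hausdorff2_outer_def hausdorff2_size_def[symmetric]
  proof (rule SUP_least)
    fix \<delta> :: real assume "\<delta> \<in> {0<..}"
    then obtain n where "1 / real (Suc n) < \<delta>" using nat_approx_posE by auto
    then have "hausdorff2_size \<delta> A \<le> hausdorff2_size (1 / real (Suc n)) A"
      by (intro hausdorff2_size_antimono) auto
    then show "hausdorff2_size \<delta> A \<le> (SUP n. hausdorff2_size (1 / real (Suc n)) A)"
      by (meson SUP_upper2 UNIV_I)
  qed
  show "(SUP n. hausdorff2_size (1 / real (Suc n)) A) \<le> hausdorff2_outer A"
    unfolding hausdorff2_outer_def hausdorff2_size_def[symmetric]
    by (rule SUP_least, rule SUP_upper) auto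
qed

lemma hausdorff2_size_incseq: "incseq (\<lambda>n. hausdorff2_size (1 / real (Suc n)) A)"
  by (intro incseq_SucI hausdorff2_size_antimono) (simp add: frac_le)

lemma hausdorff2_size_le_outer: "\<delta> > 0 \<Longrightarrow> hausdorff2_size \<delta> A \<le> hausdorff2_outer A"
  unfolding hausdorff2_outer_def hausdorff2_size_def[symmetric] by (rule SUP_upper) auto

lemma hausdorff2_size_countably_subadditive:
  "hausdorff2_size \<delta> (\<Union>i. A i) \<le> (\<Sum>i. hausdorff2_size \<delta> (A i))"
proof (rule ennreal_le_epsilon)
  let ?w = "\<lambda>C::'a set. ennreal (pi * (diameter C / 2)\<^sup>2)"
  fix e :: real assume "0 < e" and "(\<Sum>i. hausdorff2_size \<delta> (A i)) < top"
  then have *: "hausdorff2_size \<delta> (A n) < hausdorff2_size \<delta> (A n) + e * (1/2)^Suc n" for n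
    by (auto simp add: less_top dest!: ennreal_suminf_lessD)
  have "\<exists>C. A n \<subseteq> (\<Union>i. C i) \<and> (\<forall>i. bounded (C i) \<and> diameter (C i) \<le> \<delta>) \<and>
          (\<Sum>i. ?w (C i)) \<le> hausdorff2_size \<delta> (A n) + e * (1/2)^Suc n" for n
    using *[of n] unfolding hausdorff2_size_def INF_less_iff by (auto intro: less_imp_le)
  then obtain B where B: "\<And>n. A n \<subseteq> (\<Union>i. B n i)" "\<And>n i. bounded (B n i)"
      "\<And>n i. diameter (B n i) \<le> \<delta>"
      "\<And>n. (\<Sum>i. ?w (B n i)) \<le> hausdorff2_size \<delta> (A n) + e * (1/2)^Suc n" by metis
  define C where "C = case_prod B o prod_decode"
  have "(\<Union>i. A i) \<subseteq> (\<Union>i. C i)"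
    using B(1) by (auto simp add: C_def subset_eq) (metis prod.case prod_encode_inverse)
  then have "hausdorff2_size \<delta> (\<Union>i. A i) \<le> (\<Sum>i. ?w (C i))"
    by (rule hausdorff2_size_le) (simp_all add: C_def B split_beta)
  also have "\<dots> = (\<Sum>n. \<Sum>i. ?w (B n i))"
    unfolding C_def comp_def
    by (rule suminf_ennreal_2dimen[where f="\<lambda>p. ?w (case_prod B p)"]) (simp only: prod.case)
  also have "\<dots> \<le> (\<Sum>n. hausdorff2_size \<delta> (A n) + e * (1/2) ^ Suc n)"
    by (intro suminf_le B) auto
  also have "... = (\<Sum>n. hausdorff2_size \<delta> (A n)) + (\<Sum>n. ennreal e * ennreal ((1/2) ^ Suc n))"
    using \<open>0 < e\<close> by (subst suminf_add[symmetric])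
                     (auto simp del: ennreal_suminf_cmult simp add: ennreal_mult[symmetric])
  also have "\<dots> = (\<Sum>n. hausdorff2_size \<delta> (A n)) + e"
    unfolding ennreal_suminf_cmult
    by (subst suminf_ennreal_eq[OF zero_le_power power_half_series]) auto
  finally show "hausdorff2_size \<delta> (\<Union>i. A i) \<le> (\<Sum>i. hausdorff2_size \<delta> (A i)) + e" .
qed

lemma hausdorff2_outer_mono: "A \<subseteq> B \<Longrightarrow> hausdorff2_outer A \<le> hausdorff2_outer B"
  unfolding hausdorff2_outer_eq by (intro SUP_mono) (auto intro: hausdorff2_size_mono)

lemma hausdorff2_outer_empty: "hausdorff2_outer {} = 0"
proof -
  have "hausdorff2_size (1 / real (Suc n)) {} \<le> 0" for n
    using hausdorff2_size_le[of "{}" "\<lambda>_. {}" "1 / real (Suc n)"] by simp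
  then have "hausdorff2_outer {} \<le> (0::ennreal)"
    unfolding hausdorff2_outer_eq by (rule SUP_least)
  then show ?thesis by simp
qed

lemma hausdorff2_outer_countably_subadditive:
  "hausdorff2_outer (\<Union>i. A i) \<le> (\<Sum>i. hausdorff2_outer (A i))"
  unfolding hausdorff2_outer_eq[of "\<Union>i. A i"]
proof (rule SUP_least)
  fix n
  have "hausdorff2_size (1 / real (Suc n)) (\<Union>i. A i) \<le> (\<Sum>i. hausdorff2_size (1 / real (Suc n)) (A i))"
    by (rule hausdorff2_size_countably_subadditive)
  also have "\<dots> \<le> (\<Sum>i. hausdorff2_outer (A i))"
    by (intro suminf_le hausdorff2_size_le_outer) auto
  finally show "hausdorff2_size (1 / real (Suc n)) (\<Union>i. A i) \<le> (\<Sum>i. hausdorff2_outer (A i))" .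
qed

text \<open>A covering set of diameter below e cannot meet both A and B, so a cover of the union
  splits into a cover of A and a cover of B without using any set twice.\<close>

lemma hausdorff2_size_separated:
  assumes "\<delta> < e" and sep: "\<And>x y. x \<in> A \<Longrightarrow> y \<in> B \<Longrightarrow> e \<le> dist x y"
  shows "hausdorff2_size \<delta> A + hausdorff2_size \<delta> B \<le> hausdorff2_size \<delta> (A \<union> B)"
  unfolding hausdorff2_size_def[of \<delta> "A \<union> B"]
proof (rule INF_greatest)
  let ?w = "\<lambda>C::'a set. ennreal (pi * (diameter C / 2)\<^sup>2)"
  fix C :: "nat \<Rightarrow> 'a set"
  assume "C \<in> {C. A \<union> B \<subseteq> (\<Union>n. C n) \<and> (\<forall>n. bounded (C n) \<and> diameter (C n) \<le> \<delta>)}"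
  then have C: "A \<union> B \<subseteq> (\<Union>n. C n)" "\<And>n. bounded (C n)" "\<And>n. diameter (C n) \<le> \<delta>" by auto
  define CA where "CA n = (if C n \<inter> A = {} then {} else C n)" for n
  define CB where "CB n = (if C n \<inter> B = {} then {} else C n)" for n
  have \<delta>0: "0 \<le> \<delta>" using C(2,3) diameter_ge_0 order_trans by blast
  have "hausdorff2_size \<delta> A \<le> (\<Sum>n. ?w (CA n))"
    using C \<delta>0 by (intro hausdorff2_size_le) (fastforce simp: CA_def)+
  moreover have "hausdorff2_size \<delta> B \<le> (\<Sum>n. ?w (CB n))"
    using C \<delta>0 by (intro hausdorff2_size_le) (fastforce simp: CB_def)+
  ultimately have "hausdorff2_size \<delta> A + hausdorff2_size \<delta> B \<le> (\<Sum>n. ?w (CA n)) + (\<Sum>n. ?w (CB n))"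
    by (rule add_mono)
  also have "\<dots> = (\<Sum>n. ?w (CA n) + ?w (CB n))" by (rule suminf_add) auto
  also have "\<dots> \<le> (\<Sum>n. ?w (C n))"
  proof (intro suminf_le)
    fix n
    have "C n \<inter> A = {} \<or> C n \<inter> B = {}"
    proof (rule ccontr)
      assume "\<not> (C n \<inter> A = {} \<or> C n \<inter> B = {})"
      then obtain x y where xy: "x \<in> C n" "x \<in> A" "y \<in> C n" "y \<in> B" by auto
      then have "dist x y \<le> \<delta>" using diameter_bounded_bound[OF C(2)] C(3) order_trans by blast
      then show False using sep[of x y] xy assms(1) by auto
    qed
    then show "?w (CA n) + ?w (CB n) \<le> ?w (C n)" by (auto simp: CA_def CB_def)
  qed auto
  finally show "hausdorff2_size \<delta> A + hausdorff2_size \<delta> B \<le> (\<Sum>n. ?w (C n))" .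
qed

text \<open>\<open>measure_of\<close> yields the zero measure unless the given function is a measure
  on the generated sets, so only this result makes \<open>hausdorff2\<close> agree with
  \<open>hausdorff2_outer\<close> on Borel sets. In the metric property the mesh is taken below the
  distance of the two sets.\<close>

lemma measure_space_hausdorff2: "measure_space UNIV (sets borel) hausdorff2_outer"
proof (rule metric_outer_measure_space[OF hausdorff2_outer_empty hausdorff2_outer_mono
      hausdorff2_outer_countably_subadditive])
  fix A B :: "'a set" and e :: real
  assume e: "e > 0" and sep: "\<And>x y. x \<in> A \<Longrightarrow> y \<in> B \<Longrightarrow> e \<le> dist x y"
  obtain m where m: "1 / real (Suc m) < e" using nat_approx_posE[OF e] by blast
  have "hausdorff2_outer A + hausdorff2_outer B
     = (SUP n. hausdorff2_size (1 / real (Suc n)) A + hausdorff2_size (1 / real (Suc n)) B)"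
    unfolding hausdorff2_outer_eq by (rule ennreal_SUP_add[symmetric]) (rule hausdorff2_size_incseq)+
  also have "\<dots> \<le> hausdorff2_outer (A \<union> B)"
  proof (rule SUP_least)
    fix n
    define \<delta> where "\<delta> = min (1 / real (Suc n)) (1 / real (Suc m))"
    have "hausdorff2_size (1 / real (Suc n)) A + hausdorff2_size (1 / real (Suc n)) B
        \<le> hausdorff2_size \<delta> A + hausdorff2_size \<delta> B"
      by (intro add_mono hausdorff2_size_antimono) (auto simp: \<delta>_def)
    also have "\<dots> \<le> hausdorff2_size \<delta> (A \<union> B)"
      using m sep by (intro hausdorff2_size_separated[of _ e]) (auto simp: \<delta>_def)
    also have "\<dots> \<le> hausdorff2_outer (A \<union> B)"
      by (rule hausdorff2_size_le_outer) (simp add: \<delta>_def)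
    finally show "hausdorff2_size (1 / real (Suc n)) A + hausdorff2_size (1 / real (Suc n)) B
      \<le> hausdorff2_outer (A \<union> B)" .
  qed
  finally show "hausdorff2_outer A + hausdorff2_outer B \<le> hausdorff2_outer (A \<union> B)" .
qed

lemma space_hausdorff2 [simp]: "space hausdorff2 = UNIV"
  by (simp add: hausdorff2_def)

lemma sets_hausdorff2 [simp, measurable_cong]: "sets hausdorff2 = sets borel"
  unfolding hausdorff2_def
  using sets.sigma_sets_eq[of "borel::'a measure"] by (simp add: sets_measure_of_conv)

lemma emeasure_hausdorff2: "A \<in> sets borel \<Longrightarrow> emeasure hausdorff2 A = hausdorff2_outer A"
proof -
  assume A: "A \<in> sets borel"
  have "sigma_algebra UNIV (sets (borel::'a measure))"
    by (metis sets.sigma_algebra_axioms space_borel)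
  moreover have "positive (sets borel) (hausdorff2_outer::'a set \<Rightarrow> _)"
       "countably_additive (sets borel) (hausdorff2_outer::'a set \<Rightarrow> _)"
    using measure_space_hausdorff2 by (auto simp: measure_space_def)
  ultimately show ?thesis
    unfolding hausdorff2_def using A by (intro emeasure_measure_of_sigma)
qed

text \<open>A cover is intersected with A before it is pushed forward, since f contracts distances
  only there; the images have no larger diameter. Applied to f and to its inverse on A, this gives
  invariance under isometries.\<close>

lemma hausdorff2_outer_contraction_le:
  assumes lip: "\<And>x y. x \<in> A \<Longrightarrow> y \<in> A \<Longrightarrow> dist (f x) (f y) \<le> dist x y"
  shows "hausdorff2_outer (f ` A) \<le> hausdorff2_outer A"
  unfolding hausdorff2_outer_eq
proof (rule SUP_mono, intro bexI)
  fix n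
  let ?\<delta> = "1 / real (Suc n)"
  show "hausdorff2_size ?\<delta> (f ` A) \<le> hausdorff2_size ?\<delta> A"
    unfolding hausdorff2_size_def[of _ A]
  proof (rule INF_greatest)
    fix C :: "nat \<Rightarrow> 'a set"
    assume "C \<in> {C. A \<subseteq> (\<Union>n. C n) \<and> (\<forall>n. bounded (C n) \<and> diameter (C n) \<le> ?\<delta>)}"
    then have C: "A \<subseteq> (\<Union>n. C n)" "\<And>n. bounded (C n)" "\<And>n. diameter (C n) \<le> ?\<delta>" by auto
    have dist_le: "dist x y \<le> diameter (C n)" if xy: "x \<in> f ` (C n \<inter> A)" "y \<in> f ` (C n \<inter> A)" for x y n
    proof -
      obtain a b where "x = f a" "y = f b" "a \<in> C n" "b \<in> C n" "a \<in> A" "b \<in> A"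
        using xy by blast
      then show ?thesis using lip[of a b] diameter_bounded_bound[OF C(2)[of n], of a b] by simp
    qed
    have diam: "diameter (f ` (C n \<inter> A)) \<le> diameter (C n)" for n
      using diameter_ge_0[OF C(2)[of n]] unfolding diameter_def[of "f ` (C n \<inter> A)"]
      by (auto intro!: cSUP_least dist_le)
    have bdd: "bounded (f ` (C n \<inter> A))" for n
      unfolding bounded_two_points using dist_le by blast
    have "hausdorff2_size ?\<delta> (f ` A) \<le> (\<Sum>n. ennreal (pi * (diameter (f ` (C n \<inter> A)) / 2)\<^sup>2))"
    proof (rule hausdorff2_size_le)
      show "f ` A \<subseteq> (\<Union>n. f ` (C n \<inter> A))" using C(1) by blast
      show "bounded (f ` (C n \<inter> A))" for n by (rule bdd)
      show "diameter (f ` (C n \<inter> A)) \<le> ?\<delta>" for n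
        using diam C(3) order_trans by blast
    qed
    also have "\<dots> \<le> (\<Sum>n. ennreal (pi * (diameter (C n) / 2)\<^sup>2))"
    proof (intro suminf_le ennreal_leI mult_left_mono power_mono divide_right_mono diam)
      show "0 \<le> diameter (f ` (C n \<inter> A)) / 2" for n
        using bdd diameter_ge_0 by force
    qed auto
    finally show "hausdorff2_size ?\<delta> (f ` A) \<le> (\<Sum>n. ennreal (pi * (diameter (C n) / 2)\<^sup>2))" .
  qed
qed auto

lemma hausdorff2_outer_isometry:
  assumes iso: "\<And>x y. x \<in> A \<Longrightarrow> y \<in> A \<Longrightarrow> dist (f x) (f y) = dist x y"
  shows "hausdorff2_outer (f ` A) = hausdorff2_outer A"
proof (rule antisym)
  show "hausdorff2_outer (f ` A) \<le> hausdorff2_outer A"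
    by (rule hausdorff2_outer_contraction_le) (simp add: iso)
  have inj: "inj_on f A" using iso by (metis dist_eq_0_iff inj_onI)
  have "hausdorff2_outer (inv_into A f ` (f ` A)) \<le> hausdorff2_outer (f ` A)"
    by (rule hausdorff2_outer_contraction_le) (auto simp: iso inj)
  then show "hausdorff2_outer A \<le> hausdorff2_outer (f ` A)" using inj by simp
qed


section \<open>Translation-invariant measures; Hausdorff and Lebesgue measure on planes\<close>

lemma emeasure_lborel_unit_cbox: "emeasure lborel (cbox 0 (One :: 'a::euclidean_space)) = 1"
proof -
  have "(One :: 'a) \<bullet> b = 1" if "b \<in> Basis" for b
    using inner_sum_left_Basis[of b "\<lambda>_. 1"] that by simp
  then show ?thesis by (subst emeasure_lborel_cbox) auto
qed

text \<open>Uniqueness of Haar measure by double integration. With B the unit cube, m A is the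
  integral of 1_A(x) 1_B(y - x) over y and x. Exchanging the order, shifting x by y and exchanging
  back gives the Lebesgue measure of A times m(-B). It serves both for the Hausdorff measure of the
  plane and for images of Lebesgue measure under linear bijections.\<close>

lemma translation_invariant_borel_eq_density_lborel:
  fixes m :: "'a::euclidean_space measure"
  assumes sets: "sets m = sets borel"
    and inv: "\<And>a A. A \<in> sets borel \<Longrightarrow> emeasure m ((\<lambda>x. a + x) -` A) = emeasure m A"
    and fin: "emeasure m (cbox 0 One) < \<infinity>"
  shows "m = density lborel (\<lambda>_. ennreal (measure m (cbox 0 One)))"
proof -
  note [measurable_cong] = sets
  have sp: "space m = UNIV" using sets_eq_imp_space_eq[OF sets] by simp
  let ?B = "cbox (0::'a) One"
  have shift: "distr m m ((+) y) = m" for y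
  proof (rule measure_eqI)
    fix A assume "A \<in> sets (distr m m ((+) y))"
    then have A: "A \<in> sets borel" by (simp add: sets)
    then show "emeasure (distr m m ((+) y)) A = emeasure m A"
      by (subst emeasure_distr) (auto simp: sp inv sets)
  qed simp
  \<comment> \<open>Fubini needs a sigma-finite m: the preimages of the cube under translations by a
    countable dense set cover the space and all have the finite measure of the cube.\<close>
  interpret m: sigma_finite_measure m
  proof
    obtain D :: "'a set" where D: "countable D" "\<And>X. open X \<Longrightarrow> X \<noteq> {} \<Longrightarrow> \<exists>d\<in>D. d \<in> X"
      using countable_dense_exists by blast
    let ?A = "(\<lambda>d. (\<lambda>x. d + x) -` ?B) ` D"
    have B: "(\<lambda>x. d + x) -` ?B \<in> sets borel" for d
      by (rule measurable_sets_borel[of _ borel]) auto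
    have "\<Union>?A = space m"
    proof -
      have "x \<in> \<Union>?A" for x
      proof -
        have "\<exists>d\<in>D. d \<in> (\<lambda>d. d + x) -` box 0 One"
        proof (rule D(2))
          show "open ((\<lambda>d. d + x) -` box 0 One)"
            by (intro open_vimage open_box continuous_intros)
          have "One /\<^sub>R 2 - x \<in> (\<lambda>d. d + x) -` box 0 One" by (auto simp: mem_box)
          then show "(\<lambda>d. d + x) -` box 0 One \<noteq> {}" by blast
        qed
        then obtain d where "d \<in> D" "d + x \<in> box 0 One" by auto
        then have "x \<in> (\<lambda>x. d + x) -` ?B" using box_subset_cbox[of 0 "One::'a"] by blast
        then show ?thesis using \<open>d \<in> D\<close> by blast
      qed
      then show ?thesis unfolding sp by blast
    qed
    then show "\<exists>A. countable A \<and> A \<subseteq> sets m \<and> \<Union> A = space m \<and> (\<forall>a\<in>A. emeasure m a \<noteq> \<infinity>)"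
    proof (intro exI[of _ ?A] conjI ballI)
      show "countable ?A" using D(1) by (rule countable_image)
      show "?A \<subseteq> sets m" using B sets by blast
      fix a assume "a \<in> ?A"
      then obtain d where "a = (\<lambda>x. d + x) -` ?B" by blast
      then show "emeasure m a \<noteq> \<infinity>" using inv[of ?B d] fin by simp
    qed
  qed
  interpret pair_sigma_finite m "lborel::'a measure" ..
  \<comment> \<open>The reflected cube is a translate of the cube, so invariance under translations
    suffices.\<close>
  have minus: "emeasure m {x. - x \<in> ?B} = emeasure m ?B"
  proof -
    have "{x. - x \<in> ?B} = (\<lambda>x. One + x) -` ?B"
      by (auto simp: mem_box inner_simps; drule (1) bspec; linarith)
    then show ?thesis using inv[of ?B] by simp
  qed
  show ?thesis
  proof (rule measure_eqI)
    show "sets m = sets (density lborel (\<lambda>_. ennreal (measure m ?B)))" using sets by simp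
    fix A assume "A \<in> sets m"
    then have A[measurable]: "A \<in> sets borel" using sets by simp
    have Bm[measurable]: "?B \<in> sets borel" by simp
    have "emeasure m A = (\<integral>\<^sup>+x. \<integral>\<^sup>+y. indicator A x * indicator ?B (y - x) \<partial>lborel \<partial>m)"
    proof -
      have "(\<integral>\<^sup>+y. indicator ?B (y - x) \<partial>lborel) = (1::ennreal)" for x :: 'a
      proof -
        have "(\<integral>\<^sup>+y. indicator ?B (y - x) \<partial>lborel) = (\<integral>\<^sup>+y. indicator ?B y \<partial>distr lborel borel ((+) (-x)))"
          by (subst nn_integral_distr) auto
        also have "\<dots> = emeasure lborel ?B" by (simp add: lborel_distr_plus)
        also have "\<dots> = 1" by (rule emeasure_lborel_unit_cbox)
        finally show ?thesis .
      qed
      then show ?thesis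
        by (simp add: nn_integral_cmult sets)
    qed
    also have "\<dots> = (\<integral>\<^sup>+y. \<integral>\<^sup>+x. indicator A x * indicator ?B (y - x) \<partial>m \<partial>lborel)"
      by (rule Fubini'[symmetric]) measurable
    also have "\<dots> = (\<integral>\<^sup>+y. \<integral>\<^sup>+x. indicator A (y + x) * indicator ?B (- x) \<partial>m \<partial>lborel)"
    proof (rule nn_integral_cong)
      fix y :: 'a
      have "(\<integral>\<^sup>+x. indicator A x * indicator ?B (y - x) \<partial>m) =
            (\<integral>\<^sup>+x. indicator A x * indicator ?B (y - x) \<partial>distr m m ((+) y))"
        by (simp only: shift)
      also have "\<dots> = (\<integral>\<^sup>+x. indicator A (y + x) * indicator ?B (y - (y + x)) \<partial>m)"
        by (subst nn_integral_distr) measurable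
      finally show "(\<integral>\<^sup>+x. indicator A x * indicator ?B (y - x) \<partial>m) =
            (\<integral>\<^sup>+x. indicator A (y + x) * indicator ?B (- x) \<partial>m)" by simp
    qed
    also have "\<dots> = (\<integral>\<^sup>+x. \<integral>\<^sup>+y. indicator A (y + x) * indicator ?B (- x) \<partial>lborel \<partial>m)"
      by (rule Fubini') measurable
    also have "\<dots> = (\<integral>\<^sup>+x. emeasure lborel A * indicator {x. - x \<in> ?B} x \<partial>m)"
    proof (rule nn_integral_cong)
      fix x :: 'a
      have "(\<integral>\<^sup>+y. indicator A (y + x) \<partial>lborel) = (\<integral>\<^sup>+y. indicator A y \<partial>distr lborel borel ((+) x))"
        by (subst nn_integral_distr) (auto simp: add.commute)
      also have "\<dots> = emeasure lborel A" by (simp add: lborel_distr_plus)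
      finally show "(\<integral>\<^sup>+y. indicator A (y + x) * indicator ?B (- x) \<partial>lborel) =
          emeasure lborel A * indicator {x. - x \<in> ?B} x"
        by (simp add: nn_integral_multc indicator_def)
    qed
    also have "\<dots> = emeasure lborel A * emeasure m {x. - x \<in> ?B}"
      by (subst nn_integral_cmult_indicator) auto
    also have "\<dots> = emeasure (density lborel (\<lambda>_. ennreal (measure m ?B))) A"
      using fin by (simp add: minus emeasure_density_const emeasure_eq_ennreal_measure mult.commute)
    finally show "emeasure m A = emeasure (density lborel (\<lambda>_. ennreal (measure m ?B))) A" .
  qed
qed

lemma One_real_prod: "(One :: real \<times> real) = (1, 1)"
  by (simp add: Basis_prod_def)

text \<open>The square is cut into N^2 grid squares of side 1/N. The diameter of each is bounded by
  the sum 2/N of its sides, and N^2 disks of radius 1/N have total area pi. The bound is crude but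
  gives finiteness.\<close>

lemma hausdorff2_outer_unit_square_le: "hausdorff2_outer (cbox 0 (1, 1) :: (real \<times> real) set) \<le> ennreal pi"
  unfolding hausdorff2_outer_eq
proof (rule SUP_least)
  fix p :: nat
  \<comment> \<open>This choice makes the diameter bound 2/N equal to the prescribed mesh
    1/(p+1).\<close>
  define N where "N = 2 * Suc p"
  have N: "N > 0" by (simp add: N_def)
  define I where "I i = {real i / N .. real (Suc i) / N}" for i
  define C where "C k = (if k < N * N then I (k div N) \<times> I (k mod N) else {})" for k
  have dist_le: "dist x y \<le> 2 / N" if "x \<in> C k" "y \<in> C k" for x y k
  proof -
    have I: "\<bar>a - b\<bar> \<le> 1 / N" if "a \<in> I i" "b \<in> I i" for a b i
      using that by (auto simp: I_def add_divide_distrib)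
    have "dist x y \<le> \<bar>fst x - fst y\<bar> + \<bar>snd x - snd y\<bar>"
      by (simp add: dist_prod_def dist_real_def sqrt_sum_squares_le_sum_abs)
    also have "\<dots> \<le> 1 / N + 1 / N"
      using that by (intro add_mono I[of _ "k div N"] I[of _ "k mod N"]) (auto simp: C_def split: if_splits)
    finally show ?thesis by simp
  qed
  have bdd: "bounded (C k)" for k unfolding bounded_two_points using dist_le by blast
  have diam: "diameter (C k) \<le> 2 / N" for k
    unfolding diameter_def using N by (auto intro!: cSUP_least dist_le)
  have "hausdorff2_size (1 / real (Suc p)) (cbox 0 (1, 1) :: (real \<times> real) set)
      \<le> (\<Sum>k. ennreal (pi * (diameter (C k) / 2)\<^sup>2))"
  proof (rule hausdorff2_size_le)
    show "diameter (C k) \<le> 1 / real (Suc p)" for k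
    proof -
      have "2 / real N = 1 / real (Suc p)" by (simp add: N_def field_simps)
      then show ?thesis using diam[of k] by simp
    qed
    show "cbox 0 (1, 1) \<subseteq> (\<Union>k. C k)"
    proof
      fix z :: "real \<times> real" assume "z \<in> cbox 0 (1, 1)"
      then obtain x y where z: "z = (x, y)" and xy: "0 \<le> x" "x \<le> 1" "0 \<le> y" "y \<le> 1"
        by (cases z) (auto simp: cbox_Pair_eq zero_prod_def)
      have ex: "\<exists>i<N. t \<in> I i" if t: "0 \<le> t" "t \<le> 1" for t
      proof (cases "t = 1")
        case True
        then show ?thesis using N by (intro exI[of _ "N - 1"]) (auto simp: I_def of_nat_diff)
      next
        case False
        define i where "i = nat \<lfloor>t * N\<rfloor>"
        have "t * N < N" using False t N by simp
        then have "i < N" unfolding i_def using t N by (simp add: nat_less_iff floor_less_iff)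
        moreover have "real i \<le> t * N" "t * N \<le> real (Suc i)" using t N by (auto simp: i_def) linarith
        ultimately show ?thesis using N by (intro exI[of _ i]) (auto simp: I_def field_simps)
      qed
      obtain i j where ij: "i < N" "j < N" "x \<in> I i" "y \<in> I j" using ex xy by blast
      have "i * N + j < N * N"
      proof -
        have "i * N + j < Suc i * N" using ij by simp
        also have "\<dots> \<le> N * N" using ij by (intro mult_le_mono1) simp
        finally show ?thesis .
      qed
      then have "z \<in> C (i * N + j)" using ij z by (simp add: C_def)
      then show "z \<in> (\<Union>k. C k)" by blast
    qed
  qed (rule bdd)
  also have "\<dots> = (\<Sum>k<N*N. ennreal (pi * (diameter (C k) / 2)\<^sup>2))"
    by (rule suminf_finite) (auto simp: C_def)
  also have "\<dots> \<le> (\<Sum>k<N*N. ennreal (pi * (1 / N)\<^sup>2))"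
  proof (intro sum_mono ennreal_leI mult_left_mono power_mono)
    show "diameter (C k) / 2 \<le> 1 / N" for k using diam[of k] by simp
    show "0 \<le> diameter (C k) / 2" for k using diameter_ge_0[OF bdd[of k]] by simp
  qed auto
  also have "\<dots> = ennreal pi"
    using N by (simp add: ennreal_of_nat_eq_real_of_nat ennreal_mult[symmetric] power2_eq_square)
  finally show "hausdorff2_size (1 / real (Suc p)) (cbox 0 (1, 1) :: (real \<times> real) set) \<le> ennreal pi" .
qed

text \<open>A set of diameter d lies in a square of side 2d, so any cover satisfies: the sum of the
  4 d^2 is at least 1. Since pi (d/2)^2 is pi/16 times 4 d^2, the Hausdorff sums are bounded below
  by pi/16.\<close>

lemma hausdorff2_outer_unit_square_pos: "hausdorff2_outer (cbox 0 (1, 1) :: (real \<times> real) set) > 0"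
proof -
  have "ennreal (pi / 16) \<le> hausdorff2_size 1 (cbox 0 (1, 1) :: (real \<times> real) set)"
    unfolding hausdorff2_size_def
  proof (rule INF_greatest)
    fix C :: "nat \<Rightarrow> (real \<times> real) set"
    assume "C \<in> {C. cbox 0 (1, 1) \<subseteq> (\<Union>n. C n) \<and> (\<forall>n. bounded (C n) \<and> diameter (C n) \<le> 1)}"
    then have C: "cbox 0 (1, 1) \<subseteq> (\<Union>n. C n)" "\<And>n. bounded (C n)" by auto
    define d where "d n = diameter (C n)" for n
    have d0: "d n \<ge> 0" for n unfolding d_def by (rule diameter_ge_0[OF C(2)])
    have "\<exists>B. C n \<subseteq> B \<and> B \<in> sets lborel \<and> emeasure lborel B \<le> ennreal (4 * (d n)\<^sup>2)" for n
    proof (cases "C n = {}")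
      case False
      then obtain a b where ab: "(a, b) \<in> C n" by auto
      let ?B = "cbox (a - d n, b - d n) (a + d n, b + d n)"
      have "C n \<subseteq> ?B"
      proof
        fix z assume z: "z \<in> C n"
        obtain x y where xy: "z = (x, y)" by (cases z)
        have *: "dist z (a, b) \<le> d n" unfolding d_def by (rule diameter_bounded_bound[OF C(2) z ab])
        have "\<bar>x - a\<bar> \<le> d n" "\<bar>y - b\<bar> \<le> d n"
          using order_trans[OF dist_fst_le[of z "(a, b)"] *] order_trans[OF dist_snd_le[of z "(a, b)"] *]
          by (auto simp: xy dist_real_def)
        then show "z \<in> ?B" by (auto simp: xy cbox_Pair_eq)
      qed
      moreover have "emeasure lborel ?B = ennreal (4 * (d n)\<^sup>2)"
      proof -
        have "emeasure lborel ?B = emeasure (lborel \<Otimes>\<^sub>M lborel) ({a - d n..a + d n} \<times> {b - d n..b + d n})"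
          by (simp add: lborel_prod cbox_Pair_eq)
        also have "\<dots> = ennreal (2 * d n) * ennreal (2 * d n)"
          using d0[of n] by (subst lborel.emeasure_pair_measure_Times) (auto simp: algebra_simps)
        finally show ?thesis
          using d0[of n] by (simp add: ennreal_mult[symmetric] power2_eq_square)
      qed
      ultimately show ?thesis by (intro exI[of _ ?B]) auto
    qed (auto intro!: exI[of _ "{}"])
    then obtain B where B: "\<And>n. C n \<subseteq> B n" "\<And>n. B n \<in> sets lborel"
        "\<And>n. emeasure lborel (B n) \<le> ennreal (4 * (d n)\<^sup>2)" by metis
    have "1 = emeasure lborel (cbox 0 One :: (real \<times> real) set)"
      by (rule emeasure_lborel_unit_cbox[symmetric])
    also have "\<dots> \<le> emeasure lborel (\<Union>n. B n)"
    proof (rule emeasure_mono)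
      show "cbox 0 One \<subseteq> (\<Union>n. B n)" unfolding One_real_prod using C(1) B(1) by blast
    qed (use B(2) in auto)
    also have "\<dots> \<le> (\<Sum>n. emeasure lborel (B n))"
      using B(2) by (intro emeasure_subadditive_countably) auto
    also have "\<dots> \<le> (\<Sum>n. ennreal (4 * (d n)\<^sup>2))" by (intro suminf_le B) auto
    finally have 1: "1 \<le> (\<Sum>n. ennreal (4 * (d n)\<^sup>2))" .
    have "ennreal (pi / 16) \<le> ennreal (pi / 16) * (\<Sum>n. ennreal (4 * (d n)\<^sup>2))"
      using mult_left_mono[OF 1 zero_le, of "ennreal (pi / 16)"] by (simp only: mult_1_right)
    also have "\<dots> = (\<Sum>n. ennreal (pi / 16) * ennreal (4 * (d n)\<^sup>2))"
      by (rule ennreal_suminf_cmult[symmetric])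
    also have "\<dots> = (\<Sum>n. ennreal (pi * (diameter (C n) / 2)\<^sup>2))"
      by (intro suminf_cong) (auto simp: ennreal_mult[symmetric] d_def[symmetric] power2_eq_square field_simps)
    finally show "ennreal (pi / 16) \<le> (\<Sum>n. ennreal (pi * (diameter (C n) / 2)\<^sup>2))" .
  qed
  also have "\<dots> \<le> hausdorff2_outer (cbox 0 (1, 1) :: (real \<times> real) set)"
    by (rule hausdorff2_size_le_outer) simp
  finally show ?thesis by (rule less_le_trans[rotated]) simp
qed

lemma integrable_scaleR_right_iff:
  fixes f :: "'a \<Rightarrow> 'b::{banach,second_countable_topology}"
  shows "c \<noteq> 0 \<Longrightarrow> integrable M (\<lambda>x. c *\<^sub>R f x) \<longleftrightarrow> integrable M f"
  using integrable_scaleR_right[of "inverse c" M "\<lambda>x. c *\<^sub>R f x"] integrable_scaleR_right[of c M f] by auto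

text \<open>The ratio of Hausdorff to Lebesgue measure on the plane. It survives as a positive
  factor in the surface integrals and is absorbed into \<open>\<kappa>\<close>.\<close>

definition hausdorff2_const :: real where
  "hausdorff2_const = measure hausdorff2 (cbox 0 (1, 1) :: (real \<times> real) set)"

lemma hausdorff2_const_pos: "hausdorff2_const > 0"
  using hausdorff2_outer_unit_square_pos hausdorff2_outer_unit_square_le
  unfolding hausdorff2_const_def measure_def
  by (auto simp: emeasure_hausdorff2 enn2real_positive_iff intro: le_less_trans)

lemma hausdorff2_real_prod:
  "(hausdorff2 :: (real \<times> real) measure) = density lborel (\<lambda>_. ennreal hausdorff2_const)"
proof -
  have "(hausdorff2 :: (real \<times> real) measure) = density lborel (\<lambda>_. ennreal (measure hausdorff2 (cbox 0 One :: (real \<times> real) set)))"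
  proof (rule translation_invariant_borel_eq_density_lborel[where m="hausdorff2 :: (real \<times> real) measure"])
    fix a :: "real \<times> real" and A :: "(real \<times> real) set" assume A: "A \<in> sets borel"
    have "hausdorff2_outer ((\<lambda>x. a + x) ` ((\<lambda>x. a + x) -` A)) = hausdorff2_outer ((\<lambda>x. a + x) -` A)"
      by (rule hausdorff2_outer_isometry) simp
    moreover have "(\<lambda>x. a + x) ` ((\<lambda>x. a + x) -` A) = A"
      by (rule surj_image_vimage_eq) (simp add: surj_plus)
    moreover have "(\<lambda>x. a + x) -` A \<in> sets borel"
      using A by (intro measurable_sets_borel[of _ borel]) auto
    ultimately show "emeasure hausdorff2 ((\<lambda>x. a + x) -` A) = emeasure hausdorff2 A"
      using A by (simp add: emeasure_hausdorff2)
  next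
    show "emeasure hausdorff2 (cbox 0 One :: (real \<times> real) set) < \<infinity>"
      using hausdorff2_outer_unit_square_le
      by (auto simp: emeasure_hausdorff2 One_real_prod intro: le_less_trans)
  qed simp
  then show ?thesis by (simp add: hausdorff2_const_def One_real_prod)
qed

text \<open>The outer measure is invariant under isometries, so surface integrals over an
  isometrically parametrised plane reduce to planar Hausdorff, hence Lebesgue, integrals.\<close>

lemma hausdorff2_isometric_plane:
  fixes \<iota> :: "real \<times> real \<Rightarrow> 'a::euclidean_space"
  assumes iso: "\<And>p q. dist (\<iota> p) (\<iota> q) = dist p q" and R: "range \<iota> \<in> sets borel"
  shows "distr hausdorff2 borel \<iota> = density hausdorff2 (indicator (range \<iota>))"
proof (rule measure_eqI)
  have "continuous_on UNIV \<iota>"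
    unfolding continuous_on_iff using iso by auto
  then have meas: "\<iota> \<in> borel_measurable borel" by (rule borel_measurable_continuous_onI)
  fix A assume "A \<in> sets (distr hausdorff2 borel \<iota>)"
  then have A: "A \<in> sets borel" by simp
  have "hausdorff2_outer (\<iota> ` (\<iota> -` A)) = hausdorff2_outer (\<iota> -` A)"
    by (rule hausdorff2_outer_isometry) (rule iso)
  moreover have "\<iota> ` (\<iota> -` A) = A \<inter> range \<iota>" by auto
  moreover have "\<iota> -` A \<in> sets borel" using meas A by (rule measurable_sets_borel)
  ultimately have "emeasure hausdorff2 (\<iota> -` A) = emeasure hausdorff2 (A \<inter> range \<iota>)"
    using A R by (simp add: emeasure_hausdorff2)
  then show "emeasure (distr hausdorff2 borel \<iota>) A = emeasure (density hausdorff2 (indicator (range \<iota>))) A"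
    using A R meas emeasure_density[of "indicator (range \<iota>)" hausdorff2 A]
    by (subst emeasure_distr) (auto simp: nn_integral_indicator[symmetric] indicator_inter_arith
       mult.commute simp del: nn_integral_indicator)
qed simp

lemma integral_hausdorff2_isometric_plane:
  fixes \<iota> :: "real \<times> real \<Rightarrow> 'a::euclidean_space" and g :: "'a \<Rightarrow> 'b::{banach,second_countable_topology}"
  assumes iso: "\<And>p q. dist (\<iota> p) (\<iota> q) = dist p q" and R: "range \<iota> \<in> sets borel"
    and g: "g \<in> borel_measurable borel"
  shows "(LINT x|hausdorff2. indicator (range \<iota>) x *\<^sub>R g x) = hausdorff2_const *\<^sub>R (LINT p|lborel. g (\<iota> p))"
    and "integrable hausdorff2 (\<lambda>x. indicator (range \<iota>) x *\<^sub>R g x) \<longleftrightarrow> integrable lborel (\<lambda>p. g (\<iota> p))"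
proof -
  have "continuous_on UNIV \<iota>"
    unfolding continuous_on_iff using iso by auto
  then have meas[measurable]: "\<iota> \<in> borel_measurable borel" by (rule borel_measurable_continuous_onI)
  note [measurable] = g R
  have dens: "density hausdorff2 (indicator (range \<iota>)) = density hausdorff2 (\<lambda>x. ennreal (indicator (range \<iota>) x))"
    by (simp add: ennreal_indicator)
  have "(LINT x|hausdorff2. indicator (range \<iota>) x *\<^sub>R g x) = (LINT x|distr hausdorff2 borel \<iota>. g x)"
    unfolding hausdorff2_isometric_plane[OF iso R] dens
    by (subst integral_density) auto
  also have "\<dots> = (LINT p|hausdorff2. g (\<iota> p))" by (subst integral_distr) auto
  also have "\<dots> = hausdorff2_const *\<^sub>R (LINT p|lborel. g (\<iota> p))"
    unfolding hausdorff2_real_prod using hausdorff2_const_pos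
    by (subst integral_density) auto
  finally show "(LINT x|hausdorff2. indicator (range \<iota>) x *\<^sub>R g x) = hausdorff2_const *\<^sub>R (LINT p|lborel. g (\<iota> p))" .
  have "integrable hausdorff2 (\<lambda>x. indicator (range \<iota>) x *\<^sub>R g x) \<longleftrightarrow> integrable (distr hausdorff2 borel \<iota>) g"
    unfolding hausdorff2_isometric_plane[OF iso R] dens
    by (subst integrable_density) auto
  also have "\<dots> \<longleftrightarrow> integrable hausdorff2 (\<lambda>p. g (\<iota> p))" by (subst integrable_distr_eq) auto
  also have "\<dots> \<longleftrightarrow> integrable lborel (\<lambda>p. g (\<iota> p))"
    unfolding hausdorff2_real_prod using hausdorff2_const_pos
    by (subst integrable_density) (auto simp: integrable_scaleR_right_iff)
  finally show "integrable hausdorff2 (\<lambda>x. indicator (range \<iota>) x *\<^sub>R g x) \<longleftrightarrow> integrable lborel (\<lambda>p. g (\<iota> p))" .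
qed


section \<open>Calculus of partial derivatives and smooth functions\<close>

lemma pd_eq: "(f has_derivative f') (at x) \<Longrightarrow> pd i f x = f' (axis i 1)"
  unfolding pd_def by (metis frechet_derivative_at)

lemma has_derivative_pd: "f differentiable (at x) \<Longrightarrow> (f has_derivative (\<lambda>v. \<Sum>i\<in>UNIV. v $ i *\<^sub>R pd i f x)) (at x)"
proof -
  assume "f differentiable (at x)"
  then have d: "(f has_derivative frechet_derivative f (at x)) (at x)" by (simp add: frechet_derivative_works)
  then have l: "linear (frechet_derivative f (at x))" by (rule has_derivative_linear)
  have "frechet_derivative f (at x) v = (\<Sum>i\<in>UNIV. v $ i *\<^sub>R pd i f x)" for v
  proof -
    have "frechet_derivative f (at x) v = frechet_derivative f (at x) (\<Sum>i\<in>UNIV. v $ i *\<^sub>R axis i 1)"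
      by (subst basis_expansion[of v, symmetric]) (simp add: scalar_mult_eq_scaleR)
    also have "\<dots> = (\<Sum>i\<in>UNIV. v $ i *\<^sub>R pd i f x)"
      by (simp add: linear_sum[OF l] linear_cmul[OF l] pd_def)
    finally show ?thesis .
  qed
  then have "frechet_derivative f (at x) = (\<lambda>v. \<Sum>i\<in>UNIV. v $ i *\<^sub>R pd i f x)" by blast
  with d show ?thesis by simp
qed

lemma pd_bounded_bilinear:
  assumes "bounded_bilinear pr" "f differentiable (at x)" "g differentiable (at x)"
  shows "pd i (\<lambda>x. pr (f x) (g x)) x = pr (pd i f x) (g x) + pr (f x) (pd i g x)"
  using pd_eq[OF bounded_bilinear.FDERIV[OF assms(1) assms(2)[unfolded frechet_derivative_works]
        assms(3)[unfolded frechet_derivative_works]], of i]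
  by (simp add: pd_def add.commute)

lemma pd_bounded_linear:
  assumes "bounded_linear L" "f differentiable (at x)"
  shows "pd i (\<lambda>x. L (f x)) x = L (pd i f x)"
  using pd_eq[OF bounded_linear.has_derivative[OF assms(1) assms(2)[unfolded frechet_derivative_works]], of i]
  by (simp add: pd_def)

lemma pd_add:
  "f differentiable (at x) \<Longrightarrow> g differentiable (at x) \<Longrightarrow> pd i (\<lambda>x. f x + g x) x = pd i f x + pd i g x"
  unfolding frechet_derivative_works by (drule (1) has_derivative_add) (simp add: pd_eq, simp add: pd_def)

lemma pd_const [simp]: "pd i (\<lambda>x. c) = (\<lambda>x. 0)"
  by (rule ext, rule pd_eq[OF has_derivative_const])

lemma pd_cong_open:
  assumes "open S" "x \<in> S" "\<And>y. y \<in> S \<Longrightarrow> f y = g y"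
  shows "pd i f x = pd i g x"
proof -
  have "(f has_derivative D) (at x) \<longleftrightarrow> (g has_derivative D) (at x)" for D
    using assms has_derivative_transform_within_open[of f D x UNIV S g]
      has_derivative_transform_within_open[of g D x UNIV S f] by auto
  then show ?thesis unfolding pd_def frechet_derivative_def by simp
qed

lemma Ck_SucD: "Ck (Suc k) f \<Longrightarrow> Ck k f"
proof (induction k arbitrary: f)
  case 0
  then show ?case by (auto intro!: continuous_at_imp_continuous_on differentiable_imp_continuous_within)
qed auto

lemma Ck_const: "Ck k (\<lambda>x. c)"
  by (induction k arbitrary: c) auto

lemma Ck_bounded_linear: "bounded_linear L \<Longrightarrow> Ck k f \<Longrightarrow> Ck k (\<lambda>x. L (f x))"
proof (induction k arbitrary: f)
  case 0 then show ?case by (auto intro: bounded_linear.continuous_on)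
next
  case (Suc k)
  have "pd i (\<lambda>x. L (f x)) = (\<lambda>x. L (pd i f x))" for i
    using Suc.prems by (intro ext pd_bounded_linear) auto
  moreover have "(\<lambda>x. L (f x)) differentiable (at x)" for x
    using Suc.prems(2) unfolding Ck.simps differentiable_def
    by (blast intro: bounded_linear.has_derivative[OF Suc.prems(1)])
  ultimately show ?case using Suc by simp
qed

lemma Ck_add: "Ck k f \<Longrightarrow> Ck k g \<Longrightarrow> Ck k (\<lambda>x. f x + g x)"
proof (induction k arbitrary: f g)
  case 0 then show ?case by (auto intro: continuous_on_add)
next
  case (Suc k)
  have "pd i (\<lambda>x. f x + g x) = (\<lambda>x. pd i f x + pd i g x)" for i
    using Suc.prems by (intro ext pd_add) auto
  with Suc show ?case by auto
qed

lemma Ck_bounded_bilinear: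
  "bounded_bilinear pr \<Longrightarrow> Ck k f \<Longrightarrow> Ck k g \<Longrightarrow> Ck k (\<lambda>x. pr (f x) (g x))"
proof (induction k arbitrary: f g)
  case 0 then show ?case by (auto intro: bounded_bilinear.continuous_on)
next
  case (Suc k)
  have "pd i (\<lambda>x. pr (f x) (g x)) = (\<lambda>x. pr (pd i f x) (g x) + pr (f x) (pd i g x))" for i
    using Suc.prems by (intro ext pd_bounded_bilinear) auto
  moreover have "Ck k (\<lambda>x. pr (pd i f x) (g x) + pr (f x) (pd i g x))" for i
    using Suc.prems Ck_SucD[of k f] Ck_SucD[of k g] by (intro Ck_add Suc.IH[OF Suc.prems(1)]) auto
  moreover have "(\<lambda>x. pr (f x) (g x)) differentiable (at x)" for x
    using Suc.prems(2,3) unfolding Ck.simps differentiable_def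
    by (blast intro: bounded_bilinear.FDERIV[OF Suc.prems(1)])
  ultimately show ?case by simp
qed

lemma pd_linear: "bounded_linear L \<Longrightarrow> pd i L = (\<lambda>x. L (axis i 1))"
  by (rule ext, rule pd_eq) (rule bounded_linear_imp_has_derivative)

lemma Ck_linear: "bounded_linear L \<Longrightarrow> Ck k L"
  by (cases k) (auto simp: pd_linear Ck_const linear_continuous_on bounded_linear_imp_differentiable)

text \<open>Differentiability is phrased by the existence of a derivative of lower class, so that
  each closure rule supplies its own derivative and no iterated derivative has to be named.\<close>

primrec C1k :: "nat \<Rightarrow> (real \<Rightarrow> real) \<Rightarrow> bool" where
  "C1k 0 g \<longleftrightarrow> continuous_on UNIV g"
| "C1k (Suc k) g \<longleftrightarrow> (\<exists>g'. (\<forall>t. (g has_real_derivative g' t) (at t)) \<and> C1k k g')"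

lemma C1k_SucD: "C1k (Suc k) g \<Longrightarrow> C1k k g"
proof (induction k arbitrary: g)
  case 0
  then have "isCont g t" for t unfolding C1k.simps by (blast intro: DERIV_isCont)
  then show ?case by (simp add: continuous_at_imp_continuous_on)
next
  case (Suc k)
  then obtain g' where g': "\<forall>t. (g has_real_derivative g' t) (at t)" "C1k (Suc k) g'" by auto
  then have "C1k k g'" using Suc.IH by blast
  then show ?case using g' by auto
qed

lemma C1k_const: "C1k k (\<lambda>t. c)"
  by (induction k arbitrary: c) (auto intro!: exI[of _ "\<lambda>t. 0"] derivative_eq_intros)

lemma C1k_id: "C1k k (\<lambda>t. t)"
  by (cases k) (auto intro!: exI[of _ "\<lambda>t. 1"] derivative_eq_intros C1k_const)

lemma C1k_add: "C1k k f \<Longrightarrow> C1k k g \<Longrightarrow> C1k k (\<lambda>t. f t + g t)"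
proof (induction k arbitrary: f g)
  case 0 then show ?case by (auto intro: continuous_on_add)
next
  case (Suc k)
  then obtain f' g' where "\<forall>t. (f has_real_derivative f' t) (at t)" "C1k k f'"
    "\<forall>t. (g has_real_derivative g' t) (at t)" "C1k k g'" by auto
  with Suc.IH[of f' g'] show ?case by (auto intro!: exI[of _ "\<lambda>t. f' t + g' t"] DERIV_add)
qed

lemma C1k_mult: "C1k k f \<Longrightarrow> C1k k g \<Longrightarrow> C1k k (\<lambda>t. f t * g t)"
proof (induction k arbitrary: f g)
  case 0 then show ?case by (auto intro: continuous_on_mult)
next
  case (Suc k)
  then obtain f' g' where *: "\<forall>t. (f has_real_derivative f' t) (at t)" "C1k k f'"
    "\<forall>t. (g has_real_derivative g' t) (at t)" "C1k k g'" by auto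
  have "C1k k (\<lambda>t. f' t * g t + g' t * f t)"
    using * Suc.prems by (intro C1k_add Suc.IH C1k_SucD[of k f] C1k_SucD[of k g]) auto
  with * show ?case by (auto intro!: exI[of _ "\<lambda>t. f' t * g t + g' t * f t"] DERIV_mult)
qed

lemma C1k_inverse:
  assumes "C1k k g" "\<And>t. g t > 0" shows "C1k k (\<lambda>t. 1 / g t)"
  using assms(1)
proof (induction k)
  case 0 then show ?case using assms(2) by (auto intro!: continuous_intros simp: less_imp_neq[symmetric])
next
  case (Suc k)
  then obtain g' where *: "\<forall>t. (g has_real_derivative g' t) (at t)" "C1k k g'" by auto
  have i: "C1k k (\<lambda>t. 1 / g t)" using Suc C1k_SucD by blast
  have "C1k k (\<lambda>t. (- 1) * (g' t * ((1 / g t) * (1 / g t))))"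
    by (intro C1k_mult C1k_const i *)
  moreover have "((\<lambda>t. 1 / g t) has_real_derivative (- 1) * (g' t * ((1 / g t) * (1 / g t)))) (at t)" for t
    using *(1) assms(2)[of t] by (auto intro!: derivative_eq_intros simp: field_simps)
  ultimately show ?case by (auto intro!: exI[of _ "\<lambda>t. (- 1) * (g' t * ((1 / g t) * (1 / g t)))"])
qed

lemma C1k_affine: "C1k k g \<Longrightarrow> C1k k (\<lambda>t. g (a * t + b))"
proof (induction k arbitrary: g)
  case 0 
  then show ?case by (auto intro!: continuous_on_compose2[of UNIV g] continuous_intros)
next
  case (Suc k)
  then obtain g' where *: "\<forall>t. (g has_real_derivative g' t) (at t)" "C1k k g'" by auto
  have "((\<lambda>t. g (a * t + b)) has_real_derivative g' (a * t + b) * a) (at t)" for t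
    by (rule DERIV_chain2[where g="\<lambda>t. a * t + b"]) (use * in \<open>auto intro!: derivative_eq_intros\<close>)
  moreover have "C1k k (\<lambda>t. g' (a * t + b) * a)" by (intro C1k_mult C1k_const Suc.IH *)
  ultimately show ?case by (auto intro!: exI[of _ "\<lambda>t. g' (a * t + b) * a"])
qed

lemma Ck_compose: "C1k k g \<Longrightarrow> Ck k \<phi> \<Longrightarrow> Ck k (\<lambda>x. g (\<phi> x))"
proof (induction k arbitrary: g)
  case 0 then show ?case by (auto intro!: continuous_on_compose2[of UNIV g])
next
  case (Suc k)
  then obtain g' where *: "\<forall>t. (g has_real_derivative g' t) (at t)" "C1k k g'" by auto
  have d: "((\<lambda>x. g (\<phi> x)) has_derivative (\<lambda>v. frechet_derivative \<phi> (at x) v * g' (\<phi> x))) (at x)" for x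
  proof -
    have "(\<phi> has_derivative frechet_derivative \<phi> (at x)) (at x)"
      using Suc.prems(2) by (simp add: frechet_derivative_works)
    moreover have "(g has_derivative (\<lambda>h. h * g' (\<phi> x))) (at (\<phi> x))"
      using *(1) by (simp add: has_field_derivative_def mult_commute_abs)
    ultimately show ?thesis by (rule has_derivative_compose)
  qed
  have "pd i (\<lambda>x. g (\<phi> x)) = (\<lambda>x. pd i \<phi> x * g' (\<phi> x))" for i
    by (rule ext, subst pd_eq[OF d]) (simp add: pd_def)
  moreover have "Ck k (\<lambda>x. pd i \<phi> x * g' (\<phi> x))" for i
    using Suc.prems(2) Ck_SucD[OF Suc.prems(2)]
    by (intro Ck_bounded_bilinear[OF bounded_bilinear_mult] Suc.IH[OF *(2)]) auto
  ultimately show ?case using d by (auto simp: differentiable_def)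
qed

lemma power_div_fact_le_exp: "0 \<le> x \<Longrightarrow> x ^ n / fact n \<le> exp (x::real)"
proof -
  assume x: "0 \<le> x"
  have "(\<Sum>k\<in>{n}. x ^ k /\<^sub>R fact k) \<le> (\<Sum>k. x ^ k /\<^sub>R fact k)"
    using x by (intro sum_le_suminf summable_exp_generic) auto
  then show ?thesis by (simp add: exp_def divide_inverse mult.commute)
qed

text \<open>The functions t^(-m) exp(-1/t), extended by 0. The derivative of the m-th one combines
  the members m+1 and m+2, so smoothness is proved for the whole family by one induction.\<close>

definition flat :: "nat \<Rightarrow> real \<Rightarrow> real" where
  "flat m t = (if t > 0 then (1 / t) ^ m * exp (- (1 / t)) else 0)"

text \<open>One term of the exponential series bounds exp(1/t) from below by (1/t)^(m+2) / (m+2)!.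
  The resulting quadratic decay gives derivative 0 at the origin.\<close>

lemma flat_bound: "\<bar>flat m t\<bar> \<le> fact (m + 2) * t\<^sup>2"
proof (cases "t > 0")
  case True
  have "(1 / t) ^ (m + 2) / fact (m + 2) \<le> exp (1 / t)"
    using True by (intro power_div_fact_le_exp) simp
  then have "(1 / t) ^ (m + 2) \<le> exp (1 / t) * fact (m + 2)"
    by (simp only: pos_divide_le_eq fact_gt_zero)
  then have "(1 / t) ^ (m + 2) * exp (- (1 / t)) \<le> exp (1 / t) * fact (m + 2) * exp (- (1 / t))"
    by (rule mult_right_mono) simp
  also have "\<dots> = fact (m + 2) * (exp (1 / t) * exp (- (1 / t)))" by (simp only: ac_simps)
  also have "\<dots> = fact (m + 2)" by (simp only: exp_minus_inverse mult_1_right)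
  finally have "(1 / t) ^ (m + 2) * exp (- (1 / t)) \<le> fact (m + 2)" .
  then have "t\<^sup>2 * ((1 / t) ^ (m + 2) * exp (- (1 / t))) \<le> t\<^sup>2 * fact (m + 2)"
    by (rule mult_left_mono) simp
  moreover have "t\<^sup>2 * ((1 / t) ^ (m + 2) * exp (- (1 / t))) = flat m t"
    using True by (simp add: flat_def power_add power2_eq_square)
  ultimately have "flat m t \<le> t\<^sup>2 * fact (m + 2)" by metis
  then show ?thesis using True by (simp add: flat_def mult.commute)
qed (simp add: flat_def)

lemma DERIV_flat: "(flat m has_real_derivative (- real m) * flat (Suc m) t + flat (m + 2) t) (at t)"
proof (cases t "0::real" rule: linorder_cases)
  case less
  have "((\<lambda>t. 0) has_real_derivative 0) (at t)" by simp
  then have "(flat m has_real_derivative 0) (at t)"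
    by (rule has_field_derivative_transform_within_open[of _ _ _ "{..<0}"])
       (use less in \<open>auto simp: flat_def\<close>)
  then show ?thesis using less by (simp add: flat_def)
next
  case greater
  have "((\<lambda>t. (1 / t) ^ m * exp (- (1 / t))) has_real_derivative
     (- real m) * flat (Suc m) t + flat (m + 2) t) (at t)"
  proof -
    have i: "((\<lambda>t. 1 / t) has_real_derivative - (1 / t)\<^sup>2) (at t)"
      using greater by (auto intro!: derivative_eq_intros simp: power2_eq_square)
    have p: "((\<lambda>t. (1 / t) ^ m) has_real_derivative (- real m) * (1 / t) ^ Suc m) (at t)"
      by (rule DERIV_cong[OF DERIV_power[OF i]]) (cases m, auto simp: power2_eq_square algebra_simps diff_divide_distrib add_divide_distrib)
    have e: "((\<lambda>t. exp (- (1 / t))) has_real_derivative exp (- (1 / t)) * (1 / t)\<^sup>2) (at t)"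
      by (rule DERIV_cong[OF DERIV_fun_exp[OF DERIV_minus[OF i]]]) simp
    show ?thesis
      by (rule DERIV_cong[OF DERIV_mult[OF p e]])
         (use greater in \<open>simp add: flat_def power_add power2_eq_square algebra_simps\<close>)
  qed
  then show ?thesis
    by (rule has_field_derivative_transform_within_open[of _ _ _ "{0<..}"])
       (use greater in \<open>auto simp: flat_def\<close>)
next
  case equal
  have "((\<lambda>h. (flat m (0 + h) - flat m 0) / h) \<longlongrightarrow> 0) (at 0)"
  proof (rule Lim_null_comparison)
    show "((\<lambda>h. fact (m + 2) * \<bar>h\<bar>) \<longlongrightarrow> (0::real)) (at 0)"
      by (auto intro!: tendsto_eq_intros)
    show "\<forall>\<^sub>F h in at 0. norm ((flat m (0 + h) - flat m 0) / h) \<le> fact (m + 2) * \<bar>h\<bar>"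
      using flat_bound[of m]
      by (intro always_eventually allI) (auto simp: flat_def[of m 0] divide_le_eq power2_eq_square mult.assoc abs_mult[symmetric])
  qed
  then have "(flat m has_real_derivative 0) (at 0)" by (simp add: DERIV_def)
  then show ?thesis using equal by (simp add: flat_def)
qed

lemma C1k_flat: "C1k k (flat m)"
proof (induction k arbitrary: m)
  case 0
  show ?case by (auto intro!: continuous_at_imp_continuous_on DERIV_isCont[OF DERIV_flat])
next
  case (Suc k)
  have "C1k k (\<lambda>t. (- real m) * flat (Suc m) t + flat (m + 2) t)"
    by (intro C1k_add C1k_mult C1k_const Suc.IH)
  then show ?case unfolding C1k.simps
    by (intro exI[of _ "\<lambda>t. (- real m) * flat (Suc m) t + flat (m + 2) t"] conjI allI DERIV_flat)
qed

definition sstep :: "real \<Rightarrow> real" where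
  "sstep t = flat 0 t * (1 / (flat 0 t + flat 0 (1 - t)))"

lemma sstep_denom_pos: "flat 0 t + flat 0 (1 - t) > 0"
  by (auto simp: flat_def intro: add_pos_pos)

lemma C1k_sstep: "C1k k sstep"
  unfolding sstep_def[abs_def]
  using C1k_affine[OF C1k_flat, of k 0 "-1" 1]
  by (intro C1k_mult C1k_inverse C1k_add C1k_flat sstep_denom_pos) simp

lemma sstep_range: "0 \<le> sstep t" "sstep t \<le> 1"
  using sstep_denom_pos[of t] by (auto simp: sstep_def flat_def)

lemma sstep_0 [simp]: "t \<le> 0 \<Longrightarrow> sstep t = 0"
  by (simp add: sstep_def flat_def)

lemma sstep_1 [simp]: "t \<ge> 1 \<Longrightarrow> sstep t = 1"
  by (simp add: sstep_def flat_def)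

lemma sstep_pos: "t > 0 \<Longrightarrow> sstep t > 0"
  using sstep_denom_pos[of t] by (simp add: sstep_def flat_def)

text \<open>A convex combination of t and 1 that equals t from 1 on and stays positive. Its
  reciprocal is a smooth function on the whole line that agrees with 1/t for t at least 1, and is
  used wherever a quotient has to be extended past its singularity.\<close>

definition posext :: "real \<Rightarrow> real" where
  "posext t = t * sstep t + (1 - sstep t)"

lemma posext_pos: "posext t > 0"
proof (cases "t \<le> 0 \<or> t \<ge> 1")
  case False
  then show ?thesis using sstep_range[of t] sstep_pos[of t]
    by (auto simp: posext_def intro!: add_pos_nonneg)
qed (auto simp: posext_def)

lemma posext_eq: "t \<ge> 1 \<Longrightarrow> posext t = t"
  by (simp add: posext_def)

lemma C1k_inverse_posext: "C1k k (\<lambda>t. 1 / posext t)"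
  unfolding posext_def[abs_def] using posext_pos C1k_add[OF C1k_const C1k_mult[OF C1k_const C1k_sstep], of k 1 "-1"]
  by (intro C1k_inverse C1k_add C1k_mult C1k_id C1k_sstep) (auto simp: posext_def)

lemma smooth_const [intro]: "smooth (\<lambda>x. c)" by (simp add: smooth_def Ck_const)
lemma smooth_add [intro]: "smooth f \<Longrightarrow> smooth g \<Longrightarrow> smooth (\<lambda>x. f x + g x)" by (simp add: smooth_def Ck_add)
lemma smooth_bounded_linear: "bounded_linear L \<Longrightarrow> smooth f \<Longrightarrow> smooth (\<lambda>x. L (f x))"
  by (simp add: smooth_def Ck_bounded_linear)
lemma smooth_linear: "bounded_linear L \<Longrightarrow> smooth L" by (simp add: smooth_def Ck_linear)
lemma smooth_bounded_bilinear: "bounded_bilinear pr \<Longrightarrow> smooth f \<Longrightarrow> smooth g \<Longrightarrow> smooth (\<lambda>x. pr (f x) (g x))"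
  by (simp add: smooth_def Ck_bounded_bilinear)
lemma smooth_mult [intro]: "smooth f \<Longrightarrow> smooth g \<Longrightarrow> smooth (\<lambda>x. f x * g x :: 'b::real_normed_algebra)"
  by (rule smooth_bounded_bilinear[OF bounded_bilinear_mult])
lemma smooth_scaleR [intro]: "smooth f \<Longrightarrow> smooth g \<Longrightarrow> smooth (\<lambda>x. f x *\<^sub>R g x)"
  by (rule smooth_bounded_bilinear[OF bounded_bilinear_scaleR])
lemma smooth_power: "smooth f \<Longrightarrow> smooth (\<lambda>x. f x ^ n :: 'b::real_normed_algebra_1)"
  by (induction n) auto
lemma smooth_compose: "(\<And>k. C1k k g) \<Longrightarrow> smooth \<phi> \<Longrightarrow> smooth (\<lambda>x. g (\<phi> x))"
  by (simp add: smooth_def Ck_compose)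
lemma smooth_coord [intro]: "smooth (\<lambda>x. x $ i)"
  by (rule smooth_linear[OF bounded_linear_vec_nth])
lemma smooth_pd [intro]: "smooth f \<Longrightarrow> smooth (pd i f)"
  unfolding smooth_def by (metis Ck.simps(2))
lemma smooth_differentiable: "smooth f \<Longrightarrow> f differentiable (at x)"
  unfolding smooth_def by (metis Ck.simps(2))
lemma smooth_continuous: "smooth f \<Longrightarrow> continuous_on S f"
  unfolding smooth_def by (metis Ck.simps(1) continuous_on_subset top_greatest)

lemma smooth_of_real: "smooth f \<Longrightarrow> smooth (\<lambda>x. of_real (f x) :: 'b::real_normed_algebra_1)"
  by (rule smooth_bounded_linear[OF bounded_linear_of_real])

text \<open>Two applications of the mean value theorem. The second difference is symmetric in i and
  j, so letting h tend to 0 for both orders gives equality of the mixed derivatives.\<close>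

lemma second_difference_mvt:
  fixes f :: "real^'n \<Rightarrow> real"
  assumes f: "smooth f" and h: "h > 0"
  obtains s t where "0 < s" "s < h" "0 < t" "t < h"
    "f (x + h *\<^sub>R axis i 1 + h *\<^sub>R axis j 1) - f (x + h *\<^sub>R axis i 1) - f (x + h *\<^sub>R axis j 1) + f x
       = h * h * pd j (pd i f) (x + s *\<^sub>R axis i 1 + t *\<^sub>R axis j 1)"
proof -
  have D: "((\<lambda>s. g (y + s *\<^sub>R axis i 1)) has_real_derivative pd i g (y + s *\<^sub>R axis i 1)) (at s)"
    if "smooth g" for g y s i
  proof -
    have "(g has_derivative frechet_derivative g (at (y + s *\<^sub>R axis i 1))) (at (y + s *\<^sub>R axis i 1))"
      using smooth_differentiable[OF that] by (simp add: frechet_derivative_works)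
    moreover have "((\<lambda>s. y + s *\<^sub>R axis i 1) has_derivative (\<lambda>h. h *\<^sub>R axis i 1)) (at s)"
      by (auto intro!: derivative_eq_intros)
    ultimately have "((\<lambda>s. g (y + s *\<^sub>R axis i 1)) has_derivative
        (\<lambda>h. frechet_derivative g (at (y + s *\<^sub>R axis i 1)) (h *\<^sub>R axis i 1))) (at s)"
      by (rule has_derivative_compose[rotated])
    moreover have "frechet_derivative g (at z) (h *\<^sub>R axis i 1) = pd i g z * h" for z h
      using linear_frechet_derivative[OF smooth_differentiable[OF that]]
      by (simp add: linear_cmul pd_def)
    ultimately show ?thesis by (simp add: has_field_derivative_def)
  qed
  define g where "g s = f ((x + h *\<^sub>R axis j 1) + s *\<^sub>R axis i 1) - f (x + s *\<^sub>R axis i 1)" for s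
  have "\<exists>s. 0 < s \<and> s < h \<and> g h - g 0 = (h - 0) * (pd i f ((x + h *\<^sub>R axis j 1) + s *\<^sub>R axis i 1) - pd i f (x + s *\<^sub>R axis i 1))"
    using h unfolding g_def by (intro MVT2 DERIV_diff D f) auto
  then obtain s where s: "0 < s" "s < h"
    "g h - g 0 = h * (pd i f ((x + h *\<^sub>R axis j 1) + s *\<^sub>R axis i 1) - pd i f (x + s *\<^sub>R axis i 1))" by auto
  have "\<exists>t. 0 < t \<and> t < h \<and> pd i f ((x + s *\<^sub>R axis i 1) + h *\<^sub>R axis j 1) - pd i f ((x + s *\<^sub>R axis i 1) + 0 *\<^sub>R axis j 1)
     = (h - 0) * pd j (pd i f) ((x + s *\<^sub>R axis i 1) + t *\<^sub>R axis j 1)"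
    using h by (intro MVT2 D smooth_pd f) auto
  then obtain t where t: "0 < t" "t < h" "pd i f ((x + s *\<^sub>R axis i 1) + h *\<^sub>R axis j 1) - pd i f (x + s *\<^sub>R axis i 1)
     = h * pd j (pd i f) ((x + s *\<^sub>R axis i 1) + t *\<^sub>R axis j 1)" by auto
  have "f (x + h *\<^sub>R axis i 1 + h *\<^sub>R axis j 1) - f (x + h *\<^sub>R axis i 1) - f (x + h *\<^sub>R axis j 1) + f x = g h - g 0"
    by (simp add: g_def algebra_simps)
  also have "\<dots> = h * h * pd j (pd i f) (x + s *\<^sub>R axis i 1 + t *\<^sub>R axis j 1)"
    using s(3) t(3) by (simp add: algebra_simps)
  finally show ?thesis using that s t by blast
qed

lemma pd_commute_real:
  fixes f :: "real^'n \<Rightarrow> real"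
  assumes f: "smooth f"
  shows "pd i (pd j f) x = pd j (pd i f) x"
proof -
  define h where "h n = 1 / real (Suc n)" for n
  have h0: "h n > 0" for n by (simp add: h_def)
  have hl: "h \<longlonglongrightarrow> 0" unfolding h_def by (rule LIMSEQ_Suc[OF lim_1_over_n])
  have lim: "\<exists>p. (\<lambda>n. p n) \<longlonglongrightarrow> pd j (pd i f) x \<and> (\<forall>n. 
     f (x + h n *\<^sub>R axis i 1 + h n *\<^sub>R axis j 1) - f (x + h n *\<^sub>R axis i 1) - f (x + h n *\<^sub>R axis j 1) + f x
       = h n * h n * p n)" for i j
  proof -
    have "\<exists>s t. 0 < s \<and> s < h n \<and> 0 < t \<and> t < h n \<and>
      f (x + h n *\<^sub>R axis i 1 + h n *\<^sub>R axis j 1) - f (x + h n *\<^sub>R axis i 1) - f (x + h n *\<^sub>R axis j 1) + f x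
       = h n * h n * pd j (pd i f) (x + s *\<^sub>R axis i 1 + t *\<^sub>R axis j 1)" for n
      using second_difference_mvt[OF f h0[of n], of x i j] by metis
    then obtain s t where st: "\<And>n. 0 < s n" "\<And>n. s n < h n" "\<And>n. 0 < t n" "\<And>n. t n < h n"
      "\<And>n. f (x + h n *\<^sub>R axis i 1 + h n *\<^sub>R axis j 1) - f (x + h n *\<^sub>R axis i 1) - f (x + h n *\<^sub>R axis j 1) + f x
       = h n * h n * pd j (pd i f) (x + s n *\<^sub>R axis i 1 + t n *\<^sub>R axis j 1)" by metis
    have "s \<longlonglongrightarrow> 0" by (rule tendsto_sandwich[OF _ _ tendsto_const hl]) (use st in \<open>simp_all add: less_imp_le\<close>)
    moreover have "t \<longlonglongrightarrow> 0" by (rule tendsto_sandwich[OF _ _ tendsto_const hl]) (use st in \<open>simp_all add: less_imp_le\<close>)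
    ultimately have "(\<lambda>n. x + s n *\<^sub>R axis i 1 + t n *\<^sub>R axis j 1) \<longlonglongrightarrow> x"
      by (auto intro!: tendsto_eq_intros)
    moreover have "isCont (pd j (pd i f)) x"
      using smooth_continuous[of "pd j (pd i f)" UNIV] f by (auto simp: continuous_on_eq_continuous_at)
    ultimately have "(\<lambda>n. pd j (pd i f) (x + s n *\<^sub>R axis i 1 + t n *\<^sub>R axis j 1)) \<longlonglongrightarrow> pd j (pd i f) x"
      by (rule isCont_tendsto_compose[rotated])
    then show ?thesis using st(5) by blast
  qed
  obtain p where p: "p \<longlonglongrightarrow> pd j (pd i f) x" "\<And>n. 
     f (x + h n *\<^sub>R axis i 1 + h n *\<^sub>R axis j 1) - f (x + h n *\<^sub>R axis i 1) - f (x + h n *\<^sub>R axis j 1) + f x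
       = h n * h n * p n" using lim by blast
  obtain q where q: "q \<longlonglongrightarrow> pd i (pd j f) x" "\<And>n. 
     f (x + h n *\<^sub>R axis j 1 + h n *\<^sub>R axis i 1) - f (x + h n *\<^sub>R axis j 1) - f (x + h n *\<^sub>R axis i 1) + f x
       = h n * h n * q n" using lim by blast
  have "h n * h n * p n = h n * h n * q n" for n
    unfolding p(2)[symmetric] q(2)[symmetric] by (simp add: algebra_simps)
  then have "p = q" using h0 by (intro ext) (metis less_irrefl mult_cancel_left mult_pos_pos)
  then show ?thesis using p q LIMSEQ_unique by blast
qed

lemma pd_commute:
  fixes f :: "real^'n \<Rightarrow> 'b::euclidean_space"
  assumes f: "smooth f"
  shows "pd i (pd j f) = pd j (pd i f)"
proof
  fix x
  have *: "pd i (pd j f) x \<bullet> b = pd i (pd j (\<lambda>x. f x \<bullet> b)) x" for i j b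
  proof -
    have "pd j (\<lambda>x. f x \<bullet> b) = (\<lambda>x. pd j f x \<bullet> b)"
      by (rule ext, rule pd_bounded_linear[OF bounded_linear_inner_left smooth_differentiable[OF f]])
    then show ?thesis
      using pd_bounded_linear[OF bounded_linear_inner_left smooth_differentiable[OF smooth_pd[OF f, of j]], of i b x] by simp
  qed
  show "pd i (pd j f) x = pd j (pd i f) x"
    by (rule euclidean_eqI)
       (simp add: * pd_commute_real smooth_bounded_linear[OF bounded_linear_inner_left f])
qed

text \<open>The set K is any compact set outside which the function vanishes, not its support;
  derivatives, products and sums keep the same K. Unlike \<open>test_function\<close>, values in any
  normed space are allowed, and K may reach the boundary of \<open>\<Omega>\<close>.\<close>

definition tf :: "(real^'n) set \<Rightarrow> (real^'n \<Rightarrow> 'b::real_normed_vector) \<Rightarrow> bool" where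
  "tf K \<phi> \<longleftrightarrow> smooth \<phi> \<and> compact K \<and> (\<forall>x. x \<notin> K \<longrightarrow> \<phi> x = 0)"

lemma supp_subset_tf: "tf K \<phi> \<Longrightarrow> supp \<phi> \<subseteq> K"
  unfolding supp_def by (intro closure_minimal) (auto simp: tf_def compact_imp_closed)

lemma tf_test_function: "tf K \<phi> \<Longrightarrow> K \<subseteq> \<Omega> \<Longrightarrow> test_function \<Omega> \<phi>"
proof -
  assume K: "tf K \<phi>" "K \<subseteq> \<Omega>"
  have "compact (K \<inter> supp \<phi>)"
    using K by (intro compact_Int_closed) (auto simp: tf_def supp_def)
  moreover have "K \<inter> supp \<phi> = supp \<phi>" using supp_subset_tf[OF K(1)] by blast
  ultimately show ?thesis using K supp_subset_tf[OF K(1)] by (auto simp: test_function_def tf_def)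
qed

lemma tf_pd: "tf K \<phi> \<Longrightarrow> tf K (pd i \<phi>)"
proof -
  assume K: "tf K \<phi>"
  have "pd i \<phi> x = 0" if "x \<notin> K" for x
  proof -
    have "pd i \<phi> x = pd i (\<lambda>x. 0) x"
      by (rule pd_cong_open[of "- K"]) (use K that in \<open>auto simp: tf_def compact_imp_closed open_Compl\<close>)
    then show ?thesis by simp
  qed
  with K show ?thesis by (auto simp: tf_def)
qed


section \<open>Integrals of derivatives over half-spaces\<close>

lemma AE_lborel_inner_neq: "a \<noteq> 0 \<Longrightarrow> AE x in lborel. a \<bullet> (x::'a::euclidean_space) \<noteq> b"
proof -
  assume "a \<noteq> 0"
  then have "negligible {x. a \<bullet> x = b}" by (intro negligible_hyperplane) simp
  then have "{x. a \<bullet> x = b} \<in> null_sets lebesgue" by (simp add: negligible_iff_null_sets)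
  then have "{x. a \<bullet> x = b} \<in> null_sets lborel"
    using null_sets_completion_iff[of "{x. a \<bullet> x = b}" lborel] by (simp add: closed_hyperplane borel_closed)
  then show ?thesis by (rule AE_I') auto
qed

lemma integrable_lborel_bounded_support:
  fixes h :: "'a::euclidean_space \<Rightarrow> 'b::{banach,second_countable_topology}"
  assumes [measurable]: "h \<in> borel_measurable borel" and "bounded K"
    and "\<And>x. norm (h x) \<le> C" "\<And>x. x \<notin> K \<Longrightarrow> h x = 0"
  shows "integrable lborel h"
proof -
  obtain a where a: "K \<subseteq> cbox (-a) a" using bounded_subset_cbox_symmetric[OF assms(2)] by blast
  show ?thesis
  proof (rule Bochner_Integration.integrable_bound)
    show "integrable lborel (\<lambda>x. indicator (cbox (-a) a) x *\<^sub>R C)"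
      by (intro integrable_scaleR_left integrable_real_indicator) (use emeasure_bounded_finite[OF bounded_cbox, of "- a" a] in auto)
    have "norm (h x) \<le> norm (indicator (cbox (-a) a) x *\<^sub>R C)" for x
      using assms(3)[of x] assms(4)[of x] a norm_ge_zero[of "h x"] by (auto simp: indicator_def)
    then show "AE x in lborel. norm (h x) \<le> norm (indicator (cbox (-a) a) x *\<^sub>R C)" by simp
  qed simp
qed

lemma integrable_lborel_continuous_compact_support:
  fixes f :: "'a::euclidean_space \<Rightarrow> 'b::euclidean_space"
  assumes "continuous_on UNIV f" "compact K" "\<And>x. x \<notin> K \<Longrightarrow> f x = 0" and S[measurable]: "S \<in> sets borel"
  shows "integrable lborel (\<lambda>x. indicator S x *\<^sub>R f x)"
proof -
  have [measurable]: "f \<in> borel_measurable borel" using assms(1) by (rule borel_measurable_continuous_onI)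
  have "compact (f ` K)" using assms by (intro compact_continuous_image) (auto intro: continuous_on_subset)
  then obtain C where C: "\<And>x. x \<in> K \<Longrightarrow> norm (f x) \<le> C"
    using compact_imp_bounded[of "f ` K"] unfolding bounded_iff by blast
  show ?thesis
  proof (rule integrable_lborel_bounded_support[of _ K "max C 0"])
    show "norm (indicator S x *\<^sub>R f x) \<le> max C 0" for x
      using C[of x] assms(3)[of x] by (cases "x \<in> K") (auto simp: indicator_def)
  qed (use assms compact_imp_bounded in auto)
qed

lemma integral_halfline_FTC:
  fixes g g' :: "real \<Rightarrow> 'b::euclidean_space"
  assumes d: "\<And>a. (g has_vector_derivative g' a) (at a)" and c: "continuous_on UNIV g'"
    and R: "\<And>a. \<bar>a\<bar> \<ge> R \<Longrightarrow> g a = 0" "\<And>a. \<bar>a\<bar> \<ge> R \<Longrightarrow> g' a = 0"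
  shows "(LINT a|lborel. indicator {0<..} a *\<^sub>R g' a) = - g 0"
    and "(LINT a|lborel. g' a) = 0"
proof -
  define r where "r = \<bar>R\<bar>"
  have r: "r \<ge> 0" "g r = 0" "g (-r) = 0" "\<And>a. \<bar>a\<bar> > r \<Longrightarrow> g' a = 0"
    using R by (auto simp: r_def)
  have g'm[measurable]: "g' \<in> borel_measurable borel" using c by (rule borel_measurable_continuous_onI)
  have c': "continuous_on S g'" for S using c by (rule continuous_on_subset) simp
  have ne0: "AE a in lborel. a \<noteq> (0::real)" using AE_lborel_inner_neq[of "1::real" 0] by simp
  have "(LINT a|lborel. indicator {0<..} a *\<^sub>R g' a) = (LINT a|lborel. indicator {0..r} a *\<^sub>R g' a)"
  proof (rule integral_cong_AE)
    show "AE a in lborel. indicator {0<..} a *\<^sub>R g' a = indicator {0..r} a *\<^sub>R g' a"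
      using ne0 by eventually_elim (use r(4) in \<open>auto simp: indicator_def\<close>)
  qed measurable
  also have "\<dots> = g r - g 0"
    using r(1) d c' by (intro integral_FTC_Icc) (auto intro: has_vector_derivative_at_within)
  finally show "(LINT a|lborel. indicator {0<..} a *\<^sub>R g' a) = - g 0" using r by simp
  have "(LINT a|lborel. g' a) = (LINT a|lborel. indicator {-r..r} a *\<^sub>R g' a)"
    using r(4) by (intro Bochner_Integration.integral_cong) (auto simp: indicator_def abs_le_iff not_le)
  also have "\<dots> = g r - g (-r)"
    using r(1) d c' by (intro integral_FTC_Icc) (auto intro: has_vector_derivative_at_within)
  finally show "(LINT a|lborel. g' a) = 0" using r by simp
qed

text \<open>Fubini and the fundamental theorem in the first variable. The other variables may be
  confined to any Borel set S, so the same result covers a quadrant: one of its sides is the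
  half-line integrated over, the other belongs to S.\<close>

lemma integral_halfspace_FTC:
  fixes g g' :: "real \<times> 'r::euclidean_space \<Rightarrow> 'b::euclidean_space"
  assumes d: "\<And>a r. ((\<lambda>a. g (a, r)) has_vector_derivative g' (a, r)) (at a)"
    and cg: "continuous_on UNIV g" and c: "continuous_on UNIV g'" and K: "compact K"
    and z: "\<And>p. p \<notin> K \<Longrightarrow> g p = 0" "\<And>p. p \<notin> K \<Longrightarrow> g' p = 0" and S[measurable]: "S \<in> sets borel"
  shows "(LINT p|lborel. (indicator {0<..} (fst p) * indicator S (snd p)) *\<^sub>R g' p) =
           - (LINT r|lborel. indicator S r *\<^sub>R g (0, r))"
    and "(LINT p|lborel. indicator S (snd p) *\<^sub>R g' p) = 0"
proof -
  have [measurable]: "g' \<in> borel_measurable borel" using c by (rule borel_measurable_continuous_onI)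
  obtain R where R: "\<And>p. p \<in> K \<Longrightarrow> norm p \<le> R" 
    using compact_imp_bounded[OF K] unfolding bounded_iff by blast
  have z': "g (a, r) = 0" "g' (a, r) = 0" if "\<bar>a\<bar> \<ge> R + 1" for a r
  proof -
    have "norm (a, r) \<ge> \<bar>a\<bar>" using norm_fst_le[of a r] by simp
    then have "(a, r) \<notin> K" using that R[of "(a, r)"] by linarith
    then show "g (a, r) = 0" "g' (a, r) = 0" using z by auto
  qed
  have cr: "continuous_on UNIV (\<lambda>a. g' (a, r))" for r
    by (intro continuous_on_compose2[OF c] continuous_intros) auto
  have m1: "{0<..} \<times> S \<in> sets (borel :: (real \<times> 'r) measure)" "UNIV \<times> S \<in> sets (borel :: (real \<times> 'r) measure)"
    using S by (auto intro!: borel_Times)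
  have i1: "integrable lborel (\<lambda>p. indicator ({0<..} \<times> S) p *\<^sub>R g' p)"
    "integrable lborel (\<lambda>p. indicator (UNIV \<times> S) p *\<^sub>R g' p)"
    using c K z m1 by (auto intro!: integrable_lborel_continuous_compact_support)
  have int1: "integrable (lborel \<Otimes>\<^sub>M lborel) (case_prod (\<lambda>a r. (indicator {0<..} a * indicator S r) *\<^sub>R g' (a, r)))"
    using i1(1) by (simp add: lborel_prod split_beta' indicator_times)
  have int2: "integrable (lborel \<Otimes>\<^sub>M lborel) (case_prod (\<lambda>a r. indicator S r *\<^sub>R g' (a, r)))"
    using i1(2) by (simp add: lborel_prod split_beta' indicator_times)
  have "(LINT p|lborel. (indicator {0<..} (fst p) * indicator S (snd p)) *\<^sub>R g' p)
     = (LINT r|lborel. LINT a|lborel. (indicator {0<..} a * indicator S r) *\<^sub>R g' (a, r))"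
    by (subst lborel_pair.integral_snd[OF int1]) (simp add: lborel_prod split_beta')
  also have "\<dots> = (LINT r|lborel. indicator S r *\<^sub>R (LINT a|lborel. indicator {0<..} a *\<^sub>R g' (a, r)))"
    by (simp add: mult.commute[of "indicator {0<..} _"] scaleR_scaleR[symmetric] del: scaleR_scaleR)
  also have "\<dots> = (LINT r|lborel. indicator S r *\<^sub>R - g (0, r))"
    by (subst integral_halfline_FTC(1)[where g="\<lambda>a. g (a, _)", OF d cr z']) auto
  finally show "(LINT p|lborel. (indicator {0<..} (fst p) * indicator S (snd p)) *\<^sub>R g' p) =
           - (LINT r|lborel. indicator S r *\<^sub>R g (0, r))" by simp
  have "(LINT p|lborel. indicator S (snd p) *\<^sub>R g' p)
     = (LINT r|lborel. LINT a|lborel. indicator S r *\<^sub>R g' (a, r))"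
    by (subst lborel_pair.integral_snd[OF int2]) (simp add: lborel_prod split_beta')
  also have "\<dots> = (LINT r|lborel. indicator S r *\<^sub>R (LINT a|lborel. g' (a, r)))" by simp
  also have "\<dots> = 0"
    by (subst integral_halfline_FTC(2)[where g="\<lambda>a. g (a, _)", OF d cr z']) auto
  finally show "(LINT p|lborel. indicator S (snd p) *\<^sub>R g' p) = 0" .
qed

section \<open>Linear changes of variables and the divergence theorem on the wedge\<close>

text \<open>The image of Lebesgue measure under a linear bijection is translation invariant, hence a
  multiple of Lebesgue measure. The Jacobian factor appears as the volume of the preimage of the
  unit cube, without determinants.\<close>

lemma linear_bijection_distr_lborel:
  fixes T :: "'a::euclidean_space \<Rightarrow> 'b::euclidean_space"
  assumes T: "bounded_linear T" and T': "bounded_linear T'" and inv: "\<And>x. T (T' x) = x" "\<And>x. T' (T x) = x"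
  shows "distr lborel borel T = density lborel (\<lambda>_. ennreal (measure lborel (T -` cbox 0 One)))"
proof -
  have [measurable]: "T \<in> borel_measurable borel"
    using T by (intro borel_measurable_continuous_onI linear_continuous_on)
  have em: "emeasure (distr lborel borel T) A = emeasure lborel (T -` A)" if "A \<in> sets borel" for A
    using that by (subst emeasure_distr) auto
  have vim: "T -` A = T' ` A" for A
  proof (intro set_eqI iffI)
    fix x assume "x \<in> T -` A"
    then have "T' (T x) \<in> T' ` A" by blast
    then show "x \<in> T' ` A" by (simp add: inv)
  qed (auto simp: inv)
  have "distr lborel borel T = density lborel (\<lambda>_. ennreal (measure (distr lborel borel T) (cbox 0 One)))"
  proof (rule translation_invariant_borel_eq_density_lborel)
    fix a and A :: "'b set" assume A: "A \<in> sets borel"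
    have m: "(\<lambda>x. a + x) -` A \<in> sets borel" "T -` A \<in> sets borel"
      using A by (auto intro!: measurable_sets_borel[of _ borel])
    have "T -` ((\<lambda>x. a + x) -` A) = (\<lambda>x. T' a + x) -` (T -` A)"
      using inv by (auto simp: linear_add[OF bounded_linear.linear[OF T]])
    moreover have "emeasure lborel ((\<lambda>x. T' a + x) -` (T -` A)) = emeasure (distr lborel borel ((+) (T' a))) (T -` A)"
      using m by (subst emeasure_distr) auto
    ultimately show "emeasure (distr lborel borel T) ((\<lambda>x. a + x) -` A) = emeasure (distr lborel borel T) A"
      using A m by (simp add: em lborel_distr_plus)
  next
    have "bounded (T' ` cbox 0 One)" by (intro bounded_linear_image bounded_cbox T')
    then show "emeasure (distr lborel borel T) (cbox 0 One) < \<infinity>"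
      using emeasure_bounded_finite by (subst em) (simp_all add: vim)
  qed simp
  then show ?thesis using em[of "cbox 0 One"] by (simp add: measure_def)
qed

lemma integral_linear_bijection:
  fixes T :: "'a::euclidean_space \<Rightarrow> 'b::euclidean_space"
  assumes T: "bounded_linear T" and T': "bounded_linear T'" and inv: "\<And>x. T (T' x) = x" "\<And>x. T' (T x) = x"
  obtains c where "c > 0"
    "\<And>f :: 'b \<Rightarrow> 'c::{banach,second_countable_topology}. f \<in> borel_measurable borel \<Longrightarrow>
       (LINT x|lborel. f (T x)) = c *\<^sub>R (LINT x|lborel. f x)"
    "\<And>f :: 'b \<Rightarrow> 'c. f \<in> borel_measurable borel \<Longrightarrow>
       integrable lborel (\<lambda>x. f (T x)) \<longleftrightarrow> integrable lborel f"
    "c = measure lborel (T -` cbox 0 One)"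
proof -
  define c where "c = measure lborel (T -` cbox 0 One)"
  have [measurable]: "T \<in> borel_measurable borel"
    using T by (intro borel_measurable_continuous_onI linear_continuous_on)
  have *: "distr lborel borel T = density lborel (\<lambda>_. ennreal c)"
    unfolding c_def by (rule linear_bijection_distr_lborel[OF assms])
  have c: "c > 0"
  proof (rule ccontr)
    assume "\<not> c > 0"
    then have "c = 0" by (simp add: c_def measure_nonneg antisym)
    then have "emeasure (distr lborel borel T) UNIV = 0" using * by (simp add: emeasure_density)
    then show False by (subst (asm) emeasure_distr) (auto simp: emeasure_lborel_UNIV)
  qed
  show ?thesis
  proof (rule that[OF c])
    fix f :: "'b \<Rightarrow> 'c" assume [measurable]: "f \<in> borel_measurable borel"
    have "(LINT x|lborel. f (T x)) = (LINT x|distr lborel borel T. f x)" by (subst integral_distr) auto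
    also have "\<dots> = c *\<^sub>R (LINT x|lborel. f x)" unfolding * using c by (subst integral_density) auto
    finally show "(LINT x|lborel. f (T x)) = c *\<^sub>R (LINT x|lborel. f x)" .
    have "integrable lborel (\<lambda>x. f (T x)) \<longleftrightarrow> integrable (distr lborel borel T) f"
      by (subst integrable_distr_eq) auto
    also have "\<dots> \<longleftrightarrow> integrable lborel f"
      unfolding * using c by (subst integrable_density) (auto simp: integrable_scaleR_right_iff)
    finally show "integrable lborel (\<lambda>x. f (T x)) \<longleftrightarrow> integrable lborel f" .
  qed (simp add: c_def)
qed

text \<open>The wedge is the set \<open>0 < A, 0 < B\<close> if its opening angle is less than \<open>\<pi>\<close>, and \<open>0 < A\<close> or
  \<open>0 < B\<close> otherwise, where \<open>- A\<close> and \<open>- B\<close> are the inner products with the outward normals of the two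
  faces. In the oblique coordinates \<open>(a, b, c)\<close> along the faces and the edge, \<open>A = a D\<close>, \<open>B = b D\<close>.\<close>

locale wedge =
  fixes \<alpha> \<beta> :: real
  assumes angles: "- pi < \<alpha>" "\<alpha> < \<beta>" "\<beta> < pi" "\<beta> - \<alpha> \<noteq> pi"
begin

definition D :: real where "D = sin (\<beta> - \<alpha>)"

definition A :: "real^3 \<Rightarrow> real" where "A x = x$1 * sin \<beta> - x$2 * cos \<beta>"

definition B :: "real^3 \<Rightarrow> real" where "B x = x$2 * cos \<alpha> - x$1 * sin \<alpha>"

definition W :: "(real^3) set" where
  "W = {x. if D > 0 then A x > 0 \<and> B x > 0 else A x > 0 \<or> B x > 0}"

definition T :: "real \<times> real \<times> real \<Rightarrow> real^3" where
  "T p = vector [fst p * cos \<alpha> + fst (snd p) * cos \<beta>, fst p * sin \<alpha> + fst (snd p) * sin \<beta>, snd (snd p)]"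

definition T' :: "real^3 \<Rightarrow> real \<times> real \<times> real" where
  "T' x = (A x / D, B x / D, x$3)"

lemma D_neq_0: "D \<noteq> 0"
proof
  assume "D = 0"
  then have "sin (\<beta> - \<alpha> - pi) = 0" by (simp add: D_def sin_diff)
  moreover have "- pi < \<beta> - \<alpha> - pi" "\<beta> - \<alpha> - pi < pi" using angles by auto
  ultimately have "\<beta> - \<alpha> - pi = 0" using sin_eq_0_pi by blast
  then show False using angles by simp
qed

lemma D_eq: "D = sin \<beta> * cos \<alpha> - cos \<beta> * sin \<alpha>"
  by (simp add: D_def sin_diff)

lemma A_T [simp]: "A (T p) = fst p * D" and B_T [simp]: "B (T p) = fst (snd p) * D" and T_3 [simp]: "T p $ 3 = snd (snd p)"
  by (simp_all add: A_def B_def T_def D_eq algebra_simps)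

lemma linear_T: "bounded_linear T"
  unfolding linear_conv_bounded_linear[symmetric]
  by (rule linearI) (simp_all add: T_def vec_eq_iff forall_3 algebra_simps)

lemma linear_A: "bounded_linear A" and linear_B: "bounded_linear B"
  unfolding linear_conv_bounded_linear[symmetric]
  by (rule linearI; simp add: A_def B_def algebra_simps)+

lemma linear_T': "bounded_linear T'"
  unfolding T'_def
  by (intro bounded_linear_Pair bounded_linear_vec_nth linear_A[THEN bounded_linear_compose[OF bounded_linear_divide]]
      linear_B[THEN bounded_linear_compose[OF bounded_linear_divide]])

lemma T'_T [simp]: "T' (T p) = p"
  using D_neq_0 by (simp add: T'_def)

lemma T_T' [simp]: "T (T' x) = x"
proof -
  have "x$1 * D = A x * cos \<alpha> + B x * cos \<beta>" "x$2 * D = A x * sin \<alpha> + B x * sin \<beta>"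
    by (simp_all add: A_def B_def D_eq algebra_simps)
  then have "x$1 = A x * cos \<alpha> / D + B x * cos \<beta> / D" "x$2 = A x * sin \<alpha> / D + B x * sin \<beta> / D"
    using D_neq_0 by (simp_all add: field_simps)
  then show ?thesis by (simp add: T_def T'_def vec_eq_iff forall_3)
qed

lemma continuous_A: "continuous_on S A" and continuous_B: "continuous_on S B"
  and continuous_T: "continuous_on S' T"
  by (simp_all add: linear_A linear_B linear_T linear_continuous_on)

lemma measurable_A [measurable]: "A \<in> borel_measurable borel"
  and measurable_B [measurable]: "B \<in> borel_measurable borel"
  and measurable_T [measurable]: "T \<in> borel_measurable borel"
  using continuous_A continuous_B continuous_T by (auto intro: borel_measurable_continuous_onI)

lemma open_W: "open W"
proof -
  have "open {x. A x > 0}" "open {x. B x > 0}"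
    using continuous_A continuous_B by (auto intro!: open_Collect_less continuous_intros)
  then show ?thesis unfolding W_def
    by (cases "D > 0") (simp_all add: open_Collect_conj open_Collect_disj)
qed

lemma W_measurable [measurable]: "W \<in> sets borel"
  using open_W by simp

text \<open>The map \<open>T\<close> has determinant \<open>D\<close>, so this is 1 / |D|; it is
  carried along as a positive constant.\<close>

definition J :: real where "J = measure lborel (T -` cbox 0 One)"

lemma J_pos: "J > 0"
  using integral_linear_bijection[OF linear_T linear_T' T_T' T'_T] unfolding J_def by metis

lemma integral_T:
  fixes f :: "real^3 \<Rightarrow> 'c::{banach,second_countable_topology}"
  assumes "f \<in> borel_measurable borel"
  shows "(LINT x|lborel. f (T x)) = J *\<^sub>R (LINT x|lborel. f x)"
    and "integrable lborel (\<lambda>x. f (T x)) \<longleftrightarrow> integrable lborel f"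
  using integral_linear_bijection[OF linear_T linear_T' T_T' T'_T, where 'c='c] assms unfolding J_def by metis+

end

text \<open>This permutation and \<open>rot3\<close> bring the second and the third oblique
  coordinate into the first place, where \<open>integral_halfspace_FTC\<close> integrates.\<close>

definition swap12 :: "real \<times> real \<times> real \<Rightarrow> real \<times> real \<times> real" where
  "swap12 p = (fst (snd p), fst p, snd (snd p))"

definition rot3 :: "real \<times> real \<times> real \<Rightarrow> real \<times> real \<times> real" where
  "rot3 p = (fst (snd p), snd (snd p), fst p)"

lemma integral_swap12:
  fixes f :: "real \<times> real \<times> real \<Rightarrow> 'c::{banach,second_countable_topology}"
  assumes "f \<in> borel_measurable borel"
  shows "(LINT x|lborel. f (swap12 x)) = (LINT x|lborel. f x)"
    "integrable lborel (\<lambda>x. f (swap12 x)) \<longleftrightarrow> integrable lborel f"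
proof -
  have l: "bounded_linear swap12"
    unfolding swap12_def[abs_def] by (intro bounded_linear_intros)
  have One: "(One :: real \<times> real \<times> real) = (1, 1, 1)" by (simp add: Basis_prod_def)
  have v: "swap12 -` cbox 0 One = cbox 0 One"
    unfolding One by (auto simp: swap12_def cbox_Pair_eq zero_prod_def)
  have i: "\<And>x. swap12 (swap12 x) = x" by (simp add: swap12_def)
  have m1: "measure lborel (cbox 0 (One :: real \<times> real \<times> real)) = 1"
    using emeasure_lborel_unit_cbox by (simp add: measure_def)
  obtain c where "(LINT x|lborel. f (swap12 x)) = c *\<^sub>R (LINT x|lborel. f x)" "c = 1"
    "integrable lborel (\<lambda>x. f (swap12 x)) \<longleftrightarrow> integrable lborel f"
    using integral_linear_bijection[OF l l i i, where 'c='c] assms unfolding v m1 by metis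
  then show "(LINT x|lborel. f (swap12 x)) = (LINT x|lborel. f x)"
    "integrable lborel (\<lambda>x. f (swap12 x)) \<longleftrightarrow> integrable lborel f" by auto
qed

lemma integral_rot3:
  fixes f :: "real \<times> real \<times> real \<Rightarrow> 'c::{banach,second_countable_topology}"
  assumes "f \<in> borel_measurable borel"
  shows "(LINT x|lborel. f (rot3 x)) = (LINT x|lborel. f x)"
    "integrable lborel (\<lambda>x. f (rot3 x)) \<longleftrightarrow> integrable lborel f"
proof -
  let ?r = "\<lambda>p :: real \<times> real \<times> real. rot3 (rot3 p)"
  have l: "bounded_linear rot3"
    unfolding rot3_def[abs_def] by (intro bounded_linear_intros)
  then have l': "bounded_linear ?r" using bounded_linear_compose by blast
  have One: "(One :: real \<times> real \<times> real) = (1, 1, 1)" by (simp add: Basis_prod_def)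
  have v: "rot3 -` cbox 0 One = cbox 0 One"
    unfolding One by (auto simp: rot3_def cbox_Pair_eq zero_prod_def)
  have i: "\<And>x. rot3 (?r x) = x" "\<And>x. ?r (rot3 x) = x" by (simp_all add: rot3_def)
  have m1: "measure lborel (cbox 0 (One :: real \<times> real \<times> real)) = 1"
    using emeasure_lborel_unit_cbox by (simp add: measure_def)
  obtain c where "(LINT x|lborel. f (rot3 x)) = c *\<^sub>R (LINT x|lborel. f x)" "c = 1"
    "integrable lborel (\<lambda>x. f (rot3 x)) \<longleftrightarrow> integrable lborel f"
    using integral_linear_bijection[OF l l' i, where 'c='c] assms unfolding v m1 by metis
  then show "(LINT x|lborel. f (rot3 x)) = (LINT x|lborel. f x)"
    "integrable lborel (\<lambda>x. f (rot3 x)) \<longleftrightarrow> integrable lborel f" by auto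
qed

context wedge
begin

text \<open>The faces carry the coordinates \<open>(b, c)\<close> and \<open>(a, c)\<close>; both charts are isometric.\<close>

definition chart\<^sub>1 :: "real \<times> real \<Rightarrow> real^3" where "chart\<^sub>1 r = T (0, r)"

definition chart\<^sub>2 :: "real \<times> real \<Rightarrow> real^3" where "chart\<^sub>2 r = T (fst r, 0, snd r)"

definition face_integral :: "(real \<times> real \<Rightarrow> real^3) \<Rightarrow> (real^3 \<Rightarrow> 'b::euclidean_space) \<Rightarrow> 'b" where
  "face_integral c \<psi> = (LINT r|lborel. indicator {0<..} (fst r) *\<^sub>R \<psi> (c r))"

text \<open>In oblique coordinates the wedge is the quadrant a, b > 0 if D > 0, and up to a null set
  the complement of that quadrant if D < 0. A derivative of a compactly supported function has
  integral 0 over the whole space, so the second case only changes the sign; this is the factor sgn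
  D. Along the edge direction the quadrant is invariant and no boundary term arises.\<close>

lemma integral_W_directional:
  fixes \<psi> :: "real^3 \<Rightarrow> 'b::euclidean_space"
  assumes tf: "tf K \<psi>"
  defines "d \<equiv> \<lambda>v x. \<Sum>i\<in>UNIV. v $ i *\<^sub>R pd i \<psi> x"
  shows "(LINT x|lborel. indicator W x *\<^sub>R d (T (1, 0, 0)) x) = (- sgn D / J) *\<^sub>R face_integral chart\<^sub>1 \<psi>"
    and "(LINT x|lborel. indicator W x *\<^sub>R d (T (0, 1, 0)) x) = (- sgn D / J) *\<^sub>R face_integral chart\<^sub>2 \<psi>"
    and "(LINT x|lborel. indicator W x *\<^sub>R d (T (0, 0, 1)) x) = 0"
proof -
  have sm: "smooth \<psi>" and K: "compact K" and z: "\<And>x. x \<notin> K \<Longrightarrow> \<psi> x = 0"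
    using tf by (auto simp: tf_def)
  have dd: "(\<psi> has_derivative (\<lambda>v. d v x)) (at x)" for x
    unfolding d_def by (rule has_derivative_pd[OF smooth_differentiable[OF sm]])
  have dc: "continuous_on UNIV (d v)" for v
    unfolding d_def by (intro continuous_intros smooth_continuous smooth_pd sm)
  have dz: "d v x = 0" if "x \<notin> K" for v x
    using tf_pd[OF tf] that by (simp add: d_def tf_def)
  have dm[measurable]: "d v \<in> borel_measurable borel" for v
    using dc by (rule borel_measurable_continuous_onI)
  have sc: "continuous_on UNIV \<psi>" by (rule smooth_continuous[OF sm])
  have KT: "compact (T' ` K)"
    using K by (intro compact_continuous_image linear_continuous_on linear_T')
  have zT: "\<psi> (T p) = 0" "d v (T p) = 0" if "p \<notin> T' ` K" for p v
  proof -
    have "T p \<notin> K" using that by (metis T'_T image_eqI)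
    then show "\<psi> (T p) = 0" "d v (T p) = 0" using z dz by auto
  qed
  have cT: "continuous_on UNIV (\<lambda>p. \<psi> (T p))" "continuous_on UNIV (\<lambda>p. d v (T p))" for v
    using continuous_on_compose2[OF sc continuous_T] continuous_on_compose2[OF dc continuous_T] by auto
  have lin: "bounded_linear swap12" "bounded_linear rot3"
    unfolding swap12_def[abs_def] rot3_def[abs_def] by (intro bounded_linear_intros)+
  have Ks: "compact (swap12 ` T' ` K)" "compact (rot3 ` rot3 ` T' ` K)"
    using KT lin by (auto intro!: compact_continuous_image linear_continuous_on)
  have ne: "AE p in lborel. fst (p :: real \<times> real \<times> real) \<noteq> 0 \<and> fst (snd p) \<noteq> 0"
  proof -
    have "AE p in lborel. (1, 0, 0) \<bullet> (p :: real \<times> real \<times> real) \<noteq> 0"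
      "AE p in lborel. (0, 1, 0) \<bullet> (p :: real \<times> real \<times> real) \<noteq> 0"
      by (rule AE_lborel_inner_neq; simp add: zero_prod_def)+
    then show ?thesis by eventually_elim (simp add: inner_prod_def)
  qed
  define Q where "Q p = (indicator {0<..} (fst p) * indicator {0<..} (fst (snd p)) :: real)" for p :: "real \<times> real \<times> real"
  have Qm[measurable]: "Q \<in> borel_measurable borel"
  proof -
    have "Q = indicator {p. fst p > 0 \<and> fst (snd p) > 0}"
      by (auto simp: Q_def indicator_def fun_eq_iff)
    moreover have "open {p :: real \<times> real \<times> real. fst p > 0 \<and> fst (snd p) > 0}"
      by (intro open_Collect_conj open_Collect_less continuous_intros)
    ultimately show ?thesis by (auto intro!: borel_measurable_indicator)
  qed
  have Wq: "AE p in lborel. indicator W (T p) = (if D > 0 then Q p else 1 - Q p)"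
    using ne
  proof eventually_elim
    case (elim p)
    then show ?case using D_neq_0
      by (auto simp: W_def Q_def indicator_def zero_less_mult_iff)
  qed
  have base: "J *\<^sub>R (LINT x|lborel. indicator W x *\<^sub>R d v x) =
      (if D > 0 then (LINT p|lborel. Q p *\<^sub>R d v (T p))
       else (LINT p|lborel. d v (T p)) - (LINT p|lborel. Q p *\<^sub>R d v (T p)))" for v
  proof -
    have i0: "integrable lborel (\<lambda>p. d v (T p))"
      using integrable_lborel_continuous_compact_support[OF cT(2) KT zT(2), of UNIV v] by simp
    have i1: "integrable lborel (\<lambda>p. Q p *\<^sub>R d v (T p))"
    proof (rule Bochner_Integration.integrable_bound[OF i0])
      show "AE p in lborel. norm (Q p *\<^sub>R d v (T p)) \<le> norm (d v (T p))"
        by (simp add: Q_def indicator_def)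
    qed measurable
    have "J *\<^sub>R (LINT x|lborel. indicator W x *\<^sub>R d v x) = (LINT p|lborel. indicator W (T p) *\<^sub>R d v (T p))"
      by (rule integral_T(1)[symmetric]) measurable
    also have "\<dots> = (LINT p|lborel. (if D > 0 then Q p else 1 - Q p) *\<^sub>R d v (T p))"
      by (rule integral_cong_AE) (use Wq in \<open>auto elim!: eventually_mono\<close>)
    also have "\<dots> = (if D > 0 then (LINT p|lborel. Q p *\<^sub>R d v (T p))
       else (LINT p|lborel. d v (T p)) - (LINT p|lborel. Q p *\<^sub>R d v (T p)))"
      using i0 i1 by (auto simp: scaleR_diff_left Bochner_Integration.integral_diff)
    finally show ?thesis .
  qed
  have vd: "((\<lambda>a. \<psi> (T (u + a *\<^sub>R e))) has_vector_derivative d (T e) (T (u + a *\<^sub>R e))) (at a)" for u e a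
  proof -
    have "((\<lambda>a. T (u + a *\<^sub>R e)) has_derivative (\<lambda>h. T (h *\<^sub>R e))) (at a)"
      by (rule bounded_linear.has_derivative[OF linear_T]) (auto intro!: derivative_eq_intros)
    then have "((\<lambda>a. \<psi> (T (u + a *\<^sub>R e))) has_derivative (\<lambda>h. d (T (h *\<^sub>R e)) (T (u + a *\<^sub>R e)))) (at a)"
      by (rule has_derivative_compose[OF _ dd])
    moreover have "d (T (h *\<^sub>R e)) x = h *\<^sub>R d (T e) x" for h x
      using linear_cmul[OF bounded_linear.linear[OF linear_T]] by (simp add: d_def scaleR_sum_right)
    ultimately show ?thesis by (simp add: has_vector_derivative_def)
  qed
  let ?S = "{r :: real \<times> real. fst r > 0}"
  have S: "?S \<in> sets borel" by (intro borel_open open_Collect_less continuous_intros)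
  have v1: "((\<lambda>a. \<psi> (T (a, r))) has_vector_derivative d (T (1, 0, 0)) (T (a, r))) (at a)" for a r
    using vd[of "(0, r)" "(1, 0, 0)" a] by (simp flip: zero_prod_def)
  have d1: "(LINT p|lborel. Q p *\<^sub>R d (T (1, 0, 0)) (T p)) = - face_integral chart\<^sub>1 \<psi>"
    using integral_halfspace_FTC(1)[OF v1 cT(1) cT(2) KT zT(1) zT(2) S]
    by (simp add: Q_def face_integral_def chart\<^sub>1_def indicator_def)
  have e1: "(LINT p|lborel. d (T (1, 0, 0)) (T p)) = 0"
    using integral_halfspace_FTC(2)[OF v1 cT(1) cT(2) KT zT(1) zT(2), of UNIV] by simp
  show "(LINT x|lborel. indicator W x *\<^sub>R d (T (1, 0, 0)) x) = (- sgn D / J) *\<^sub>R face_integral chart\<^sub>1 \<psi>"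
  proof -
    have "J *\<^sub>R (LINT x|lborel. indicator W x *\<^sub>R d (T (1, 0, 0)) x) = (- sgn D) *\<^sub>R face_integral chart\<^sub>1 \<psi>"
      unfolding base d1 e1 using D_neq_0 by (auto simp: sgn_if)
    then show ?thesis using J_pos
      by (metis (no_types, lifting) divideR_right less_numeral_extra(3) scaleR_scaleR divide_inverse_commute)
  qed
  have v2: "((\<lambda>a. \<psi> (T (swap12 (a, r)))) has_vector_derivative d (T (0, 1, 0)) (T (swap12 (a, r)))) (at a)" for a r
    using vd[of "(fst r, 0, snd r)" "(0, 1, 0)" a] by (simp add: zero_prod_def swap12_def)
  have cS: "continuous_on UNIV (\<lambda>p. \<psi> (T (swap12 p)))" "continuous_on UNIV (\<lambda>p. d v (T (swap12 p)))"
    "continuous_on UNIV (\<lambda>p. \<psi> (T (rot3 p)))" "continuous_on UNIV (\<lambda>p. d v (T (rot3 p)))" for v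
    using continuous_on_compose2[OF cT(1) linear_continuous_on] continuous_on_compose2[OF cT(2) linear_continuous_on] lin by auto
  have zS: "\<psi> (T (swap12 p)) = 0" "d v (T (swap12 p)) = 0" if "p \<notin> swap12 ` T' ` K" for p v
  proof -
    have "swap12 p \<notin> T' ` K"
    proof
      assume "swap12 p \<in> T' ` K"
      then have "swap12 (swap12 p) \<in> swap12 ` T' ` K" by blast
      with that show False by (simp add: swap12_def)
    qed
    then show "\<psi> (T (swap12 p)) = 0" "d v (T (swap12 p)) = 0" using zT by auto
  qed
  have zR: "\<psi> (T (rot3 p)) = 0" "d v (T (rot3 p)) = 0" if "p \<notin> rot3 ` rot3 ` T' ` K" for p v
  proof -
    have "rot3 p \<notin> T' ` K"
    proof
      assume "rot3 p \<in> T' ` K"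
      then have "rot3 (rot3 (rot3 p)) \<in> rot3 ` rot3 ` T' ` K" by blast
      with that show False by (simp add: rot3_def)
    qed
    then show "\<psi> (T (rot3 p)) = 0" "d v (T (rot3 p)) = 0" using zT by auto
  qed
  have d2: "(LINT p|lborel. Q p *\<^sub>R d (T (0, 1, 0)) (T p)) = - face_integral chart\<^sub>2 \<psi>"
  proof -
    have "(LINT p|lborel. Q p *\<^sub>R d (T (0, 1, 0)) (T p)) = (LINT p|lborel. Q (swap12 p) *\<^sub>R d (T (0, 1, 0)) (T (swap12 p)))"
      by (rule integral_swap12(1)[symmetric]) measurable
    then show ?thesis
      using integral_halfspace_FTC(1)[OF v2 cS(1) cS(2) Ks(1) zS(1) zS(2) S]
      by (simp add: Q_def face_integral_def chart\<^sub>2_def indicator_def swap12_def mult.commute)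
  qed
  have e2: "(LINT p|lborel. d (T (0, 1, 0)) (T p)) = 0"
  proof -
    have "(LINT p|lborel. d (T (0, 1, 0)) (T p)) = (LINT p|lborel. d (T (0, 1, 0)) (T (swap12 p)))"
      by (rule integral_swap12(1)[symmetric]) measurable
    then show ?thesis
      using integral_halfspace_FTC(2)[OF v2 cS(1) cS(2) Ks(1) zS(1) zS(2), of UNIV] by simp
  qed
  show "(LINT x|lborel. indicator W x *\<^sub>R d (T (0, 1, 0)) x) = (- sgn D / J) *\<^sub>R face_integral chart\<^sub>2 \<psi>"
  proof -
    have "J *\<^sub>R (LINT x|lborel. indicator W x *\<^sub>R d (T (0, 1, 0)) x) = (- sgn D) *\<^sub>R face_integral chart\<^sub>2 \<psi>"
      unfolding base d2 e2 using D_neq_0 by (auto simp: sgn_if)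
    then show ?thesis using J_pos
      by (metis (no_types, lifting) divideR_right less_numeral_extra(3) scaleR_scaleR divide_inverse_commute)
  qed
  have v3: "((\<lambda>a. \<psi> (T (rot3 (a, r)))) has_vector_derivative d (T (0, 0, 1)) (T (rot3 (a, r)))) (at a)" for a r
    using vd[of "(fst r, snd r, 0)" "(0, 0, 1)" a] by (simp add: zero_prod_def rot3_def)
  let ?S3 = "{r :: real \<times> real. fst r > 0 \<and> snd r > 0}"
  have S3: "?S3 \<in> sets borel" by (intro borel_open open_Collect_conj open_Collect_less continuous_intros)
  have d3: "(LINT p|lborel. Q p *\<^sub>R d (T (0, 0, 1)) (T p)) = 0"
  proof -
    have "(LINT p|lborel. Q p *\<^sub>R d (T (0, 0, 1)) (T p)) = (LINT p|lborel. Q (rot3 p) *\<^sub>R d (T (0, 0, 1)) (T (rot3 p)))"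
      by (rule integral_rot3(1)[symmetric]) measurable
    also have "\<dots> = (LINT p|lborel. indicator ?S3 (snd p) *\<^sub>R d (T (0, 0, 1)) (T (rot3 p)))"
      by (rule Bochner_Integration.integral_cong) (auto simp: Q_def rot3_def indicator_def)
    finally show ?thesis
      using integral_halfspace_FTC(2)[OF v3 cS(3) cS(4) Ks(2) zR(1) zR(2) S3] by simp
  qed
  have e3: "(LINT p|lborel. d (T (0, 0, 1)) (T p)) = 0"
  proof -
    have "(LINT p|lborel. d (T (0, 0, 1)) (T p)) = (LINT p|lborel. d (T (0, 0, 1)) (T (rot3 p)))"
      by (rule integral_rot3(1)[symmetric]) measurable
    then show ?thesis
      using integral_halfspace_FTC(2)[OF v3 cS(3) cS(4) Ks(2) zR(1) zR(2), of UNIV] by simp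
  qed
  have "J *\<^sub>R (LINT x|lborel. indicator W x *\<^sub>R d (T (0, 0, 1)) x) = 0"
    unfolding base d3 e3 by simp
  then show "(LINT x|lborel. indicator W x *\<^sub>R d (T (0, 0, 1)) x) = 0"
    using J_pos by simp
qed

text \<open>\<open>- A\<close> and \<open>- B\<close> of the \<open>j\<close>-th unit vector are the components of the outward normals.\<close>

lemma divergence_W:
  fixes \<psi> :: "real^3 \<Rightarrow> 'b::euclidean_space"
  assumes tf: "tf K \<psi>"
  shows "(LINT x|lborel. indicator W x *\<^sub>R pd j \<psi> x) =
    (1 / (J * \<bar>D\<bar>)) *\<^sub>R ((- A (axis j 1)) *\<^sub>R face_integral chart\<^sub>1 \<psi> + (- B (axis j 1)) *\<^sub>R face_integral chart\<^sub>2 \<psi>)"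
proof -
  define d where "d = (\<lambda>v x. \<Sum>i\<in>UNIV. v $ i *\<^sub>R pd i \<psi> x)"
  have d_axis: "d (axis j 1) x = pd j \<psi> x" for x
    unfolding d_def axis_def by (simp add: if_distrib[where f="\<lambda>c. c *\<^sub>R _"] cong: if_cong)
  have d_add: "d (u + v) x = d u x + d v x" and d_scale: "d (c *\<^sub>R u) x = c *\<^sub>R d u x" for u v c x
    by (simp_all add: d_def scaleR_add_left sum.distrib scaleR_sum_right)
  let ?a = "A (axis j 1) / D" and ?b = "B (axis j 1) / D" and ?c = "axis j 1 $ 3 :: real"
  \<comment> \<open>The unit vector is expanded in the directions of the two faces and the edge. Its
    first two coefficients are the negated normal components divided by \<open>D\<close>.\<close>
  have "axis j 1 = T (T' (axis j 1))" by simp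
  also have "T' (axis j 1) = ?a *\<^sub>R (1, 0, 0) + ?b *\<^sub>R (0, 1, 0) + ?c *\<^sub>R (0, 0, 1)"
    by (simp add: T'_def)
  also have "T \<dots> = ?a *\<^sub>R T (1, 0, 0) + ?b *\<^sub>R T (0, 1, 0) + ?c *\<^sub>R T (0, 0, 1)"
    by (simp only: linear_add[OF bounded_linear.linear[OF linear_T]] linear_cmul[OF bounded_linear.linear[OF linear_T]])
  finally have ax: "axis j 1 = ?a *\<^sub>R T (1, 0, 0) + ?b *\<^sub>R T (0, 1, 0) + ?c *\<^sub>R T (0, 0, 1)" .
  have pd: "pd j \<psi> x = ?a *\<^sub>R d (T (1, 0, 0)) x + ?b *\<^sub>R d (T (0, 1, 0)) x + ?c *\<^sub>R d (T (0, 0, 1)) x" for x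
    unfolding d_axis[symmetric] by (subst ax) (simp only: d_add d_scale)
  have int: "integrable lborel (\<lambda>x. indicator W x *\<^sub>R d v x)" for v
  proof (rule integrable_lborel_continuous_compact_support[where K=K])
    show "continuous_on UNIV (d v)"
      unfolding d_def using tf by (intro continuous_intros smooth_continuous smooth_pd) (simp add: tf_def)
    show "d v x = 0" if "x \<notin> K" for x
      using tf_pd[OF tf] that by (simp add: d_def tf_def)
  qed (use tf in \<open>auto simp: tf_def\<close>)
  have "(LINT x|lborel. indicator W x *\<^sub>R pd j \<psi> x) =
     (LINT x|lborel. ?a *\<^sub>R (indicator W x *\<^sub>R d (T (1, 0, 0)) x) + ?b *\<^sub>R (indicator W x *\<^sub>R d (T (0, 1, 0)) x)
        + ?c *\<^sub>R (indicator W x *\<^sub>R d (T (0, 0, 1)) x))"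
    by (simp add: pd scaleR_add_right mult.commute)
  also have "\<dots> = ?a *\<^sub>R (LINT x|lborel. indicator W x *\<^sub>R d (T (1, 0, 0)) x)
      + ?b *\<^sub>R (LINT x|lborel. indicator W x *\<^sub>R d (T (0, 1, 0)) x)
      + ?c *\<^sub>R (LINT x|lborel. indicator W x *\<^sub>R d (T (0, 0, 1)) x)"
    by (simp only: integral_scaleR_right Bochner_Integration.integral_add Bochner_Integration.integrable_add
          integrable_scaleR_right int)
  also have "\<dots> = ?a *\<^sub>R ((- sgn D / J) *\<^sub>R face_integral chart\<^sub>1 \<psi>) + ?b *\<^sub>R ((- sgn D / J) *\<^sub>R face_integral chart\<^sub>2 \<psi>)"
    using integral_W_directional[OF tf] unfolding d_def by (simp only: scaleR_zero_right add_0_right)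
  also have "\<dots> = (1 / (J * \<bar>D\<bar>)) *\<^sub>R ((- A (axis j 1)) *\<^sub>R face_integral chart\<^sub>1 \<psi> + (- B (axis j 1)) *\<^sub>R face_integral chart\<^sub>2 \<psi>)"
    using D_neq_0 J_pos by (simp add: scaleR_add_right sgn_if field_simps abs_if)
  finally show ?thesis .
qed

end


section \<open>Outward normals and surface integrals near the edge\<close>

text \<open>The direction m - n is tested: its product with n is negative and its product with m
  positive, because 1 - m.n is half of |m - n|^2. A short step in this direction would have to lie
  both inside and outside.\<close>

lemma is_outward_normal_unique:
  assumes n: "is_outward_normal \<Omega> x n" and m: "is_outward_normal \<Omega> x m"
  shows "n = m"
proof (rule ccontr)
  assume "n \<noteq> m"
  define v where "v = m - n"
  define e where "e = 1 - m \<bullet> n"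
  have nm: "n \<bullet> n = 1" "m \<bullet> m = 1"
    using n m by (auto simp: is_outward_normal_def norm_eq_1)
  have v0: "norm v > 0" using \<open>n \<noteq> m\<close> by (simp add: v_def)
  have "norm v ^ 2 = 2 * e"
    by (simp add: v_def e_def power2_norm_eq_inner inner_diff nm inner_commute)
  then have e: "e > 0" using v0 by (smt (verit) zero_less_power)
  \<comment> \<open>With this value the tolerance at the test point is half of its product with m,
    so both strict inequalities hold.\<close>
  define \<epsilon> where "\<epsilon> = e / (2 * norm v)"
  have \<epsilon>: "\<epsilon> > 0" using e v0 by (simp add: \<epsilon>_def)
  obtain r1 where r1: "r1 > 0" "\<And>y. y \<in> ball x r1 \<Longrightarrow> (y - x) \<bullet> n < - \<epsilon> * norm (y - x) \<Longrightarrow> y \<in> \<Omega>"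
    using n \<epsilon> unfolding is_outward_normal_def by blast
  obtain r2 where r2: "r2 > 0" "\<And>y. y \<in> ball x r2 \<Longrightarrow> (y - x) \<bullet> m > \<epsilon> * norm (y - x) \<Longrightarrow> y \<notin> \<Omega>"
    using m \<epsilon> unfolding is_outward_normal_def by blast
  define t where "t = min r1 r2 / (2 * norm v)"
  have t: "t > 0" using r1 r2 v0 by (simp add: t_def)
  define y where "y = x + t *\<^sub>R v"
  have "t * norm v = min r1 r2 / 2" using v0 by (simp add: t_def)
  then have y: "y \<in> ball x r1" "y \<in> ball x r2"
    using t r1 r2 by (auto simp: y_def dist_norm)
  have ny: "\<epsilon> * norm (y - x) = t * e / 2" using t v0 by (simp add: y_def \<epsilon>_def)
  have te: "t * e > 0" using t e by simp
  have "(y - x) \<bullet> n = - (t * e)" "(y - x) \<bullet> m = t * e"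
    by (simp_all add: y_def v_def e_def inner_diff nm inner_commute algebra_simps)
  then show False using r1(2)[OF y(1)] r2(2)[OF y(2)] ny te by linarith
qed

lemma outward_normal_eq: "is_outward_normal \<Omega> x n \<Longrightarrow> outward_normal \<Omega> x = n"
  unfolding outward_normal_def by (rule the_equality) (auto intro: is_outward_normal_unique)

lemma horiz_nth [simp]: "horiz x $ 1 = x $ 1" "horiz x $ 2 = x $ 2"
  by (simp_all add: horiz_def)

text \<open>The angle differences range over (-2 pi, 2 pi), where a sine may also be positive below
  -pi. For an opening below pi such a wrap-around of one difference forces the other above pi, where
  the sine is negative. For an opening above pi both sines are nonpositive outside the
  sector.\<close>

lemma sector_sin_iff:
  fixes \<alpha> \<beta> \<phi> :: real
  assumes "- pi < \<alpha>" "\<alpha> < \<beta>" "\<beta> < pi" "\<beta> - \<alpha> \<noteq> pi" "- pi < \<phi>" "\<phi> \<le> pi"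
  shows "\<alpha> < \<phi> \<and> \<phi> < \<beta> \<longleftrightarrow>
    (if sin (\<beta> - \<alpha>) > 0 then sin (\<beta> - \<phi>) > 0 \<and> sin (\<phi> - \<alpha>) > 0 else sin (\<beta> - \<phi>) > 0 \<or> sin (\<phi> - \<alpha>) > 0)"
proof -
  have neg: "sin t \<le> 0" if "- pi \<le> t" "t \<le> 0" for t :: real
    using that sin_ge_zero[of "- t"] by simp
  have neg': "sin t < 0" if "pi < t" "t < 2 * pi" for t :: real
    using that sin_lt_zero by blast
  have pos': "sin t > 0" if "- 2 * pi < t" "t < - pi" for t :: real
    using that sin_lt_zero[of "- t"] by simp
  have pos: "sin t > 0" if "0 < t" "t < pi" for t :: real
    using that sin_gt_zero by blast
  show ?thesis
  proof (cases "\<beta> - \<alpha> < pi")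
    case True
    then have D: "sin (\<beta> - \<alpha>) > 0" using assms pos[of "\<beta> - \<alpha>"] by simp
    show ?thesis
    proof
      assume "\<alpha> < \<phi> \<and> \<phi> < \<beta>"
      then show "if sin (\<beta> - \<alpha>) > 0 then sin (\<beta> - \<phi>) > 0 \<and> sin (\<phi> - \<alpha>) > 0
          else sin (\<beta> - \<phi>) > 0 \<or> sin (\<phi> - \<alpha>) > 0"
        using D True pos[of "\<beta> - \<phi>"] pos[of "\<phi> - \<alpha>"] by auto
    next
      assume "if sin (\<beta> - \<alpha>) > 0 then sin (\<beta> - \<phi>) > 0 \<and> sin (\<phi> - \<alpha>) > 0
          else sin (\<beta> - \<phi>) > 0 \<or> sin (\<phi> - \<alpha>) > 0"
      then have s: "sin (\<beta> - \<phi>) > 0" "sin (\<phi> - \<alpha>) > 0" using D by auto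
      have "\<alpha> < \<phi>"
      proof (rule ccontr)
        assume "\<not> \<alpha> < \<phi>"
        then have "\<phi> - \<alpha> < - pi" using s neg[of "\<phi> - \<alpha>"] by linarith
        then show False using s neg'[of "\<beta> - \<phi>"] assms by linarith
      qed
      moreover have "\<phi> < \<beta>"
      proof (rule ccontr)
        assume "\<not> \<phi> < \<beta>"
        then have "\<beta> - \<phi> < - pi" using s neg[of "\<beta> - \<phi>"] by linarith
        then show False using s neg'[of "\<phi> - \<alpha>"] assms by linarith
      qed
      ultimately show "\<alpha> < \<phi> \<and> \<phi> < \<beta>" ..
    qed
  next
    case False
    then have D: "\<not> sin (\<beta> - \<alpha>) > 0" using assms neg'[of "\<beta> - \<alpha>"] by simp
    show ?thesis
    proof
      assume "\<alpha> < \<phi> \<and> \<phi> < \<beta>"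
      then have "sin (\<beta> - \<phi>) > 0 \<or> sin (\<phi> - \<alpha>) > 0"
      proof -
        have "\<beta> - \<phi> < pi \<or> \<phi> - \<alpha> < pi" using assms by linarith
        then show ?thesis
          using \<open>\<alpha> < \<phi> \<and> \<phi> < \<beta>\<close> pos[of "\<beta> - \<phi>"] pos[of "\<phi> - \<alpha>"] by auto
      qed
      then show "if sin (\<beta> - \<alpha>) > 0 then sin (\<beta> - \<phi>) > 0 \<and> sin (\<phi> - \<alpha>) > 0
          else sin (\<beta> - \<phi>) > 0 \<or> sin (\<phi> - \<alpha>) > 0" using D by simp
    next
      assume "if sin (\<beta> - \<alpha>) > 0 then sin (\<beta> - \<phi>) > 0 \<and> sin (\<phi> - \<alpha>) > 0
          else sin (\<beta> - \<phi>) > 0 \<or> sin (\<phi> - \<alpha>) > 0"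
      then have s: "sin (\<beta> - \<phi>) > 0 \<or> sin (\<phi> - \<alpha>) > 0" using D by auto
      show "\<alpha> < \<phi> \<and> \<phi> < \<beta>"
      proof (rule ccontr)
        assume "\<not> (\<alpha> < \<phi> \<and> \<phi> < \<beta>)"
        then consider "\<phi> \<le> \<alpha>" | "\<phi> \<ge> \<beta>" by linarith
        then show False
        proof cases
          case 1
          have "sin (\<phi> - \<alpha>) \<le> 0" using 1 False assms by (intro neg) linarith+
          moreover have "sin (\<beta> - \<phi>) \<le> 0"
            using 1 False assms neg'[of "\<beta> - \<phi>"] by (cases "\<beta> - \<phi> = pi") auto
          ultimately show False using s by linarith
        next
          case 2
          have "sin (\<beta> - \<phi>) \<le> 0" using 2 False assms by (intro neg) linarith+
          moreover have "sin (\<phi> - \<alpha>) \<le> 0"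
            using 2 False assms neg'[of "\<phi> - \<alpha>"] by (cases "\<phi> - \<alpha> = pi") auto
          ultimately show False using s by linarith
        qed
      qed
    qed
  qed
qed

context wedge
begin

lemma polar: 
  assumes "horiz x \<noteq> 0"
  defines "\<phi> \<equiv> Arg (Complex (x$1) (x$2))"
  obtains r where "r > 0" "x$1 = r * cos \<phi>" "x$2 = r * sin \<phi>" "A x = r * sin (\<beta> - \<phi>)" "B x = r * sin (\<phi> - \<alpha>)"
    "r = norm (horiz x)"
proof -
  let ?z = "Complex (x$1) (x$2)"
  have z: "?z \<noteq> 0" using assms(1) by (auto simp: complex_eq_iff vec_eq_iff forall_2)
  have "?z = of_real (cmod ?z) * exp (\<i> * of_real \<phi>)"
    unfolding \<phi>_def using z by (rule Arg_eq)
  then have "x$1 = cmod ?z * cos \<phi>" "x$2 = cmod ?z * sin \<phi>"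
    unfolding cis_conv_exp[symmetric] by (auto simp: complex_eq_iff)
  moreover have "cmod ?z = norm (horiz x)"
    by (simp add: cmod_def norm_vec_def L2_set_def sum_2)
  moreover have "cmod ?z > 0" using z by simp
  ultimately show ?thesis
    by (intro that[of "cmod ?z"]) (auto simp: A_def B_def sin_diff algebra_simps)
qed

lemma sector_iff_W: "horiz x \<in> sector \<alpha> \<beta> \<longleftrightarrow> x \<in> W"
proof (cases "horiz x = 0")
  case True
  then have "x$1 = 0" "x$2 = 0" by (metis horiz_nth zero_index)+
  then show ?thesis using True by (auto simp: W_def A_def B_def sector_def)
next
  case False
  define \<phi> where "\<phi> = Arg (Complex (x$1) (x$2))"
  obtain r where r: "r > 0" "A x = r * sin (\<beta> - \<phi>)" "B x = r * sin (\<phi> - \<alpha>)"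
    using polar[OF False] unfolding \<phi>_def by metis
  have \<phi>: "- pi < \<phi>" "\<phi> \<le> pi" unfolding \<phi>_def using mpi_less_Arg Arg_le_pi by auto
  show ?thesis
    using sector_sin_iff[OF angles \<phi>] r(1) False
    by (simp add: sector_def W_def r(2,3) D_def \<phi>_def[symmetric] zero_less_mult_iff)
qed

definition n\<^sub>1 :: "real^3" where "n\<^sub>1 = vector [- sin \<beta>, cos \<beta>, 0]"

definition n\<^sub>2 :: "real^3" where "n\<^sub>2 = vector [sin \<alpha>, - cos \<alpha>, 0]"

lemma inner_n: "x \<bullet> n\<^sub>1 = - A x" "x \<bullet> n\<^sub>2 = - B x"
  by (simp_all add: n\<^sub>1_def n\<^sub>2_def inner_vec_def sum_3 A_def B_def algebra_simps)

lemma n_nth: "n\<^sub>1 $ j = - A (axis j 1)" "n\<^sub>2 $ j = - B (axis j 1)"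
  using inner_n(1)[of "axis j 1"] inner_n(2)[of "axis j 1"] by (simp_all add: inner_axis' )

lemma norm_n: "norm n\<^sub>1 = 1" "norm n\<^sub>2 = 1"
  by (simp_all add: n\<^sub>1_def n\<^sub>2_def norm_vec_def L2_set_def sum_3)

lemma A_diff: "A (x - y) = A x - A y" and B_diff: "B (x - y) = B x - B y"
  by (simp_all add: A_def B_def algebra_simps)

text \<open>On the edge, where both faces meet, the value of \<open>nu\<close> is immaterial.\<close>

definition nu :: "real^3 \<Rightarrow> real^3" where "nu x = (if A x = 0 then n\<^sub>1 else n\<^sub>2)"

text \<open>Since A = a D and B = b D, the conditions on \<open>B x * D\<close> and
  \<open>A x * D\<close> say that the oblique coordinate along the face is nonnegative, whatever the
  sign of \<open>D\<close>. Both closed half-planes contain the edge.\<close>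

definition faces :: "(real^3) set" where
  "faces = {x. (A x = 0 \<and> B x * D \<ge> 0) \<or> (B x = 0 \<and> A x * D \<ge> 0)}"

definition edge :: "(real^3) set" where "edge = {x. A x = 0 \<and> B x = 0}"

lemma edge_iff: "x \<in> edge \<longleftrightarrow> horiz x = 0"
proof
  assume "x \<in> edge"
  then have "x = T (0, 0, x$3)" using T_T'[of x] by (simp add: T'_def edge_def)
  then have "x$1 = T (0, 0, x$3) $ 1" "x$2 = T (0, 0, x$3) $ 2" by metis+
  then show "horiz x = 0" by (simp add: vec_eq_iff forall_2 T_def)
next
  assume "horiz x = 0"
  then have "x$1 = 0" "x$2 = 0" by (metis horiz_nth zero_index)+
  then show "x \<in> edge" by (simp add: edge_def A_def B_def)
qed

lemma closure_W_diff: "closure W - W = faces"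
proof (rule set_eqI, rule iffI)
  fix x assume x: "x \<in> closure W - W"
  show "x \<in> faces"
  proof (cases "D > 0")
    case True
    have "closure W \<subseteq> {x. A x \<ge> 0 \<and> B x \<ge> 0}"
      using True continuous_A continuous_B
      by (intro closure_minimal closed_Collect_conj closed_Collect_le) (auto simp: W_def continuous_intros)
    then show ?thesis using x True by (fastforce simp: W_def faces_def)
  next
    case False
    have "closure W \<subseteq> {x. A x \<ge> 0 \<or> B x \<ge> 0}"
      using False continuous_A continuous_B
      by (intro closure_minimal closed_Collect_disj closed_Collect_le) (auto simp: W_def continuous_intros)
    moreover have "D < 0" using False D_neq_0 by simp
    ultimately show ?thesis using x
      by (auto simp: W_def faces_def mult_nonpos_nonpos)
  qed
next
  fix x assume x: "x \<in> faces"
  have nW: "x \<notin> W"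
    using x D_neq_0 by (auto simp: W_def faces_def zero_le_mult_iff)
  \<comment> \<open>A direction with A = B = 1: it points into the wedge from every point of the
    faces, for openings below and above pi alike.\<close>
  define v where "v = T (1 / D, 1 / D, 0)"
  have v: "A v = 1" "B v = 1" using D_neq_0 by (simp_all add: v_def)
  have "x + (1 / real (Suc n)) *\<^sub>R v \<in> W" for n
  proof -
    have "A (x + (1 / real (Suc n)) *\<^sub>R v) = A x + 1 / real (Suc n)" "B (x + (1 / real (Suc n)) *\<^sub>R v) = B x + 1 / real (Suc n)"
      using v linear_add[OF bounded_linear.linear[OF linear_A]] linear_add[OF bounded_linear.linear[OF linear_B]]
        linear_cmul[OF bounded_linear.linear[OF linear_A]] linear_cmul[OF bounded_linear.linear[OF linear_B]] by simp_all
    moreover have "1 / real (Suc n) > 0" by simp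
    ultimately show ?thesis using x D_neq_0
      by (auto simp: W_def faces_def zero_le_mult_iff intro: add_nonneg_pos)
  qed
  moreover have "(\<lambda>n. x + (1 / real (Suc n)) *\<^sub>R v) \<longlonglongrightarrow> x + 0 *\<^sub>R v"
    by (intro tendsto_intros LIMSEQ_Suc lim_1_over_n)
  ultimately have "x \<in> closure W" unfolding closure_sequential
    by (intro exI[of _ "\<lambda>n. x + (1 / real (Suc n)) *\<^sub>R v"]) simp
  with nW show "x \<in> closure W - W" by blast
qed

lemma charts_isometric: "dist (chart\<^sub>1 p) (chart\<^sub>1 q) = dist p q" "dist (chart\<^sub>2 p) (chart\<^sub>2 q) = dist p q"
proof -
  have c: "(a * cos t - b * cos t)\<^sup>2 + (a * sin t - b * sin t)\<^sup>2 = (a - b)\<^sup>2" for a b t :: real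
  proof -
    have "(a * cos t - b * cos t)\<^sup>2 + (a * sin t - b * sin t)\<^sup>2 = (a - b)\<^sup>2 * ((sin t)\<^sup>2 + (cos t)\<^sup>2)"
      by (simp only: left_diff_distrib[symmetric] power_mult_distrib distrib_left add.commute)
    then show ?thesis by simp
  qed
  show "dist (chart\<^sub>1 p) (chart\<^sub>1 q) = dist p q" "dist (chart\<^sub>2 p) (chart\<^sub>2 q) = dist p q"
    using c[of "fst p" \<beta> "fst q"] c[of "fst p" \<alpha> "fst q"]
    by (simp_all add: chart\<^sub>1_def chart\<^sub>2_def T_def dist_norm norm_vec_def L2_set_def sum_3 norm_prod_def)
qed

lemma range_charts: "range chart\<^sub>1 = {x. A x = 0}" "range chart\<^sub>2 = {x. B x = 0}"
proof -
  show "range chart\<^sub>1 = {x. A x = 0}"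
  proof (intro set_eqI iffI)
    fix x assume "x \<in> {x. A x = 0}"
    then have "x = chart\<^sub>1 (B x / D, x$3)" using T_T'[of x] by (simp add: chart\<^sub>1_def T'_def)
    then show "x \<in> range chart\<^sub>1" by blast
  qed (auto simp: chart\<^sub>1_def)
  show "range chart\<^sub>2 = {x. B x = 0}"
  proof (intro set_eqI iffI)
    fix x assume "x \<in> {x. B x = 0}"
    then have "x = chart\<^sub>2 (A x / D, x$3)" using T_T'[of x] by (simp add: chart\<^sub>2_def T'_def)
    then show "x \<in> range chart\<^sub>2" by blast
  qed (auto simp: chart\<^sub>2_def)
qed

lemma planes_borel: "{x. A x = 0} \<in> sets borel" "{x. B x = 0} \<in> sets borel"
  using continuous_A continuous_B by (auto intro!: borel_closed closed_Collect_eq continuous_intros)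

lemma charts_measurable [measurable]: "chart\<^sub>1 \<in> borel_measurable borel" "chart\<^sub>2 \<in> borel_measurable borel"
  using charts_isometric by (auto intro!: borel_measurable_continuous_onI simp: continuous_on_iff)

lemma edge_measurable [measurable]: "edge \<in> sets borel"
proof -
  have "edge = {x. A x = 0} \<inter> {x. B x = 0}" by (auto simp: edge_def)
  then show ?thesis using planes_borel by (metis sets.Int)
qed

lemma nu_measurable [measurable]: "nu \<in> borel_measurable borel"
  unfolding nu_def using planes_borel(1) by (intro measurable_If) auto

lemma nu_nth_measurable [measurable]: "(\<lambda>x. nu x $ j) \<in> borel_measurable borel"
  by (rule measurable_compose[OF nu_measurable])
     (intro borel_measurable_continuous_onI linear_continuous_on bounded_linear_vec_nth)

text \<open>The edge is the isometric image of a line in the plane, which is a Lebesgue null set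
  there.\<close>

lemma AE_not_edge: "AE x in hausdorff2. x \<notin> edge"
proof -
  have "edge = chart\<^sub>1 ` ({0} \<times> UNIV)"
    using range_charts(1) D_neq_0 by (auto simp: edge_def chart\<^sub>1_def image_iff) 
      (metis T_T' T'_def div_0)
  then have "hausdorff2_outer edge = hausdorff2_outer ({0::real} \<times> (UNIV :: real set))"
    using hausdorff2_outer_isometry[of "{0} \<times> UNIV" chart\<^sub>1] charts_isometric by simp
  also have "\<dots> = emeasure hausdorff2 ({0::real} \<times> (UNIV :: real set))"
    by (subst emeasure_hausdorff2) (auto intro!: borel_closed closed_Times)
  also have "\<dots> = ennreal hausdorff2_const * emeasure lborel ({0::real} \<times> (UNIV :: real set))"
    unfolding hausdorff2_real_prod
    by (subst emeasure_density_const) (auto intro!: borel_closed closed_Times)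
  also have "emeasure lborel ({0::real} \<times> (UNIV :: real set)) = 0"
  proof -
    have "AE p in lborel. (1, 0) \<bullet> (p :: real \<times> real) \<noteq> 0"
      by (rule AE_lborel_inner_neq) (simp add: zero_prod_def)
    then have "AE p in lborel. p \<notin> {0::real} \<times> (UNIV :: real set)"
      by eventually_elim auto
    moreover have "{0::real} \<times> (UNIV :: real set) \<in> sets lborel"
      by (auto intro!: borel_closed closed_Times)
    ultimately show ?thesis by (metis AE_iff_null_sets null_setsD1)
  qed
  finally have "emeasure hausdorff2 edge = 0" by (simp add: emeasure_hausdorff2)
  then show ?thesis by (subst AE_iff_null_sets[symmetric]) (auto simp: null_sets_def)
qed

end

locale wedge_domain = wedge +
  fixes \<Omega> :: "(real^3) set" and h M :: real
  assumes h: "h > 0" and M: "M > 0" and open_\<Omega>: "open \<Omega>" and bounded_\<Omega>: "bounded \<Omega>"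
    and local: "cyl (ball 0 h) {-M<..<M} \<inter> \<Omega> = cyl (sector \<alpha> \<beta> \<inter> ball 0 h) {-M<..<M}"
begin

definition N :: "(real^3) set" where "N = cyl (ball 0 h) {-M<..<M}"

lemma linear_horiz: "bounded_linear horiz"
  unfolding linear_conv_bounded_linear[symmetric]
  by (rule linearI) (simp_all add: horiz_def vec_eq_iff forall_2)

lemma N_iff: "x \<in> N \<longleftrightarrow> norm (horiz x) < h \<and> \<bar>x$3\<bar> < M"
  by (auto simp: N_def cyl_def)

lemma open_N: "open N"
proof -
  have "N = {x. norm (horiz x) < h} \<inter> {x. \<bar>x$3\<bar> < M}" by (auto simp: N_iff)
  moreover have "open {x. norm (horiz x) < h}" "open {x::real^3. \<bar>x$3\<bar> < M}"
    by (auto intro!: open_Collect_less continuous_on_norm[OF linear_continuous_on[OF linear_horiz]] continuous_intros)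
  ultimately show ?thesis by auto
qed

lemma \<Omega>_N: "x \<in> N \<Longrightarrow> x \<in> \<Omega> \<longleftrightarrow> x \<in> W"
  using local sector_iff_W[of x] by (auto simp: N_def cyl_def)

lemma frontier_N: "x \<in> N \<Longrightarrow> x \<in> frontier \<Omega> \<longleftrightarrow> x \<in> faces"
proof -
  assume x: "x \<in> N"
  have eq: "N \<inter> \<Omega> = N \<inter> W" using \<Omega>_N by auto
  have "x \<in> closure \<Omega> \<longleftrightarrow> x \<in> closure W"
    using x eq open_Int_closure_subset[OF open_N, of \<Omega>] open_Int_closure_subset[OF open_N, of W]
      closure_mono[of "N \<inter> \<Omega>" \<Omega>] closure_mono[of "N \<inter> W" W] by auto
  then show ?thesis
    using x \<Omega>_N[OF x] closure_W_diff open_\<Omega> by (auto simp: frontier_def interior_open)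
qed

text \<open>Near a point of a face off the edge, \<open>\<Omega>\<close> is exactly an open
  half-space, so one radius r serves for all \<open>\<epsilon>\<close> in the definition of the
  normal.\<close>

lemma outward_normal_faces:
  assumes "x \<in> N" "x \<in> faces" "x \<notin> edge"
  shows "outward_normal \<Omega> x = nu x"
proof (rule outward_normal_eq)
  show "is_outward_normal \<Omega> x (nu x)"
  proof (cases "A x = 0")
    case True
    then have "B x \<noteq> 0" using assms(3) by (simp add: edge_def)
    then have "B x * D \<ge> 0" "B x * D \<noteq> 0" using assms(2) True D_neq_0 by (simp_all add: faces_def)
    then have B: "B x * D > 0" by linarith
    have "open (N \<inter> {y. B y * D > 0})"
      using continuous_B by (intro open_Int open_N open_Collect_less continuous_intros)
    then obtain r where r: "r > 0" "ball x r \<subseteq> N \<inter> {y. B y * D > 0}"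
      using assms(1) B unfolding open_contains_ball by blast
    have iff: "y \<in> \<Omega> \<longleftrightarrow> A y > 0" if "y \<in> ball x r" for y
    proof -
      have "y \<in> N" "B y * D > 0" using that r by auto
      then show ?thesis using \<Omega>_N[of y] by (auto simp: W_def zero_less_mult_iff)
    qed
    show ?thesis
      unfolding is_outward_normal_def
    proof (intro conjI allI impI exI[of _ r] ballI)
      fix \<epsilon> :: real and y assume e: "0 < \<epsilon>" and y: "y \<in> ball x r"
      have n: "(y - x) \<bullet> nu x = - A y" using True by (simp add: nu_def inner_n A_diff)
      have "\<epsilon> * norm (y - x) \<ge> 0" using e by simp
      then show "(y - x) \<bullet> nu x < - \<epsilon> * norm (y - x) \<Longrightarrow> y \<in> \<Omega>"
        "\<epsilon> * norm (y - x) < (y - x) \<bullet> nu x \<Longrightarrow> y \<notin> \<Omega>"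
        unfolding n iff[OF y] by linarith+
    qed (use r True norm_n in \<open>auto simp: nu_def\<close>)
  next
    case False
    then have "A x * D \<ge> 0" "A x * D \<noteq> 0" and "B x = 0"
      using assms(2) D_neq_0 by (simp_all add: faces_def)
    then have B: "A x * D > 0" "B x = 0" by linarith+
    have "open (N \<inter> {y. A y * D > 0})"
      using continuous_A by (intro open_Int open_N open_Collect_less continuous_intros)
    then obtain r where r: "r > 0" "ball x r \<subseteq> N \<inter> {y. A y * D > 0}"
      using assms(1) B unfolding open_contains_ball by blast
    have iff: "y \<in> \<Omega> \<longleftrightarrow> B y > 0" if "y \<in> ball x r" for y
    proof -
      have "y \<in> N" "A y * D > 0" using that r by auto
      then show ?thesis using \<Omega>_N[of y] by (auto simp: W_def zero_less_mult_iff)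
    qed
    show ?thesis
      unfolding is_outward_normal_def
    proof (intro conjI allI impI exI[of _ r] ballI)
      fix \<epsilon> :: real and y assume e: "0 < \<epsilon>" and y: "y \<in> ball x r"
      have n: "(y - x) \<bullet> nu x = - B y" using False B by (simp add: nu_def inner_n B_diff)
      have "\<epsilon> * norm (y - x) \<ge> 0" using e by simp
      then show "(y - x) \<bullet> nu x < - \<epsilon> * norm (y - x) \<Longrightarrow> y \<in> \<Omega>"
        "\<epsilon> * norm (y - x) < (y - x) \<bullet> nu x \<Longrightarrow> y \<notin> \<Omega>"
        unfolding n iff[OF y] by linarith+
    qed (use r False norm_n in \<open>auto simp: nu_def\<close>)
  qed
qed

text \<open>Within \<open>N\<close> the boundary of \<open>\<Omega>\<close> consists of two
  half-planes that overlap only in the edge, which is null. Each is carried by an isometric chart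
  onto the half-plane of the coordinate plane on which the first coordinate is positive.\<close>

lemma surface_integral:
  fixes g :: "real^3 \<Rightarrow> 'b::euclidean_space"
  assumes gm[measurable]: "g \<in> borel_measurable borel" and K: "compact K" "K \<subseteq> N"
    and g0: "\<And>x. x \<notin> K \<Longrightarrow> g x = 0" and gC: "\<And>x. norm (g x) \<le> C"
  shows "integrable (surface_measure \<Omega>) g"
    and "(LINT x|surface_measure \<Omega>. g x) = hausdorff2_const *\<^sub>R (face_integral chart\<^sub>1 g + face_integral chart\<^sub>2 g)"
proof -
  have fr: "frontier \<Omega> \<in> sets hausdorff2" by (simp add: borel_closed)
  define g1 where "g1 x = indicator {x. B x * D > 0} x *\<^sub>R g x" for x
  define g2 where "g2 x = indicator {x. A x * D > 0} x *\<^sub>R g x" for x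
  have hs: "{x. B x * D > 0} \<in> sets borel" "{x. A x * D > 0} \<in> sets borel"
    using continuous_A continuous_B by (auto intro!: borel_open open_Collect_less continuous_intros)
  have gm12: "g1 \<in> borel_measurable borel" "g2 \<in> borel_measurable borel"
    unfolding g1_def g2_def using hs by auto
  have bnd: "bounded (c -` K)" if "\<And>p q. dist (c p) (c q) = dist p q" for c :: "real \<times> real \<Rightarrow> real^3"
    using compact_imp_bounded[OF K(1)] unfolding bounded_two_points by (metis that vimageE)
  have b1: "integrable lborel (\<lambda>p. g1 (chart\<^sub>1 p))"
    using g0 gC gm12 norm_ge_zero[THEN order_trans, OF gC]
    by (intro integrable_lborel_bounded_support[where K="chart\<^sub>1 -` K" and C=C] bnd charts_isometric)
      (auto simp: g1_def indicator_def)
  have b2: "integrable lborel (\<lambda>p. g2 (chart\<^sub>2 p))"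
    using g0 gC gm12 norm_ge_zero[THEN order_trans, OF gC]
    by (intro integrable_lborel_bounded_support[where K="chart\<^sub>2 -` K" and C=C] bnd charts_isometric)
      (auto simp: g2_def indicator_def)
  have rb: "range chart\<^sub>1 \<in> sets borel" "range chart\<^sub>2 \<in> sets borel"
    unfolding range_charts by (rule planes_borel)+
  note I1 = integral_hausdorff2_isometric_plane[OF charts_isometric(1) rb(1) gm12(1)]
  note I2 = integral_hausdorff2_isometric_plane[OF charts_isometric(2) rb(2) gm12(2)]
  have ae: "AE x in hausdorff2. indicator (frontier \<Omega>) x *\<^sub>R g x =
      indicator (range chart\<^sub>1) x *\<^sub>R g1 x + indicator (range chart\<^sub>2) x *\<^sub>R g2 x"
    using AE_not_edge
  proof eventually_elim
    case (elim x)
    show ?case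
    proof (cases "x \<in> N")
      case True
      have "indicator (frontier \<Omega>) x = (indicator {x. A x = 0} x * indicator {x. B x * D > 0} x
         + indicator {x. B x = 0} x * indicator {x. A x * D > 0} x :: real)"
        using frontier_N[OF True] elim D_neq_0
        by (auto simp: faces_def edge_def indicator_def less_eq_real_def)
      then show ?thesis by (simp add: g1_def g2_def range_charts scaleR_add_left)
    next
      case False
      then have "g x = 0" using g0 K by blast
      then show ?thesis by (simp add: g1_def g2_def)
    qed
  qed
  have int: "integrable hausdorff2 (\<lambda>x. indicator (range chart\<^sub>1) x *\<^sub>R g1 x)"
    "integrable hausdorff2 (\<lambda>x. indicator (range chart\<^sub>2) x *\<^sub>R g2 x)"
    using I1(2) I2(2) b1 b2 by blast+
  have gm': "g \<in> borel_measurable hausdorff2" "g1 \<in> borel_measurable hausdorff2" "g2 \<in> borel_measurable hausdorff2"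
    using gm gm12 by (simp_all cong: measurable_cong_sets)
  have m: "(\<lambda>x. indicator (frontier \<Omega>) x *\<^sub>R g x) \<in> borel_measurable hausdorff2"
    "(\<lambda>x. indicator (range chart\<^sub>1) x *\<^sub>R g1 x + indicator (range chart\<^sub>2) x *\<^sub>R g2 x) \<in> borel_measurable hausdorff2"
    using gm' fr rb by (auto intro!: borel_measurable_scaleR borel_measurable_indicator borel_measurable_add)
  have "integrable hausdorff2 (\<lambda>x. indicator (frontier \<Omega>) x *\<^sub>R g x)"
    using integrable_cong_AE[OF m ae] int by (simp add: Bochner_Integration.integrable_add)
  then show "integrable (surface_measure \<Omega>) g"
    unfolding surface_measure_def using fr by (subst integrable_restrict_space) auto
  have "(LINT x|surface_measure \<Omega>. g x) = (LINT x|hausdorff2. indicator (frontier \<Omega>) x *\<^sub>R g x)"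
    unfolding surface_measure_def using fr by (subst integral_restrict_space) auto
  also have "\<dots> = (LINT x|hausdorff2. indicator (range chart\<^sub>1) x *\<^sub>R g1 x + indicator (range chart\<^sub>2) x *\<^sub>R g2 x)"
    by (rule integral_cong_AE[OF m ae])
  also have "\<dots> = hausdorff2_const *\<^sub>R (LINT p|lborel. g1 (chart\<^sub>1 p)) + hausdorff2_const *\<^sub>R (LINT p|lborel. g2 (chart\<^sub>2 p))"
    using int by (simp add: Bochner_Integration.integral_add I1(1) I2(1))
  also have "(LINT p|lborel. g1 (chart\<^sub>1 p)) = face_integral chart\<^sub>1 g"
    unfolding face_integral_def g1_def using D_neq_0
    by (intro Bochner_Integration.integral_cong) (auto simp: chart\<^sub>1_def indicator_def zero_less_mult_iff mult_less_0_iff)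
  also have "(LINT p|lborel. g2 (chart\<^sub>2 p)) = face_integral chart\<^sub>2 g"
    unfolding face_integral_def g2_def using D_neq_0
    by (intro Bochner_Integration.integral_cong) (auto simp: chart\<^sub>2_def indicator_def zero_less_mult_iff mult_less_0_iff)
  finally show "(LINT x|surface_measure \<Omega>. g x) = hausdorff2_const *\<^sub>R (face_integral chart\<^sub>1 g + face_integral chart\<^sub>2 g)"
    by (simp add: scaleR_add_right)
qed

text \<open>Collects the constants of the two changes of variables, so that the divergence theorem
  takes its usual form up to one factor. The surface terms of \<open>v\<close> and \<open>w\<close>
  carry the same factor and cancel.\<close>

definition \<kappa> :: real where "\<kappa> = 1 / (J * \<bar>D\<bar> * hausdorff2_const)"

lemma \<kappa>_pos: "\<kappa> > 0"
  using J_pos D_neq_0 hausdorff2_const_pos by (simp add: \<kappa>_def)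

lemma tf_bounded:
  fixes \<psi> :: "real^3 \<Rightarrow> 'b::euclidean_space"
  assumes "tf K \<psi>" shows "\<exists>C. \<forall>x. norm (\<psi> x) \<le> C"
proof -
  have "compact (\<psi> ` K)" using assms by (intro compact_continuous_image smooth_continuous) (auto simp: tf_def)
  then obtain C where C: "\<And>x. x \<in> K \<Longrightarrow> norm (\<psi> x) \<le> C"
    using compact_imp_bounded[of "\<psi> ` K"] unfolding bounded_iff by blast
  have "norm (\<psi> x) \<le> max C 0" for x using C[of x] assms by (cases "x \<in> K") (auto simp: tf_def)
  then show ?thesis by blast
qed

lemma tf_measurable: "tf K \<psi> \<Longrightarrow> \<psi> \<in> borel_measurable borel"
  by (intro borel_measurable_continuous_onI smooth_continuous) (simp add: tf_def)

lemma integral_lebesgue_on_\<Omega>: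
  fixes g :: "real^3 \<Rightarrow> 'b::euclidean_space"
  assumes gm: "g \<in> borel_measurable borel" and g0: "\<And>x. x \<notin> N \<Longrightarrow> g x = 0"
  shows "(LINT x|lebesgue_on \<Omega>. g x) = (LINT x|lborel. indicator W x *\<^sub>R g x)"
proof -
  have "(LINT x|lebesgue_on \<Omega>. g x) = (LINT x|lebesgue. indicator \<Omega> x *\<^sub>R g x)"
    using open_\<Omega> by (subst integral_restrict_space) auto
  also have "(\<lambda>x. indicator \<Omega> x *\<^sub>R g x) = (\<lambda>x. indicator W x *\<^sub>R g x)"
    using g0 \<Omega>_N by (fastforce simp: indicator_def)
  also have "(LINT x|lebesgue. indicator W x *\<^sub>R g x) = (LINT x|lborel. indicator W x *\<^sub>R g x)"
    using gm by (intro integral_completion) measurable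
  finally show ?thesis .
qed

lemma divergence_\<Omega>:
  fixes \<psi> :: "real^3 \<Rightarrow> 'b::euclidean_space"
  assumes tf: "tf K \<psi>" and K: "K \<subseteq> N"
  shows "(LINT x|lebesgue_on \<Omega>. pd j \<psi> x) = \<kappa> *\<^sub>R (LINT x|surface_measure \<Omega>. nu x $ j *\<^sub>R \<psi> x)"
proof -
  have cK: "compact K" and z: "\<And>x. x \<notin> K \<Longrightarrow> \<psi> x = 0" using tf by (auto simp: tf_def)
  note [measurable] = tf_measurable[OF tf] tf_measurable[OF tf_pd[OF tf]]
  obtain C where C: "\<And>x. norm (\<psi> x) \<le> C" using tf_bounded[OF tf] by blast
  have nb: "\<bar>nu x $ j\<bar> \<le> 1" for x
    using component_le_norm_cart[of "nu x" j] norm_n by (auto simp: nu_def split: if_splits)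
  have "(LINT x|lebesgue_on \<Omega>. pd j \<psi> x) = (LINT x|lborel. indicator W x *\<^sub>R pd j \<psi> x)"
    using tf_pd[OF tf, of j] K by (intro integral_lebesgue_on_\<Omega>) (auto simp: tf_def)
  also have "\<dots> = (1 / (J * \<bar>D\<bar>)) *\<^sub>R (n\<^sub>1 $ j *\<^sub>R face_integral chart\<^sub>1 \<psi> + n\<^sub>2 $ j *\<^sub>R face_integral chart\<^sub>2 \<psi>)"
    unfolding n_nth by (rule divergence_W[OF tf])
  also have "n\<^sub>1 $ j *\<^sub>R face_integral chart\<^sub>1 \<psi> = face_integral chart\<^sub>1 (\<lambda>x. nu x $ j *\<^sub>R \<psi> x)"
    unfolding face_integral_def integral_scaleR_right[symmetric]
    by (intro Bochner_Integration.integral_cong) (auto simp: nu_def chart\<^sub>1_def)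
  also have "n\<^sub>2 $ j *\<^sub>R face_integral chart\<^sub>2 \<psi> = face_integral chart\<^sub>2 (\<lambda>x. nu x $ j *\<^sub>R \<psi> x)"
    unfolding face_integral_def integral_scaleR_right[symmetric] using D_neq_0
    by (intro Bochner_Integration.integral_cong) (auto simp: nu_def chart\<^sub>2_def indicator_def)
  also have "(1 / (J * \<bar>D\<bar>)) *\<^sub>R (face_integral chart\<^sub>1 (\<lambda>x. nu x $ j *\<^sub>R \<psi> x) + face_integral chart\<^sub>2 (\<lambda>x. nu x $ j *\<^sub>R \<psi> x))
     = \<kappa> *\<^sub>R (LINT x|surface_measure \<Omega>. nu x $ j *\<^sub>R \<psi> x)"
  proof -
    have "norm (nu x $ j *\<^sub>R \<psi> x) \<le> 1 * C" for x
      unfolding norm_scaleR using nb[of x] C[of x] by (intro mult_mono) auto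
    then have "(LINT x|surface_measure \<Omega>. nu x $ j *\<^sub>R \<psi> x) =
        hausdorff2_const *\<^sub>R (face_integral chart\<^sub>1 (\<lambda>x. nu x $ j *\<^sub>R \<psi> x) + face_integral chart\<^sub>2 (\<lambda>x. nu x $ j *\<^sub>R \<psi> x))"
      using z by (intro surface_integral(2)[OF _ cK K]) (auto intro!: borel_measurable_scaleR)
    then show ?thesis using hausdorff2_const_pos by (simp add: \<kappa>_def)
  qed
  finally show ?thesis .
qed

end


section \<open>Pairings in L2 and the stress tensor\<close>

lemma L2_measurable: "L2 N f \<Longrightarrow> f \<in> borel_measurable N"
  and L2_square_integrable: "L2 N f \<Longrightarrow> integrable N (\<lambda>x. (norm (f x))\<^sup>2)"
  by (simp_all add: L2_def)

lemma mult_le_weighted_squares: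
  fixes a b t :: real
  assumes "t > 0" shows "a * b \<le> (t * a\<^sup>2 + b\<^sup>2 / t) / 2"
proof -
  have "0 \<le> (t * a - b)\<^sup>2 / t" using assms by simp
  also have "\<dots> = t * a\<^sup>2 - 2 * a * b + b\<^sup>2 / t"
    using assms by (simp add: power2_eq_square field_simps)
  finally show ?thesis by simp
qed

lemma L2_integrable_scaleR:
  fixes f :: "'a \<Rightarrow> 'b::{banach,second_countable_topology}"
  assumes f: "L2 N f" and B: "L2 N B"
  shows "integrable N (\<lambda>x. B x *\<^sub>R f x)"
proof (rule Bochner_Integration.integrable_bound)
  show "integrable N (\<lambda>x. (norm (B x))\<^sup>2 + (norm (f x))\<^sup>2)"
    using assms by (intro Bochner_Integration.integrable_add L2_square_integrable)
  have "norm (B x *\<^sub>R f x) \<le> norm ((norm (B x))\<^sup>2 + (norm (f x))\<^sup>2)" for x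
  proof -
    have "a * b \<le> a\<^sup>2 + b\<^sup>2" for a b :: real
      using sum_squares_bound[of a b] zero_le_power2[of a] zero_le_power2[of b] by linarith
    then have "\<bar>B x\<bar> * norm (f x) \<le> \<bar>B x\<bar>\<^sup>2 + (norm (f x))\<^sup>2" .
    then show ?thesis by simp
  qed
  then show "AE x in N. norm (B x *\<^sub>R f x) \<le> norm ((norm (B x))\<^sup>2 + (norm (f x))\<^sup>2)" by simp
  show "(\<lambda>x. B x *\<^sub>R f x) \<in> borel_measurable N"
    using L2_measurable[OF f] L2_measurable[OF B] by measurable
qed

lemma L2_add:
  fixes f g :: "'a \<Rightarrow> 'b::{banach,second_countable_topology}"
  assumes f: "L2 N f" and g: "L2 N g" shows "L2 N (\<lambda>x. f x + g x)"
  unfolding L2_def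
proof
  show m: "(\<lambda>x. f x + g x) \<in> borel_measurable N"
    using L2_measurable[OF f] L2_measurable[OF g] by measurable
  show "integrable N (\<lambda>x. (norm (f x + g x))\<^sup>2)"
  proof (rule Bochner_Integration.integrable_bound)
    show "integrable N (\<lambda>x. 2 * (norm (f x))\<^sup>2 + 2 * (norm (g x))\<^sup>2)"
      using f g by (intro Bochner_Integration.integrable_add integrable_mult_right L2_square_integrable)
    have "norm ((norm (f x + g x))\<^sup>2) \<le> norm (2 * (norm (f x))\<^sup>2 + 2 * (norm (g x))\<^sup>2)" for x
    proof -
      have "(norm (f x + g x))\<^sup>2 \<le> (norm (f x) + norm (g x))\<^sup>2"
        by (intro power_mono norm_triangle_ineq) simp
      also have "\<dots> \<le> 2 * (norm (f x))\<^sup>2 + 2 * (norm (g x))\<^sup>2"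
        using sum_squares_bound[of "norm (f x)" "norm (g x)"] by (simp add: power2_sum)
      finally show ?thesis by simp
    qed
    then show "AE x in N. norm ((norm (f x + g x))\<^sup>2) \<le> norm (2 * (norm (f x))\<^sup>2 + 2 * (norm (g x))\<^sup>2)" by simp
    show "(\<lambda>x. (norm (f x + g x))\<^sup>2) \<in> borel_measurable N" using m by measurable
  qed
qed

lemma L2_scaleR: 
  fixes f :: "'a \<Rightarrow> 'b::{banach,second_countable_topology}"
  shows "L2 N f \<Longrightarrow> L2 N (\<lambda>x. c *\<^sub>R f x)"
  by (auto simp: L2_def power_mult_distrib)

lemma L2_diff:
  fixes f g :: "'a \<Rightarrow> 'b::{banach,second_countable_topology}"
  shows "L2 N f \<Longrightarrow> L2 N g \<Longrightarrow> L2 N (\<lambda>x. f x - g x)"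
  using L2_add[OF _ L2_scaleR[of N g "-1"], of f] by simp

text \<open>Young's inequality in place of Cauchy-Schwarz. The free weight t is chosen later, close
  to the L2 norm of the small factor.\<close>

lemma norm_integral_le_weighted:
  fixes d :: "'a \<Rightarrow> 'b::{banach,second_countable_topology}"
  assumes B: "L2 N B" and d: "L2 N d" and t: "t > 0"
  shows "norm (LINT x|N. B x *\<^sub>R d x) \<le> (t * (LINT x|N. (norm (B x))\<^sup>2) + (LINT x|N. (norm (d x))\<^sup>2) / t) / 2"
proof -
  have i: "integrable N (\<lambda>x. (t * (norm (B x))\<^sup>2 + (norm (d x))\<^sup>2 / t) / 2)"
    using L2_square_integrable[OF B] L2_square_integrable[OF d] by simp
  have "norm (LINT x|N. B x *\<^sub>R d x) \<le> (LINT x|N. norm (B x *\<^sub>R d x))" by (rule integral_norm_bound)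
  also have "\<dots> \<le> (LINT x|N. (t * (norm (B x))\<^sup>2 + (norm (d x))\<^sup>2 / t) / 2)"
  proof (intro integral_mono integrable_norm L2_integrable_scaleR B d i)
    show "norm (B x *\<^sub>R d x) \<le> (t * (norm (B x))\<^sup>2 + (norm (d x))\<^sup>2 / t) / 2" for x
      using mult_le_weighted_squares[OF t, of "norm (B x)" "norm (d x)"] by simp
  qed
  also have "\<dots> = (t * (LINT x|N. (norm (B x))\<^sup>2) + (LINT x|N. (norm (d x))\<^sup>2) / t) / 2"
    using L2_square_integrable[OF B] L2_square_integrable[OF d] by simp
  finally show ?thesis .
qed

text \<open>The convergence is given by extended integrals, which may be infinite for early n. The
  estimate is therefore made for those n at which the distance is finite, which holds
  eventually.\<close>

lemma L2_tendsto_integral: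
  fixes U :: "nat \<Rightarrow> 'a \<Rightarrow> 'b::{banach,second_countable_topology}"
  assumes conv: "L2_tendsto N U u" and U: "\<And>n. U n \<in> borel_measurable N" and u: "L2 N u" and B: "L2 N B"
  shows "(\<lambda>n. LINT x|N. B x *\<^sub>R U n x) \<longlonglongrightarrow> (LINT x|N. B x *\<^sub>R u x)"
proof -
  define e where "e n = (\<integral>\<^sup>+ x. ennreal ((norm (U n x - u x))\<^sup>2) \<partial>N)" for n
  define b where "b = (LINT x|N. (norm (B x))\<^sup>2)"
  have e: "e \<longlonglongrightarrow> 0" using conv by (simp add: L2_tendsto_def e_def[abs_def])
  have um: "u \<in> borel_measurable N" using u by (rule L2_measurable)
  have dm: "(\<lambda>x. (norm (U n x - u x))\<^sup>2) \<in> borel_measurable N" for n using U um by measurable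
  have fin: "L2 N (\<lambda>x. U n x - u x)" if "e n < top" for n
    unfolding L2_def using that U[of n] um dm[of n]
    by (auto intro!: integrableI_bounded simp: e_def)
  define r where "r n = enn2real (e n)" for n
  have r: "r \<longlonglongrightarrow> 0"
    using tendsto_enn2real[of e 0 sequentially] e unfolding r_def by simp
  \<comment> \<open>The weight should be the L2 distance \<open>sqrt (r n)\<close>; the added
    1/(n+1) keeps it positive when that distance is 0.\<close>
  define t where "t n = sqrt (r n) + 1 / real (Suc n)" for n
  have t0: "t n > 0" for n unfolding t_def r_def by (intro add_nonneg_pos) auto
  have t: "t \<longlonglongrightarrow> 0"
    unfolding t_def using tendsto_add[OF tendsto_real_sqrt[OF r] LIMSEQ_Suc[OF lim_1_over_n]] by simp
  have bound: "norm ((LINT x|N. B x *\<^sub>R U n x) - (LINT x|N. B x *\<^sub>R u x)) \<le> (t n * b + sqrt (r n)) / 2"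
    if "e n < top" for n
  proof -
    note d = fin[OF that]
    have Un: "L2 N (U n)" using L2_add[OF d u] by simp
    have re: "r n = (LINT x|N. (norm (U n x - u x))\<^sup>2)"
      unfolding r_def e_def using dm[of n] by (subst integral_eq_nn_integral) auto
    have "(LINT x|N. B x *\<^sub>R U n x) - (LINT x|N. B x *\<^sub>R u x) = (LINT x|N. B x *\<^sub>R (U n x - u x))"
      using L2_integrable_scaleR[OF Un B] L2_integrable_scaleR[OF u B] by (simp add: scaleR_diff_right)
    also have "norm \<dots> \<le> (t n * b + r n / t n) / 2"
      unfolding b_def re by (rule norm_integral_le_weighted[OF B d t0])
    also have "r n / t n \<le> sqrt (r n)"
    proof -
      have "r n = sqrt (r n) * sqrt (r n)" by (simp add: r_def)
      also have "\<dots> \<le> sqrt (r n) * t n" by (intro mult_left_mono) (auto simp: t_def r_def)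
      finally show ?thesis using t0[of n] by (simp add: divide_le_eq)
    qed
    finally show ?thesis by simp
  qed
  have "(\<lambda>n. (LINT x|N. B x *\<^sub>R U n x) - (LINT x|N. B x *\<^sub>R u x)) \<longlonglongrightarrow> 0"
  proof (rule Lim_null_comparison)
    have "eventually (\<lambda>n. e n < top) sequentially"
      using order_tendstoD(2)[OF e, of top] by simp
    then show "eventually (\<lambda>n. norm ((LINT x|N. B x *\<^sub>R U n x) - (LINT x|N. B x *\<^sub>R u x)) \<le> (t n * b + sqrt (r n)) / 2) sequentially"
      by eventually_elim (rule bound)
    show "(\<lambda>n. (t n * b + sqrt (r n)) / 2) \<longlonglongrightarrow> 0"
      by (auto intro!: tendsto_eq_intros t r)
  qed
  then show ?thesis by (simp add: LIM_zero_iff)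
qed

text \<open>Used with \<open>B n\<close> of size \<open>1 / \<delta>\<close> on the \<open>\<delta>\<close>-neighbourhood of an edge: lines in \<open>\<real>\<^sup>3\<close> have
  zero capacity.\<close>

lemma integral_concentrating_tendsto_0:
  fixes g :: "'a \<Rightarrow> 'b::{banach,second_countable_topology}"
  assumes g: "L2 N g" and B: "\<And>n. L2 N (B n)" "\<And>n. (LINT x|N. (norm (B n x))\<^sup>2) \<le> C"
    and S: "\<And>n. S n \<in> sets N" "\<And>n x. x \<in> space N \<Longrightarrow> x \<notin> S n \<Longrightarrow> B n x = 0"
    and shrink: "AE x in N. eventually (\<lambda>n. x \<notin> S n) sequentially"
  shows "(\<lambda>n. LINT x|N. B n x *\<^sub>R g x) \<longlonglongrightarrow> 0"
proof -
  \<comment> \<open>\<open>B n\<close> sees \<open>g\<close> only on \<open>S n\<close>. The L2 norm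
    of the restricted \<open>g\<close> tends to 0 by dominated convergence, while that of
    \<open>B n\<close> stays bounded.\<close>
  define d where "d n x = indicator (S n) x *\<^sub>R g x" for n x
  have gm: "g \<in> borel_measurable N" using g by (rule L2_measurable)
  have dm: "d n \<in> borel_measurable N" for n unfolding d_def using gm S(1) by measurable
  have d: "L2 N (d n)" for n
    unfolding L2_def
  proof (intro conjI dm Bochner_Integration.integrable_bound[OF L2_square_integrable[OF g]])
    show "(\<lambda>x. (norm (d n x))\<^sup>2) \<in> borel_measurable N" using dm[of n] by measurable
    show "AE x in N. norm ((norm (d n x))\<^sup>2) \<le> norm ((norm (g x))\<^sup>2)"
      by (auto simp: d_def indicator_def)
  qed
  define e where "e n = (LINT x|N. (norm (d n x))\<^sup>2)" for n
  have e: "e \<longlonglongrightarrow> (LINT x|N. 0)"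
    unfolding e_def
  proof (rule integral_dominated_convergence[where w="\<lambda>x. (norm (g x))\<^sup>2"])
    show "AE x in N. (\<lambda>n. (norm (d n x))\<^sup>2) \<longlonglongrightarrow> 0"
      using shrink
    proof eventually_elim
      case (elim x)
      then have "eventually (\<lambda>n. (norm (d n x))\<^sup>2 = 0) sequentially"
        by eventually_elim (simp add: d_def)
      then show ?case by (rule tendsto_eventually)
    qed
    show "AE x in N. norm ((norm (d n x))\<^sup>2) \<le> (norm (g x))\<^sup>2" for n
      by (auto simp: d_def indicator_def)
  qed (use L2_square_integrable[OF g] dm in measurable)
  define t where "t n = sqrt (e n) + 1 / real (Suc n)" for n
  have e0: "e n \<ge> 0" for n by (simp add: e_def)
  have t0: "t n > 0" for n unfolding t_def using e0 by (intro add_nonneg_pos) auto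
  have e': "e \<longlonglongrightarrow> 0" using e by simp
  have t: "t \<longlonglongrightarrow> 0"
    unfolding t_def using tendsto_add[OF tendsto_real_sqrt[OF e'] LIMSEQ_Suc[OF lim_1_over_n]] by simp
  show ?thesis
  proof (rule Lim_null_comparison)
    show "(\<lambda>n. (t n * C + sqrt (e n)) / 2) \<longlonglongrightarrow> 0"
      by (auto intro!: tendsto_eq_intros t e')
    have "norm (LINT x|N. B n x *\<^sub>R g x) \<le> (t n * C + sqrt (e n)) / 2" for n
    proof -
      have "(LINT x|N. B n x *\<^sub>R g x) = (LINT x|N. B n x *\<^sub>R d n x)"
        using S(2) by (intro Bochner_Integration.integral_cong) (auto simp: d_def indicator_def)
      also have "norm \<dots> \<le> (t n * (LINT x|N. (norm (B n x))\<^sup>2) + e n / t n) / 2"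
        unfolding e_def by (rule norm_integral_le_weighted[OF B(1) d t0])
      also have "t n * (LINT x|N. (norm (B n x))\<^sup>2) \<le> t n * C" using B(2) t0 by (intro mult_left_mono) (auto simp: less_imp_le)
      also have "e n / t n \<le> sqrt (e n)"
      proof -
        have "e n = sqrt (e n) * sqrt (e n)" using e0 by simp
        also have "\<dots> \<le> sqrt (e n) * t n" using e0 by (intro mult_left_mono) (auto simp: t_def)
        finally show ?thesis using t0[of n] by (simp add: divide_le_eq)
      qed
      finally show ?thesis by simp
    qed
    then show "eventually (\<lambda>n. norm (LINT x|N. B n x *\<^sub>R g x) \<le> (t n * C + sqrt (e n)) / 2) sequentially" by simp
  qed
qed

text \<open>\<open>stress lam \<mu> j\<close> is the \<open>j\<close>-th column of the stress tensor as a function of the gradient.\<close>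

definition stress :: "real \<Rightarrow> real \<Rightarrow> 3 \<Rightarrow> (3 \<Rightarrow> complex^3) \<Rightarrow> complex^3" where
  "stress lam \<mu> j G = lam *\<^sub>R (\<chi> k. if k = j then (\<Sum>l\<in>UNIV. G l $ l) else 0) + \<mu> *\<^sub>R (G j + (\<chi> k. G k $ j))"

lemma stress_nth: "stress lam \<mu> j G $ k = lam *\<^sub>R (if k = j then (\<Sum>l\<in>UNIV. G l $ l) else 0) + \<mu> *\<^sub>R (G j $ k + G k $ j)"
  by (simp add: stress_def)

lemma stress_diff: "stress lam \<mu> j (\<lambda>l. G l - H l) = stress lam \<mu> j G - stress lam \<mu> j H"
  by (simp add: vec_eq_iff stress_nth sum_subtractf algebra_simps)

lemma stress_minus: "stress lam \<mu> j (\<lambda>l. - G l) = - stress lam \<mu> j G"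
  by (simp add: vec_eq_iff stress_nth sum_negf algebra_simps)

text \<open>The vector n x curl U is the transposed gradient applied to n minus the normal
  derivative. Hence the given traction is the symmetric stress tensor applied to n.\<close>

lemma traction_stress: "traction lam \<mu> n U x = (\<Sum>j\<in>UNIV. n $ j *\<^sub>R stress lam \<mu> j (\<lambda>l. pd l U x))"
  by (simp add: vec_eq_iff forall_3 traction_def stress_nth sum_3 diverg_def curl_def ccross_def cvec_def
      complex_eq_iff algebra_simps)

lemma pd_nth: "smooth U \<Longrightarrow> pd i (\<lambda>x. U x $ k :: complex) x = pd i U x $ k"
  by (rule pd_bounded_linear[OF bounded_linear_vec_nth smooth_differentiable])

lemma smooth_nth: "smooth U \<Longrightarrow> smooth (\<lambda>x. U x $ k :: complex)"
  by (rule smooth_bounded_linear[OF bounded_linear_vec_nth])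

lemma bounded_linear_axis_cart: "bounded_linear (\<lambda>z::complex. axis k z)"
  unfolding linear_conv_bounded_linear[symmetric]
  by (rule linearI) (simp_all add: vec_eq_iff axis_def)

text \<open>A finite sum of bounded linear maps of the gradient entries: in this form smoothness,
  limits and integrals pass through \<open>stress\<close> term by term.\<close>

lemma stress_expand: "stress lam \<mu> j G = 
   (\<Sum>l\<in>UNIV. axis j (lam *\<^sub>R G l $ l)) + \<mu> *\<^sub>R G j + (\<Sum>l\<in>UNIV. axis l (\<mu> *\<^sub>R G l $ j))"
  by (simp add: vec_eq_iff stress_nth axis_def scaleR_sum_right algebra_simps sum.delta if_distrib cong: if_cong)

lemma smooth_stress: "smooth U \<Longrightarrow> smooth (\<lambda>x. stress lam \<mu> j (\<lambda>l. pd l U x))"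
  unfolding stress_expand sum_3
  by (intro smooth_add smooth_scaleR smooth_const smooth_pd smooth_bounded_linear[OF bounded_linear_axis_cart] smooth_nth)

lemma pd_stress:
  assumes U: "smooth U"
  shows "pd i (\<lambda>x. stress lam \<mu> j (\<lambda>l. pd l U x)) x = stress lam \<mu> j (\<lambda>l. pd i (pd l U) x)"
proof -
  have d: "(\<lambda>x. stress lam \<mu> j (\<lambda>l. pd l U x)) differentiable (at x)"
    by (rule smooth_differentiable[OF smooth_stress[OF U]])
  have c: "((\<lambda>x. pd l U x) has_derivative frechet_derivative (pd l U) (at x)) (at x)" for l
    using smooth_differentiable[OF smooth_pd[OF U, of l]] by (simp add: frechet_derivative_works)
  have "((\<lambda>x. stress lam \<mu> j (\<lambda>l. pd l U x)) has_derivative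
     (\<lambda>v. stress lam \<mu> j (\<lambda>l. frechet_derivative (pd l U) (at x) v))) (at x)"
    unfolding stress_expand
    by (intro has_derivative_add has_derivative_sum has_derivative_scaleR_right c
        bounded_linear.has_derivative[OF bounded_linear_axis_cart] bounded_linear.has_derivative[OF bounded_linear_vec_nth])
  then show ?thesis using pd_eq by (fastforce simp: pd_def)
qed

text \<open>Second derivatives commute, so the divergence of the transposed gradient is the gradient
  of the divergence; this accounts for the coefficient lam + \<open>\<mu>\<close>.\<close>

lemma divergence_stress:
  assumes U: "smooth U"
  shows "(\<Sum>j\<in>UNIV. pd j (\<lambda>x. stress lam \<mu> j (\<lambda>l. pd l U x)) x) = lame lam \<mu> U x"
proof -
  have dv: "pd k (diverg U) x = (\<Sum>j\<in>UNIV. pd k (pd j U) x $ j)" for k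
  proof -
    have "pd k (diverg U) x = pd k (\<lambda>x. pd 1 U x $ 1 + pd 2 U x $ 2 + pd 3 U x $ 3) x"
      unfolding diverg_def by (simp add: sum_3)
    also have "\<dots> = pd k (pd 1 U) x $ 1 + pd k (pd 2 U) x $ 2 + pd k (pd 3 U) x $ 3"
      using U by (simp add: pd_add pd_nth smooth_differentiable smooth_add smooth_nth smooth_pd)
    finally show ?thesis by (simp add: sum_3)
  qed
  have c: "pd i (pd j U) x = pd j (pd i U) x" for i j
    by (rule fun_cong[OF pd_commute[OF U]])
  show ?thesis
    unfolding pd_stress[OF U]
    by (simp add: vec_eq_iff forall_3 lame_def dv stress_nth sum_3 c[of 2 1] c[of 3 1] c[of 3 2] algebra_simps)
qed

lemma tendsto_stress:
  assumes "\<And>l. (G l \<longlongrightarrow> H l) F"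
  shows "((\<lambda>n. stress lam \<mu> j (\<lambda>l. G l n)) \<longlongrightarrow> stress lam \<mu> j H) F"
  unfolding stress_expand
  by (intro tendsto_intros assms bounded_linear.tendsto[OF bounded_linear_axis_cart] bounded_linear.tendsto[OF bounded_linear_vec_nth])

lemma integral_stress:
  assumes i: "\<And>l. integrable N (\<lambda>x. \<phi> x *\<^sub>R G l x)"
  shows "(LINT x|N. \<phi> x *\<^sub>R stress lam \<mu> j (\<lambda>l. G l x)) = stress lam \<mu> j (\<lambda>l. LINT x|N. \<phi> x *\<^sub>R G l x)"
    and "integrable N (\<lambda>x. \<phi> x *\<^sub>R stress lam \<mu> j (\<lambda>l. G l x))"
proof -
  have e: "\<phi> x *\<^sub>R stress lam \<mu> j (\<lambda>l. G l x) = stress lam \<mu> j (\<lambda>l. \<phi> x *\<^sub>R G l x)" for x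
    by (simp add: vec_eq_iff stress_nth scaleR_add_right scaleR_sum_right algebra_simps)
  have b: "bounded_linear (\<lambda>y. axis k (c *\<^sub>R y $ l) :: complex^3)" for k l c
    by (intro bounded_linear_compose[OF bounded_linear_axis_cart] bounded_linear_compose[OF bounded_linear_scaleR_right]
        bounded_linear_vec_nth)
  show "(LINT x|N. \<phi> x *\<^sub>R stress lam \<mu> j (\<lambda>l. G l x)) = stress lam \<mu> j (\<lambda>l. LINT x|N. \<phi> x *\<^sub>R G l x)"
    unfolding e unfolding stress_expand
    by (simp only: i integral_bounded_linear[OF b] integrable_bounded_linear[OF b] Bochner_Integration.integral_add
        Bochner_Integration.integral_sum Bochner_Integration.integrable_add Bochner_Integration.integrable_sum
        integrable_scaleR_right integral_scaleR_right)
  show "integrable N (\<lambda>x. \<phi> x *\<^sub>R stress lam \<mu> j (\<lambda>l. G l x))"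
    unfolding e unfolding stress_expand
    by (intro Bochner_Integration.integrable_add Bochner_Integration.integrable_sum integrable_scaleR_right
        integrable_bounded_linear[OF b] i)
qed


section \<open>Betti's formula, traces and tractions near the edge\<close>

context wedge_domain
begin

text \<open>At an edge point \<open>\<Omega>\<close> is locally a cone, so a normal n would force
  v.n <= 0 for all directions v in W and v.n >= 0 for all others. On the faces both hold in the
  limit, so n is orthogonal to them; but the two faces span the space.\<close>

lemma no_outward_normal_edge:
  assumes x: "x \<in> N" "x \<in> edge" shows "\<not> is_outward_normal \<Omega> x n"
proof
  assume n: "is_outward_normal \<Omega> x n"
  have AB: "A (x + t *\<^sub>R v) = t * A v" "B (x + t *\<^sub>R v) = t * B v" for t v
    using x linear_add[OF bounded_linear.linear[OF linear_A]] linear_add[OF bounded_linear.linear[OF linear_B]]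
      linear_cmul[OF bounded_linear.linear[OF linear_A]] linear_cmul[OF bounded_linear.linear[OF linear_B]]
    by (simp_all add: edge_def)
  obtain r0 where r0: "r0 > 0" "ball x r0 \<subseteq> N"
    using open_N x(1) unfolding open_contains_ball by blast
  \<comment> \<open>A direction violating the sign condition is scaled down to a point near x.
    Scaling does not change membership in \<open>W\<close>, while the tolerance
    \<open>\<epsilon>\<close> amounts to half of |v.n|.\<close>
  have sign: "v \<bullet> n \<le> 0 \<and> v \<in> W \<or> v \<bullet> n \<ge> 0 \<and> v \<notin> W" if "v \<noteq> 0" for v
  proof (rule ccontr)
    assume H: "\<not> (v \<bullet> n \<le> 0 \<and> v \<in> W \<or> v \<bullet> n \<ge> 0 \<and> v \<notin> W)"
    then have vn: "v \<bullet> n \<noteq> 0" by (cases "v \<in> W") auto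
    define \<epsilon> where "\<epsilon> = \<bar>v \<bullet> n\<bar> / (2 * norm v)"
    have \<epsilon>: "\<epsilon> > 0" using that vn by (simp add: \<epsilon>_def)
    obtain r where r: "r > 0" "\<And>y. y \<in> ball x r \<Longrightarrow> (y - x) \<bullet> n < - \<epsilon> * norm (y - x) \<Longrightarrow> y \<in> \<Omega>"
       "\<And>y. y \<in> ball x r \<Longrightarrow> (y - x) \<bullet> n > \<epsilon> * norm (y - x) \<Longrightarrow> y \<notin> \<Omega>"
      using n \<epsilon> unfolding is_outward_normal_def by blast
    define t where "t = min r r0 / (2 * norm v)"
    have t: "t > 0" using r r0 that by (simp add: t_def)
    have "t * norm v = min r r0 / 2" using that by (simp add: t_def)
    then have y: "x + t *\<^sub>R v \<in> ball x r" "x + t *\<^sub>R v \<in> N"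
      using t r r0 by (auto simp: dist_norm subset_iff)
    have iff: "x + t *\<^sub>R v \<in> \<Omega> \<longleftrightarrow> v \<in> W"
      unfolding \<Omega>_N[OF y(2)] using t by (simp add: W_def AB zero_less_mult_iff)
    have e: "\<epsilon> * norm (x + t *\<^sub>R v - x) = t * (\<bar>v \<bullet> n\<bar> / 2)" using t that by (simp add: \<epsilon>_def)
    have p: "t * (\<bar>v \<bullet> n\<bar> / 2) < t * \<bar>v \<bullet> n\<bar>" using t vn by simp
    have i: "(x + t *\<^sub>R v - x) \<bullet> n = t * (v \<bullet> n)" by simp
    show False
    proof (cases "v \<in> W")
      case True
      then have "v \<bullet> n > 0" using H by auto
      then show False using r(3)[OF y(1)] iff True p unfolding e i by simp
    next
      case False
      then have "v \<bullet> n < 0" using H by auto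
      then show False using r(2)[OF y(1)] iff False p e i by simp
    qed
  qed
  have "closure W \<subseteq> {v. v \<bullet> n \<le> 0}"
  proof (intro closure_minimal closed_Collect_le continuous_intros subsetI CollectI)
    fix v assume v: "v \<in> W"
    have "0 \<notin> W" by (simp add: W_def A_def B_def)
    then have "v \<noteq> 0" using v by metis
    then show "v \<bullet> n \<le> 0" using sign v by blast
  qed
  then have z: "v \<bullet> n = 0" if "v \<in> faces" for v
    using sign[of v] that closure_W_diff by (cases "v = 0") auto
  have "T (1, 0, 0) \<in> faces" "T (0, 1, 0) \<in> faces" "T (0, 0, 1) \<in> faces"
    using D_neq_0 by (auto simp: faces_def)
  then have z3: "T (1, 0, 0) \<bullet> n = 0" "T (0, 1, 0) \<bullet> n = 0" "T (0, 0, 1) \<bullet> n = 0" using z by auto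
  have "v \<bullet> n = 0" for v
  proof -
    have "v = T (T' v)" by simp
    also have "T' v = (A v / D) *\<^sub>R (1, 0, 0) + (B v / D) *\<^sub>R (0, 1, 0) + (v$3) *\<^sub>R (0, 0, 1)"
      by (simp add: T'_def)
    also have "T \<dots> = (A v / D) *\<^sub>R T (1, 0, 0) + (B v / D) *\<^sub>R T (0, 1, 0) + (v$3) *\<^sub>R T (0, 0, 1)"
      by (simp only: linear_add[OF bounded_linear.linear[OF linear_T]] linear_cmul[OF bounded_linear.linear[OF linear_T]])
    finally show ?thesis using z3 by (metis (no_types, lifting) add.right_neutral inner_left_distrib inner_scaleR_left mult_zero_right)
  qed
  then have "n \<bullet> n = 0" .
  then show False using n by (simp add: is_outward_normal_def)
qed

lemma emeasure_lebesgue_on_\<Omega>: "emeasure (lebesgue_on \<Omega>) (space (lebesgue_on \<Omega>)) < \<infinity>"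
  using open_\<Omega> emeasure_bounded_finite[OF bounded_\<Omega>] by (simp add: emeasure_restrict_space)

lemma finite_measure_\<Omega>: "finite_measure (lebesgue_on \<Omega>)"
  using emeasure_lebesgue_on_\<Omega> by (intro finite_measureI) simp

lemma borel_measurable_lebesgue_on_\<Omega>: "g \<in> borel_measurable borel \<Longrightarrow> g \<in> borel_measurable (lebesgue_on \<Omega>)"
  by (intro measurable_restrict_space1 measurable_completion) simp

lemma integrable_tf_\<Omega>:
  fixes \<phi> :: "real^3 \<Rightarrow> 'b::euclidean_space"
  assumes "tf K \<phi>" shows "integrable (lebesgue_on \<Omega>) \<phi>"
proof -
  obtain C where "\<And>x. norm (\<phi> x) \<le> C" using tf_bounded[OF assms] by blast
  then show ?thesis
    by (intro finite_measure.integrable_const_bound[OF finite_measure_\<Omega>, of _ C]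
        borel_measurable_lebesgue_on_\<Omega> tf_measurable[OF assms]) auto
qed

lemma L2_bounded_\<Omega>:
  fixes \<phi> :: "real^3 \<Rightarrow> 'b::euclidean_space"
  assumes "\<phi> \<in> borel_measurable borel" "\<And>x. norm (\<phi> x) \<le> C" shows "L2 (lebesgue_on \<Omega>) \<phi>"
  unfolding L2_def
proof
  show m: "\<phi> \<in> borel_measurable (lebesgue_on \<Omega>)" by (rule borel_measurable_lebesgue_on_\<Omega>[OF assms(1)])
  have "norm ((norm (\<phi> x))\<^sup>2) \<le> C\<^sup>2" for x using assms(2)[of x] by (simp add: power_mono)
  then show "integrable (lebesgue_on \<Omega>) (\<lambda>x. (norm (\<phi> x))\<^sup>2)"
    using m by (intro finite_measure.integrable_const_bound[OF finite_measure_\<Omega>, of _ "C\<^sup>2"]) auto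
qed

lemma L2_tf_\<Omega>: 
  fixes \<phi> :: "real^3 \<Rightarrow> 'b::euclidean_space"
  shows "tf K \<phi> \<Longrightarrow> L2 (lebesgue_on \<Omega>) \<phi>"
  using tf_bounded[of K \<phi>] tf_measurable[of K \<phi>] by (blast intro: L2_bounded_\<Omega>)

lemma regular_distr_integrable:
  fixes f :: "real^3 \<Rightarrow> 'b::euclidean_space"
  shows "L2 (lebesgue_on \<Omega>) f \<Longrightarrow> tf K \<phi> \<Longrightarrow> integrable (lebesgue_on \<Omega>) (\<lambda>x. \<phi> x *\<^sub>R f x)"
  by (rule L2_integrable_scaleR[OF _ L2_tf_\<Omega>])

lemma regular_distr_diff:
  fixes f :: "real^3 \<Rightarrow> 'b::euclidean_space"
  assumes "L2 (lebesgue_on \<Omega>) f" "L2 (lebesgue_on \<Omega>) g" "tf K \<phi>"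
  shows "regular_distr \<Omega> (\<lambda>x. f x - g x) \<phi> = regular_distr \<Omega> f \<phi> - regular_distr \<Omega> g \<phi>"
  unfolding regular_distr_def using regular_distr_integrable[OF assms(1,3)] regular_distr_integrable[OF assms(2,3)]
  by (simp add: scaleR_diff_right)

lemma regular_distr_tendsto:
  fixes U :: "nat \<Rightarrow> real^3 \<Rightarrow> 'b::euclidean_space"
  assumes "L2_tendsto (lebesgue_on \<Omega>) U u" "\<And>n. smooth (U n)" "L2 (lebesgue_on \<Omega>) u" "tf K \<phi>"
  shows "(\<lambda>n. regular_distr \<Omega> (U n) \<phi>) \<longlonglongrightarrow> regular_distr \<Omega> u \<phi>"
  unfolding regular_distr_def
  by (intro L2_tendsto_integral[OF assms(1)] borel_measurable_lebesgue_on_\<Omega> L2_tf_\<Omega>[OF assms(4)] assms(3)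
      borel_measurable_continuous_onI smooth_continuous assms(2))

lemma tf_scaleR: "tf K \<psi> \<Longrightarrow> smooth U \<Longrightarrow> tf K (\<lambda>x. \<psi> x *\<^sub>R U x)"
  unfolding tf_def by auto

lemma nu_bound: "\<bar>nu x $ j\<bar> \<le> 1"
  using component_le_norm_cart[of "nu x" j] norm_n by (auto simp: nu_def split: if_splits)

lemma surface_integrable_tf:
  fixes \<psi> :: "real^3 \<Rightarrow> 'b::euclidean_space"
  assumes tf: "tf K \<psi>" and K: "K \<subseteq> N"
  shows "integrable (surface_measure \<Omega>) (\<lambda>x. nu x $ j *\<^sub>R \<psi> x)"
proof -
  obtain C where C: "\<And>x. norm (\<psi> x) \<le> C" using tf_bounded[OF tf] by blast
  have "norm (nu x $ j *\<^sub>R \<psi> x) \<le> 1 * C" for x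
    unfolding norm_scaleR using nu_bound[of x j] C[of x] by (intro mult_mono) auto
  then show ?thesis
    using tf K tf_measurable[OF tf]
    by (intro surface_integral(1)[of _ K "1 * C"]) (auto simp: tf_def intro!: borel_measurable_scaleR)
qed

text \<open>The divergence theorem for the products of \<open>\<psi>\<close> with the columns of the
  stress tensor, summed over the columns. \<open>\<psi>\<close> need not vanish on the faces or on
  the edge.\<close>

lemma betti:
  assumes U: "smooth U" and tf: "tf K \<psi>" and K: "K \<subseteq> N"
  shows "regular_distr \<Omega> (lame lam \<mu> U) \<psi> + (\<Sum>j\<in>UNIV. stress lam \<mu> j (\<lambda>l. regular_distr \<Omega> (pd l U) (pd j \<psi>)))
    = \<kappa> *\<^sub>R (LINT x|surface_measure \<Omega>. \<psi> x *\<^sub>R traction lam \<mu> (nu x) U x)"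
proof -
  define S where "S j x = stress lam \<mu> j (\<lambda>l. pd l U x)" for j x
  have S: "smooth (S j)" for j unfolding S_def by (rule smooth_stress[OF U])
  have p: "pd j (\<lambda>x. \<psi> x *\<^sub>R S j x) = (\<lambda>x. pd j \<psi> x *\<^sub>R S j x + \<psi> x *\<^sub>R pd j (S j) x)" for j
    using tf S by (intro ext pd_bounded_bilinear[OF bounded_bilinear_scaleR] smooth_differentiable) (auto simp: tf_def)
  have i1: "integrable (lebesgue_on \<Omega>) (\<lambda>x. pd j \<psi> x *\<^sub>R S j x)" for j
    by (intro integrable_tf_\<Omega>[where K=K] tf_scaleR tf_pd tf S)
  have i2: "integrable (lebesgue_on \<Omega>) (\<lambda>x. \<psi> x *\<^sub>R pd j (S j) x)" for j
    by (intro integrable_tf_\<Omega>[where K=K] tf_scaleR tf smooth_pd S)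
  have i3: "integrable (lebesgue_on \<Omega>) (\<lambda>x. pd j \<psi> x *\<^sub>R pd l U x)" for j l
    by (intro integrable_tf_\<Omega>[where K=K] tf_scaleR tf_pd tf smooth_pd U)
  have e1: "(\<Sum>j\<in>UNIV. LINT x|lebesgue_on \<Omega>. \<psi> x *\<^sub>R pd j (S j) x) = regular_distr \<Omega> (lame lam \<mu> U) \<psi>"
    unfolding regular_distr_def divergence_stress[OF U, symmetric] S_def[symmetric] scaleR_sum_right
    by (rule Bochner_Integration.integral_sum[symmetric]) (rule i2)
  have e2: "(LINT x|lebesgue_on \<Omega>. pd j \<psi> x *\<^sub>R S j x) = stress lam \<mu> j (\<lambda>l. regular_distr \<Omega> (pd l U) (pd j \<psi>))" for j
    unfolding regular_distr_def S_def by (rule integral_stress(1)) (rule i3)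
  have "(\<Sum>j\<in>UNIV. LINT x|lebesgue_on \<Omega>. pd j (\<lambda>x. \<psi> x *\<^sub>R S j x) x)
      = (\<Sum>j\<in>UNIV. (LINT x|lebesgue_on \<Omega>. pd j \<psi> x *\<^sub>R S j x) + (LINT x|lebesgue_on \<Omega>. \<psi> x *\<^sub>R pd j (S j) x))"
    by (simp only: p Bochner_Integration.integral_add i1 i2)
  also have "\<dots> = regular_distr \<Omega> (lame lam \<mu> U) \<psi> + (\<Sum>j\<in>UNIV. stress lam \<mu> j (\<lambda>l. regular_distr \<Omega> (pd l U) (pd j \<psi>)))"
    by (simp only: sum.distrib e1 e2 add.commute)
  finally have "regular_distr \<Omega> (lame lam \<mu> U) \<psi> + (\<Sum>j\<in>UNIV. stress lam \<mu> j (\<lambda>l. regular_distr \<Omega> (pd l U) (pd j \<psi>)))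
      = (\<Sum>j\<in>UNIV. LINT x|lebesgue_on \<Omega>. pd j (\<lambda>x. \<psi> x *\<^sub>R S j x) x)" by simp
  also have "\<dots> = (\<Sum>j\<in>UNIV. \<kappa> *\<^sub>R (LINT x|surface_measure \<Omega>. nu x $ j *\<^sub>R (\<psi> x *\<^sub>R S j x)))"
    by (intro sum.cong refl divergence_\<Omega>[where K=K] tf_scaleR tf S K)
  also have "\<dots> = \<kappa> *\<^sub>R (LINT x|surface_measure \<Omega>. (\<Sum>j\<in>UNIV. nu x $ j *\<^sub>R (\<psi> x *\<^sub>R S j x)))"
    unfolding scaleR_sum_right[symmetric]
    by (subst Bochner_Integration.integral_sum, intro surface_integrable_tf[where K=K] tf_scaleR tf S K, rule refl)
  also have "(\<lambda>x. (\<Sum>j\<in>UNIV. nu x $ j *\<^sub>R (\<psi> x *\<^sub>R S j x))) = (\<lambda>x. \<psi> x *\<^sub>R traction lam \<mu> (nu x) U x)"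
    by (simp add: traction_stress S_def scaleR_sum_right mult.commute)
  finally show ?thesis .
qed

lemma AE_surface_not_edge: "AE x in surface_measure \<Omega>. x \<notin> edge"
  unfolding surface_measure_def using AE_not_edge
  by (subst AE_restrict_space_iff) (auto simp: borel_closed elim: eventually_mono)

lemma sets_surface_measure: "sets (surface_measure \<Omega>) = sets (restrict_space borel (frontier \<Omega>))"
  unfolding surface_measure_def by (rule sets_restrict_space_cong) simp

lemma space_surface_measure: "space (surface_measure \<Omega>) = frontier \<Omega>"
  by (simp add: surface_measure_def space_restrict_space)

lemma borel_measurable_surface: "g \<in> borel_measurable borel \<Longrightarrow> g \<in> borel_measurable (surface_measure \<Omega>)"
  by (subst measurable_cong_sets[OF sets_surface_measure refl]) (rule measurable_restrict_space1)

lemma traction_measurable: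
  assumes "smooth U" "tf K \<psi>"
  shows "(\<lambda>x. \<psi> x *\<^sub>R traction lam \<mu> (nu x) U x) \<in> borel_measurable borel"
    and "(\<lambda>x. \<psi> x *\<^sub>R traction lam \<mu> n U x) \<in> borel_measurable borel"
proof -
  have "(\<lambda>x. stress lam \<mu> j (\<lambda>l. pd l U x)) \<in> borel_measurable borel" for j
    by (intro borel_measurable_continuous_onI smooth_continuous smooth_stress assms)
  then show "(\<lambda>x. \<psi> x *\<^sub>R traction lam \<mu> (nu x) U x) \<in> borel_measurable borel"
    "(\<lambda>x. \<psi> x *\<^sub>R traction lam \<mu> n U x) \<in> borel_measurable borel"
    unfolding traction_stress
    by (intro borel_measurable_scaleR borel_measurable_sum tf_measurable[OF assms(2)] nu_nth_measurable
        measurable_const; simp)+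
qed

text \<open>No normal exists on the edge, so \<open>outward_normal\<close> has a single junk value there; this makes the
  integrand of the traction measurable.\<close>

lemma surface_traction_nu:
  assumes U: "smooth U" and tf: "tf K \<psi>" and K: "K \<subseteq> N"
  shows "(LINT x|surface_measure \<Omega>. \<psi> x *\<^sub>R traction lam \<mu> (outward_normal \<Omega> x) U x)
    = (LINT x|surface_measure \<Omega>. \<psi> x *\<^sub>R traction lam \<mu> (nu x) U x)"
proof (rule integral_cong_AE)
  define n0 :: "real^3" where "n0 = (THE n. False)"
  have edge: "outward_normal \<Omega> x = n0" if "x \<in> N" "x \<in> edge" for x
    unfolding outward_normal_def n0_def using no_outward_normal_edge[OF that]
    by (intro arg_cong[where f=The] ext) blast
  have off: "\<psi> x *\<^sub>R traction lam \<mu> (outward_normal \<Omega> x) U x = \<psi> x *\<^sub>R traction lam \<mu> (nu x) U x"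
    if "x \<in> frontier \<Omega>" "x \<notin> edge" for x
  proof (cases "x \<in> K")
    case True
    then have "x \<in> N" using K by blast
    then show ?thesis using outward_normal_faces frontier_N that by simp
  qed (use tf in \<open>simp add: tf_def\<close>)
  have on: "\<psi> x *\<^sub>R traction lam \<mu> (outward_normal \<Omega> x) U x = \<psi> x *\<^sub>R traction lam \<mu> n0 U x"
    if "x \<in> edge" for x
    using edge[OF _ that] tf K by (cases "x \<in> K") (auto simp: tf_def)
  have "(\<lambda>x. if x \<in> edge then \<psi> x *\<^sub>R traction lam \<mu> n0 U x else \<psi> x *\<^sub>R traction lam \<mu> (nu x) U x)
      \<in> borel_measurable (surface_measure \<Omega>)"
    by (intro borel_measurable_surface measurable_If_set traction_measurable[OF U tf]) simp
  then show "(\<lambda>x. \<psi> x *\<^sub>R traction lam \<mu> (outward_normal \<Omega> x) U x) \<in> borel_measurable (surface_measure \<Omega>)"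
    by (subst measurable_cong[where g="\<lambda>x. if x \<in> edge then \<psi> x *\<^sub>R traction lam \<mu> n0 U x else \<psi> x *\<^sub>R traction lam \<mu> (nu x) U x"])
       (auto simp: space_surface_measure on off)
  show "(\<lambda>x. \<psi> x *\<^sub>R traction lam \<mu> (nu x) U x) \<in> borel_measurable (surface_measure \<Omega>)"
    by (intro borel_measurable_surface traction_measurable[OF U tf])
  show "AE x in surface_measure \<Omega>. \<psi> x *\<^sub>R traction lam \<mu> (outward_normal \<Omega> x) U x = \<psi> x *\<^sub>R traction lam \<mu> (nu x) U x"
    using AE_surface_not_edge AE_space by eventually_elim (use off in \<open>simp add: space_surface_measure\<close>)
qed

text \<open>Betti's formula along the approximating sequence, passed to the limit. The traction
  functional is thereby expressed through quantities in the interior, namely the weak gradient and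
  the Lame operator in L2.\<close>

lemma has_tractionD:
  assumes t: "has_traction \<Omega> lam \<mu> u t" 
  obtains G f where "\<And>i. L2 (lebesgue_on \<Omega>) (G i)" "\<And>i. weak_pd \<Omega> i u (G i)" "L2 (lebesgue_on \<Omega>) f"
    "distr_eq_on \<Omega> (distr_lame lam \<mu> (regular_distr \<Omega> u)) (regular_distr \<Omega> f)"
    "\<And>K \<psi>. tf K \<psi> \<Longrightarrow> K \<subseteq> N \<Longrightarrow>
      regular_distr \<Omega> f \<psi> + (\<Sum>j\<in>UNIV. stress lam \<mu> j (\<lambda>l. regular_distr \<Omega> (G l) (pd j \<psi>))) = \<kappa> *\<^sub>R t \<psi>"
proof -
  obtain U f where U: "smooth_H1_tendsto \<Omega> U u" and f: "L2 (lebesgue_on \<Omega>) f"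
    "distr_eq_on \<Omega> (distr_lame lam \<mu> (regular_distr \<Omega> u)) (regular_distr \<Omega> f)"
    "L2_tendsto (lebesgue_on \<Omega>) (\<lambda>n. lame lam \<mu> (U n)) f"
    and lim: "\<And>\<phi>. test_function UNIV \<phi> \<Longrightarrow> (\<lambda>n. LINT x|surface_measure \<Omega>.
                  \<phi> x *\<^sub>R traction lam \<mu> (outward_normal \<Omega> x) (U n) x) \<longlonglongrightarrow> t \<phi>"
    using t unfolding has_traction_def by blast
  have sU: "\<And>n. smooth (U n)" using U by (simp add: smooth_H1_tendsto_def)
  obtain G where G: "\<And>i. L2 (lebesgue_on \<Omega>) (G i)" "\<And>i. weak_pd \<Omega> i u (G i)"
    "\<And>i. L2_tendsto (lebesgue_on \<Omega>) (\<lambda>n. pd i (U n)) (G i)"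
    using U unfolding smooth_H1_tendsto_def by metis
  show ?thesis
  proof (rule that[OF G(1,2) f(1,2)])
    fix K and \<psi> :: "real^3 \<Rightarrow> real" assume tf: "tf K \<psi>" and K: "K \<subseteq> N"
    have slame: "smooth (lame lam \<mu> (U n))" for n
      unfolding divergence_stress[OF sU, symmetric, abs_def] sum_3
      by (intro smooth_add smooth_pd smooth_stress sU)
    have "(\<lambda>n. regular_distr \<Omega> (lame lam \<mu> (U n)) \<psi>
        + (\<Sum>j\<in>UNIV. stress lam \<mu> j (\<lambda>l. regular_distr \<Omega> (pd l (U n)) (pd j \<psi>))))
      \<longlonglongrightarrow> regular_distr \<Omega> f \<psi> + (\<Sum>j\<in>UNIV. stress lam \<mu> j (\<lambda>l. regular_distr \<Omega> (G l) (pd j \<psi>)))"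
      by (intro tendsto_add tendsto_sum tendsto_stress regular_distr_tendsto[OF f(3) slame f(1) tf]
          regular_distr_tendsto[OF G(3) smooth_pd[OF sU] G(1) tf_pd[OF tf]])
    moreover have "(\<lambda>n. \<kappa> *\<^sub>R (LINT x|surface_measure \<Omega>. \<psi> x *\<^sub>R traction lam \<mu> (nu x) (U n) x)) \<longlonglongrightarrow> \<kappa> *\<^sub>R t \<psi>"
      unfolding surface_traction_nu[OF sU tf K, symmetric]
      by (intro tendsto_scaleR tendsto_const lim tf_test_function[OF tf]) simp
    ultimately show "regular_distr \<Omega> f \<psi> + (\<Sum>j\<in>UNIV. stress lam \<mu> j (\<lambda>l. regular_distr \<Omega> (G l) (pd j \<psi>))) = \<kappa> *\<^sub>R t \<psi>"
      unfolding betti[OF sU tf K] by (rule LIMSEQ_unique)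
  qed
qed

text \<open>Integration by parts along the sequence that defines the trace. The weak gradient
  obtained here belongs to that sequence and has to be identified later with the one that comes with
  the traction.\<close>

lemma has_traceD:
  assumes g: "has_trace \<Omega> u g" and u: "L2 (lebesgue_on \<Omega>) u"
  obtains G where "\<And>i. L2 (lebesgue_on \<Omega>) (G i)" "\<And>i. weak_pd \<Omega> i u (G i)"
    "\<And>K \<psi> i. tf K \<psi> \<Longrightarrow> K \<subseteq> N \<Longrightarrow>
      regular_distr \<Omega> u (pd i \<psi>) + regular_distr \<Omega> (G i) \<psi> = \<kappa> *\<^sub>R (LINT x|surface_measure \<Omega>. (nu x $ i * \<psi> x) *\<^sub>R g x)"
proof -
  obtain U where U: "smooth_H1_tendsto \<Omega> U u" and lim: "L2_tendsto (surface_measure \<Omega>) U g" and g2: "L2 (surface_measure \<Omega>) g"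
    using g unfolding has_trace_def by blast
  have sU: "\<And>n. smooth (U n)" and Uu: "L2_tendsto (lebesgue_on \<Omega>) U u" using U by (simp_all add: smooth_H1_tendsto_def)
  obtain G where G: "\<And>i. L2 (lebesgue_on \<Omega>) (G i)" "\<And>i. weak_pd \<Omega> i u (G i)"
    "\<And>i. L2_tendsto (lebesgue_on \<Omega>) (\<lambda>n. pd i (U n)) (G i)"
    using U unfolding smooth_H1_tendsto_def by metis
  show ?thesis
  proof (rule that[OF G(1,2)])
    fix K i and \<psi> :: "real^3 \<Rightarrow> real" assume tf: "tf K \<psi>" and K: "K \<subseteq> N"
    have "(\<lambda>n. regular_distr \<Omega> (U n) (pd i \<psi>) + regular_distr \<Omega> (pd i (U n)) \<psi>)
       \<longlonglongrightarrow> regular_distr \<Omega> u (pd i \<psi>) + regular_distr \<Omega> (G i) \<psi>"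
      by (intro tendsto_add regular_distr_tendsto[OF Uu sU u tf_pd[OF tf]]
          regular_distr_tendsto[OF G(3) smooth_pd[OF sU] G(1) tf])
    moreover have "regular_distr \<Omega> (U n) (pd i \<psi>) + regular_distr \<Omega> (pd i (U n)) \<psi>
        = \<kappa> *\<^sub>R (LINT x|surface_measure \<Omega>. (nu x $ i * \<psi> x) *\<^sub>R U n x)" for n
    proof -
      have "pd i (\<lambda>x. \<psi> x *\<^sub>R U n x) = (\<lambda>x. pd i \<psi> x *\<^sub>R U n x + \<psi> x *\<^sub>R pd i (U n) x)"
        using tf sU by (intro ext pd_bounded_bilinear[OF bounded_bilinear_scaleR] smooth_differentiable) (auto simp: tf_def)
      then have "regular_distr \<Omega> (U n) (pd i \<psi>) + regular_distr \<Omega> (pd i (U n)) \<psi>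
          = (LINT x|lebesgue_on \<Omega>. pd i (\<lambda>x. \<psi> x *\<^sub>R U n x) x)"
        unfolding regular_distr_def
        by (simp add: Bochner_Integration.integral_add integrable_tf_\<Omega>[where K=K] tf_scaleR tf_pd tf smooth_pd sU)
      also have "\<dots> = \<kappa> *\<^sub>R (LINT x|surface_measure \<Omega>. nu x $ i *\<^sub>R (\<psi> x *\<^sub>R U n x))"
        by (rule divergence_\<Omega>[OF tf_scaleR[OF tf sU] K])
      finally show ?thesis by simp
    qed
    moreover have "(\<lambda>n. \<kappa> *\<^sub>R (LINT x|surface_measure \<Omega>. (nu x $ i * \<psi> x) *\<^sub>R U n x))
       \<longlonglongrightarrow> \<kappa> *\<^sub>R (LINT x|surface_measure \<Omega>. (nu x $ i * \<psi> x) *\<^sub>R g x)"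
    proof (intro tendsto_scaleR tendsto_const L2_tendsto_integral[OF lim] g2)
      show "U n \<in> borel_measurable (surface_measure \<Omega>)" for n
        by (intro borel_measurable_surface borel_measurable_continuous_onI smooth_continuous sU)
      have m: "(\<lambda>x. nu x $ i * \<psi> x) \<in> borel_measurable borel"
        by (intro borel_measurable_times nu_nth_measurable tf_measurable[OF tf])
      obtain C where C: "\<And>x. norm (\<psi> x) \<le> C" using tf_bounded[OF tf] by blast
      have "integrable (surface_measure \<Omega>) (\<lambda>x. (nu x $ i * \<psi> x)\<^sup>2)"
      proof (rule surface_integral(1))
        show "(\<lambda>x. (nu x $ i * \<psi> x)\<^sup>2) \<in> borel_measurable borel" using m by measurable
        have "\<bar>nu x $ i * \<psi> x\<bar> \<le> 1 * C" for x
          unfolding abs_mult using nu_bound[of x i] C[of x] by (intro mult_mono) auto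
        then have "\<bar>nu x $ i * \<psi> x\<bar>\<^sup>2 \<le> C\<^sup>2" for x by (intro power_mono) auto
        then show "norm ((nu x $ i * \<psi> x)\<^sup>2) \<le> C\<^sup>2" for x by simp
      qed (use tf K in \<open>auto simp: tf_def\<close>)
      then show "L2 (surface_measure \<Omega>) (\<lambda>x. nu x $ i * \<psi> x)"
        unfolding L2_def using borel_measurable_surface[OF m] by simp
    qed
    ultimately show "regular_distr \<Omega> u (pd i \<psi>) + regular_distr \<Omega> (G i) \<psi> =
        \<kappa> *\<^sub>R (LINT x|surface_measure \<Omega>. (nu x $ i * \<psi> x) *\<^sub>R g x)"
      using LIMSEQ_unique by simp
  qed
qed

end


section \<open>Cut-offs at the edge and the weak transmission problem\<close>

definition rho :: "real^3 \<Rightarrow> real" where "rho x = (x$1)\<^sup>2 + (x$2)\<^sup>2"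

lemma rho_horiz: "rho x = (norm (horiz x))\<^sup>2"
  by (simp add: rho_def norm_vec_def L2_set_def sum_2)

lemma smooth_rho: "smooth rho"
  unfolding rho_def[abs_def] power2_eq_square by (intro smooth_add smooth_mult smooth_coord)

lemma pd_rho: "pd j rho x = 2 * (if j = 3 then 0 else x$j)"
proof -
  have "(rho has_derivative (\<lambda>v. 2 * (x$1 * v$1) + 2 * (x$2 * v$2))) (at x)"
    unfolding rho_def[abs_def]
    by (auto intro!: derivative_eq_intros bounded_linear.has_derivative[OF bounded_linear_vec_nth] simp: algebra_simps)
  from pd_eq[OF this, of j] show ?thesis
    using exhaust_3[of j] by (auto simp: axis_def)
qed

lemma pd_rho_le: "\<bar>pd j rho x\<bar> \<le> 2 * sqrt (rho x)"
proof -
  have "\<bar>x$1\<bar> \<le> sqrt (rho x)" "\<bar>x$2\<bar> \<le> sqrt (rho x)"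
    by (simp_all add: rho_def real_le_rsqrt)
  moreover have "0 \<le> rho x" by (simp add: rho_def)
  ultimately show ?thesis using exhaust_3[of j] by (auto simp: pd_rho abs_mult)
qed

lemma smooth_affine_compose:
  assumes "\<And>k. C1k k g" "smooth \<phi>" shows "smooth (\<lambda>x. g (a * \<phi> x + b))"
  using smooth_compose[of "\<lambda>t. g (a * t + b)" \<phi>] C1k_affine[OF assms(1)] assms(2) by blast

lemma sstep_derivative:
  obtains d C where "\<And>t. (sstep has_real_derivative d t) (at t)" "\<And>t. \<bar>d t\<bar> \<le> C" "\<And>t. t > 1 \<Longrightarrow> d t = 0"
proof -
  obtain d where d: "\<And>t. (sstep has_real_derivative d t) (at t)" "C1k 0 d"
    using C1k_sstep[of "Suc 0"] by auto
  have "compact (d ` {0..1})"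
    using d(2) by (intro compact_continuous_image) (auto intro: continuous_on_subset)
  then obtain C where "\<forall>y\<in>d ` {0..1}. norm y \<le> C"
    using compact_imp_bounded[of "d ` {0..1}"] unfolding bounded_iff by blast
  then have C: "\<And>t. t \<in> {0..1} \<Longrightarrow> \<bar>d t\<bar> \<le> C" by simp
  have z: "d t = 0" if "t > 1 \<or> t < 0" for t
  proof -
    have "((\<lambda>t. if t > 1 then 1 else 0) has_real_derivative 0) (at t)"
    proof (cases "t > 1")
      case True
      have "((\<lambda>t. 1) has_real_derivative 0) (at t)" by simp
      then show ?thesis
        by (rule has_field_derivative_transform_within_open[of _ _ _ "{1<..}"]) (use True in auto)
    next
      case False
      have "((\<lambda>t. 0) has_real_derivative 0) (at t)" by simp
      then show ?thesis
        by (rule has_field_derivative_transform_within_open[of _ _ _ "{..<0}"]) (use False that in auto)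
    qed
    then have "(sstep has_real_derivative 0) (at t)"
      by (rule has_field_derivative_transform_within_open[of _ _ _ "{..<0} \<union> {1<..}"])
         (use that in auto)
    then show ?thesis using d(1) DERIV_unique by blast
  qed
  have "\<bar>d t\<bar> \<le> C" for t
    using C[of t] C[of 0] z[of t] by (cases "t > 1 \<or> t < 0") auto
  with d(1) z show ?thesis using that[of d C] by blast
qed

text \<open>Vanishes within distance 1/(n+1) of the edge line and equals 1 beyond sqrt 2 /
  (n+1).\<close>

definition edge_cutoff :: "nat \<Rightarrow> real^3 \<Rightarrow> real" where
  "edge_cutoff n x = sstep ((real (Suc n))\<^sup>2 * rho x + (- 1))"

lemma smooth_edge_cutoff: "smooth (edge_cutoff n)"
  unfolding edge_cutoff_def[abs_def] by (rule smooth_affine_compose[OF C1k_sstep smooth_rho])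

text \<open>The chain rule gives a factor (n+1)^2 times a derivative of \<open>rho\<close>, which is
  at most 2 sqrt rho. Where the derivative is nonzero, sqrt rho is at most 2/(n+1), so one factor
  n+1 remains.\<close>

lemma pd_edge_cutoff_le:
  obtains C where "\<And>n j x. \<bar>pd j (edge_cutoff n) x\<bar> \<le> C * real (Suc n)"
    "\<And>n j x. rho x > (2 / real (Suc n))\<^sup>2 \<Longrightarrow> pd j (edge_cutoff n) x = 0"
proof -
  obtain d C where d: "\<And>t. (sstep has_real_derivative d t) (at t)" "\<And>t. \<bar>d t\<bar> \<le> C" "\<And>t. t > 1 \<Longrightarrow> d t = 0"
    by (rule sstep_derivative) blast
  have C0: "C \<ge> 0" using d(2)[of 0] by linarith
  have pd: "pd j (edge_cutoff n) x = d ((real (Suc n))\<^sup>2 * rho x + (- 1)) * ((real (Suc n))\<^sup>2 * pd j rho x)" for j n x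
  proof -
    have "(rho has_derivative frechet_derivative rho (at x)) (at x)"
      using smooth_differentiable[OF smooth_rho] by (simp add: frechet_derivative_works)
    then have "((\<lambda>x. (real (Suc n))\<^sup>2 * rho x + (- 1)) has_derivative (\<lambda>v. (real (Suc n))\<^sup>2 * frechet_derivative rho (at x) v)) (at x)"
      by (auto intro!: derivative_eq_intros)
    from has_derivative_compose[OF this, of sstep "(*) (d ((real (Suc n))\<^sup>2 * rho x + (- 1)))"]
    have "(edge_cutoff n has_derivative (\<lambda>v. d ((real (Suc n))\<^sup>2 * rho x + (- 1)) * ((real (Suc n))\<^sup>2 * frechet_derivative rho (at x) v))) (at x)"
      using d(1) by (simp add: edge_cutoff_def[abs_def] has_field_derivative_def)
    from pd_eq[OF this, of j] show ?thesis by (simp add: pd_def)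
  qed
  have big: "(real (Suc n))\<^sup>2 * rho x + (- 1) > 1" if "rho x > (2 / real (Suc n))\<^sup>2" for n x
  proof -
    have "(real (Suc n))\<^sup>2 * rho x > (real (Suc n))\<^sup>2 * (2 / real (Suc n))\<^sup>2"
      using that by (intro mult_strict_left_mono) auto
    also have "(real (Suc n))\<^sup>2 * (2 / real (Suc n))\<^sup>2 = 4"
      by (simp add: power_divide)
    finally show ?thesis by simp
  qed
  have zero: "pd j (edge_cutoff n) x = 0" if "rho x > (2 / real (Suc n))\<^sup>2" for n j x
    unfolding pd using d(3)[OF big[OF that]] by simp
  have "\<bar>pd j (edge_cutoff n) x\<bar> \<le> (4 * C) * real (Suc n)" for n j x
  proof (cases "rho x > (2 / real (Suc n))\<^sup>2")
    case True
    then show ?thesis using zero[OF True] C0 by simp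
  next
    case False
    then have "sqrt (rho x) \<le> 2 / real (Suc n)" by (intro real_le_lsqrt) auto
    then have p: "\<bar>pd j rho x\<bar> \<le> 4 / real (Suc n)" using pd_rho_le[of j x] by simp
    have "\<bar>pd j (edge_cutoff n) x\<bar> \<le> C * ((real (Suc n))\<^sup>2 * (4 / real (Suc n)))"
      unfolding pd abs_mult using d(2) p C0 by (intro mult_mono) auto
    also have "\<dots> = (4 * C) * real (Suc n)" by (simp add: power2_eq_square)
    finally show ?thesis .
  qed
  with zero show ?thesis using that by blast
qed

context wedge_domain
begin

lemma W_not_edge: "x \<in> W \<Longrightarrow> x \<notin> edge"
  by (auto simp: W_def edge_def split: if_splits)

text \<open>Dominated convergence. It is used both for cut-offs at the whole boundary of the wedge
  and for cut-offs at the edge alone.\<close>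

lemma regular_distr_cutoff_tendsto:
  fixes f :: "real^3 \<Rightarrow> 'b::euclidean_space"
  assumes f: "L2 (lebesgue_on \<Omega>) f" and tf: "tf K \<phi>" and K: "K \<subseteq> N"
    and c: "\<And>n. c n \<in> borel_measurable borel" "\<And>n x. 0 \<le> c n x \<and> c n x \<le> 1"
    and lim: "\<And>x. x \<in> W \<Longrightarrow> eventually (\<lambda>n. c n x = (1::real)) sequentially"
  shows "(\<lambda>n. regular_distr \<Omega> f (\<lambda>x. c n x * \<phi> x)) \<longlonglongrightarrow> regular_distr \<Omega> f \<phi>"
  unfolding regular_distr_def
proof (rule integral_dominated_convergence[where w="\<lambda>x. norm (\<phi> x *\<^sub>R f x)"])
  note i = regular_distr_integrable[OF f tf]
  show "(\<lambda>x. \<phi> x *\<^sub>R f x) \<in> borel_measurable (lebesgue_on \<Omega>)" using i by auto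
  have "(\<lambda>x. c n x *\<^sub>R (\<phi> x *\<^sub>R f x)) \<in> borel_measurable (lebesgue_on \<Omega>)" for n
    by (rule borel_measurable_scaleR[OF borel_measurable_lebesgue_on_\<Omega>[OF c(1)] borel_measurable_integrable[OF i]])
  then show "(\<lambda>x. (c n x * \<phi> x) *\<^sub>R f x) \<in> borel_measurable (lebesgue_on \<Omega>)" for n by simp
  show "integrable (lebesgue_on \<Omega>) (\<lambda>x. norm (\<phi> x *\<^sub>R f x))" by (rule integrable_norm[OF i])
  have "norm ((c n x * \<phi> x) *\<^sub>R f x) \<le> 1 * norm (\<phi> x *\<^sub>R f x)" for n x
    using c(2)[where n=n and x=x] unfolding scaleR_scaleR[symmetric] norm_scaleR[of "c n x"] by (intro mult_right_mono) auto
  then show "AE x in lebesgue_on \<Omega>. norm ((c n x * \<phi> x) *\<^sub>R f x) \<le> norm (\<phi> x *\<^sub>R f x)" for n by simp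
  show "AE x in lebesgue_on \<Omega>. (\<lambda>n. (c n x * \<phi> x) *\<^sub>R f x) \<longlonglongrightarrow> \<phi> x *\<^sub>R f x"
  proof (rule AE_I2)
    fix x assume "x \<in> space (lebesgue_on \<Omega>)"
    then have x: "x \<in> \<Omega>" by simp
    show "(\<lambda>n. (c n x * \<phi> x) *\<^sub>R f x) \<longlonglongrightarrow> \<phi> x *\<^sub>R f x"
    proof (cases "x \<in> K")
      case True
      then have "x \<in> W" using x K \<Omega>_N by blast
      from lim[OF this] have "eventually (\<lambda>n. (c n x * \<phi> x) *\<^sub>R f x = \<phi> x *\<^sub>R f x) sequentially"
        by eventually_elim simp
      then show ?thesis by (rule tendsto_eventually)
    qed (use tf in \<open>simp add: tf_def\<close>)
  qed
qed

text \<open>The product is a smooth conjunction of the conditions on A and B, for openings below pi.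
  The complement of the product of complements is the corresponding smooth disjunction, for openings
  above pi.\<close>

definition W_cutoff :: "nat \<Rightarrow> real^3 \<Rightarrow> real" where
  "W_cutoff n x = (let a = sstep (real (Suc n) * A x + (- 1)); b = sstep (real (Suc n) * B x + (- 1))
     in if D > 0 then a * b else 1 + (- 1) * ((1 + (- 1) * a) * (1 + (- 1) * b)))"

lemma smooth_W_cutoff: "smooth (W_cutoff n)"
proof -
  have a: "smooth (\<lambda>x. sstep (real (Suc n) * A x + (- 1)))" and b: "smooth (\<lambda>x. sstep (real (Suc n) * B x + (- 1)))"
    by (intro smooth_affine_compose C1k_sstep smooth_linear linear_A linear_B)+
  show ?thesis
  proof (cases "D > 0")
    case True
    then show ?thesis unfolding W_cutoff_def[abs_def] Let_def using a b by (simp only: if_True) (intro smooth_mult; assumption)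
  next
    case False
    then show ?thesis unfolding W_cutoff_def[abs_def] Let_def using a b
      by (simp only: if_False) (intro smooth_add smooth_mult smooth_const; assumption)
  qed
qed

lemma W_cutoff_range: "0 \<le> W_cutoff n x \<and> W_cutoff n x \<le> 1"
proof -
  define a b where "a = sstep (real (Suc n) * A x + (- 1))" "b = sstep (real (Suc n) * B x + (- 1))"
  have ab: "0 \<le> a" "a \<le> 1" "0 \<le> b" "b \<le> 1" unfolding a_b_def by (rule sstep_range)+
  have "0 \<le> a * b \<and> a * b \<le> 1" "0 \<le> (1 - a) * (1 - b) \<and> (1 - a) * (1 - b) \<le> 1"
    using ab by (auto intro: mult_le_one)
  then show ?thesis unfolding W_cutoff_def Let_def a_b_def[symmetric] by auto
qed

lemma W_cutoff_tendsto: "x \<in> W \<Longrightarrow> eventually (\<lambda>n. W_cutoff n x = 1) sequentially"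
proof -
  have ev: "eventually (\<lambda>n. sstep (real (Suc n) * t + (- 1)) = 1) sequentially" if "t > 0" for t
  proof -
    obtain m :: nat where m: "2 / t < real m" using reals_Archimedean2[of "2 / t"] by blast
    have "sstep (real (Suc n) * t + (- 1)) = 1" if "n \<ge> m" for n
    proof (rule sstep_1)
      have "2 = (2 / t) * t" using \<open>t > 0\<close> by simp
      also have "\<dots> \<le> real (Suc n) * t" using m that \<open>t > 0\<close> by (intro mult_right_mono) auto
      finally show "1 \<le> real (Suc n) * t + (- 1)" by simp
    qed
    then show ?thesis by (auto simp: eventually_sequentially)
  qed
  assume x: "x \<in> W"
  show ?thesis
  proof (cases "D > 0")
    case True
    then have "A x > 0" "B x > 0" using x by (auto simp: W_def)
    from ev[OF this(1)] ev[OF this(2)] show ?thesis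
      by eventually_elim (use True in \<open>simp add: W_cutoff_def\<close>)
  next
    case False
    then have "A x > 0 \<or> B x > 0" using x by (auto simp: W_def)
    then show ?thesis
    proof
      assume "A x > 0"
      from ev[OF this] show ?thesis by eventually_elim (use False in \<open>simp add: W_cutoff_def\<close>)
    next
      assume "B x > 0"
      from ev[OF this] show ?thesis by eventually_elim (use False in \<open>simp add: W_cutoff_def\<close>)
    qed
  qed
qed

lemma W_cutoff_support:
  "\<exists>C. closed C \<and> C \<subseteq> W \<and> (\<forall>x. x \<notin> C \<longrightarrow> W_cutoff n x = 0)"
proof -
  define C where "C = (if D > 0 then {x. 1 \<le> real (Suc n) * A x \<and> 1 \<le> real (Suc n) * B x}
     else {x. 1 \<le> real (Suc n) * A x \<or> 1 \<le> real (Suc n) * B x})"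
  have "closed C"
    unfolding C_def using continuous_A continuous_B
    by (auto intro!: closed_Collect_conj closed_Collect_disj closed_Collect_le continuous_intros)
  moreover have "C \<subseteq> W"
  proof -
    have "t > 0" if "1 \<le> real (Suc n) * t" for t
      using that mult_nonneg_nonpos[of "real (Suc n)" t] by (cases "t > 0") auto
    then show ?thesis unfolding C_def W_def by auto
  qed
  moreover have "W_cutoff n x = 0" if "x \<notin> C" for x
    using that by (auto simp: C_def W_cutoff_def Let_def split: if_splits)
  ultimately show ?thesis by blast
qed

text \<open>Identities between distributions hold for tests supported inside
  \<open>\<Omega>\<close>, whereas the tests used here reach the boundary. Multiplication by
  \<open>W_cutoff\<close> makes a test admissible, and no derivative falls on the cut-off, so the
  limit is harmless.\<close>

lemma regular_distr_vanish:
  fixes f :: "real^3 \<Rightarrow> 'b::euclidean_space"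
  assumes f: "L2 (lebesgue_on \<Omega>) f" and z: "\<And>\<phi>. test_function \<Omega> \<phi> \<Longrightarrow> regular_distr \<Omega> f \<phi> = 0"
    and tf: "tf K \<psi>" and K: "K \<subseteq> N"
  shows "regular_distr \<Omega> f \<psi> = 0"
proof -
  have "regular_distr \<Omega> f (\<lambda>x. W_cutoff n x * \<psi> x) = 0" for n
  proof -
    obtain C where C: "closed C" "C \<subseteq> W" "\<And>x. x \<notin> C \<Longrightarrow> W_cutoff n x = 0"
      using W_cutoff_support[of n] by blast
    have "tf (K \<inter> C) (\<lambda>x. W_cutoff n x * \<psi> x)"
      using tf C smooth_W_cutoff[of n] by (auto simp: tf_def compact_Int_closed)
    moreover have "K \<inter> C \<subseteq> \<Omega>" using K C(2) \<Omega>_N by blast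
    ultimately show ?thesis using z tf_test_function by blast
  qed
  moreover have "(\<lambda>n. regular_distr \<Omega> f (\<lambda>x. W_cutoff n x * \<psi> x)) \<longlonglongrightarrow> regular_distr \<Omega> f \<psi>"
    using smooth_W_cutoff
    by (intro regular_distr_cutoff_tendsto[OF f tf K] W_cutoff_range W_cutoff_tendsto
        borel_measurable_continuous_onI smooth_continuous)
  ultimately have "(\<lambda>n. 0) \<longlonglongrightarrow> regular_distr \<Omega> f \<psi>" by simp
  then show ?thesis by (rule LIMSEQ_unique) (rule tendsto_const)
qed

lemma regular_distr_eqI:
  fixes f :: "real^3 \<Rightarrow> 'b::euclidean_space"
  assumes f: "L2 (lebesgue_on \<Omega>) f" and g: "L2 (lebesgue_on \<Omega>) g"
    and z: "\<And>\<phi>. test_function \<Omega> \<phi> \<Longrightarrow> regular_distr \<Omega> f \<phi> = regular_distr \<Omega> g \<phi>"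
    and tf: "tf K \<psi>" and K: "K \<subseteq> N"
  shows "regular_distr \<Omega> f \<psi> = regular_distr \<Omega> g \<psi>"
proof -
  have "regular_distr \<Omega> (\<lambda>x. f x - g x) \<psi> = 0"
  proof (rule regular_distr_vanish[OF L2_diff[OF f g] _ tf K])
    fix \<phi> assume t: "test_function \<Omega> \<phi>"
    have "\<phi> x = 0" if "x \<notin> supp \<phi>" for x
      using that closure_subset[of "{x. \<phi> x \<noteq> 0}"] unfolding supp_def by blast
    then have "tf (supp \<phi>) \<phi>" using t by (simp add: test_function_def tf_def)
    from regular_distr_diff[OF f g this] z[OF t]
    show "regular_distr \<Omega> (\<lambda>x. f x - g x) \<phi> = 0" by simp
  qed
  then show ?thesis using regular_distr_diff[OF f g tf] by simp
qed

lemma \<Omega>_not_edge: "x \<in> \<Omega> \<Longrightarrow> \<bar>x$3\<bar> < M \<Longrightarrow> rho x > 0"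
proof (rule ccontr)
  assume x: "x \<in> \<Omega>" "\<bar>x$3\<bar> < M" and "\<not> rho x > 0"
  then have "horiz x = 0" by (simp add: rho_horiz)
  then have "x \<in> N" "x \<in> edge" using x h edge_iff by (auto simp: N_iff)
  then show False using \<Omega>_N x W_not_edge by blast
qed

text \<open>The functions \<open>b n\<close> live in a box of volume (2c/(n+1))^2 times 2M and are
  bounded by C (n+1), so their squared L2 norms are at most 8 c^2 M C^2, uniformly in n.\<close>

lemma integral_edge_concentration:
  fixes g :: "real^3 \<Rightarrow> 'b::euclidean_space"
  assumes g: "L2 (lebesgue_on \<Omega>) g" and Bm: "\<And>n. b n \<in> borel_measurable borel"
    and c: "c \<ge> 0" and Bb: "\<And>n x. \<bar>b n x\<bar> \<le> C * real (Suc n)"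
    and B0: "\<And>n x. rho x > (c / real (Suc n))\<^sup>2 \<or> \<bar>x$3\<bar> \<ge> M \<Longrightarrow> b n x = 0"
  shows "(\<lambda>n. regular_distr \<Omega> g (b n)) \<longlonglongrightarrow> 0"
  unfolding regular_distr_def
proof (rule integral_concentrating_tendsto_0[OF g, where S="\<lambda>n. {x \<in> \<Omega>. rho x \<le> (c / real (Suc n))\<^sup>2 \<and> \<bar>x$3\<bar> < M}"
      and C="8 * c\<^sup>2 * M * C\<^sup>2"])
  fix n
  let ?N = "real (Suc n)"
  let ?S = "{x \<in> \<Omega>. rho x \<le> (c / ?N)\<^sup>2 \<and> \<bar>x$3\<bar> < M}"
  show "L2 (lebesgue_on \<Omega>) (b n)" using Bb[where n=n] by (intro L2_bounded_\<Omega>[OF Bm, where C="C * ?N"]) simp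
  have "?S = \<Omega> \<inter> ({x. rho x \<le> (c / ?N)\<^sup>2} \<inter> {x. \<bar>x$3\<bar> < M})" by auto
  moreover have "{x. rho x \<le> (c / ?N)\<^sup>2} \<in> sets borel"
    by (intro borel_closed closed_Collect_le smooth_continuous[OF smooth_rho] continuous_intros)
  moreover have "{x::real^3. \<bar>x$3\<bar> < M} \<in> sets borel"
    by (intro borel_open open_Collect_less continuous_intros)
  ultimately show "?S \<in> sets (lebesgue_on \<Omega>)"
    using open_\<Omega> by (auto simp: sets_restrict_space)
  show "b n x = 0" if "x \<in> space (lebesgue_on \<Omega>)" "x \<notin> ?S" for x
    using that by (intro B0) auto
  let ?u = "vector [c / ?N, c / ?N, M] :: real^3"
  have box: "b n x \<noteq> 0 \<Longrightarrow> x \<in> cbox (- ?u) ?u" for x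
  proof -
    assume "b n x \<noteq> 0"
    then have "\<not> (rho x > (c / ?N)\<^sup>2 \<or> \<bar>x$3\<bar> \<ge> M)" using B0 by blast
    then have x: "rho x \<le> (c / ?N)\<^sup>2" "\<bar>x$3\<bar> \<le> M" by linarith+
    have "(x$1)\<^sup>2 \<le> (c / ?N)\<^sup>2" "(x$2)\<^sup>2 \<le> (c / ?N)\<^sup>2"
      using x(1) zero_le_power2[of "x$1"] zero_le_power2[of "x$2"] unfolding rho_def by linarith+
    then have "\<bar>x$1\<bar> \<le> c / ?N" "\<bar>x$2\<bar> \<le> c / ?N"
      using c abs_le_square_iff[of "x$1" "c / ?N"] abs_le_square_iff[of "x$2" "c / ?N"] by auto
    then show ?thesis using x(2) by (auto simp: mem_box_cart forall_3 abs_le_iff)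
  qed
  have "(LINT x|lebesgue_on \<Omega>. (norm (b n x))\<^sup>2) = (LINT x|lebesgue. indicator \<Omega> x *\<^sub>R (norm (b n x))\<^sup>2)"
    using open_\<Omega> by (subst integral_restrict_space) auto
  also have "\<dots> = (LINT x|lborel. indicator \<Omega> x *\<^sub>R (norm (b n x))\<^sup>2)"
    using open_\<Omega> Bm[of n] by (intro integral_completion) (auto intro!: borel_measurable_times borel_measurable_indicator)
  also have "\<dots> \<le> (LINT x|lborel. indicator (cbox (- ?u) ?u) x *\<^sub>R (C * ?N)\<^sup>2)"
  proof (rule integral_mono')
    show "integrable lborel (\<lambda>x. indicator (cbox (- ?u) ?u) x *\<^sub>R (C * ?N)\<^sup>2)"
      using emeasure_bounded_finite[OF bounded_cbox, of "- ?u" ?u]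
      by (intro integrable_scaleR_left integrable_real_indicator) auto
    show "indicator \<Omega> x *\<^sub>R (norm (b n x))\<^sup>2 \<le> indicator (cbox (- ?u) ?u) x *\<^sub>R (C * ?N)\<^sup>2" for x
    proof (cases "b n x = 0")
      case False
      have "(norm (b n x))\<^sup>2 \<le> (C * ?N)\<^sup>2" using Bb[of n x] by (intro power_mono) auto
      then show ?thesis using box[OF False] by (auto simp: indicator_def)
    qed (simp add: indicator_def)
  qed simp
  also have "\<dots> = measure lborel (cbox (- ?u) ?u) * (C * ?N)\<^sup>2" by simp
  also have "measure lborel (cbox (- ?u) ?u) = 8 * c\<^sup>2 * M / ?N\<^sup>2"
  proof -
    have "0 \<in> cbox (- ?u) ?u" using c M by (simp add: mem_box_cart forall_3)
    then have "cbox (- ?u) ?u \<noteq> {}" by blast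
    then have "measure lborel (cbox (- ?u) ?u) = (\<Prod>i\<in>UNIV. ?u $ i - (- ?u) $ i)"
      by (rule content_cbox_cart)
    also have "\<dots> = (c / ?N + c / ?N) * ((c / ?N + c / ?N) * (M + M))"
      unfolding UNIV_3 by simp
    also have "\<dots> = 8 * c\<^sup>2 * M / ?N\<^sup>2"
    proof -
      have "(c / k + c / k) * ((c / k + c / k) * (M + M)) = 8 * c\<^sup>2 * M / k\<^sup>2" for k :: real
        by (simp add: power2_eq_square)
      then show ?thesis .
    qed
    finally show ?thesis .
  qed
  also have "8 * c\<^sup>2 * M / ?N\<^sup>2 * (C * ?N)\<^sup>2 = 8 * c\<^sup>2 * M * C\<^sup>2"
    by (simp add: power_mult_distrib del: of_nat_Suc)
  finally show "(LINT x|lebesgue_on \<Omega>. (norm (b n x))\<^sup>2) \<le> 8 * c\<^sup>2 * M * C\<^sup>2" .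
next
  show "AE x in lebesgue_on \<Omega>. eventually (\<lambda>n. x \<notin> {x \<in> \<Omega>. rho x \<le> (c / real (Suc n))\<^sup>2 \<and> \<bar>x$3\<bar> < M}) sequentially"
  proof (rule AE_I2)
    fix x assume x: "x \<in> space (lebesgue_on \<Omega>)"
    show "eventually (\<lambda>n. x \<notin> {x \<in> \<Omega>. rho x \<le> (c / real (Suc n))\<^sup>2 \<and> \<bar>x$3\<bar> < M}) sequentially"
    proof (cases "\<bar>x$3\<bar> < M")
      case True
      then have r: "rho x > 0" using x \<Omega>_not_edge by simp
      have "(\<lambda>n. (c * (1 / real (Suc n)))\<^sup>2) \<longlonglongrightarrow> (c * 0)\<^sup>2"
        by (intro tendsto_intros LIMSEQ_Suc lim_1_over_n)
      then have "eventually (\<lambda>n. (c * (1 / real (Suc n)))\<^sup>2 < rho x) sequentially"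
        using r by (intro order_tendstoD) auto
      then show ?thesis by eventually_elim (simp add: not_le)
    qed simp
  qed
qed

text \<open>The zero capacity of the edge. An equation known for tests supported off the edge is
  applied to \<open>edge_cutoff\<close> times \<open>\<psi>\<close>; the extra term, with the
  derivative on the cut-off, tends to 0 against the L2 gradient.\<close>

lemma edge_cutoff_extension:
  assumes F: "L2 (lebesgue_on \<Omega>) F" and G: "\<And>l. L2 (lebesgue_on \<Omega>) (G l)"
    and eq: "\<And>K \<psi>. tf K \<psi> \<Longrightarrow> K \<subseteq> N \<Longrightarrow> K \<inter> edge = {} \<Longrightarrow>
       regular_distr \<Omega> F \<psi> + (\<Sum>j\<in>UNIV. stress lam \<mu> j (\<lambda>l. regular_distr \<Omega> (G l) (pd j \<psi>))) = 0"
    and tf: "tf K \<psi>" and K: "K \<subseteq> N"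
  shows "regular_distr \<Omega> F \<psi> + (\<Sum>j\<in>UNIV. stress lam \<mu> j (\<lambda>l. regular_distr \<Omega> (G l) (pd j \<psi>))) = 0"
proof -
  define p where "p n x = edge_cutoff n x * \<psi> x" for n x
  have cm: "edge_cutoff n \<in> borel_measurable borel" for n
    by (intro borel_measurable_continuous_onI smooth_continuous smooth_edge_cutoff)
  have cr: "0 \<le> edge_cutoff n x \<and> edge_cutoff n x \<le> 1" for n x
    by (simp add: edge_cutoff_def sstep_range)
  have ce: "eventually (\<lambda>n. edge_cutoff n x = 1) sequentially" if "x \<in> W" for x
  proof -
    have "horiz x \<noteq> 0" using W_not_edge[OF that] edge_iff by simp
    then have r: "rho x > 0" by (simp add: rho_horiz)
    have "(\<lambda>n. (2 * (1 / real (Suc n)))\<^sup>2) \<longlonglongrightarrow> (2 * 0)\<^sup>2"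
      by (intro tendsto_intros LIMSEQ_Suc lim_1_over_n)
    then have "eventually (\<lambda>n. (2 * (1 / real (Suc n)))\<^sup>2 < rho x) sequentially"
      using r by (intro order_tendstoD) auto
    then show ?thesis
    proof eventually_elim
      case (elim n)
      have "(real (Suc n))\<^sup>2 * (2 * (1 / real (Suc n)))\<^sup>2 \<le> (real (Suc n))\<^sup>2 * rho x"
        using elim by (intro mult_left_mono) auto
      moreover have "(real (Suc n))\<^sup>2 * (2 * (1 / real (Suc n)))\<^sup>2 = 4" by (simp add: power_divide)
      ultimately show ?case unfolding edge_cutoff_def by (intro sstep_1) linarith
    qed
  qed
  have tfp: "tf (K \<inter> {x. 1 \<le> (real (Suc n))\<^sup>2 * rho x}) (p n)" for n
  proof -
    have "closed {x. 1 \<le> (real (Suc n))\<^sup>2 * rho x}"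
      using smooth_continuous[OF smooth_rho] by (intro closed_Collect_le continuous_intros)
    moreover have "smooth (p n)" unfolding p_def using tf smooth_edge_cutoff by (auto simp: tf_def)
    moreover have "p n x = 0" if "x \<notin> K \<inter> {x. 1 \<le> (real (Suc n))\<^sup>2 * rho x}" for x
      using that tf by (auto simp: p_def tf_def edge_cutoff_def)
    ultimately show ?thesis using tf by (auto simp: tf_def compact_Int_closed)
  qed
  have zero: "regular_distr \<Omega> F (p n) + (\<Sum>j\<in>UNIV. stress lam \<mu> j (\<lambda>l. regular_distr \<Omega> (G l) (pd j (p n)))) = 0" for n
  proof (rule eq[OF tfp])
    show "K \<inter> {x. 1 \<le> (real (Suc n))\<^sup>2 * rho x} \<inter> edge = {}"
      by (auto simp: edge_iff rho_horiz)
  qed (use K in auto)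
  obtain C where C: "\<And>n j x. \<bar>pd j (edge_cutoff n) x\<bar> \<le> C * real (Suc n)"
    "\<And>n j x. rho x > (2 / real (Suc n))\<^sup>2 \<Longrightarrow> pd j (edge_cutoff n) x = 0"
    by (rule pd_edge_cutoff_le) blast
  obtain C' where C': "\<And>x. norm (\<psi> x) \<le> C'" using tf_bounded[OF tf] by blast
  have limF: "(\<lambda>n. regular_distr \<Omega> F (p n)) \<longlonglongrightarrow> regular_distr \<Omega> F \<psi>"
    unfolding p_def by (rule regular_distr_cutoff_tendsto[OF F tf K cm cr ce])
  have limG: "(\<lambda>n. regular_distr \<Omega> (G l) (pd j (p n))) \<longlonglongrightarrow> regular_distr \<Omega> (G l) (pd j \<psi>)" for l j
  proof -
    have sp: "smooth \<psi>" using tf by (simp add: tf_def)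
    have pd: "pd j (p n) = (\<lambda>x. pd j (edge_cutoff n) x * \<psi> x + edge_cutoff n x * pd j \<psi> x)" for n
      unfolding p_def
      by (intro ext pd_bounded_bilinear[OF bounded_bilinear_mult] smooth_differentiable smooth_edge_cutoff sp)
    have i1: "integrable (lebesgue_on \<Omega>) (\<lambda>x. (pd j (edge_cutoff n) x * \<psi> x) *\<^sub>R G l x)" for n
    proof (rule regular_distr_integrable[OF G])
      show "tf K (\<lambda>x. pd j (edge_cutoff n) x * \<psi> x)"
        using tf smooth_edge_cutoff by (auto simp: tf_def)
    qed
    have i2: "integrable (lebesgue_on \<Omega>) (\<lambda>x. (edge_cutoff n x * pd j \<psi> x) *\<^sub>R G l x)" for n
    proof (rule regular_distr_integrable[OF G])
      show "tf K (\<lambda>x. edge_cutoff n x * pd j \<psi> x)"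
        using tf_pd[OF tf, of j] smooth_edge_cutoff by (auto simp: tf_def)
    qed
    have split: "regular_distr \<Omega> (G l) (pd j (p n)) = regular_distr \<Omega> (G l) (\<lambda>x. pd j (edge_cutoff n) x * \<psi> x)
       + regular_distr \<Omega> (G l) (\<lambda>x. edge_cutoff n x * pd j \<psi> x)" for n
      unfolding regular_distr_def pd scaleR_add_left by (rule Bochner_Integration.integral_add[OF i1 i2])
    have "(\<lambda>n. regular_distr \<Omega> (G l) (\<lambda>x. pd j (edge_cutoff n) x * \<psi> x)) \<longlonglongrightarrow> 0"
    proof (rule integral_edge_concentration[OF G, where c=2 and C="C * C'"])
      show "(\<lambda>x. pd j (edge_cutoff n) x * \<psi> x) \<in> borel_measurable borel" for n
        using smooth_edge_cutoff sp by (intro borel_measurable_continuous_onI smooth_continuous) auto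
      have "\<bar>pd j (edge_cutoff n) x * \<psi> x\<bar> \<le> (C * real (Suc n)) * C'" for n x
        unfolding abs_mult using C(1)[where n=n and j=j and x=x] C'[of x] by (intro mult_mono) auto
      then show "\<bar>pd j (edge_cutoff n) x * \<psi> x\<bar> \<le> C * C' * real (Suc n)" for n x
        by (simp only: ac_simps)
      fix n x assume "rho x > (2 / real (Suc n))\<^sup>2 \<or> \<bar>x$3\<bar> \<ge> M"
      then show "pd j (edge_cutoff n) x * \<psi> x = 0"
      proof
        assume "\<bar>x$3\<bar> \<ge> M"
        then have "x \<notin> K" using K by (auto simp: N_iff)
        then show ?thesis using tf by (simp add: tf_def)
      qed (simp add: C(2))
    qed simp
    then show ?thesis
      unfolding split
      using tendsto_add[OF _ regular_distr_cutoff_tendsto[OF G tf_pd[OF tf] K cm cr ce]] by fastforce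
  qed
  have "(\<lambda>n. regular_distr \<Omega> F (p n) + (\<Sum>j\<in>UNIV. stress lam \<mu> j (\<lambda>l. regular_distr \<Omega> (G l) (pd j (p n)))))
    \<longlonglongrightarrow> regular_distr \<Omega> F \<psi> + (\<Sum>j\<in>UNIV. stress lam \<mu> j (\<lambda>l. regular_distr \<Omega> (G l) (pd j \<psi>)))"
    by (intro tendsto_add tendsto_sum tendsto_stress limF limG)
  then show ?thesis unfolding zero by (rule LIMSEQ_unique) (rule tendsto_const)
qed

text \<open>The boundary terms of two integrations by parts are the same for \<open>v\<close> and
  \<open>w\<close> and cancel upon subtraction. The first-order relation uses equality of the
  traces, the second-order one equality of the tractions; combined, both derivatives fall on the
  test function, with no term on the faces or on the edge.\<close>

lemma weak_transmission_equation:
  assumes v: "L2 (lebesgue_on \<Omega>) v" and w: "L2 (lebesgue_on \<Omega>) w" and fw: "L2 (lebesgue_on \<Omega>) Fw" and fv: "L2 (lebesgue_on \<Omega>) Fv"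
    and eqv: "distr_eq_on \<Omega> (\<lambda>\<phi>. distr_lame lam \<mu> (regular_distr \<Omega> v) \<phi> + regular_distr \<Omega> Fv \<phi>) (\<lambda>\<phi>. 0)"
    and eqw: "distr_eq_on \<Omega> (\<lambda>\<phi>. distr_lame lam \<mu> (regular_distr \<Omega> w) \<phi> + regular_distr \<Omega> Fw \<phi>) (\<lambda>\<phi>. 0)"
    and \<Gamma>: "N \<inter> faces - edge \<subseteq> \<Gamma>"
    and trace: "trace_eq_on \<Omega> \<Gamma> w v" and traction: "traction_eq_on \<Omega> \<Gamma> lam \<mu> v w"
  defines "u \<equiv> \<lambda>x. v x - w x" and "F \<equiv> \<lambda>x. Fw x - Fv x"
  obtains G where "\<And>i. L2 (lebesgue_on \<Omega>) (G i)"
    "\<And>K \<psi> i. tf K \<psi> \<Longrightarrow> K \<subseteq> N \<Longrightarrow> regular_distr \<Omega> (G i) \<psi> = - regular_distr \<Omega> u (pd i \<psi>)"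
    "\<And>K \<psi>. tf K \<psi> \<Longrightarrow> K \<subseteq> N \<Longrightarrow>
       regular_distr \<Omega> F \<psi> = (\<Sum>j\<in>UNIV. stress lam \<mu> j (\<lambda>l. regular_distr \<Omega> u (pd l (pd j \<psi>))))"
proof -
  have F: "L2 (lebesgue_on \<Omega>) F" unfolding F_def by (rule L2_diff[OF fw fv])
  obtain g k where g: "has_trace \<Omega> w g" and k: "has_trace \<Omega> v k"
    and gk: "AE x in surface_measure \<Omega>. x \<in> \<Gamma> \<longrightarrow> g x = k x"
    using trace unfolding trace_eq_on_def by blast
  obtain Gw' where Gw': "\<And>i. L2 (lebesgue_on \<Omega>) (Gw' i)" "\<And>i. weak_pd \<Omega> i w (Gw' i)"
    "\<And>K \<psi> i. tf K \<psi> \<Longrightarrow> K \<subseteq> N \<Longrightarrow>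
      regular_distr \<Omega> w (pd i \<psi>) + regular_distr \<Omega> (Gw' i) \<psi> = \<kappa> *\<^sub>R (LINT x|surface_measure \<Omega>. (nu x $ i * \<psi> x) *\<^sub>R g x)"
    using has_traceD[OF g w] by blast
  obtain Gv' where Gv': "\<And>i. L2 (lebesgue_on \<Omega>) (Gv' i)" "\<And>i. weak_pd \<Omega> i v (Gv' i)"
    "\<And>K \<psi> i. tf K \<psi> \<Longrightarrow> K \<subseteq> N \<Longrightarrow>
      regular_distr \<Omega> v (pd i \<psi>) + regular_distr \<Omega> (Gv' i) \<psi> = \<kappa> *\<^sub>R (LINT x|surface_measure \<Omega>. (nu x $ i * \<psi> x) *\<^sub>R k x)"
    using has_traceD[OF k v] by blast
  obtain s t where s: "has_traction \<Omega> lam \<mu> v s" and t: "has_traction \<Omega> lam \<mu> w t"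
    and st: "\<And>\<phi>. test_function UNIV \<phi> \<Longrightarrow> supp \<phi> \<inter> frontier \<Omega> \<subseteq> \<Gamma> \<Longrightarrow> s \<phi> = t \<phi>"
    using traction unfolding traction_eq_on_def by blast
  obtain Gv f\<^sub>v where Gv: "\<And>i. L2 (lebesgue_on \<Omega>) (Gv i)" "\<And>i. weak_pd \<Omega> i v (Gv i)" "L2 (lebesgue_on \<Omega>) f\<^sub>v"
    "distr_eq_on \<Omega> (distr_lame lam \<mu> (regular_distr \<Omega> v)) (regular_distr \<Omega> f\<^sub>v)"
    "\<And>K \<psi>. tf K \<psi> \<Longrightarrow> K \<subseteq> N \<Longrightarrow>
      regular_distr \<Omega> f\<^sub>v \<psi> + (\<Sum>j\<in>UNIV. stress lam \<mu> j (\<lambda>l. regular_distr \<Omega> (Gv l) (pd j \<psi>))) = \<kappa> *\<^sub>R s \<psi>"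
    using has_tractionD[OF s] by blast
  obtain Gw f\<^sub>w where Gw: "\<And>i. L2 (lebesgue_on \<Omega>) (Gw i)" "\<And>i. weak_pd \<Omega> i w (Gw i)" "L2 (lebesgue_on \<Omega>) f\<^sub>w"
    "distr_eq_on \<Omega> (distr_lame lam \<mu> (regular_distr \<Omega> w)) (regular_distr \<Omega> f\<^sub>w)"
    "\<And>K \<psi>. tf K \<psi> \<Longrightarrow> K \<subseteq> N \<Longrightarrow>
      regular_distr \<Omega> f\<^sub>w \<psi> + (\<Sum>j\<in>UNIV. stress lam \<mu> j (\<lambda>l. regular_distr \<Omega> (Gw l) (pd j \<psi>))) = \<kappa> *\<^sub>R t \<psi>"
    using has_tractionD[OF t] by blast
  \<comment> \<open>Trace and traction bring their own approximating sequences and so their own weak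
    gradients. These agree inside \<open>\<Omega>\<close>, hence also against tests that reach the
    boundary.\<close>
  have same: "regular_distr \<Omega> G1 \<psi> = regular_distr \<Omega> G2 \<psi>"
    if "L2 (lebesgue_on \<Omega>) G1" "L2 (lebesgue_on \<Omega>) G2" "weak_pd \<Omega> i y G1" "weak_pd \<Omega> i y G2" "tf K \<psi>" "K \<subseteq> N"
    for G1 G2 y :: "real^3 \<Rightarrow> complex^3" and i K \<psi>
    using that(3,4) unfolding weak_pd_def distr_eq_on_def
    by (intro regular_distr_eqI[OF that(1,2) _ that(5,6)]) auto
  have minus: "regular_distr \<Omega> (\<lambda>x. - f x) \<phi> = - regular_distr \<Omega> f \<phi>" for f :: "real^3 \<Rightarrow> complex^3" and \<phi>
    by (simp add: regular_distr_def)
  have L2m: "L2 (lebesgue_on \<Omega>) (\<lambda>x. - f x)" if "L2 (lebesgue_on \<Omega>) f" for f :: "real^3 \<Rightarrow> complex^3"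
    using L2_scaleR[OF that, of "-1"] by simp
  \<comment> \<open>The L2 representative of the Lame operator that comes with the traction is
    identified with the source prescribed by the equation.\<close>
  have ffv: "regular_distr \<Omega> f\<^sub>v \<psi> = - regular_distr \<Omega> Fv \<psi>" if "tf K \<psi>" "K \<subseteq> N" for K \<psi>
    unfolding minus[symmetric]
  proof (rule regular_distr_eqI[OF Gv(3) L2m[OF fv] _ that])
    fix \<phi> assume t: "test_function \<Omega> \<phi>"
    then have "distr_lame lam \<mu> (regular_distr \<Omega> v) \<phi> = regular_distr \<Omega> f\<^sub>v \<phi>"
      "distr_lame lam \<mu> (regular_distr \<Omega> v) \<phi> + regular_distr \<Omega> Fv \<phi> = 0"
      using Gv(4) eqv unfolding distr_eq_on_def by blast+
    then show "regular_distr \<Omega> f\<^sub>v \<phi> = regular_distr \<Omega> (\<lambda>x. - Fv x) \<phi>"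
      by (simp add: minus eq_neg_iff_add_eq_0)
  qed
  have ffw: "regular_distr \<Omega> f\<^sub>w \<psi> = - regular_distr \<Omega> Fw \<psi>" if "tf K \<psi>" "K \<subseteq> N" for K \<psi>
    unfolding minus[symmetric]
  proof (rule regular_distr_eqI[OF Gw(3) L2m[OF fw] _ that])
    fix \<phi> assume t: "test_function \<Omega> \<phi>"
    then have "distr_lame lam \<mu> (regular_distr \<Omega> w) \<phi> = regular_distr \<Omega> f\<^sub>w \<phi>"
      "distr_lame lam \<mu> (regular_distr \<Omega> w) \<phi> + regular_distr \<Omega> Fw \<phi> = 0"
      using Gw(4) eqw unfolding distr_eq_on_def by blast+
    then show "regular_distr \<Omega> f\<^sub>w \<phi> = regular_distr \<Omega> (\<lambda>x. - Fw x) \<phi>"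
      by (simp add: minus eq_neg_iff_add_eq_0)
  qed
  define G where "G i x = Gv i x - Gw i x" for i x
  have G: "L2 (lebesgue_on \<Omega>) (G i)" for i unfolding G_def by (rule L2_diff[OF Gv(1) Gw(1)])
  \<comment> \<open>Equality of traces is an almost everywhere statement and the edge is a null set
    of the surface, so tests crossing the edge are covered at once.\<close>
  have Gpd: "regular_distr \<Omega> (G i) \<psi> = - regular_distr \<Omega> u (pd i \<psi>)" if tf: "tf K \<psi>" and K: "K \<subseteq> N" for K \<psi> i
  proof -
    have "(LINT x|surface_measure \<Omega>. (nu x $ i * \<psi> x) *\<^sub>R g x) = (LINT x|surface_measure \<Omega>. (nu x $ i * \<psi> x) *\<^sub>R k x)"
    proof (rule integral_cong_AE)
      have m: "(\<lambda>x. nu x $ i * \<psi> x) \<in> borel_measurable (surface_measure \<Omega>)"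
        by (intro borel_measurable_surface borel_measurable_times nu_nth_measurable tf_measurable[OF tf])
      show "(\<lambda>x. (nu x $ i * \<psi> x) *\<^sub>R g x) \<in> borel_measurable (surface_measure \<Omega>)"
        "(\<lambda>x. (nu x $ i * \<psi> x) *\<^sub>R k x) \<in> borel_measurable (surface_measure \<Omega>)"
        using g k m by (auto simp: has_trace_def L2_def intro!: borel_measurable_scaleR)
      show "AE x in surface_measure \<Omega>. (nu x $ i * \<psi> x) *\<^sub>R g x = (nu x $ i * \<psi> x) *\<^sub>R k x"
        using gk AE_surface_not_edge AE_space
      proof eventually_elim
        case (elim x)
        show ?case
        proof (cases "x \<in> K")
          case True
          then have "x \<in> N" using K by blast
          moreover have "x \<in> frontier \<Omega>" using elim by (simp add: space_surface_measure)
          ultimately have "x \<in> \<Gamma>" using \<Gamma> elim frontier_N by blast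
          then show ?thesis using elim by simp
        qed (use tf in \<open>simp add: tf_def\<close>)
      qed
    qed
    then have "regular_distr \<Omega> v (pd i \<psi>) + regular_distr \<Omega> (Gv' i) \<psi> = regular_distr \<Omega> w (pd i \<psi>) + regular_distr \<Omega> (Gw' i) \<psi>"
      by (simp only: Gv'(3)[OF tf K] Gw'(3)[OF tf K])
    moreover have "regular_distr \<Omega> (Gv' i) \<psi> = regular_distr \<Omega> (Gv i) \<psi>"
      by (rule same[OF Gv'(1) Gv(1) Gv'(2) Gv(2) tf K])
    moreover have "regular_distr \<Omega> (Gw' i) \<psi> = regular_distr \<Omega> (Gw i) \<psi>"
      by (rule same[OF Gw'(1) Gw(1) Gw'(2) Gw(2) tf K])
    ultimately show ?thesis
      unfolding G_def[abs_def] u_def regular_distr_diff[OF Gv(1) Gw(1) tf] regular_distr_diff[OF v w tf_pd[OF tf]]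
      by (simp add: algebra_simps)
  qed
  \<comment> \<open>The traction is only a functional, and the two functionals are known to agree on
    tests whose support meets the boundary inside \<open>\<Gamma>\<close>; the support must avoid
    the edge here.\<close>
  have off: "regular_distr \<Omega> F \<psi> + (\<Sum>j\<in>UNIV. stress lam \<mu> j (\<lambda>l. regular_distr \<Omega> (G l) (pd j \<psi>))) = 0"
    if tf: "tf K \<psi>" and K: "K \<subseteq> N" and e: "K \<inter> edge = {}" for K \<psi>
  proof -
    have "supp \<psi> \<inter> frontier \<Omega> \<subseteq> \<Gamma>"
      using supp_subset_tf[OF tf] \<Gamma> frontier_N K e by blast
    then have "s \<psi> = t \<psi>" using st tf_test_function[OF tf, of UNIV] by simp
    then have "- regular_distr \<Omega> Fv \<psi> + (\<Sum>j\<in>UNIV. stress lam \<mu> j (\<lambda>l. regular_distr \<Omega> (Gv l) (pd j \<psi>)))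
      = - regular_distr \<Omega> Fw \<psi> + (\<Sum>j\<in>UNIV. stress lam \<mu> j (\<lambda>l. regular_distr \<Omega> (Gw l) (pd j \<psi>)))"
      by (simp only: Gv(5)[OF tf K] Gw(5)[OF tf K] ffv[OF tf K, symmetric] ffw[OF tf K, symmetric])
    moreover have "regular_distr \<Omega> F \<psi> = regular_distr \<Omega> Fw \<psi> - regular_distr \<Omega> Fv \<psi>"
      unfolding F_def by (rule regular_distr_diff[OF fw fv tf])
    moreover have "(\<Sum>j\<in>UNIV. stress lam \<mu> j (\<lambda>l. regular_distr \<Omega> (G l) (pd j \<psi>))) =
       (\<Sum>j\<in>UNIV. stress lam \<mu> j (\<lambda>l. regular_distr \<Omega> (Gv l) (pd j \<psi>)))
       - (\<Sum>j\<in>UNIV. stress lam \<mu> j (\<lambda>l. regular_distr \<Omega> (Gw l) (pd j \<psi>)))"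
      unfolding G_def[abs_def] regular_distr_diff[OF Gv(1) Gw(1) tf_pd[OF tf]] stress_diff sum_subtractf ..
    moreover have "f + g = 0" if "- a + x = - b + y" "f = b - a" "g = x - y" for a b x y f g :: "complex^3"
    proof -
      have "x = a + (- b + y)" using that(1) by (metis add_minus_cancel)
      then show ?thesis using that(2,3) by simp
    qed
    ultimately show ?thesis by blast
  qed
  have "regular_distr \<Omega> F \<psi> = (\<Sum>j\<in>UNIV. stress lam \<mu> j (\<lambda>l. regular_distr \<Omega> u (pd l (pd j \<psi>))))"
    if tf: "tf K \<psi>" and K: "K \<subseteq> N" for K \<psi>
    using edge_cutoff_extension[OF F G off tf K]
    unfolding Gpd[OF tf_pd[OF tf] K] stress_minus sum_negf by simp
  with G Gpd show ?thesis by (rule that)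
qed

end


section \<open>Horizontal dilations and scaling limits at the edge\<close>

lemma integrable_inverse_1_plus_square: "integrable lborel (\<lambda>x::real. 1 / (1 + x\<^sup>2))"
proof -
  let ?f = "\<lambda>x::real. 1 / (1 + x\<^sup>2)"
  have m: "?f \<in> borel_measurable borel"
    by (intro borel_measurable_continuous_onI continuous_intros) (auto simp: add_nonneg_eq_0_iff)
  have "(\<integral>\<^sup>+x. ennreal (?f x) * indicator {0..} x \<partial>lborel) = ennreal (pi / 2 - arctan 0)"
  proof (rule nn_integral_FTC_atLeast[OF m])
    show "DERIV arctan x :> ?f x" for x
      using DERIV_arctan[of x] by (simp add: divide_inverse)
  qed (auto intro: tendsto_arctan_at_top)
  moreover have "(\<integral>\<^sup>+x. ennreal (indicator {0..} x *\<^sub>R ?f x) \<partial>lborel) = (\<integral>\<^sup>+x. ennreal (?f x) * indicator {0..} x \<partial>lborel)"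
    by (intro nn_integral_cong) (auto simp: indicator_def)
  ultimately have i: "integrable lborel (\<lambda>x. indicator {0..} x *\<^sub>R ?f x)"
    using m by (intro integrableI_nonneg) (auto intro!: borel_measurable_times borel_measurable_indicator)
  then have "integrable lborel (\<lambda>x. indicator {0..} (0 + (- 1) * x) *\<^sub>R ?f (0 + (- 1) * x))"
    by (rule lborel_integrable_real_affine) simp
  with i have "integrable lborel (\<lambda>x. indicator {0..} x *\<^sub>R ?f x + indicator {0..} (- x) *\<^sub>R ?f x)"
    by (intro Bochner_Integration.integrable_add) auto
  then show ?thesis
    by (rule Bochner_Integration.integrable_bound) (use m in \<open>auto simp: indicator_def\<close>)
qed

lemma integrable_lborel_product:
  fixes f :: "'a::euclidean_space \<Rightarrow> real" and g :: "'b::euclidean_space \<Rightarrow> real"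
  assumes f: "integrable lborel f" and g: "integrable lborel g"
  shows "integrable lborel (\<lambda>p. f (fst p) * g (snd p))"
proof -
  have [measurable]: "f \<in> borel_measurable borel" "g \<in> borel_measurable borel" using f g by auto
  have "integrable (lborel \<Otimes>\<^sub>M lborel) (\<lambda>p. f (fst p) * g (snd p))"
  proof (rule lborel_pair.Fubini_integrable)
    show "integrable lborel (\<lambda>x. LINT y|lborel. norm (f (fst (x, y)) * g (snd (x, y))))"
      using integrable_norm[OF f] by (simp add: abs_mult)
    show "AE x in lborel. integrable lborel (\<lambda>y. f (fst (x, y)) * g (snd (x, y)))"
      using g by simp
  qed measurable
  then show ?thesis by (simp add: lborel_prod)
qed

definition cart3 :: "real \<times> real \<times> real \<Rightarrow> real^3" where
  "cart3 p = vector [fst (snd p), snd (snd p), fst p]"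

definition cart3' :: "real^3 \<Rightarrow> real \<times> real \<times> real" where
  "cart3' x = (x$3, x$1, x$2)"

lemma cart3_inverse [simp]: "cart3 (cart3' x) = x" "cart3' (cart3 p) = p"
  by (simp_all add: cart3_def cart3'_def vec_eq_iff forall_3)

lemma cart3_3 [simp]: "cart3 p $ 3 = fst p"
  by (simp add: cart3_def)

lemma linear_cart3: "bounded_linear cart3" "bounded_linear cart3'"
proof -
  show "bounded_linear cart3" unfolding linear_conv_bounded_linear[symmetric]
    by (rule linearI) (simp_all add: cart3_def vec_eq_iff forall_3)
  show "bounded_linear cart3'" unfolding cart3'_def[abs_def]
    by (intro bounded_linear_Pair bounded_linear_vec_nth)
qed

text \<open>Fubini with the vertical variable separated. The point is the order of quantifiers:
  \<open>I\<close> depends on the horizontal factor alone and is the same for every vertical factor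
  m.\<close>

lemma integral_horizontal_times_vertical:
  fixes f :: "real^3 \<Rightarrow> complex"
  assumes f: "\<And>x y. x$1 = y$1 \<Longrightarrow> x$2 = y$2 \<Longrightarrow> f x = f y"
  obtains I where "\<And>m. integrable lborel (\<lambda>x. f x * m (x$3)) \<Longrightarrow>
     (LINT x|lborel. f x * m (x$3)) = I * (LINT t|lborel. m t)"
proof -
  obtain c where c: "c > 0"
    "\<And>g :: real^3 \<Rightarrow> complex. g \<in> borel_measurable borel \<Longrightarrow> (LINT p|lborel. g (cart3 p)) = c *\<^sub>R (LINT x|lborel. g x)"
    "\<And>g :: real^3 \<Rightarrow> complex. g \<in> borel_measurable borel \<Longrightarrow> integrable lborel (\<lambda>p. g (cart3 p)) \<longleftrightarrow> integrable lborel g"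
    using integral_linear_bijection[OF linear_cart3 cart3_inverse, where 'c=complex] by metis
  define k where "k r = f (cart3 (0, r))" for r
  define I where "I = (LINT r|lborel. k r) /\<^sub>R c"
  show ?thesis
  proof (rule that[of I])
    fix m assume i: "integrable lborel (\<lambda>x. f x * m (x$3))"
    then have mm: "(\<lambda>x. f x * m (x$3)) \<in> borel_measurable borel" by auto
    have fe: "f (cart3 (t, r)) = k r" for t r unfolding k_def by (rule f) (simp_all add: cart3_def)
    have ip: "integrable (lborel \<Otimes>\<^sub>M lborel) (\<lambda>p. f (cart3 p) * m (cart3 p $ 3))"
      using c(3)[OF mm] i by (simp add: lborel_prod)
    have "c *\<^sub>R (LINT x|lborel. f x * m (x$3)) = (LINT p|lborel. f (cart3 p) * m (cart3 p $ 3))"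
      by (rule c(2)[OF mm, symmetric])
    also have "\<dots> = (LINT t|lborel. LINT r|lborel. f (cart3 (t, r)) * m (cart3 (t, r) $ 3))"
      using lborel_pair.integral_fst'[OF ip] by (simp add: lborel_prod)
    also have "\<dots> = (LINT t|lborel. (LINT r|lborel. k r) * m t)"
      by (simp add: fe)
    also have "\<dots> = c *\<^sub>R (I * (LINT t|lborel. m t))" using c(1) by (simp add: I_def)
    finally show "(LINT x|lborel. f x * m (x$3)) = I * (LINT t|lborel. m t)" using c(1) by simp
  qed
qed

definition hscale :: "real \<Rightarrow> real^3 \<Rightarrow> real^3" where
  "hscale d x = vector [d * x$1, d * x$2, x$3]"

lemma hscale_nth [simp]: "hscale d x $ 1 = d * x$1" "hscale d x $ 2 = d * x$2" "hscale d x $ 3 = x$3"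
  by (simp_all add: hscale_def)

lemma hscale_hscale [simp]: "hscale d (hscale e x) = hscale (d * e) x"
  by (simp add: vec_eq_iff forall_3)

lemma hscale_1 [simp]: "hscale 1 x = x"
  by (simp add: vec_eq_iff forall_3)

lemma linear_hscale: "bounded_linear (hscale d)"
  unfolding linear_conv_bounded_linear[symmetric]
  by (rule linearI) (simp_all add: vec_eq_iff forall_3 algebra_simps)

lemma hscale_measurable [measurable]: "hscale d \<in> borel_measurable borel"
  by (intro borel_measurable_continuous_onI linear_continuous_on linear_hscale)

lemma integral_hscale:
  fixes f :: "real^3 \<Rightarrow> complex"
  assumes d: "d > 0" and f: "f \<in> borel_measurable borel"
  shows "(LINT x|lborel. f (hscale d x)) = (LINT x|lborel. f x) /\<^sub>R d\<^sup>2"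
proof -
  have inv: "hscale d (hscale (1 / d) x) = x" "hscale (1 / d) (hscale d x) = x" for x
    using d by simp_all
  have One: "(One :: real^3) $ i = 1" for i
    using inner_sum_left_Basis[of "axis i 1 :: real^3" "\<lambda>_. 1"] by (simp add: inner_axis axis_in_Basis_iff)
  let ?u = "vector [1 / d, 1 / d, 1] :: real^3"
  have v: "hscale d -` cbox 0 One = cbox 0 ?u"
    using d One by (auto simp: mem_box_cart forall_3 field_simps zero_le_mult_iff)
  have "0 \<in> cbox 0 ?u" using d by (simp add: mem_box_cart forall_3)
  then have "cbox 0 ?u \<noteq> {}" by blast
  then have "measure lborel (cbox 0 ?u) = (\<Prod>i\<in>UNIV. ?u $ i - 0 $ i)" by (rule content_cbox_cart)
  also have "\<dots> = 1 / d\<^sup>2" unfolding UNIV_3 by (simp add: power2_eq_square)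
  finally have c: "measure lborel (hscale d -` cbox 0 One) = 1 / d\<^sup>2" unfolding v .
  obtain c where "(LINT x|lborel. f (hscale d x)) = c *\<^sub>R (LINT x|lborel. f x)"
     "c = measure lborel (hscale d -` cbox 0 One)"
    using integral_linear_bijection[OF linear_hscale linear_hscale inv, where 'c=complex] f by metis
  then show ?thesis unfolding c by (simp add: divide_inverse)
qed

text \<open>A majorant of (1 + rho)^(-2) on a slab, in product form so that integrability reduces to
  one variable at a time.\<close>

definition dominator :: "real \<Rightarrow> real^3 \<Rightarrow> real" where
  "dominator M x = indicator {-M..M} (x$3) * (1 / (1 + (x$1)\<^sup>2) * (1 / (1 + (x$2)\<^sup>2)))"

lemma dominator_nonneg: "dominator M x \<ge> 0"
  by (auto simp: dominator_def add_nonneg_nonneg)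

lemma integrable_dominator: "integrable lborel (dominator M)"
proof -
  have "integrable lborel (indicator {-M..M} :: real \<Rightarrow> real)"
    by (rule integrable_real_indicator) (auto simp: emeasure_lborel_Icc_eq)
  then have i: "integrable lborel (\<lambda>p :: real \<times> real \<times> real. indicator {-M..M} (fst p) *
      (1 / (1 + (fst (snd p))\<^sup>2) * (1 / (1 + (snd (snd p))\<^sup>2))))"
    using integrable_lborel_product[OF _ integrable_lborel_product[OF integrable_inverse_1_plus_square integrable_inverse_1_plus_square]]
    by blast
  have m: "dominator M \<in> borel_measurable borel"
  proof -
    have c: "(\<lambda>x::real^3. 1 / (1 + (x$1)\<^sup>2) * (1 / (1 + (x$2)\<^sup>2))) \<in> borel_measurable borel"
      by (intro borel_measurable_continuous_onI continuous_intros) (auto simp: add_nonneg_eq_0_iff)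
    have "{x::real^3. x$3 \<in> {-M..M}} = {x. -M \<le> x$3} \<inter> {x. x$3 \<le> M}" by auto
    moreover have "closed ({x::real^3. -M \<le> x$3} \<inter> {x. x$3 \<le> M})"
      by (intro closed_Int closed_Collect_le continuous_intros)
    ultimately have s: "{x::real^3. x$3 \<in> {-M..M}} \<in> sets borel" by simp
    have "dominator M = (\<lambda>x. indicator {x::real^3. x$3 \<in> {-M..M}} x * (1 / (1 + (x$1)\<^sup>2) * (1 / (1 + (x$2)\<^sup>2))))"
      by (auto simp: dominator_def indicator_def)
    then show ?thesis using c s by (auto intro!: borel_measurable_times borel_measurable_indicator)
  qed
  obtain c where "integrable lborel (\<lambda>p. dominator M (cart3 p)) \<longleftrightarrow> integrable lborel (dominator M)"
    using integral_linear_bijection[OF linear_cart3 cart3_inverse, where 'c=real] m by metis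
  moreover have "integrable lborel (\<lambda>p. dominator M (cart3 p))"
    using i by (simp add: dominator_def cart3_def)
  ultimately show ?thesis by simp
qed

context wedge
begin

lemma W_hscale: "d > 0 \<Longrightarrow> hscale d x \<in> W \<longleftrightarrow> x \<in> W"
proof -
  assume d: "d > 0"
  have "A (hscale d x) = d * A x" "B (hscale d x) = d * B x" by (simp_all add: A_def B_def algebra_simps)
  then show ?thesis using d by (simp add: W_def zero_less_mult_iff)
qed

text \<open>Substituting the inverse dilation moves it from the kernel f to H, whose values tend to
  those on the edge. W is invariant under horizontal dilations, and the Jacobian cancels the factor
  (n+1)^2.\<close>

lemma scaling_limit:
  fixes H f :: "real^3 \<Rightarrow> complex"
  assumes Hm: "H \<in> borel_measurable borel" and HC: "\<And>x. norm (H x) \<le> C"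
    and Hl: "\<And>x. x \<in> W \<Longrightarrow> \<bar>x$3\<bar> \<le> M \<Longrightarrow> (\<lambda>n. H (hscale (1 / real (Suc n)) x)) \<longlonglongrightarrow> H0 (x$3)"
    and H0m: "(\<lambda>x::real^3. H0 (x$3)) \<in> borel_measurable borel"
    and fm: "f \<in> borel_measurable borel" and fC: "\<And>x. x \<in> W \<Longrightarrow> norm (f x) \<le> C' * dominator M x"
  shows "(\<lambda>n. (LINT x|lborel. indicator W x *\<^sub>R (H x * f (hscale (real (Suc n)) x))) * complex_of_real ((real (Suc n))\<^sup>2))
     \<longlonglongrightarrow> (LINT x|lborel. indicator W x *\<^sub>R (H0 (x$3) * f x))"
    and "integrable lborel (\<lambda>x. indicator W x *\<^sub>R (H0 (x$3) * f x))"
proof -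
  have C0: "C \<ge> 0" using HC[of 0] norm_ge_zero order_trans by blast
  have i: "integrable lborel (\<lambda>x. C * (C' * dominator M x))"
    using integrable_dominator by simp
  have mm: "(\<lambda>x. indicator W x *\<^sub>R (H0 (x$3) * f x)) \<in> borel_measurable borel"
    by (intro borel_measurable_scaleR borel_measurable_indicator borel_measurable_times H0m fm W_measurable)
  have Hs: "(\<lambda>x. H (hscale t x)) \<in> borel_measurable borel" "(\<lambda>x. f (hscale t x)) \<in> borel_measurable borel" for t
    by (rule measurable_compose[OF hscale_measurable Hm], rule measurable_compose[OF hscale_measurable fm])
  have fz: "f x = 0" if "x \<in> W" "\<not> \<bar>x$3\<bar> \<le> M" for x
  proof -
    have "dominator M x = 0" using that(2) by (auto simp: dominator_def indicator_def)
    then show ?thesis using fC[OF that(1)] by simp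
  qed
  have mm2: "(\<lambda>x. indicator W x *\<^sub>R (H (hscale t x) * f x)) \<in> borel_measurable borel" for t
    by (intro borel_measurable_scaleR borel_measurable_indicator borel_measurable_times Hs fm W_measurable)
  have b: "norm (indicator W x *\<^sub>R (h * f x)) \<le> C * (C' * dominator M x)"
    if "norm h \<le> C \<or> \<bar>x$3\<bar> > M" for h x
  proof (cases "x \<in> W")
    case True
    have "norm (h * f x) \<le> C * (C' * dominator M x)"
    proof (cases "\<bar>x$3\<bar> > M")
      case False
      then show ?thesis unfolding norm_mult using that fC[OF True] C0 by (intro mult_mono) auto
    next
      case o: True
      then have "dominator M x = 0" by (auto simp: dominator_def indicator_def)
      then show ?thesis using fC[OF True] by simp
    qed
    then show ?thesis using True by simp
  next
    case False
    \<comment> \<open>The bound on f is given only inside W. That its right-hand side is nonnegative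
      elsewhere is read off at a wedge point of the same height.\<close>
    have "0 \<le> C' * dominator M x"
    proof (cases "dominator M x = 0")
      case False
      have "\<exists>y\<in>W. True"
      proof -
        have "T (1 / D, 1 / D, 0) \<in> W" using D_neq_0 by (simp add: W_def)
        then show ?thesis by blast
      qed
      then obtain y where y: "y \<in> W" by blast
      have "A (vector [y$1, y$2, x$3]) = A y" "B (vector [y$1, y$2, x$3]) = B y"
        by (simp_all add: A_def B_def)
      then have "vector [y$1, y$2, x$3] \<in> W" using y by (simp add: W_def)
      then have "0 \<le> C' * dominator M (vector [y$1, y$2, x$3])"
        using fC norm_ge_zero order_trans by blast
      moreover have "dominator M (vector [y$1, y$2, x$3]) > 0"
        using False by (auto simp: dominator_def indicator_def add_pos_nonneg split: if_splits)
      ultimately have "C' \<ge> 0" by (simp add: zero_le_mult_iff)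
      then show ?thesis using dominator_nonneg by simp
    qed simp
    then show ?thesis using False C0 by simp
  qed
  have lim: "(\<lambda>n. LINT x|lborel. indicator W x *\<^sub>R (H (hscale (1 / real (Suc n)) x) * f x))
      \<longlonglongrightarrow> (LINT x|lborel. indicator W x *\<^sub>R (H0 (x$3) * f x))"
  proof (rule integral_dominated_convergence[where w="\<lambda>x. C * (C' * dominator M x)"])
    show "(\<lambda>x. indicator W x *\<^sub>R (H0 (x$3) * f x)) \<in> borel_measurable lborel"
      using mm by simp
    show "(\<lambda>x. indicator W x *\<^sub>R (H (hscale (1 / real (Suc n)) x) * f x)) \<in> borel_measurable lborel" for n
      using mm2 by simp
    show "AE x in lborel. norm (indicator W x *\<^sub>R (H (hscale (1 / real (Suc n)) x) * f x)) \<le> C * (C' * dominator M x)" for n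
      using b HC by (intro AE_I2) blast
    show "AE x in lborel. (\<lambda>n. indicator W x *\<^sub>R (H (hscale (1 / real (Suc n)) x) * f x))
        \<longlonglongrightarrow> indicator W x *\<^sub>R (H0 (x$3) * f x)"
    proof (rule AE_I2)
      fix x :: "real^3"
      show "(\<lambda>n. indicator W x *\<^sub>R (H (hscale (1 / real (Suc n)) x) * f x)) \<longlonglongrightarrow> indicator W x *\<^sub>R (H0 (x$3) * f x)"
      proof (cases "x \<in> W \<and> \<bar>x$3\<bar> \<le> M")
        case True
        then show ?thesis by (intro tendsto_intros Hl) auto
      next
        case False
        then have "indicator W x *\<^sub>R (h * f x) = 0" for h
          using fz[of x] by (auto simp: indicator_def)
        then show ?thesis by (simp only: tendsto_const)
      qed
    qed
  qed (rule i)
  have "(LINT x|lborel. indicator W x *\<^sub>R (H x * f (hscale (real (Suc n)) x))) * complex_of_real ((real (Suc n))\<^sup>2)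
      = (LINT x|lborel. indicator W x *\<^sub>R (H (hscale (1 / real (Suc n)) x) * f x))" for n
  proof -
    define k where "k = real (Suc n)"
    have k: "k > 0" by (simp add: k_def)
    let ?g = "\<lambda>x. indicator W x *\<^sub>R (H x * f (hscale k x))"
    have "(LINT x|lborel. ?g x) * complex_of_real (k\<^sup>2) = (LINT x|lborel. ?g x) /\<^sub>R (1 / k)\<^sup>2"
      using k by (simp only: scaleR_conv_of_real power_divide power_one inverse_divide div_by_1 mult.commute)
    also have "\<dots> = (LINT x|lborel. ?g (hscale (1 / k) x))"
      using k by (intro integral_hscale[symmetric] borel_measurable_scaleR borel_measurable_indicator
          borel_measurable_times Hs Hm W_measurable) simp
    also have "\<dots> = (LINT x|lborel. indicator W x *\<^sub>R (H (hscale (1 / k) x) * f x))"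
      using W_hscale[of "1 / k"] k by (intro Bochner_Integration.integral_cong) (auto simp: indicator_def)
    finally show ?thesis by (simp only: k_def)
  qed
  with lim show "(\<lambda>n. (LINT x|lborel. indicator W x *\<^sub>R (H x * f (hscale (real (Suc n)) x))) * complex_of_real ((real (Suc n))\<^sup>2))
     \<longlonglongrightarrow> (LINT x|lborel. indicator W x *\<^sub>R (H0 (x$3) * f x))" by simp
  show "integrable lborel (\<lambda>x. indicator W x *\<^sub>R (H0 (x$3) * f x))"
  proof (rule Bochner_Integration.integrable_bound[OF i])
    show "(\<lambda>x. indicator W x *\<^sub>R (H0 (x$3) * f x)) \<in> borel_measurable lborel"
      using mm by simp
    show "AE x in lborel. norm (indicator W x *\<^sub>R (H0 (x$3) * f x)) \<le> norm (C * (C' * dominator M x))"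
    proof (rule AE_I2)
      fix x :: "real^3"
      have "norm (indicator W x *\<^sub>R (H0 (x$3) * f x)) \<le> C * (C' * dominator M x)"
      proof (cases "x \<in> W \<and> \<bar>x$3\<bar> \<le> M")
        case True
        then have "norm (H0 (x$3)) \<le> C"
          using LIMSEQ_le_const2[OF tendsto_norm[OF Hl[of x]], of C] HC by blast
        then show ?thesis using b by blast
      next
        case False
        then have "indicator W x *\<^sub>R (H0 (x$3) * f x) = 0"
          using fz[of x] by (auto simp: indicator_def)
        moreover have "0 \<le> C * (C' * dominator M x)" using b[of 0 x] C0 by simp
        ultimately show ?thesis by (simp only: norm_zero)
      qed
      then show "norm (indicator W x *\<^sub>R (H0 (x$3) * f x)) \<le> norm (C * (C' * dominator M x))" by simp
    qed
  qed
qed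

text \<open>Integrating along both faces leaves only the values on the edge.\<close>

lemma edge_formula:
  fixes \<psi> :: "real^3 \<Rightarrow> 'b::euclidean_space"
  assumes tf: "tf K \<psi>"
  defines "d \<equiv> \<lambda>v \<psi> x. \<Sum>i\<in>UNIV. v $ i *\<^sub>R pd i (\<psi> :: real^3 \<Rightarrow> 'b) x"
  shows "(LINT x|lborel. indicator W x *\<^sub>R d (T (1, 0, 0)) (d (T (0, 1, 0)) \<psi>) x)
    = (sgn D / J) *\<^sub>R (LINT c|lborel. \<psi> (T (0, 0, c)))"
proof -
  let ?e = "T (0, 1, 0)"
  have sm: "smooth \<psi>" and K: "compact K" and z: "\<And>x. x \<notin> K \<Longrightarrow> \<psi> x = 0" using tf by (auto simp: tf_def)
  have tfd: "tf K (d ?e \<psi>)"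
  proof -
    have "smooth (d ?e \<psi>)" unfolding d_def sum_3 by (intro smooth_add smooth_scaleR smooth_const smooth_pd sm)
    moreover have "d ?e \<psi> x = 0" if "x \<notin> K" for x using tf_pd[OF tf] that by (simp add: d_def tf_def)
    ultimately show ?thesis using K by (simp add: tf_def)
  qed
  have dc: "continuous_on UNIV (d ?e \<psi>)" using tfd by (intro smooth_continuous) (simp add: tf_def)
  have dd: "(\<psi> has_derivative (\<lambda>v. d v \<psi> x)) (at x)" for x
    unfolding d_def by (rule has_derivative_pd[OF smooth_differentiable[OF sm]])
  have vd: "((\<lambda>b. \<psi> (chart\<^sub>1 (b, c))) has_vector_derivative d ?e \<psi> (chart\<^sub>1 (b, c))) (at b)" for b c
  proof -
    have "((\<lambda>b. T ((0, 0, c) + b *\<^sub>R (0, 1, 0))) has_derivative (\<lambda>h. T (h *\<^sub>R (0, 1, 0)))) (at b)"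
      by (rule bounded_linear.has_derivative[OF linear_T]) (auto intro!: derivative_eq_intros)
    moreover have "(0, 0, c) + b *\<^sub>R (0, 1, 0) = (0 :: real, b :: real, c :: real)" for b by simp
    ultimately have "((\<lambda>b. T (0, b, c)) has_derivative (\<lambda>h. T (h *\<^sub>R (0, 1, 0)))) (at b)"
      by (simp only:)
    then have "((\<lambda>b. \<psi> (T (0, b, c))) has_derivative (\<lambda>h. d (T (h *\<^sub>R (0, 1, 0))) \<psi> (T (0, b, c)))) (at b)"
      by (rule has_derivative_compose[OF _ dd])
    moreover have "d (T (h *\<^sub>R (0, 1, 0))) \<psi> x = h *\<^sub>R d ?e \<psi> x" for h x
    proof -
      have "T (h *\<^sub>R (0, 1, 0)) = h *\<^sub>R ?e" by (rule linear_cmul[OF bounded_linear.linear[OF linear_T]])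
      then show ?thesis by (simp only: d_def vector_scaleR_component scaleR_sum_right scaleR_scaleR real_scaleR_def)
    qed
    ultimately show ?thesis unfolding has_vector_derivative_def chart\<^sub>1_def by (simp only:)
  qed
  define K' where "K' = (\<lambda>x. snd (T' x)) ` K"
  have K': "compact K'"
    unfolding K'_def by (rule compact_continuous_image[OF continuous_on_snd[OF linear_continuous_on[OF linear_T']] K])
  have z': "\<psi> (chart\<^sub>1 p) = 0" "d ?e \<psi> (chart\<^sub>1 p) = 0" if "p \<notin> K'" for p
  proof -
    have "chart\<^sub>1 p \<notin> K"
    proof
      assume "chart\<^sub>1 p \<in> K"
      then have "snd (T' (chart\<^sub>1 p)) \<in> K'" unfolding K'_def by blast
      then show False using that by (simp add: chart\<^sub>1_def)
    qed
    then show "\<psi> (chart\<^sub>1 p) = 0" "d ?e \<psi> (chart\<^sub>1 p) = 0" using z tfd by (auto simp: tf_def)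
  qed
  have cc: "continuous_on UNIV chart\<^sub>1" using charts_isometric(1) by (auto simp: continuous_on_iff)
  have c1: "continuous_on UNIV (\<lambda>p. \<psi> (chart\<^sub>1 p))" "continuous_on UNIV (\<lambda>p. d ?e \<psi> (chart\<^sub>1 p))"
    using continuous_on_compose2[OF smooth_continuous[OF sm, of UNIV] cc] continuous_on_compose2[OF dc cc] by auto
  have "(LINT x|lborel. indicator W x *\<^sub>R d (T (1, 0, 0)) (d ?e \<psi>) x) = (- sgn D / J) *\<^sub>R face_integral chart\<^sub>1 (d ?e \<psi>)"
    unfolding d_def by (rule integral_W_directional(1)[OF tfd[unfolded d_def]])
  also have "face_integral chart\<^sub>1 (d ?e \<psi>) = - (LINT c|lborel. \<psi> (T (0, 0, c)))"
    using integral_halfspace_FTC(1)[OF vd c1 K' z', of UNIV]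
    by (simp add: face_integral_def chart\<^sub>1_def)
  finally show ?thesis by simp
qed

end


section \<open>Bumps along the edge and limits of dilated kernels\<close>

definition ept :: "real \<Rightarrow> real^3" where "ept t = vector [0, 0, t]"

lemma ept_nth [simp]: "ept t $ 1 = 0" "ept t $ 2 = 0" "ept t $ 3 = t"
  by (simp_all add: ept_def)

lemma continuous_ept: "continuous_on S ept"
proof -
  have "bounded_linear ept"
    unfolding linear_conv_bounded_linear[symmetric]
    by (rule linearI) (simp_all add: vec_eq_iff forall_3)
  then show ?thesis by (rule linear_continuous_on)
qed

definition plateau :: "real \<Rightarrow> real \<Rightarrow> real" where
  "plateau \<tau> s = sstep ((- 1 / \<tau>\<^sup>2) * s + 2)"

lemma plateau_range: "0 \<le> plateau \<tau> s" "plateau \<tau> s \<le> 1"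
  by (simp_all only: plateau_def sstep_range)

lemma plateau_1: "\<tau> > 0 \<Longrightarrow> s \<le> \<tau>\<^sup>2 \<Longrightarrow> plateau \<tau> s = 1"
  unfolding plateau_def by (intro sstep_1) (simp add: divide_le_eq)

lemma plateau_0: "\<tau> > 0 \<Longrightarrow> s \<ge> 2 * \<tau>\<^sup>2 \<Longrightarrow> plateau \<tau> s = 0"
  unfolding plateau_def by (intro sstep_0) (simp add: le_divide_eq)

lemma smooth_plateau: "smooth \<phi> \<Longrightarrow> smooth (\<lambda>x. plateau \<tau> (\<phi> x))"
  unfolding plateau_def by (rule smooth_affine_compose[OF C1k_sstep])

definition vbump :: "real \<Rightarrow> real \<Rightarrow> real \<Rightarrow> real" where
  "vbump \<tau> t0 t = plateau \<tau> ((t + (- t0)) * (t + (- t0)))"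

lemma continuous_vbump: "continuous_on S (vbump \<tau> t0)"
proof -
  have "continuous_on UNIV sstep" using C1k_sstep[of 0] by simp
  then have "continuous_on S (\<lambda>t. sstep (c * ((t + (- t0)) * (t + (- t0))) + 2))" for c
    by (rule continuous_on_compose2) (auto intro!: continuous_intros)
  then show ?thesis unfolding vbump_def plateau_def .
qed

lemma vbump_0: "\<tau> > 0 \<Longrightarrow> \<bar>t - t0\<bar> \<ge> 2 * \<tau> \<Longrightarrow> vbump \<tau> t0 t = 0"
proof -
  assume a: "\<tau> > 0" "\<bar>t - t0\<bar> \<ge> 2 * \<tau>"
  then have "(2 * \<tau>)\<^sup>2 \<le> \<bar>t - t0\<bar>\<^sup>2" by (intro power_mono) auto
  then have "4 * \<tau>\<^sup>2 \<le> (t + (- t0)) * (t + (- t0))" by (simp add: power2_eq_square)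
  then show ?thesis unfolding vbump_def using a by (intro plateau_0) (auto simp: order_trans[rotated])
qed

lemma vbump_1: "\<tau> > 0 \<Longrightarrow> \<bar>t - t0\<bar> \<le> \<tau> \<Longrightarrow> vbump \<tau> t0 t = 1"
proof -
  assume a: "\<tau> > 0" "\<bar>t - t0\<bar> \<le> \<tau>"
  then have "\<bar>t - t0\<bar>\<^sup>2 \<le> \<tau>\<^sup>2" by (intro power_mono) auto
  then show ?thesis unfolding vbump_def using a by (intro plateau_1) (simp_all add: power2_eq_square)
qed

lemma integral_vbump_pos: "\<tau> > 0 \<Longrightarrow> (LINT t|lborel. vbump \<tau> t0 t) > 0"
proof -
  assume \<tau>: "\<tau> > 0"
  have "0 < measure lborel {t0 - \<tau>..t0 + \<tau>}" using \<tau> by simp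
  also have "\<dots> = (LINT t|lborel. indicator {t0 - \<tau>..t0 + \<tau>} t)" by simp
  also have "\<dots> \<le> (LINT t|lborel. vbump \<tau> t0 t)"
  proof (rule integral_mono)
    show "integrable lborel (indicator {t0 - \<tau>..t0 + \<tau>} :: real \<Rightarrow> real)"
      by (rule integrable_real_indicator) (auto simp: emeasure_lborel_Icc_eq)
    show "integrable lborel (vbump \<tau> t0)"
      using integrable_lborel_continuous_compact_support[OF continuous_vbump, of "{t0 - 2*\<tau>..t0 + 2*\<tau>}" \<tau> t0 UNIV]
        vbump_0[OF \<tau>] by (force simp: abs_le_iff)
    show "indicator {t0 - \<tau>..t0 + \<tau>} t \<le> vbump \<tau> t0 t" for t
      using vbump_1[OF \<tau>, of t t0] plateau_range(1)[of \<tau>]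
      by (auto simp: indicator_def vbump_def abs_le_iff)
  qed
  finally show ?thesis .
qed

text \<open>A continuous function is determined by its moments against bumps. Multiplied by the
  conjugate of its value at t0, a nonzero f has real part bounded below near t0, and the moment
  against a narrow bump is positive.\<close>

lemma vbump_moments_zero:
  fixes f :: "real \<Rightarrow> complex"
  assumes c: "continuous_on {-M<..<M} f" and t0: "\<bar>t0\<bar> < M"
    and z: "\<And>\<tau>. \<tau> > 0 \<Longrightarrow> \<bar>t0\<bar> + 2 * \<tau> < M \<Longrightarrow>
      (LINT t|lborel. indicator {-M<..<M} t *\<^sub>R (complex_of_real (vbump \<tau> t0 t) * f t)) = 0"
  shows "f t0 = 0"
proof (rule ccontr)
  assume f0: "f t0 \<noteq> 0"
  define g where "g t = Re (cnj (f t0) * f t)" for t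
  have g0: "g t0 > 0"
  proof -
    have "g t0 = (cmod (f t0))\<^sup>2" by (simp add: g_def cmod_power2 flip: power2_eq_square)
    then show ?thesis using f0 by simp
  qed
  have cg: "continuous_on {-M<..<M} g" unfolding g_def by (intro continuous_intros c)
  have "t0 \<in> {-M<..<M}" using t0 by auto
  then have "isCont g t0" using cg continuous_on_eq_continuous_at[of "{-M<..<M}" g] by auto
  then obtain e where e: "e > 0" "\<And>t. \<bar>t - t0\<bar> < e \<Longrightarrow> \<bar>g t - g t0\<bar> < g t0 / 2"
    unfolding continuous_at_eps_delta using g0 by (metis dist_real_def half_gt_zero)
  \<comment> \<open>Small enough that the bump lives both where g exceeds half of its value at t0
    and inside the open interval.\<close>
  define \<tau> where "\<tau> = min (e / 2) ((M - \<bar>t0\<bar>) / 4)"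
  have \<tau>: "\<tau> > 0" "2 * \<tau> \<le> e" "\<bar>t0\<bar> + 2 * \<tau> < M" using e t0 by (auto simp: \<tau>_def min_def field_simps)
  have inM: "\<bar>t - t0\<bar> < 2 * \<tau> \<Longrightarrow> t \<in> {-M<..<M}" for t using \<tau> by auto
  let ?I = "{t0 - 2*\<tau>..t0 + 2*\<tau>}"
  have int: "integrable lborel (\<lambda>t. indicator {-M<..<M} t *\<^sub>R (complex_of_real (vbump \<tau> t0 t) * f t))"
  proof -
    have cI: "continuous_on ?I (\<lambda>t. complex_of_real (vbump \<tau> t0 t) * f t)"
      using \<tau> by (intro continuous_intros continuous_vbump continuous_on_subset[OF c]) auto
    have "set_integrable lborel ?I (\<lambda>t. complex_of_real (vbump \<tau> t0 t) * f t)"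
      by (rule borel_integrable_compact[OF _ cI, folded set_integrable_def]) simp
    moreover have "(\<lambda>t. indicator {-M<..<M} t *\<^sub>R (complex_of_real (vbump \<tau> t0 t) * f t)) =
      (\<lambda>t. indicator ?I t *\<^sub>R (complex_of_real (vbump \<tau> t0 t) * f t))"
    proof
      fix t
      show "indicator {-M<..<M} t *\<^sub>R (complex_of_real (vbump \<tau> t0 t) * f t) =
        indicator ?I t *\<^sub>R (complex_of_real (vbump \<tau> t0 t) * f t)"
        using inM[of t] vbump_0[OF \<tau>(1), of t t0] \<tau> by (cases "\<bar>t - t0\<bar> < 2 * \<tau>") (auto simp: indicator_def)
    qed
    ultimately show ?thesis by (simp add: set_integrable_def)
  qed
  have "0 = Re (cnj (f t0) * (LINT t|lborel. indicator {-M<..<M} t *\<^sub>R (complex_of_real (vbump \<tau> t0 t) * f t)))"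
    using z[OF \<tau>(1,3)] by simp
  also have "\<dots> = (LINT t|lborel. Re (cnj (f t0) * (indicator {-M<..<M} t *\<^sub>R (complex_of_real (vbump \<tau> t0 t) * f t))))"
    using integral_Re[OF integrable_mult_right[OF int, of "cnj (f t0)"]]
    by (simp only: integral_mult_right_zero)
  also have "\<dots> = (LINT t|lborel. indicator {-M<..<M} t * (vbump \<tau> t0 t * g t))"
    by (intro Bochner_Integration.integral_cong) (auto simp: g_def indicator_def algebra_simps)
  also have "\<dots> \<ge> (LINT t|lborel. (g t0 / 2) * vbump \<tau> t0 t)"
  proof (rule integral_mono)
    show "integrable lborel (\<lambda>t. (g t0 / 2) * vbump \<tau> t0 t)"
      using integral_vbump_pos[OF \<tau>(1), of t0] not_integrable_integral_eq by fastforce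
    have "(\<lambda>t. Re (cnj (f t0) * (indicator {-M<..<M} t *\<^sub>R (complex_of_real (vbump \<tau> t0 t) * f t)))) =
        (\<lambda>t. indicator {-M<..<M} t * (vbump \<tau> t0 t * g t))"
      by (auto simp: g_def indicator_def algebra_simps fun_eq_iff)
    then show "integrable lborel (\<lambda>t. indicator {-M<..<M} t * (vbump \<tau> t0 t * g t))"
      using integrable_Re[OF integrable_mult_right[OF int, of "cnj (f t0)"]] by (simp only:)
    fix t
    show "(g t0 / 2) * vbump \<tau> t0 t \<le> indicator {-M<..<M} t * (vbump \<tau> t0 t * g t)"
    proof (cases "\<bar>t - t0\<bar> < 2 * \<tau>")
      case True
      then have "g t \<ge> g t0 / 2" using e(2)[of t] \<tau>(2) by (simp add: abs_if split: if_splits)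
      then have "(g t0 / 2) * vbump \<tau> t0 t \<le> g t * vbump \<tau> t0 t"
        by (intro mult_right_mono) (simp_all add: vbump_def plateau_range)
      then show ?thesis using inM[OF True] by (simp add: mult.commute)
    qed (simp add: vbump_0[OF \<tau>(1)])
  qed
  finally have "(g t0 / 2) * (LINT t|lborel. vbump \<tau> t0 t) \<le> 0" by simp
  then show False using integral_vbump_pos[OF \<tau>(1), of t0] g0 by (simp add: mult_le_0_iff)
qed

definition hbump :: "real \<Rightarrow> real^3 \<Rightarrow> real" where
  "hbump \<sigma> x = plateau \<sigma> (rho x)"

definition bump :: "real \<Rightarrow> real \<Rightarrow> real \<Rightarrow> real^3 \<Rightarrow> real" where
  "bump \<sigma> \<tau> t0 x = vbump \<tau> t0 (x$3) * hbump \<sigma> x"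

lemma smooth_vbump: "smooth (\<lambda>x::real^3. vbump \<tau> t0 (x$3))"
  unfolding vbump_def by (intro smooth_plateau smooth_mult smooth_add smooth_coord smooth_const)

lemma smooth_hbump: "smooth (hbump \<sigma>)"
  unfolding hbump_def[abs_def] by (intro smooth_plateau smooth_rho)

lemma bump_ept: "\<sigma> > 0 \<Longrightarrow> bump \<sigma> \<tau> t0 (ept t) = vbump \<tau> t0 t"
  by (simp add: bump_def hbump_def plateau_1 rho_def)

context wedge_domain
begin

lemma tf_bump:
  assumes "\<sigma> > 0" "\<tau> > 0" "2 * \<sigma> < h" "\<bar>t0\<bar> + 2 * \<tau> < M"
  shows "tf {x. rho x \<le> 2 * \<sigma>\<^sup>2 \<and> \<bar>x$3 - t0\<bar> \<le> 2 * \<tau>} (bump \<sigma> \<tau> t0)"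
    and "{x. rho x \<le> 2 * \<sigma>\<^sup>2 \<and> \<bar>x$3 - t0\<bar> \<le> 2 * \<tau>} \<subseteq> N"
proof -
  let ?K = "{x. rho x \<le> 2 * \<sigma>\<^sup>2 \<and> \<bar>x$3 - t0\<bar> \<le> 2 * \<tau>}"
  have rh: "rho x < h\<^sup>2" if "rho x \<le> 2 * \<sigma>\<^sup>2" for x
  proof -
    have "2 * \<sigma>\<^sup>2 < (2 * \<sigma>)\<^sup>2" using assms by (simp add: power2_eq_square)
    also have "\<dots> < h\<^sup>2" using assms by (intro power_strict_mono) auto
    finally show ?thesis using that by simp
  qed
  show KN: "?K \<subseteq> N"
  proof
    fix x assume "x \<in> ?K"
    then have x: "rho x \<le> 2 * \<sigma>\<^sup>2" "\<bar>x$3 - t0\<bar> \<le> 2 * \<tau>" by auto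
    have "(norm (horiz x))\<^sup>2 < h\<^sup>2" using rh[OF x(1)] by (simp only: rho_horiz)
    then have "norm (horiz x) < h" by (rule power2_less_imp_less) (use h in linarith)
    moreover have "\<bar>x$3\<bar> < M" using x(2) assms(4) by linarith
    ultimately show "x \<in> N" by (simp add: N_iff)
  qed
  have "closed ?K"
    by (intro closed_Collect_conj closed_Collect_le smooth_continuous[OF smooth_rho] continuous_intros)
  moreover have "bounded ?K"
  proof -
    have "norm x \<le> h + h + M" if "x \<in> N" for x
    proof -
      have "norm x \<le> \<bar>x$1\<bar> + \<bar>x$2\<bar> + \<bar>x$3\<bar>" using norm_le_l1_cart[of x] by (simp add: sum_3)
      moreover have "\<bar>x$1\<bar> \<le> norm (horiz x)" "\<bar>x$2\<bar> \<le> norm (horiz x)"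
        using component_le_norm_cart[of "horiz x" 1] component_le_norm_cart[of "horiz x" 2] by simp_all
      ultimately show ?thesis using that by (simp add: N_iff)
    qed
    then show ?thesis using KN unfolding bounded_iff by blast
  qed
  ultimately have "compact ?K" by (simp add: compact_eq_bounded_closed)
  moreover have "bump \<sigma> \<tau> t0 x = 0" if "x \<notin> ?K" for x
    using that assms by (auto simp: bump_def hbump_def vbump_0 plateau_0 not_le less_imp_le)
  moreover have "smooth (bump \<sigma> \<tau> t0)" unfolding bump_def[abs_def] by (intro smooth_mult smooth_vbump smooth_hbump)
  ultimately show "tf ?K (bump \<sigma> \<tau> t0)" by (simp add: tf_def)
qed

text \<open>What the scaling limit asks of a field: continuity on \<open>W \<inter> N\<close> for
  measurability, boundedness for the majorant, convergence along horizontal contractions for the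
  pointwise limit, and continuity along the edge so that moments determine the edge values.\<close>

definition edge_regular :: "(real^3 \<Rightarrow> complex) \<Rightarrow> bool" where
  "edge_regular f \<longleftrightarrow> continuous_on (W \<inter> N) f \<and> bounded (f ` (W \<inter> N)) \<and>
     continuous_on {-M<..<M} (\<lambda>t. f (ept t)) \<and>
     (\<forall>x\<in>W. \<bar>x$3\<bar> < M \<longrightarrow> (\<lambda>n. f (hscale (1 / real (Suc n)) x)) \<longlonglongrightarrow> f (ept (x$3)))"

lemma hscale_tendsto: "(\<lambda>n. hscale (1 / real (Suc n)) x) \<longlonglongrightarrow> ept (x$3)"
proof (rule vec_tendstoI)
  fix i :: 3
  have "(\<lambda>n. (1 / real (Suc n)) * y) \<longlonglongrightarrow> 0 * y" for y :: real
    by (intro tendsto_intros LIMSEQ_Suc lim_1_over_n)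
  then show "(\<lambda>n. hscale (1 / real (Suc n)) x $ i) \<longlonglongrightarrow> ept (x$3) $ i"
    using exhaust_3[of i] by auto
qed

lemma eventually_hscale_N: "\<bar>x$3\<bar> < M \<Longrightarrow> eventually (\<lambda>n. hscale (1 / real (Suc n)) x \<in> N) sequentially"
proof -
  assume x: "\<bar>x$3\<bar> < M"
  have "horiz (ept (x$3)) = 0" by (simp add: vec_eq_iff forall_2)
  then have "ept (x$3) \<in> N" using x h by (simp add: N_iff)
  then show ?thesis using topological_tendstoD[OF hscale_tendsto open_N] by blast
qed

text \<open>Extension by 0, so that a field regular only in the wedge near the edge becomes Borel
  measurable on the whole space; \<open>trace0\<close> does the same for the edge values.\<close>

definition hat :: "(real^3 \<Rightarrow> complex) \<Rightarrow> real^3 \<Rightarrow> complex" where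
  "hat f x = indicator (W \<inter> N) x *\<^sub>R f x"

definition trace0 :: "(real^3 \<Rightarrow> complex) \<Rightarrow> real \<Rightarrow> complex" where
  "trace0 f t = indicator {-M<..<M} t *\<^sub>R f (ept t)"

lemma trace0_measurable: "edge_regular f \<Longrightarrow> trace0 f \<in> borel_measurable borel"
  unfolding trace0_def[abs_def] edge_regular_def
  by (intro borel_measurable_continuous_on_indicator) auto

lemma hat_measurable: "edge_regular f \<Longrightarrow> hat f \<in> borel_measurable borel"
  unfolding hat_def[abs_def] edge_regular_def using open_W open_N
  by (intro borel_measurable_continuous_on_indicator) auto

text \<open>The kernel \<open>\<phi>\<close> decays horizontally but not vertically, so it is first
  cut off outside |x$3| < M. The factor P vanishes there, hence the integrals do not change.\<close>

lemma scaled_limit: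
  assumes f: "edge_regular f" and P: "continuous_on UNIV P" "compact K" "K \<subseteq> N" "\<And>x. x \<notin> K \<Longrightarrow> P x = 0"
    and fm: "\<phi> \<in> borel_measurable borel"
    and fC: "\<And>x. x \<in> W \<Longrightarrow> norm (\<phi> x) \<le> C' * (1 / (1 + (x$1)\<^sup>2) * (1 / (1 + (x$2)\<^sup>2)))"
  shows "(\<lambda>n. (LINT x|lborel. indicator W x *\<^sub>R (hat f x * P x * \<phi> (hscale (real (Suc n)) x))) * complex_of_real ((real (Suc n))\<^sup>2))
     \<longlonglongrightarrow> (LINT x|lborel. (indicator W x *\<^sub>R \<phi> x) * (trace0 f (x$3) * P (ept (x$3))))"
    and "integrable lborel (\<lambda>x. (indicator W x *\<^sub>R \<phi> x) * (trace0 f (x$3) * P (ept (x$3))))"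
proof -
  define \<phi>' where "\<phi>' x = indicator {x::real^3. \<bar>x$3\<bar> < M} x *\<^sub>R \<phi> x" for x
  define H0 where "H0 t = trace0 f t * P (ept t)" for t
  obtain C1 where C1: "\<And>x. x \<in> W \<inter> N \<Longrightarrow> norm (f x) \<le> C1"
    using f unfolding edge_regular_def bounded_iff by blast
  have "compact (P ` K)" using P by (intro compact_continuous_image) (auto intro: continuous_on_subset)
  then obtain C2 where C2: "\<And>x. x \<in> K \<Longrightarrow> norm (P x) \<le> C2"
    using compact_imp_bounded[of "P ` K"] unfolding bounded_iff by blast
  have Hb: "norm (hat f x * P x) \<le> max C1 0 * max C2 0" for x
  proof -
    have "norm (hat f x) \<le> max C1 0" using C1[of x] by (cases "x \<in> W \<inter> N") (auto simp: hat_def)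
    moreover have "norm (P x) \<le> max C2 0" using C2[of x] P(4)[of x] by (cases "x \<in> K") auto
    ultimately show ?thesis unfolding norm_mult by (intro mult_mono) auto
  qed
  have Pm: "P \<in> borel_measurable borel" using P(1) by (rule borel_measurable_continuous_onI)
  have sl: "{x::real^3. \<bar>x$3\<bar> < M} \<in> sets borel"
    by (intro borel_open open_Collect_less continuous_intros)
  have c3: "(\<lambda>x::real^3. x$3) \<in> borel_measurable borel"
    by (intro borel_measurable_continuous_onI continuous_intros)
  have H0m: "(\<lambda>x::real^3. H0 (x$3)) \<in> borel_measurable borel"
  proof -
    have "H0 \<in> borel_measurable borel"
      unfolding H0_def
      by (intro borel_measurable_times trace0_measurable[OF f] borel_measurable_continuous_onI
          continuous_on_compose2[OF P(1) continuous_ept]) auto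
    then show ?thesis by (rule measurable_compose[OF c3])
  qed
  have lim: "(\<lambda>n. hat f (hscale (1 / real (Suc n)) x) * P (hscale (1 / real (Suc n)) x)) \<longlonglongrightarrow> H0 (x$3)"
    if x: "x \<in> W" "\<bar>x$3\<bar> \<le> M" for x
  proof (cases "\<bar>x$3\<bar> < M")
    case True
    have "eventually (\<lambda>n. f (hscale (1 / real (Suc n)) x) = hat f (hscale (1 / real (Suc n)) x)) sequentially"
      using eventually_hscale_N[OF True]
      by eventually_elim (use x W_hscale in \<open>simp add: hat_def\<close>)
    moreover have "(\<lambda>n. f (hscale (1 / real (Suc n)) x)) \<longlonglongrightarrow> trace0 f (x$3)"
      using f x True unfolding edge_regular_def trace0_def by (auto simp: abs_less_iff indicator_def)
    ultimately have "(\<lambda>n. hat f (hscale (1 / real (Suc n)) x)) \<longlonglongrightarrow> trace0 f (x$3)"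
      by (rule Lim_transform_eventually[rotated])
    moreover have "(\<lambda>n. P (hscale (1 / real (Suc n)) x)) \<longlonglongrightarrow> P (ept (x$3))"
      by (rule continuous_on_tendsto_compose[OF P(1) hscale_tendsto]) auto
    ultimately show ?thesis unfolding H0_def by (intro tendsto_mult)
  next
    case False
    then have "hscale d x \<notin> N" for d by (simp add: N_iff)
    then have "P (hscale d x) = 0" for d using P(3,4) by blast
    moreover have "H0 (x$3) = 0" using False by (auto simp: H0_def trace0_def indicator_def)
    ultimately show ?thesis by simp
  qed
  have \<phi>'C: "norm (\<phi>' x) \<le> C' * dominator M x" if "x \<in> W" for x
    using fC[OF that] order_trans[OF norm_ge_zero fC[OF that]] by (auto simp: \<phi>'_def dominator_def indicator_def)
  have \<phi>'m: "\<phi>' \<in> borel_measurable borel"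
    unfolding \<phi>'_def using fm sl by (intro borel_measurable_scaleR borel_measurable_indicator)
  note SL = scaling_limit[where H="\<lambda>x. hat f x * P x" and f="\<phi>'" and ?H0.0=H0,
      OF borel_measurable_times[OF hat_measurable[OF f] Pm] Hb lim H0m \<phi>'m \<phi>'C]
  have e1: "hat f x * P x * \<phi>' (hscale k x) = hat f x * P x * \<phi> (hscale k x)" for k x
    using P(3) P(4)[of x] by (cases "x \<in> K") (auto simp: \<phi>'_def N_iff subset_iff indicator_def)
  have e2: "indicator W x *\<^sub>R (H0 (x$3) * \<phi>' x) = (indicator W x *\<^sub>R \<phi> x) * (trace0 f (x$3) * P (ept (x$3)))" for x
    by (auto simp: H0_def \<phi>'_def trace0_def indicator_def abs_less_iff)
  show "(\<lambda>n. (LINT x|lborel. indicator W x *\<^sub>R (hat f x * P x * \<phi> (hscale (real (Suc n)) x))) * complex_of_real ((real (Suc n))\<^sup>2))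
     \<longlonglongrightarrow> (LINT x|lborel. (indicator W x *\<^sub>R \<phi> x) * (trace0 f (x$3) * P (ept (x$3))))"
    using SL(1) unfolding e1 e2 .
  show "integrable lborel (\<lambda>x. (indicator W x *\<^sub>R \<phi> x) * (trace0 f (x$3) * P (ept (x$3))))"
    using SL(2) unfolding e2 .
qed

text \<open>For a kernel independent of the height the limit factors into a constant and an integral
  over the edge. The same constant serves for all f and P, so it can be examined with f = 1.\<close>

lemma horizontal_constant:
  assumes fm: "\<phi> \<in> borel_measurable borel"
    and fC: "\<And>x. x \<in> W \<Longrightarrow> norm (\<phi> x) \<le> C' * (1 / (1 + (x$1)\<^sup>2) * (1 / (1 + (x$2)\<^sup>2)))"
    and hz: "\<And>x y. x$1 = y$1 \<Longrightarrow> x$2 = y$2 \<Longrightarrow> \<phi> x = \<phi> y"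
  obtains I where "\<And>f P K. edge_regular f \<Longrightarrow> continuous_on UNIV P \<Longrightarrow> compact K \<Longrightarrow> K \<subseteq> N \<Longrightarrow> (\<And>x. x \<notin> K \<Longrightarrow> P x = 0) \<Longrightarrow>
    (\<lambda>n. (LINT x|lborel. indicator W x *\<^sub>R (hat f x * P x * \<phi> (hscale (real (Suc n)) x))) * complex_of_real ((real (Suc n))\<^sup>2))
     \<longlonglongrightarrow> I * (LINT t|lborel. trace0 f t * P (ept t))"
proof -
  have "indicator W x *\<^sub>R \<phi> x = indicator W y *\<^sub>R \<phi> y" if "x$1 = y$1" "x$2 = y$2" for x y
  proof -
    have "x \<in> W \<longleftrightarrow> y \<in> W" using that by (simp add: W_def A_def B_def)
    then show ?thesis using hz[OF that] by (simp add: indicator_def)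
  qed
  then obtain I where I: "\<And>m. integrable lborel (\<lambda>x. (indicator W x *\<^sub>R \<phi> x) * m (x$3)) \<Longrightarrow>
     (LINT x|lborel. (indicator W x *\<^sub>R \<phi> x) * m (x$3)) = I * (LINT t|lborel. m t)"
    using integral_horizontal_times_vertical[of "\<lambda>x. indicator W x *\<^sub>R \<phi> x"] by blast
  show ?thesis
  proof (rule that[of I])
    fix f P :: "real^3 \<Rightarrow> complex" and K assume a: "edge_regular f" "continuous_on UNIV P" "compact K" "K \<subseteq> N" "\<And>x. x \<notin> K \<Longrightarrow> P x = 0"
    note S = scaled_limit[OF a fm fC]
    show "(\<lambda>n. (LINT x|lborel. indicator W x *\<^sub>R (hat f x * P x * \<phi> (hscale (real (Suc n)) x))) * complex_of_real ((real (Suc n))\<^sup>2))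
     \<longlonglongrightarrow> I * (LINT t|lborel. trace0 f t * P (ept t))"
      using S(1) I[OF S(2)] by simp
  qed
qed

end


section \<open>Directional derivatives of invariant and dilated functions\<close>

lemma pd_invariant:
  assumes d: "f differentiable (at x)" and inv: "\<And>t. f (x + t *\<^sub>R axis i 1) = f x"
  shows "pd i f x = 0"
proof -
  have df: "(f has_derivative frechet_derivative f (at x)) (at (x + 0 *\<^sub>R axis i 1))"
    using d by (simp add: frechet_derivative_works)
  have "((\<lambda>t::real. x + t *\<^sub>R axis i 1) has_derivative (\<lambda>t. t *\<^sub>R axis i 1)) (at 0)"
    by (auto intro!: derivative_eq_intros)
  from has_derivative_compose[OF this df]
  have "((\<lambda>t::real. f x) has_derivative (\<lambda>t. frechet_derivative f (at x) (t *\<^sub>R axis i 1))) (at 0)"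
    unfolding inv .
  moreover have "((\<lambda>t::real. f x) has_derivative (\<lambda>t. 0)) (at 0)" by simp
  ultimately have "(\<lambda>t::real. frechet_derivative f (at x) (t *\<^sub>R axis i 1)) = (\<lambda>t. 0)"
    by (rule has_derivative_unique)
  from fun_cong[OF this, of 1] show ?thesis by (simp add: pd_def)
qed

lemma pd_translate:
  assumes f: "f differentiable (at (x + a))" shows "pd i (\<lambda>x. f (x + a)) x = pd i f (x + a)"
proof -
  have "((\<lambda>x. x + a) has_derivative (\<lambda>h. h)) (at x)" by (auto intro!: derivative_eq_intros)
  moreover have "(f has_derivative frechet_derivative f (at (x + a))) (at (x + a))"
    using f by (simp add: frechet_derivative_works)
  ultimately have "((\<lambda>x. f (x + a)) has_derivative frechet_derivative f (at (x + a))) (at x)"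
    by (rule has_derivative_compose)
  from pd_eq[OF this, of i] show ?thesis by (simp add: pd_def[of i f "x + a"])
qed

lemma pd_hscale:
  assumes f: "f differentiable (at (hscale d x))"
  shows "pd j (\<lambda>x. f (hscale d x)) x = (if j = 3 then 1 else d) *\<^sub>R pd j f (hscale d x)"
proof -
  have "(hscale d has_derivative hscale d) (at x)"
    by (rule bounded_linear_imp_has_derivative[OF linear_hscale])
  moreover have df: "(f has_derivative frechet_derivative f (at (hscale d x))) (at (hscale d x))"
    using f by (simp add: frechet_derivative_works)
  ultimately have "((\<lambda>x. f (hscale d x)) has_derivative (\<lambda>h. frechet_derivative f (at (hscale d x)) (hscale d h))) (at x)"
    by (rule has_derivative_compose)
  note pd_eq[OF this, of j]
  moreover have "hscale d (axis j 1) = (if j = 3 then 1 else d) *\<^sub>R axis j 1"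
    using exhaust_3[of j] by (auto simp: vec_eq_iff forall_3 axis_def)
  ultimately show ?thesis
    using linear_cmul[OF has_derivative_linear[OF df]] by (simp add: pd_def[of j f "hscale d x"])
qed

definition dird :: "real^3 \<Rightarrow> (real^3 \<Rightarrow> 'b::real_normed_vector) \<Rightarrow> real^3 \<Rightarrow> 'b" where
  "dird v \<psi> x = (\<Sum>i\<in>UNIV. v $ i *\<^sub>R pd i \<psi> x)"

lemma smooth_dird: "smooth \<psi> \<Longrightarrow> smooth (dird v \<psi>)"
  unfolding dird_def[abs_def] sum_3 by (intro smooth_add smooth_scaleR smooth_const smooth_pd)

lemma tf_dird: "tf K \<psi> \<Longrightarrow> tf K (dird v \<psi>)"
  using tf_pd[of K \<psi>] smooth_dird[of \<psi> v] by (auto simp: tf_def dird_def)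

lemma dird_hscale:
  assumes "smooth f" "v $ 3 = 0"
  shows "dird v (\<lambda>x. f (hscale d x)) x = d *\<^sub>R dird v f (hscale d x)"
  unfolding dird_def sum_3 using assms
  by (simp add: pd_hscale smooth_differentiable scaleR_add_right mult.commute)

lemma dird_scaleR: "smooth f \<Longrightarrow> dird v (\<lambda>x. c *\<^sub>R f x) x = c *\<^sub>R dird v f x"
  unfolding dird_def sum_3
  by (simp add: pd_bounded_linear[OF bounded_linear_scaleR_right] smooth_differentiable scaleR_add_right mult.commute)

lemma dird_vertical_mult:
  fixes a g :: "real^3 \<Rightarrow> real"
  assumes "smooth a" "smooth g" "v $ 3 = 0" and a: "\<And>x y. x$3 = y$3 \<Longrightarrow> a x = a y"
  shows "dird v (\<lambda>x. a x * g x) = (\<lambda>x. a x * dird v g x)"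
proof
  fix x
  have "pd 1 a x = 0" "pd 2 a x = 0"
    by (rule pd_invariant[OF smooth_differentiable[OF assms(1)]], rule a, simp add: axis_def)+
  moreover have "pd j (\<lambda>x. a x * g x) x = pd j a x * g x + a x * pd j g x" for j
    by (rule pd_bounded_bilinear[OF bounded_bilinear_mult]) (intro smooth_differentiable assms)+
  ultimately show "dird v (\<lambda>x. a x * g x) x = a x * dird v g x"
    using assms(3) by (simp add: dird_def sum_3 algebra_simps)
qed

lemma dird_horizontal:
  assumes g: "smooth g" and hz: "\<And>x y. x$1 = y$1 \<Longrightarrow> x$2 = y$2 \<Longrightarrow> g x = g y"
    and xy: "x$1 = y$1" "x$2 = y$2"
  shows "dird v g x = dird v g y"
proof -
  define a where "a = y - x"
  have "(\<lambda>x. g (x + a)) = g" using xy by (intro ext hz) (simp_all add: a_def)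
  then have "pd i g x = pd i g y" for i
    using pd_translate[OF smooth_differentiable[OF g], where x=x and a=a and i=i] by (simp add: a_def)
  then show ?thesis by (simp add: dird_def)
qed

context wedge_domain
begin

text \<open>A scalar pairing that accepts complex test functions, as the powers of 1/(z + 1/k)
  require; \<open>regular_distr\<close> pairs with real ones.\<close>

definition sreg :: "(real^3 \<Rightarrow> complex) \<Rightarrow> (real^3 \<Rightarrow> complex) \<Rightarrow> complex" where
  "sreg f \<Psi> = (LINT x|lebesgue_on \<Omega>. \<Psi> x * f x)"

lemma sreg_hat:
  assumes f: "edge_regular f" and m: "\<Psi> \<in> borel_measurable borel" and z: "\<And>x. x \<notin> N \<Longrightarrow> \<Psi> x = 0"
  shows "sreg f \<Psi> = (LINT x|lborel. indicator W x *\<^sub>R (hat f x * \<Psi> x))"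
proof -
  have "sreg f \<Psi> = (LINT x|lebesgue_on \<Omega>. hat f x * \<Psi> x)"
    unfolding sreg_def
  proof (rule Bochner_Integration.integral_cong)
    fix x assume "x \<in> space (lebesgue_on \<Omega>)"
    then show "\<Psi> x * f x = hat f x * \<Psi> x"
      using z[of x] \<Omega>_N[of x] by (cases "x \<in> N") (auto simp: hat_def)
  qed simp
  also have "\<dots> = (LINT x|lborel. indicator W x *\<^sub>R (hat f x * \<Psi> x))"
    using z by (intro integral_lebesgue_on_\<Omega> borel_measurable_times hat_measurable f m) auto
  finally show ?thesis .
qed

lemma regular_distr_nth:
  assumes "L2 (lebesgue_on \<Omega>) u" "tf K \<psi>"
  shows "regular_distr \<Omega> u \<psi> $ i = sreg (\<lambda>x. u x $ i) (\<lambda>x. complex_of_real (\<psi> x))"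
proof -
  have "regular_distr \<Omega> u \<psi> $ i = (LINT x|lebesgue_on \<Omega>. (\<psi> x *\<^sub>R u x) $ i)"
    unfolding regular_distr_def
    by (rule integral_bounded_linear[OF bounded_linear_vec_nth[of i] regular_distr_integrable[OF assms], symmetric])
  also have "\<dots> = sreg (\<lambda>x. u x $ i) (\<lambda>x. complex_of_real (\<psi> x))"
    unfolding sreg_def by (simp only: vector_scaleR_component) (simp only: scaleR_conv_of_real)
  finally show ?thesis .
qed

lemma T_axes: "T (1, 0, 0) $ 3 = 0" "T (0, 1, 0) $ 3 = 0" "T (0, 0, c) = ept c"
  by (simp_all add: T_def vec_eq_iff forall_3)

end


lemma tf_of_real: "tf K \<psi> \<Longrightarrow> tf K (\<lambda>x. complex_of_real (\<psi> x))"
  by (auto simp: tf_def intro: smooth_of_real)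

context wedge_domain
begin

text \<open>The constant I plays the part of the integral of the kernel over a horizontal
  cross-section of the wedge. One I serves for all regular fields and all cut-offs.\<close>

definition edge_limit :: "(real^3 \<Rightarrow> complex) \<Rightarrow> complex \<Rightarrow> bool" where
  "edge_limit \<phi> I \<longleftrightarrow> (\<forall>f P K. edge_regular f \<longrightarrow> tf K P \<longrightarrow> K \<subseteq> N \<longrightarrow>
    (\<lambda>n. (LINT x|lborel. indicator W x *\<^sub>R (hat f x * P x * \<phi> (hscale (real (Suc n)) x))) * complex_of_real ((real (Suc n))\<^sup>2))
     \<longlonglongrightarrow> I * (LINT t|lborel. trace0 f t * P (ept t)))"

lemma edge_limitD:
  assumes "edge_limit \<phi> I" "edge_regular f" "tf K P" "K \<subseteq> N"
  shows "(\<lambda>n. (LINT x|lborel. indicator W x *\<^sub>R (hat f x * P x * \<phi> (hscale (real (Suc n)) x))) * complex_of_real ((real (Suc n))\<^sup>2))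
     \<longlonglongrightarrow> I * (LINT t|lborel. trace0 f t * P (ept t))"
  using assms unfolding edge_limit_def by blast

lemma edge_limit_ex:
  assumes fm: "\<phi> \<in> borel_measurable borel"
    and fC: "\<forall>x\<in>W. norm (\<phi> x) \<le> C' * (1 / (1 + (x$1)\<^sup>2) * (1 / (1 + (x$2)\<^sup>2)))"
    and hz: "\<forall>x y. x$1 = y$1 \<longrightarrow> x$2 = y$2 \<longrightarrow> \<phi> x = \<phi> y"
  shows "\<exists>I. edge_limit \<phi> I"
proof (rule horizontal_constant[OF fm])
  show "norm (\<phi> x) \<le> C' * (1 / (1 + (x$1)\<^sup>2) * (1 / (1 + (x$2)\<^sup>2)))" if "x \<in> W" for x
    using fC that by blast
  show "\<phi> x = \<phi> y" if "x$1 = y$1" "x$2 = y$2" for x y using hz that by blast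
  fix I
  assume I: "\<And>f P K. edge_regular f \<Longrightarrow> continuous_on UNIV P \<Longrightarrow> compact K \<Longrightarrow> K \<subseteq> N \<Longrightarrow> (\<And>x. x \<notin> K \<Longrightarrow> P x = 0) \<Longrightarrow>
    (\<lambda>n. (LINT x|lborel. indicator W x *\<^sub>R (hat f x * P x * \<phi> (hscale (real (Suc n)) x))) * complex_of_real ((real (Suc n))\<^sup>2))
     \<longlonglongrightarrow> I * (LINT t|lborel. trace0 f t * P (ept t))"
  have "edge_limit \<phi> I" unfolding edge_limit_def
  proof (intro allI impI)
    fix f K and P :: "real^3 \<Rightarrow> complex" assume f: "edge_regular f" and P: "tf K P" "K \<subseteq> N"
    show "(\<lambda>n. (LINT x|lborel. indicator W x *\<^sub>R (hat f x * P x * \<phi> (hscale (real (Suc n)) x))) * complex_of_real ((real (Suc n))\<^sup>2))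
     \<longlonglongrightarrow> I * (LINT t|lborel. trace0 f t * P (ept t))"
      by (rule I[OF f, of P K]) (use P in \<open>auto simp: tf_def intro: smooth_continuous\<close>)
  qed
  then show "\<exists>I. edge_limit \<phi> I" ..
qed

end


section \<open>Vanishing of the difference on the edge\<close>

context wedge_domain
begin

text \<open>Let e1 and e2 point along the faces and let \<open>X n\<close> be a bump squeezed
  horizontally by n+1. The e2-derivative of \<open>X n\<close> has size n+1 on a tube of radius of
  order 1/n, so its pairing with the e1-component of the L2 gradient tends to 0. Moving e1 onto the
  test, the same number is minus the pairing of \<open>u\<close> with the mixed derivative of
  \<open>X n\<close>, which is (n+1)^2 times a dilated kernel; its limit is I times a moment of the
  edge values. Since I is nonzero, all these moments vanish.\<close>

lemma edge_value_zero:
  assumes u: "L2 (lebesgue_on \<Omega>) u" and G: "\<And>l. L2 (lebesgue_on \<Omega>) (G l)"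
    and eq: "\<And>K \<psi> i. tf K \<psi> \<Longrightarrow> K \<subseteq> N \<Longrightarrow> regular_distr \<Omega> (G i) \<psi> = - regular_distr \<Omega> u (pd i \<psi>)"
    and er: "\<And>i. edge_regular (\<lambda>x. u x $ i)" and t0: "\<bar>t0\<bar> < M"
  shows "u (ept t0) = 0"
proof -
  let ?e1 = "T (1, 0, 0)" and ?e2 = "T (0, 1, 0)"
  \<comment> \<open>Leaves room in \<open>N\<close> for a second bump of twice the radius, used
    below as \<open>P\<close>.\<close>
  define \<sigma> where "\<sigma> = h / 8"
  have \<sigma>: "\<sigma> > 0" "2 * (2 * \<sigma>) < h" "2 * \<sigma> < h" using h by (simp_all add: \<sigma>_def)
  have "u (ept t0) $ i = 0" for i
  proof (rule vbump_moments_zero[where f="\<lambda>t. u (ept t) $ i", OF _ t0])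
    show "continuous_on {-M<..<M} (\<lambda>t. u (ept t) $ i)" using er[of i] by (simp add: edge_regular_def)
    fix \<tau> assume \<tau>: "\<tau> > 0" "\<bar>t0\<bar> + 2 * \<tau> < M"
    define a where "a x = vbump \<tau> t0 (x$3)" for x :: "real^3"
    define g where "g = hbump \<sigma>"
    define \<phi> where "\<phi> = dird ?e1 (dird ?e2 g)"
    have sa: "smooth a" unfolding a_def by (rule smooth_vbump)
    have sg: "smooth g" unfolding g_def by (rule smooth_hbump)
    have s\<phi>: "smooth \<phi>" unfolding \<phi>_def by (intro smooth_dird sg)
    have ah: "a x = a y" if "x$3 = y$3" for x y using that by (simp add: a_def)
    have gh: "g x = g y" if "x$1 = y$1" "x$2 = y$2" for x y using that by (simp add: g_def hbump_def rho_def)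
    have dgh: "dird ?e2 g x = dird ?e2 g y" if "x$1 = y$1" "x$2 = y$2" for x y
      by (rule dird_horizontal[OF sg gh that])
    have \<phi>h: "\<phi> x = \<phi> y" if "x$1 = y$1" "x$2 = y$2" for x y
      unfolding \<phi>_def by (rule dird_horizontal[OF smooth_dird[OF sg] dgh that])
    have X: "bump \<sigma> \<tau> t0 = (\<lambda>x. a x * g x)" by (simp add: fun_eq_iff bump_def a_def g_def)
    have dX: "dird ?e2 (\<lambda>x. a x * g x) = (\<lambda>x. a x * dird ?e2 g x)"
      "dird ?e1 (\<lambda>x. a x * dird ?e2 g x) = (\<lambda>x. a x * \<phi> x)"
      unfolding \<phi>_def by (rule dird_vertical_mult[OF sa sg T_axes(2) ah], assumption,
          rule dird_vertical_mult[OF sa smooth_dird[OF sg] T_axes(1) ah], assumption)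
    note tX = tf_bump[OF \<sigma>(1) \<tau>(1) \<sigma>(3) \<tau>(2)]
    have \<phi>0: "\<phi> x = 0" if "rho x > 2 * \<sigma>\<^sup>2" for x
    proof -
      \<comment> \<open>The kernel does not depend on the height, so it is evaluated at height t0,
        where the vertical factor \<open>a\<close> equals 1.\<close>
      define y :: "real^3" where "y = vector [x$1, x$2, t0]"
      have y: "y \<notin> {x. rho x \<le> 2 * \<sigma>\<^sup>2 \<and> \<bar>x$3 - t0\<bar> \<le> 2 * \<tau>}" using that by (simp add: y_def rho_def)
      have "a y * \<phi> y = 0"
        using tf_dird[OF tf_dird[OF tX(1), of ?e2], of ?e1] y unfolding X dX by (simp add: tf_def)
      moreover have "a y = 1" using vbump_1[OF \<tau>(1), of t0 t0] \<tau> by (simp add: a_def y_def)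
      moreover have "\<phi> x = \<phi> y" by (rule \<phi>h) (simp_all add: y_def)
      ultimately show ?thesis by simp
    qed
    obtain C where "\<forall>x. norm (dird ?e2 (bump \<sigma> \<tau> t0) x) \<le> C"
      using tf_bounded[OF tf_dird[OF tX(1), of ?e2]] by blast
    then have C: "\<bar>a x * dird ?e2 g x\<bar> \<le> C" for x unfolding X dX by simp
    obtain C2 where "\<forall>x. norm (dird ?e1 (dird ?e2 (bump \<sigma> \<tau> t0)) x) \<le> C2"
      using tf_bounded[OF tf_dird[OF tf_dird[OF tX(1), of ?e2], of ?e1]] by blast
    then have C2: "\<bar>a x * \<phi> x\<bar> \<le> C2" for x unfolding X dX by simp
    have a1: "a (vector [p, q, t0]) = 1" for p q using vbump_1[OF \<tau>(1), of t0 t0] \<tau> by (simp add: a_def)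
    have \<phi>C: "norm (complex_of_real (\<phi> x)) \<le> (C2 * (1 + 2 * \<sigma>\<^sup>2)\<^sup>2) * (1 / (1 + (x$1)\<^sup>2) * (1 / (1 + (x$2)\<^sup>2)))" for x
    proof (cases "rho x > 2 * \<sigma>\<^sup>2")
      case True
      moreover have "C2 \<ge> 0" using C2[of 0] by linarith
      ultimately show ?thesis using \<phi>0[OF True] by (simp add: add_nonneg_nonneg)
    next
      case False
      have f1: "\<bar>\<phi> x\<bar> \<le> C2"
        using C2[of "vector [x$1, x$2, t0]"] \<phi>h[of x "vector [x$1, x$2, t0]"] unfolding a1 by simp
      have f2: "(1 + (x$1)\<^sup>2) * (1 + (x$2)\<^sup>2) \<le> (1 + 2 * \<sigma>\<^sup>2) * (1 + 2 * \<sigma>\<^sup>2)"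
        using False zero_le_power2[of "x$1"] zero_le_power2[of "x$2"] unfolding rho_def by (intro mult_mono) linarith+
      have f3: "C2 \<ge> 0" using C2[of 0] by linarith
      have "\<bar>\<phi> x\<bar> * ((1 + (x$1)\<^sup>2) * (1 + (x$2)\<^sup>2)) \<le> C2 * (1 + 2 * \<sigma>\<^sup>2)\<^sup>2"
        unfolding power2_eq_square[of "1 + 2 * \<sigma>\<^sup>2"] by (rule mult_mono[OF f1 f2 f3]) (simp add: add_nonneg_nonneg)
      moreover have "(1 + (x$1)\<^sup>2) * (1 + (x$2)\<^sup>2) > 0" by (intro mult_pos_pos add_pos_nonneg) auto
      ultimately have "\<bar>\<phi> x\<bar> \<le> C2 * (1 + 2 * \<sigma>\<^sup>2)\<^sup>2 / ((1 + (x$1)\<^sup>2) * (1 + (x$2)\<^sup>2))"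
        by (simp add: le_divide_eq)
      then show ?thesis by simp
    qed
    have \<phi>m: "(\<lambda>x. complex_of_real (\<phi> x)) \<in> borel_measurable borel"
      by (intro borel_measurable_continuous_onI continuous_intros smooth_continuous s\<phi>)
    have "\<forall>x\<in>W. norm (complex_of_real (\<phi> x)) \<le> (C2 * (1 + 2 * \<sigma>\<^sup>2)\<^sup>2) * (1 / (1 + (x$1)\<^sup>2) * (1 / (1 + (x$2)\<^sup>2)))"
      using \<phi>C by blast
    moreover have "\<forall>x y. x$1 = y$1 \<longrightarrow> x$2 = y$2 \<longrightarrow> complex_of_real (\<phi> x) = complex_of_real (\<phi> y)"
      by (intro allI impI arg_cong[where f=complex_of_real] \<phi>h)
    ultimately obtain I where I: "edge_limit (\<lambda>x. complex_of_real (\<phi> x)) I" using edge_limit_ex[OF \<phi>m] by metis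
    \<comment> \<open>The wider bump equals \<open>a\<close> wherever the dilated kernel is nonzero.
      Inserting it leaves the integrand unchanged and gives it the form required by
      \<open>edge_limit\<close>.\<close>
    define P where "P x = complex_of_real (bump (2 * \<sigma>) \<tau> t0 x)" for x
    have "2 * \<sigma> > 0" using \<sigma> by simp
    note tP = tf_bump[OF this \<tau>(1) \<sigma>(2) \<tau>(2)]
    have rk: "rho (hscale k x) = k\<^sup>2 * rho x" for k x by (simp add: rho_def power_mult_distrib algebra_simps)
    have h24: "rho x \<le> (2 * \<sigma>)\<^sup>2" if "rho x \<le> 2 * \<sigma>\<^sup>2" for x
    proof -
      have "(2 * \<sigma>)\<^sup>2 = 2 * \<sigma>\<^sup>2 + 2 * \<sigma>\<^sup>2" "0 \<le> \<sigma>\<^sup>2" by (simp_all add: power_mult_distrib)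
      then show ?thesis using that by linarith
    qed
    have P: "tf {x. rho x \<le> 2 * (2 * \<sigma>)\<^sup>2 \<and> \<bar>x$3 - t0\<bar> \<le> 2 * \<tau>} P"
      unfolding P_def by (rule tf_of_real[OF tP(1)])
    have Pe: "P (ept t) = vbump \<tau> t0 t" for t unfolding P_def using \<sigma> by (simp add: bump_ept)
    define X where "X n = bump (\<sigma> / real (Suc n)) \<tau> t0" for n
    have Xs: "X n = (\<lambda>x. (\<lambda>x. a x * g x) (hscale (real (Suc n)) x))" for n
    proof
      fix x
      have "rho (hscale k x) = k\<^sup>2 * rho x" for k by (simp add: rho_def power_mult_distrib algebra_simps)
      then show "X n x = a (hscale (real (Suc n)) x) * g (hscale (real (Suc n)) x)"
        by (simp add: X_def bump_def a_def g_def hbump_def plateau_def power_divide del: of_nat_Suc)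
    qed
    have tfX: "\<exists>K. tf K (X n) \<and> K \<subseteq> N" for n
    proof -
      have "\<sigma> / real (Suc n) > 0" using \<sigma> by simp
      moreover have "\<sigma> / real (Suc n) \<le> \<sigma> / 1" using \<sigma> by (intro divide_left_mono) auto
      ultimately show ?thesis unfolding X_def using tf_bump[of "\<sigma> / real (Suc n)", OF _ \<tau>(1) _ \<tau>(2)] \<sigma>(3) by fastforce
    qed
    have dX2: "dird ?e2 (X n) = (\<lambda>x. real (Suc n) *\<^sub>R (a (hscale (real (Suc n)) x) * dird ?e2 g (hscale (real (Suc n)) x)))" for n
      unfolding Xs by (rule ext, subst dird_hscale) (auto intro: sa sg T_axes simp: dX)
    have dX1: "dird ?e1 (dird ?e2 (X n)) x = (real (Suc n))\<^sup>2 * (a x * \<phi> (hscale (real (Suc n)) x))" for n x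
    proof -
      let ?k = "real (Suc n)"
      have s2: "smooth (\<lambda>x. a x * dird ?e2 g x)" by (intro smooth_mult sa smooth_dird sg)
      have "smooth (\<lambda>x. (\<lambda>x. a x * dird ?e2 g x) (hscale ?k x))"
      proof -
        have eX: "(\<lambda>x. (\<lambda>x. a x * dird ?e2 g x) (hscale ?k x)) = (\<lambda>x. (1 / ?k) *\<^sub>R dird ?e2 (X n) x)"
          unfolding dX2 by (simp add: fun_eq_iff)
        have sX: "smooth (X n)" using tfX[of n] by (auto simp: tf_def)
        show ?thesis unfolding eX by (intro smooth_scaleR smooth_const smooth_dird sX)
      qed
      then have "dird ?e1 (dird ?e2 (X n)) x = ?k *\<^sub>R dird ?e1 (\<lambda>x. (\<lambda>x. a x * dird ?e2 g x) (hscale ?k x)) x"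
        unfolding dX2 by (rule dird_scaleR)
      also have "dird ?e1 (\<lambda>x. (\<lambda>x. a x * dird ?e2 g x) (hscale ?k x)) x = ?k *\<^sub>R dird ?e1 (\<lambda>x. a x * dird ?e2 g x) (hscale ?k x)"
        by (rule dird_hscale[OF s2 T_axes(1)])
      finally show ?thesis unfolding dX by (simp add: power2_eq_square a_def)
    qed
    have lhs: "(\<lambda>n. \<Sum>l\<in>UNIV. ?e1 $ l *\<^sub>R regular_distr \<Omega> (G l) (dird ?e2 (X n))) \<longlonglongrightarrow> (\<Sum>l\<in>UNIV. ?e1 $ l *\<^sub>R 0)"
    proof (intro tendsto_sum tendsto_scaleR tendsto_const)
      fix l
      show "(\<lambda>n. regular_distr \<Omega> (G l) (dird ?e2 (X n))) \<longlonglongrightarrow> 0"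
      proof (rule integral_edge_concentration[OF G, where c="2 * \<sigma>" and C=C])
        show "dird ?e2 (X n) \<in> borel_measurable borel" for n
          using tfX[of n] by (auto intro!: borel_measurable_continuous_onI smooth_continuous smooth_dird simp: tf_def)
        show "\<bar>dird ?e2 (X n) x\<bar> \<le> C * real (Suc n)" for n x
          unfolding dX2 using C[of "hscale (real (Suc n)) x"] by (simp add: abs_mult mult.commute mult_left_mono del: of_nat_Suc)
        fix n x assume "rho x > (2 * \<sigma> / real (Suc n))\<^sup>2 \<or> \<bar>x$3\<bar> \<ge> M"
        moreover have "0 < \<sigma> / real (Suc n)" using \<sigma> by simp
        ultimately have "x \<notin> {x. rho x \<le> 2 * (\<sigma> / real (Suc n))\<^sup>2 \<and> \<bar>x$3 - t0\<bar> \<le> 2 * \<tau>}"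
          using \<tau>(2) by (auto simp: power_divide power_mult_distrib)
            (smt (verit, best) divide_right_mono zero_le_power2)
        moreover have "tf {x. rho x \<le> 2 * (\<sigma> / real (Suc n))\<^sup>2 \<and> \<bar>x$3 - t0\<bar> \<le> 2 * \<tau>} (X n)"
        proof -
          have "\<sigma> / real (Suc n) \<le> \<sigma> / 1" using \<sigma> by (intro divide_left_mono) auto
          then show ?thesis unfolding X_def using \<sigma> by (intro tf_bump(1) \<tau>) auto
        qed
        ultimately show "dird ?e2 (X n) x = 0" using tf_dird[of _ "X n" ?e2] unfolding tf_def by blast
      qed (use \<sigma> in auto)
    qed
    have rhs: "(\<Sum>l\<in>UNIV. ?e1 $ l *\<^sub>R regular_distr \<Omega> (G l) (dird ?e2 (X n))) $ i
       = - ((LINT x|lborel. indicator W x *\<^sub>R (hat (\<lambda>x. u x $ i) x * P x * complex_of_real (\<phi> (hscale (real (Suc n)) x))))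
           * complex_of_real ((real (Suc n))\<^sup>2))" for n
    proof -
      obtain K where K: "tf K (X n)" "K \<subseteq> N" using tfX by blast
      have td: "tf K (dird ?e2 (X n))" by (rule tf_dird[OF K(1)])
      have int: "integrable (lebesgue_on \<Omega>) (\<lambda>x. pd l (dird ?e2 (X n)) x *\<^sub>R u x)" for l
        by (rule regular_distr_integrable[OF u tf_pd[OF td]])
      have "(\<Sum>l\<in>UNIV. ?e1 $ l *\<^sub>R regular_distr \<Omega> (G l) (dird ?e2 (X n)))
          = - (\<Sum>l\<in>UNIV. ?e1 $ l *\<^sub>R regular_distr \<Omega> u (pd l (dird ?e2 (X n))))"
        unfolding eq[OF td K(2)] by (simp add: sum_negf)
      also have "(\<Sum>l\<in>UNIV. ?e1 $ l *\<^sub>R regular_distr \<Omega> u (pd l (dird ?e2 (X n)))) = regular_distr \<Omega> u (dird ?e1 (dird ?e2 (X n)))"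
      proof -
        have "dird ?e1 (dird ?e2 (X n)) x *\<^sub>R u x = (\<Sum>l\<in>UNIV. ?e1 $ l *\<^sub>R (pd l (dird ?e2 (X n)) x *\<^sub>R u x))" for x
          unfolding dird_def[of ?e1] by (simp add: scaleR_sum_left)
        then show ?thesis
          by (simp only: regular_distr_def Bochner_Integration.integral_sum[OF integrable_scaleR_right[OF int]] integral_scaleR_right)
      qed
      finally have "(\<Sum>l\<in>UNIV. ?e1 $ l *\<^sub>R regular_distr \<Omega> (G l) (dird ?e2 (X n))) $ i
          = - sreg (\<lambda>x. u x $ i) (\<lambda>x. complex_of_real (dird ?e1 (dird ?e2 (X n)) x))"
        by (simp add: regular_distr_nth[OF u tf_dird[OF td]])
      also have "sreg (\<lambda>x. u x $ i) (\<lambda>x. complex_of_real (dird ?e1 (dird ?e2 (X n)) x))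
         = (LINT x|lborel. indicator W x *\<^sub>R (hat (\<lambda>x. u x $ i) x * complex_of_real (dird ?e1 (dird ?e2 (X n)) x)))"
        using tf_dird[OF td, of ?e1] K(2)
        by (intro sreg_hat[OF er] borel_measurable_continuous_onI continuous_intros smooth_continuous) (auto simp: tf_def)
      also have "\<dots> = (LINT x|lborel. (indicator W x *\<^sub>R (hat (\<lambda>x. u x $ i) x * P x * complex_of_real (\<phi> (hscale (real (Suc n)) x))))
           * complex_of_real ((real (Suc n))\<^sup>2))"
      proof (rule Bochner_Integration.integral_cong[OF refl])
        fix x
        have "a x * \<phi> (hscale (real (Suc n)) x) = bump (2 * \<sigma>) \<tau> t0 x * \<phi> (hscale (real (Suc n)) x)"
        proof (cases "rho x \<le> 2 * \<sigma>\<^sup>2")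
          case True
          then have "hbump (2 * \<sigma>) x = 1" unfolding hbump_def using \<sigma> by (intro plateau_1 h24) auto
          then show ?thesis by (simp add: bump_def a_def)
        next
          case False
          have "rho x = 1 * rho x" by simp
          also have "\<dots> \<le> (real (Suc n))\<^sup>2 * rho x" by (intro mult_right_mono) (auto simp: rho_def one_le_power)
          also have "\<dots> = rho (hscale (real (Suc n)) x)" by (rule rk[symmetric])
          finally have "\<phi> (hscale (real (Suc n)) x) = 0" using False by (intro \<phi>0) linarith
          then show ?thesis by simp
        qed
        then have e: "dird ?e1 (dird ?e2 (X n)) x = (real (Suc n))\<^sup>2 * (bump (2 * \<sigma>) \<tau> t0 x * \<phi> (hscale (real (Suc n)) x))"
          unfolding dX1 by (simp only:)
        show "indicator W x *\<^sub>R (hat (\<lambda>x. u x $ i) x * complex_of_real (dird ?e1 (dird ?e2 (X n)) x))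
          = (indicator W x *\<^sub>R (hat (\<lambda>x. u x $ i) x * P x * complex_of_real (\<phi> (hscale (real (Suc n)) x)))) * complex_of_real ((real (Suc n))\<^sup>2)"
          unfolding e P_def of_real_mult by (simp only: scaleR_conv_of_real ac_simps)
      qed
      finally show ?thesis by (simp only: integral_mult_left_zero)
    qed
    have "(\<lambda>n. (\<Sum>l\<in>UNIV. ?e1 $ l *\<^sub>R regular_distr \<Omega> (G l) (dird ?e2 (X n))) $ i) \<longlonglongrightarrow> 0"
      using tendsto_vec_nth[OF lhs, of i] by (simp only: scaleR_zero_right sum.neutral_const zero_index)
    moreover have "(\<lambda>n. (\<Sum>l\<in>UNIV. ?e1 $ l *\<^sub>R regular_distr \<Omega> (G l) (dird ?e2 (X n))) $ i)
        \<longlonglongrightarrow> - (I * (LINT t|lborel. trace0 (\<lambda>x. u x $ i) t * P (ept t)))"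
      unfolding rhs by (intro tendsto_minus edge_limitD[OF I er P tP(2)])
    ultimately have Iu: "I * (LINT t|lborel. trace0 (\<lambda>x. u x $ i) t * P (ept t)) = 0"
      using LIMSEQ_unique by fastforce
    have one: "edge_regular (\<lambda>x. 1)"
      using bounded_subset[of "{1 :: complex}" "(\<lambda>x. 1) ` (W \<inter> N)"] by (auto simp: edge_regular_def)
    \<comment> \<open>With 1 in place of the field, \<open>edge_formula\<close> evaluates the
      integral exactly. The result is the same for every n and nonzero, because \<open>X n\<close>
      equals \<open>vbump\<close> on the edge for all n.\<close>
    have "I \<noteq> 0"
    proof
      assume "I = 0"
      then have lim0: "(\<lambda>n. (LINT x|lborel. indicator W x *\<^sub>R (hat (\<lambda>x. 1) x * P x * complex_of_real (\<phi> (hscale (real (Suc n)) x))))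
           * complex_of_real ((real (Suc n))\<^sup>2)) \<longlonglongrightarrow> 0"
        using edge_limitD[OF I one P tP(2)] by simp
      have val: "(LINT x|lborel. indicator W x *\<^sub>R (hat (\<lambda>x. 1) x * P x * complex_of_real (\<phi> (hscale (real (Suc n)) x))))
           * complex_of_real ((real (Suc n))\<^sup>2) = complex_of_real ((sgn D / J) * (LINT c|lborel. vbump \<tau> t0 c))" for n
      proof -
        obtain K where K: "tf K (X n)" "K \<subseteq> N" using tfX by blast
        have "(LINT x|lborel. indicator W x *\<^sub>R (hat (\<lambda>x. 1) x * P x * complex_of_real (\<phi> (hscale (real (Suc n)) x))))
           * complex_of_real ((real (Suc n))\<^sup>2) = (LINT x|lborel. (indicator W x *\<^sub>R (hat (\<lambda>x. 1) x * P x * complex_of_real (\<phi> (hscale (real (Suc n)) x))))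
           * complex_of_real ((real (Suc n))\<^sup>2))" by (rule integral_mult_left_zero[symmetric])
        also have "\<dots> = (LINT x|lborel. complex_of_real (indicator W x *\<^sub>R dird ?e1 (dird ?e2 (X n)) x))"
        proof (rule Bochner_Integration.integral_cong[OF refl])
          fix x
          have e: "P x * complex_of_real (\<phi> (hscale (real (Suc n)) x)) = complex_of_real (a x * \<phi> (hscale (real (Suc n)) x))"
          proof (cases "rho x \<le> 2 * \<sigma>\<^sup>2")
            case True
            then have "hbump (2 * \<sigma>) x = 1" unfolding hbump_def using \<sigma> by (intro plateau_1 h24) auto
            then show ?thesis by (simp add: bump_def a_def P_def)
          next
            case False
            have "rho x = 1 * rho x" by simp
            also have "\<dots> \<le> (real (Suc n))\<^sup>2 * rho x" by (intro mult_right_mono) (auto simp: rho_def one_le_power)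
            also have "\<dots> = rho (hscale (real (Suc n)) x)" by (rule rk[symmetric])
            finally have "\<phi> (hscale (real (Suc n)) x) = 0" using False by (intro \<phi>0) linarith
            then show ?thesis by simp
          qed
          have h1: "hat (\<lambda>x. 1) x * (P x * complex_of_real (\<phi> (hscale (real (Suc n)) x))) = indicator W x *\<^sub>R (P x * complex_of_real (\<phi> (hscale (real (Suc n)) x)))"
            using P tP(2) by (cases "x \<in> N") (auto simp: hat_def indicator_def tf_def)
          show "(indicator W x *\<^sub>R (hat (\<lambda>x. 1) x * P x * complex_of_real (\<phi> (hscale (real (Suc n)) x)))) * complex_of_real ((real (Suc n))\<^sup>2)
             = complex_of_real (indicator W x *\<^sub>R dird ?e1 (dird ?e2 (X n)) x)"
          proof (cases "x \<in> W")
            case True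
            then have f: "hat (\<lambda>x. 1) x * P x * complex_of_real (\<phi> (hscale (real (Suc n)) x)) = complex_of_real (a x * \<phi> (hscale (real (Suc n)) x))"
              using h1 by (simp only: mult.assoc e indicator_simps scaleR_one)
            show ?thesis unfolding f dX1 using True by (simp only: indicator_simps scaleR_one of_real_mult ac_simps)
          next
            case False
            then show ?thesis by (simp add: indicator_def)
          qed
        qed
        also have "\<dots> = complex_of_real (LINT x|lborel. indicator W x *\<^sub>R dird ?e1 (dird ?e2 (X n)) x)"
          by (rule integral_complex_of_real)
        also have "(LINT x|lborel. indicator W x *\<^sub>R dird ?e1 (dird ?e2 (X n)) x) = (sgn D / J) *\<^sub>R (LINT c|lborel. X n (T (0, 0, c)))"
          using edge_formula[OF K(1)] unfolding dird_def[abs_def] .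
        also have "(\<lambda>c. X n (T (0, 0, c))) = vbump \<tau> t0"
        proof -
          have "\<sigma> / real (Suc n) > 0" using \<sigma> by simp
          then show ?thesis by (simp only: X_def T_axes bump_ept)
        qed
        finally show ?thesis by (simp only: real_scaleR_def)
      qed
      have "complex_of_real ((sgn D / J) * (LINT c|lborel. vbump \<tau> t0 c)) = 0"
        by (rule LIMSEQ_unique[OF tendsto_const lim0[unfolded val]])
      then show False using D_neq_0 J_pos integral_vbump_pos[OF \<tau>(1), of t0] by (simp add: sgn_if split: if_splits)
    qed
    with Iu have "(LINT t|lborel. trace0 (\<lambda>x. u x $ i) t * P (ept t)) = 0" by simp
    then show "(LINT t|lborel. indicator {-M<..<M} t *\<^sub>R (complex_of_real (vbump \<tau> t0 t) * u (ept t) $ i)) = 0"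
      by (simp add: trace0_def Pe mult.commute)
  qed
  then show ?thesis by (simp add: vec_eq_iff)
qed

end


section \<open>Powers of 1/(z + 1/k) as test functions\<close>

definition zc :: "real^3 \<Rightarrow> complex" where "zc x = Complex (x$1) (x$2)"

definition cdir :: "3 \<Rightarrow> complex" where "cdir j = zc (axis j 1)"

lemma linear_zc: "bounded_linear zc"
  unfolding linear_conv_bounded_linear[symmetric] by (rule linearI) (simp_all add: zc_def complex_eq_iff)

lemma cdir_simps [simp]: "cdir 1 = 1" "cdir 2 = \<i>" "cdir 3 = 0"
  by (simp_all add: cdir_def zc_def axis_def complex_eq_iff)

lemma zc_expand: "zc v = (\<Sum>i\<in>UNIV. v $ i *\<^sub>R cdir i)"
  by (simp add: sum_3 zc_def complex_eq_iff)

lemma zc_hscale: "zc (hscale d x) = complex_of_real d * zc x"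
  by (simp add: zc_def complex_eq_iff)

lemma zc_ept [simp]: "zc (ept t) = 0"
  by (simp add: zc_def complex_eq_iff)

text \<open>The hypothesis on R is the differential equation of 1/(z + const), with c the derivative
  of z. A derivative either falls on P or raises the power of R by one.\<close>

lemma pd_mult_power:
  fixes P R :: "real^3 \<Rightarrow> complex"
  assumes P: "P differentiable (at x)" and R: "R differentiable (at x)" and d: "pd j R x = - (c * (R x)\<^sup>2)"
  shows "pd j (\<lambda>x. P x * R x ^ m) x = pd j P x * R x ^ m + (- (of_nat m * c)) * (P x * R x ^ Suc m)"
proof (induction m)
  case (Suc m)
  have "(\<lambda>x. P x * R x ^ m) differentiable (at x)" using P R by (intro differentiable_mult differentiable_power)
  then have "pd j (\<lambda>x. (P x * R x ^ m) * R x) x = pd j (\<lambda>x. P x * R x ^ m) x * R x + (P x * R x ^ m) * pd j R x"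
    by (rule pd_bounded_bilinear[OF bounded_bilinear_mult _ R])
  moreover have "(\<lambda>x. P x * R x ^ Suc m) = (\<lambda>x. (P x * R x ^ m) * R x)" by (simp add: fun_eq_iff ac_simps)
  ultimately show ?case unfolding Suc.IH d by (simp add: algebra_simps power2_eq_square)
qed simp

lemma pd_linear_combination:
  fixes f g :: "real^3 \<Rightarrow> complex"
  assumes "smooth f" "smooth g"
  shows "pd j (\<lambda>x. f x + c * g x) x = pd j f x + c * pd j g x"
proof -
  have "pd j (\<lambda>x. f x + c * g x) x = pd j f x + pd j (\<lambda>x. c * g x) x"
    by (intro pd_add smooth_differentiable smooth_mult smooth_const assms)
  then show ?thesis
    by (simp only: pd_bounded_linear[OF bounded_linear_mult_right smooth_differentiable[OF assms(2)]])
qed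

lemma dird_linear_combination:
  fixes f g :: "real^3 \<Rightarrow> complex"
  assumes "smooth f" "smooth g"
  shows "dird v (\<lambda>x. f x + c * g x) x = dird v f x + c * dird v g x"
  unfolding dird_def pd_linear_combination[OF assms] by (simp add: sum_3 algebra_simps)

lemma tf_linear_combination:
  fixes f g :: "real^3 \<Rightarrow> complex"
  shows "tf K f \<Longrightarrow> tf K g \<Longrightarrow> tf K (\<lambda>x. f x + c * g x)"
  unfolding tf_def by (auto intro!: smooth_add smooth_mult smooth_const)

lemma tf_sum_3:
  fixes f :: "3 \<Rightarrow> real^3 \<Rightarrow> complex"
  shows "(\<And>j. tf K (f j)) \<Longrightarrow> tf K (\<lambda>x. \<Sum>j\<in>UNIV. a j * f j x)"
  unfolding sum_3 tf_def by (auto intro!: smooth_add smooth_mult)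

lemma tf_mult_smooth:
  fixes f g :: "real^3 \<Rightarrow> complex"
  shows "tf K f \<Longrightarrow> smooth g \<Longrightarrow> tf K (\<lambda>x. f x * g x)"
  by (auto simp: tf_def)

lemma pd_Re_Im:
  assumes "smooth \<Psi>"
  shows "pd j (\<lambda>x. Re (\<Psi> x)) = (\<lambda>x. Re (pd j \<Psi> x))" "pd j (\<lambda>x. Im (\<Psi> x)) = (\<lambda>x. Im (pd j \<Psi> x))"
    "pd j (\<lambda>x. cnj (\<Psi> x)) = (\<lambda>x. cnj (pd j \<Psi> x))"
  using assms by (intro ext pd_bounded_linear bounded_linear_Re bounded_linear_Im bounded_linear_cnj smooth_differentiable; assumption)+

lemma tf_Re_Im:
  assumes "tf K \<Psi>"
  shows "tf K (\<lambda>x. Re (\<Psi> x))" "tf K (\<lambda>x. Im (\<Psi> x))" "tf K (\<lambda>x. cnj (\<Psi> x))"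
  using assms by (auto simp: tf_def intro: smooth_bounded_linear[OF bounded_linear_Re]
      smooth_bounded_linear[OF bounded_linear_Im] smooth_bounded_linear[OF bounded_linear_cnj])

lemma mult_divide_swap: "a \<noteq> 0 \<Longrightarrow> (a * b * s) / a = s * b" for a b s :: complex
  by simp

lemma tendsto_divide_higher_power:
  fixes a :: "nat \<Rightarrow> complex"
  assumes a: "(\<lambda>n. a n / complex_of_real (real (Suc n)) ^ j) \<longlonglongrightarrow> L" and j: "j < 4"
  shows "(\<lambda>n. a n / complex_of_real (real (Suc n)) ^ 4) \<longlonglongrightarrow> 0"
proof -
  have "(\<lambda>n. complex_of_real (1 / real (Suc n))) \<longlonglongrightarrow> complex_of_real 0"
    by (intro tendsto_of_real LIMSEQ_Suc lim_1_over_n)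
  then have "(\<lambda>n. a n / complex_of_real (real (Suc n)) ^ j * complex_of_real (1 / real (Suc n)) ^ (4 - j))
      \<longlonglongrightarrow> L * complex_of_real 0 ^ (4 - j)"
    by (intro tendsto_mult a tendsto_power)
  moreover have "a n / complex_of_real k ^ j * complex_of_real (1 / k) ^ (4 - j) = a n / complex_of_real k ^ 4" if "k \<noteq> 0" for n k
  proof -
    have "complex_of_real k ^ 4 = complex_of_real k ^ j * complex_of_real k ^ (4 - j)" using j by (simp flip: power_add)
    then show ?thesis by (simp add: power_one_over)
  qed
  moreover have "real (Suc n) \<noteq> 0" for n by simp
  moreover have "L * complex_of_real 0 ^ (4 - j) = 0" using j by simp
  ultimately show ?thesis by (simp only: not_False_eq_True)
qed

context wedge_domain
begin

text \<open>Directions in W make an angle of at most s = max(|\<alpha>|, |\<beta>|) < pi with the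
  positive axis, so the cosine stays above cos s > -1. In |z + 1|^2 = 1 + rho + 2 x$1 the linear
  term then takes away at most a fixed fraction of 1 + rho.\<close>

lemma W_gap: "\<exists>m. 0 < m \<and> m \<le> 1 \<and> (\<forall>x\<in>W. m * (1 + rho x) \<le> (cmod (zc x + 1))\<^sup>2)"
proof -
  define s where "s = max \<bar>\<alpha>\<bar> \<bar>\<beta>\<bar>"
  have s: "0 \<le> s" "s < pi" using angles by (auto simp: s_def)
  define k where "k = max 0 (- cos s)"
  have "cos pi < cos s" using s by (intro cos_monotone_0_pi) auto
  then have k: "0 \<le> k" "k < 1" by (auto simp: k_def)
  have "(1 - k) * (1 + rho x) \<le> (cmod (zc x + 1))\<^sup>2" if x: "x \<in> W" for x
  proof -
    let ?p = "Arg (Complex (x$1) (x$2))"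
    have h0: "horiz x \<noteq> 0" using W_not_edge[OF x] by (simp add: edge_iff)
    obtain r where r: "r > 0" "x$1 = r * cos ?p" "r = norm (horiz x)" using polar[OF h0] by blast
    have "horiz x \<in> sector \<alpha> \<beta>" using x by (simp add: sector_iff_W)
    then have "\<alpha> < ?p" "?p < \<beta>" by (auto simp: sector_def)
    then have "\<bar>?p\<bar> \<le> s" by (auto simp: s_def)
    then have "cos s \<le> cos \<bar>?p\<bar>" using s by (intro cos_monotone_0_pi_le) auto
    then have "- k \<le> cos ?p" by (simp add: k_def)
    then have "r * (- k) \<le> r * cos ?p" using r(1) by (intro mult_left_mono) auto
    then have x1: "r * (- k) \<le> x$1" using r(2) by linarith
    have "0 \<le> (1 - r)\<^sup>2" by simp
    then have "2 * r \<le> 1 + r\<^sup>2" by (simp add: power2_eq_square algebra_simps)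
    then have "k * (2 * r) \<le> k * (1 + r\<^sup>2)" using k by (intro mult_left_mono) auto
    moreover have "rho x = r\<^sup>2" using r(3) by (simp add: rho_horiz)
    moreover have "(cmod (zc x + 1))\<^sup>2 = rho x + 2 * x$1 + 1"
      unfolding cmod_power2 by (simp add: zc_def rho_def power2_eq_square algebra_simps)
    ultimately show ?thesis using x1 by (simp add: algebra_simps)
  qed
  then show ?thesis using k by (intro exI[of _ "1 - k"]) auto
qed

definition gap :: real where
  "gap = (SOME m. 0 < m \<and> m \<le> 1 \<and> (\<forall>x\<in>W. m * (1 + rho x) \<le> (cmod (zc x + 1))\<^sup>2))"

lemma gap: "0 < gap" "gap \<le> 1" "x \<in> W \<Longrightarrow> gap * (1 + rho x) \<le> (cmod (zc x + 1))\<^sup>2"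
  using someI_ex[OF W_gap] unfolding gap_def by blast+

definition qq :: "real^3 \<Rightarrow> complex" where "qq x = inverse (zc x + 1)"

text \<open>A smooth function on the whole space that coincides with \<open>1 / (x\<^sub>1 + i x\<^sub>2 + 1 / k)\<close> on the
  wedge, which the pole avoids because the angles are strictly between \<open>-\<pi>\<close> and \<open>\<pi>\<close>.\<close>

definition Q :: "real \<Rightarrow> real^3 \<Rightarrow> complex" where
  "Q k x = (cnj (zc x) + complex_of_real (1 / k)) *
     complex_of_real (1 / posext ((k\<^sup>2 / gap) * ((x$1 + 1 / k) * (x$1 + 1 / k) + x$2 * x$2) + 0) * (k\<^sup>2 / gap))"

lemma smooth_Q: "smooth (Q k)"
proof -
  have "smooth (\<lambda>x::real^3. (x$1 + 1 / k) * (x$1 + 1 / k) + x$2 * x$2)"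
    by (intro smooth_add smooth_mult smooth_coord smooth_const)
  then have "smooth (\<lambda>x::real^3. 1 / posext ((k\<^sup>2 / gap) * ((x$1 + 1 / k) * (x$1 + 1 / k) + x$2 * x$2) + 0))"
    by (rule smooth_affine_compose[where g="\<lambda>t. 1 / posext t", OF C1k_inverse_posext])
  moreover have "smooth (\<lambda>x. cnj (zc x))"
    by (rule smooth_linear[OF bounded_linear_compose[OF bounded_linear_cnj linear_zc]])
  ultimately show ?thesis unfolding Q_def[abs_def]
    by (intro smooth_mult smooth_of_real smooth_add smooth_const)
qed

text \<open>With w = z + 1/k the function is built as cnj w / |w|^2. The hypothesis puts the
  argument of \<open>posext\<close> at 1 or above, where \<open>posext\<close> is the identity and
  the built-in division is exact.\<close>

lemma Q_eq:
  assumes k: "k > 0" and g: "gap \<le> k\<^sup>2 * (cmod (zc x + complex_of_real (1 / k)))\<^sup>2"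
  shows "Q k x = inverse (zc x + complex_of_real (1 / k))" "zc x + complex_of_real (1 / k) \<noteq> 0"
proof -
  define w where "w = zc x + complex_of_real (1 / k)"
  have g': "gap \<le> k\<^sup>2 * (cmod w)\<^sup>2" using g by (simp only: w_def)
  have w0: "w \<noteq> 0" using g' gap(1) by auto
  then show "zc x + complex_of_real (1 / k) \<noteq> 0" unfolding w_def .
  have "Re w = x$1 + 1 / k" "Im w = x$2" by (simp_all add: w_def zc_def del: of_real_divide)
  then have \<nu>: "(x$1 + 1 / k) * (x$1 + 1 / k) + x$2 * x$2 = (cmod w)\<^sup>2"
    unfolding cmod_power2 by (simp add: power2_eq_square)
  have "1 \<le> (k\<^sup>2 / gap) * (cmod w)\<^sup>2" using g' gap(1) by (simp add: le_divide_eq)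
  then have p: "posext ((k\<^sup>2 / gap) * (cmod w)\<^sup>2 + 0) = (k\<^sup>2 / gap) * (cmod w)\<^sup>2" by (simp add: posext_eq)
  have c: "cnj (zc x) + complex_of_real (1 / k) = cnj w" by (simp add: w_def)
  have "1 / ((k\<^sup>2 / gap) * (cmod w)\<^sup>2) * (k\<^sup>2 / gap) = 1 / (cmod w)\<^sup>2" using k gap(1) by simp
  then have "Q k x = cnj w * complex_of_real (1 / (cmod w)\<^sup>2)"
    unfolding Q_def \<nu> p c by (simp only:)
  also have "\<dots> = inverse w" using complex_div_cnj[of 1 w] by (simp add: inverse_eq_divide)
  finally show "Q k x = inverse (zc x + complex_of_real (1 / k))" by (simp only: w_def)
qed

lemma Q_W_gap: "k > 0 \<Longrightarrow> x \<in> W \<Longrightarrow> gap \<le> k\<^sup>2 * (cmod (zc x + complex_of_real (1 / k)))\<^sup>2"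
proof -
  assume k: "k > 0" and x: "x \<in> W"
  have "gap * 1 \<le> gap * (1 + rho (hscale k x))" using gap(1) by (intro mult_left_mono) (auto simp: rho_def)
  also have "\<dots> \<le> (cmod (zc (hscale k x) + 1))\<^sup>2" using x k by (intro gap(3)) (simp add: W_hscale)
  also have "zc (hscale k x) + 1 = complex_of_real k * (zc x + complex_of_real (1 / k))"
    using k by (simp add: zc_hscale distrib_left)
  also have "(cmod \<dots>)\<^sup>2 = k\<^sup>2 * (cmod (zc x + complex_of_real (1 / k)))\<^sup>2"
    by (simp only: norm_mult power_mult_distrib norm_of_real power2_abs)
  finally show ?thesis by simp
qed

lemma Q_W:
  assumes "k > 0" "x \<in> W"
  shows "Q k x = inverse (zc x + complex_of_real (1 / k))" "zc x + complex_of_real (1 / k) \<noteq> 0"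
    "Q k x = complex_of_real k * qq (hscale k x)"
proof -
  note q = Q_eq[OF assms(1) Q_W_gap[OF assms]]
  show "Q k x = inverse (zc x + complex_of_real (1 / k))" "zc x + complex_of_real (1 / k) \<noteq> 0" by (fact q)+
  have "zc (hscale k x) + 1 = complex_of_real k * (zc x + complex_of_real (1 / k))"
    using assms(1) by (simp add: zc_hscale distrib_left)
  then show "Q k x = complex_of_real k * qq (hscale k x)"
    unfolding qq_def q(1) using assms(1) by (simp add: field_simps)
qed

text \<open>The edge is not in W, so the gap condition is checked directly: it reads gap <= 1 there,
  which is why the gap is chosen at most 1.\<close>

lemma Q_ept: "k > 0 \<Longrightarrow> Q k (ept t) = complex_of_real k"
  using Q_eq[of k "ept t"] gap(2) by (simp add: norm_divide power_divide)

lemma pd_Q: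
  assumes "k > 0" "x \<in> W" shows "pd j (Q k) x = - (cdir j * (Q k x)\<^sup>2)"
proof -
  have "((\<lambda>x. zc x + complex_of_real (1 / k)) has_derivative zc) (at x)"
    by (rule has_derivative_eq_rhs[OF has_derivative_add[OF bounded_linear_imp_has_derivative[OF linear_zc] has_derivative_const]]) simp
  note d1 = this
  have "(inverse has_derivative (\<lambda>h. - (inverse (zc x + complex_of_real (1 / k)) * h * inverse (zc x + complex_of_real (1 / k)))))
      (at (zc x + complex_of_real (1 / k)))"
    by (rule has_derivative_inverse'[OF Q_W(2)[OF assms]])
  from pd_eq[OF has_derivative_compose[OF d1 this], where i=j]
  have "pd j (\<lambda>x. inverse (zc x + complex_of_real (1 / k))) x = - (cdir j * (Q k x)\<^sup>2)"
    unfolding Q_W(1)[OF assms] by (simp add: cdir_def power2_eq_square)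
  moreover have "pd j (Q k) x = pd j (\<lambda>x. inverse (zc x + complex_of_real (1 / k))) x"
    by (rule pd_cong_open[OF open_W assms(2) Q_W(1)[OF assms(1)]])
  ultimately show ?thesis by simp
qed

lemma pd_mult_Q_power:
  assumes "smooth P" "k > 0" "x \<in> W"
  shows "pd j (\<lambda>x. P x * Q k x ^ m) x = pd j P x * Q k x ^ m + (- (of_nat m * cdir j)) * (P x * Q k x ^ Suc m)"
  by (rule pd_mult_power[OF smooth_differentiable[OF assms(1)] smooth_differentiable[OF smooth_Q] pd_Q[OF assms(2,3)]])

lemma dird_mult_Q_power:
  assumes "smooth P" "k > 0" "x \<in> W"
  shows "dird v (\<lambda>x. P x * Q k x ^ m) x = dird v P x * Q k x ^ m + (- (of_nat m * zc v)) * (P x * Q k x ^ Suc m)"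
  unfolding dird_def pd_mult_Q_power[OF assms] zc_expand
  by (simp add: sum_3 algebra_simps)

lemma dird_cong_W:
  assumes "\<And>x. x \<in> W \<Longrightarrow> f x = g x" "x \<in> W" shows "dird v f x = dird v g x"
  unfolding dird_def using pd_cong_open[OF open_W assms(2), of f g] assms(1) by simp

text \<open>The squares of the derivatives of z add up to 1 + i^2 + 0 = 0. This is the harmonicity
  of powers of \<open>Q\<close>, and it removes the term with two derivatives on them.\<close>

lemma laplacian_mult_Q_power:
  assumes P: "smooth P" and k: "k > 0" and x: "x \<in> W"
  shows "(\<Sum>j\<in>UNIV. pd j (pd j (\<lambda>x. P x * Q k x ^ m)) x) = (\<Sum>j\<in>UNIV. 1 * pd j (pd j P) x) * Q k x ^ m
     + (- (2 * of_nat m)) * ((\<Sum>j\<in>UNIV. cdir j * pd j P x) * Q k x ^ Suc m)"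
proof -
  have "pd j (pd j (\<lambda>x. P x * Q k x ^ m)) x = pd j (pd j P) x * Q k x ^ m - (2 * of_nat m) * (cdir j * pd j P x * Q k x ^ Suc m)
      + (of_nat m * of_nat (Suc m)) * (cdir j * cdir j * (P x * Q k x ^ Suc (Suc m)))" for j
  proof -
    have "pd j (pd j (\<lambda>x. P x * Q k x ^ m)) x
       = pd j (\<lambda>x. pd j P x * Q k x ^ m + (- (of_nat m * cdir j)) * (P x * Q k x ^ Suc m)) x"
      by (rule pd_cong_open[OF open_W x pd_mult_Q_power[OF P k]])
    also have "\<dots> = pd j (\<lambda>x. pd j P x * Q k x ^ m) x + (- (of_nat m * cdir j)) * pd j (\<lambda>x. P x * Q k x ^ Suc m) x"
      by (intro pd_linear_combination smooth_mult smooth_power smooth_Q smooth_pd P)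
    finally show ?thesis
      unfolding pd_mult_Q_power[OF P k x] pd_mult_Q_power[OF smooth_pd[OF P] k x]
      by (simp add: algebra_simps)
  qed
  note * = this
  have "(\<Sum>j\<in>UNIV. pd j (pd j (\<lambda>x. P x * Q k x ^ m)) x) =
     (\<Sum>j\<in>UNIV. 1 * pd j (pd j P) x) * Q k x ^ m - (2 * of_nat m) * ((\<Sum>j\<in>UNIV. cdir j * pd j P x) * Q k x ^ Suc m)
      + (of_nat m * of_nat (Suc m)) * ((\<Sum>j\<in>UNIV. cdir j * cdir j) * (P x * Q k x ^ Suc (Suc m)))"
    unfolding * sum_3 by (simp add: algebra_simps)
  moreover have "(\<Sum>j\<in>UNIV. cdir j * cdir j) = 0" by (simp add: sum_3)
  ultimately show ?thesis by simp
qed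

lemma tf_mult_Q_power: "tf K P \<Longrightarrow> tf K (\<lambda>x. P x * Q k x ^ m)"
  by (intro tf_mult_smooth smooth_power smooth_Q)

lemma hat_bounded: "edge_regular f \<Longrightarrow> \<exists>C\<ge>0. \<forall>x. norm (hat f x) \<le> C"
proof -
  assume f: "edge_regular f"
  then obtain C where "\<And>x. x \<in> W \<inter> N \<Longrightarrow> norm (f x) \<le> C"
    unfolding edge_regular_def bounded_iff by blast
  then have "norm (hat f x) \<le> max C 0" for x by (auto simp: hat_def indicator_def intro: max.coboundedI1)
  then show ?thesis by (intro exI[of _ "max C 0"]) auto
qed

lemma sreg_integrable:
  assumes f: "edge_regular f" and \<Psi>: "tf K \<Psi>"
  shows "integrable lborel (\<lambda>x. indicator W x *\<^sub>R (hat f x * \<Psi> x))"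
proof -
  obtain C where C: "C \<ge> 0" "\<And>x. norm (hat f x) \<le> C" using hat_bounded[OF f] by blast
  obtain C2 where C2: "\<And>x. norm (\<Psi> x) \<le> C2" using tf_bounded[OF \<Psi>] by blast
  have K: "compact K" using \<Psi> by (simp add: tf_def)
  show ?thesis
  proof (rule Bochner_Integration.integrable_bound)
    show "integrable lborel (\<lambda>x. (C * C2) * indicator K x :: real)"
      using K emeasure_compact_finite[of K] by (intro integrable_mult_right integrable_real_indicator) (auto simp: compact_imp_closed)
    show "(\<lambda>x. indicator W x *\<^sub>R (hat f x * \<Psi> x)) \<in> borel_measurable lborel"
      using open_W hat_measurable[OF f] tf_measurable[OF \<Psi>] by (intro borel_measurable_scaleR borel_measurable_indicator borel_measurable_times) auto
    have "norm (indicator W x *\<^sub>R (hat f x * \<Psi> x)) \<le> norm ((C * C2) * indicator K x :: real)" for x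
    proof (cases "x \<in> K")
      case True
      have "norm (hat f x * \<Psi> x) \<le> C * C2"
        unfolding norm_mult using C C2 by (intro mult_mono) auto
      moreover have "C2 \<ge> 0" using C2[of x] norm_ge_zero order_trans by blast
      ultimately show ?thesis using True C(1) by (auto simp: indicator_def)
    next
      case False
      then show ?thesis using \<Psi> by (simp add: tf_def)
    qed
    then show "AE x in lborel. norm (indicator W x *\<^sub>R (hat f x * \<Psi> x)) \<le> norm ((C * C2) * indicator K x :: real)" by simp
  qed
qed

lemma sreg_W:
  assumes "edge_regular f" "tf K \<Psi>" "K \<subseteq> N"
  shows "sreg f \<Psi> = (LINT x|lborel. indicator W x *\<^sub>R (hat f x * \<Psi> x))"
  using assms(2,3) by (intro sreg_hat assms tf_measurable[OF assms(2)]) (auto simp: tf_def)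

lemma sreg_linear_combination:
  assumes f: "edge_regular f" and t: "tf K \<Psi>" "tf K \<Phi>" and K: "K \<subseteq> N"
  shows "sreg f (\<lambda>x. \<Psi> x + c * \<Phi> x) = sreg f \<Psi> + c * sreg f \<Phi>"
proof -
  have e: "(\<lambda>x. indicator W x *\<^sub>R (hat f x * (\<Psi> x + c * \<Phi> x))) =
     (\<lambda>x. indicator W x *\<^sub>R (hat f x * \<Psi> x) + c * (indicator W x *\<^sub>R (hat f x * \<Phi> x)))"
    by (simp add: fun_eq_iff indicator_def algebra_simps)
  show ?thesis
    unfolding sreg_W[OF f tf_linear_combination[OF t] K] sreg_W[OF f t(1) K] sreg_W[OF f t(2) K] e
    by (simp only: Bochner_Integration.integral_add[OF sreg_integrable[OF f t(1)] integrable_mult_right[OF sreg_integrable[OF f t(2)]]]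
        integral_mult_right_zero)
qed

text \<open>The pairing sees tests only on W, so the identities for \<open>Q\<close>, which fail
  near the pole, may be used in it.\<close>

lemma sreg_cong_W:
  assumes f: "edge_regular f" and t: "tf K \<Psi>" "tf K \<Phi>" and K: "K \<subseteq> N" and e: "\<And>x. x \<in> W \<Longrightarrow> \<Psi> x = \<Phi> x"
  shows "sreg f \<Psi> = sreg f \<Phi>"
  unfolding sreg_W[OF f t(1) K] sreg_W[OF f t(2) K]
  by (intro Bochner_Integration.integral_cong) (auto simp: indicator_def e)

lemma sreg_sum_3:
  assumes f: "edge_regular f" and t: "\<And>j::3. tf K (\<Psi> j)" and K: "K \<subseteq> N"
  shows "(\<Sum>j\<in>UNIV. sreg f (\<Psi> j)) = sreg f (\<lambda>x. \<Sum>j\<in>UNIV. \<Psi> j x)"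
proof -
  have "sreg f (\<lambda>x. (\<Psi> 1 x + 1 * \<Psi> 2 x) + 1 * \<Psi> 3 x) = (sreg f (\<Psi> 1) + 1 * sreg f (\<Psi> 2)) + 1 * sreg f (\<Psi> 3)"
    by (simp only: sreg_linear_combination[OF f tf_linear_combination[OF t t] t K] sreg_linear_combination[OF f t t K])
  then show ?thesis by (simp add: sum_3)
qed

text \<open>All three bounds come from |qq|^2 <= 1 / (gap (1 + rho)). The fourth power is where the
  decay (1 + rho)^(-2) becomes integrable over the cross-section.\<close>

lemma qq_bound:
  assumes x: "x \<in> W"
  shows "norm (qq x) \<le> 1 / gap" "rho x * (norm (qq x))\<^sup>2 \<le> 1 / gap"
    "norm (qq x ^ 4) \<le> (1 / gap)\<^sup>2 * (1 / (1 + (x$1)\<^sup>2) * (1 / (1 + (x$2)\<^sup>2)))"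
proof -
  let ?r = "1 + rho x"
  have r: "?r > 0" "?r \<ge> 1" "rho x \<ge> 0" by (auto simp: rho_def intro: add_pos_nonneg)
  have nq: "(norm (qq x))\<^sup>2 = 1 / (cmod (zc x + 1))\<^sup>2"
    by (simp only: qq_def norm_inverse power_inverse) (simp only: inverse_eq_divide)
  have gr: "0 < gap * ?r" using r gap(1) by simp
  then have "1 / (cmod (zc x + 1))\<^sup>2 \<le> 1 / (gap * ?r)" using gap(3)[OF x] gap(1) r gr by (intro divide_left_mono mult_pos_pos) (auto simp: not_less[symmetric] simp del: mult_le_0_iff)
  then have q2: "(norm (qq x))\<^sup>2 \<le> (1 / gap) * (1 / ?r)"
    by (simp add: nq)
  have g1: "1 / gap \<ge> 1" using gap by simp
  have g0: "1 / gap \<ge> 0" using gap by simp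
  have "1 / ?r \<le> 1" using r by simp
  then have "(1 / gap) * (1 / ?r) \<le> (1 / gap) * (1 / gap)" using g0 g1 by (intro mult_left_mono) linarith+
  then have "(norm (qq x))\<^sup>2 \<le> (1 / gap)\<^sup>2" using q2 unfolding power2_eq_square[of "1 / gap"] by linarith
  then show "norm (qq x) \<le> 1 / gap" using g0 by (rule power2_le_imp_le)
  have "rho x * (norm (qq x))\<^sup>2 \<le> rho x * ((1 / gap) * (1 / ?r))" using q2 r by (intro mult_left_mono) auto
  also have "\<dots> = (1 / gap) * (rho x / ?r)" by simp
  also have "\<dots> \<le> (1 / gap) * 1" using r g0 by (intro mult_left_mono) auto
  finally show "rho x * (norm (qq x))\<^sup>2 \<le> 1 / gap" by simp
  have "norm (qq x ^ 4) = (norm (qq x))\<^sup>2 * (norm (qq x))\<^sup>2" by (simp add: norm_power flip: power_add)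
  also have "\<dots> \<le> ((1 / gap) * (1 / ?r)) * ((1 / gap) * (1 / ?r))" using q2 r g0 by (intro mult_mono) auto
  also have "\<dots> = (1 / gap)\<^sup>2 * ((1 / ?r) * (1 / ?r))" by (simp add: power2_eq_square)
  also have "\<dots> \<le> (1 / gap)\<^sup>2 * (1 / (1 + (x$1)\<^sup>2) * (1 / (1 + (x$2)\<^sup>2)))"
    by (intro mult_left_mono mult_mono divide_left_mono mult_pos_pos add_pos_nonneg) (auto simp: rho_def add_nonneg_nonneg)
  finally show "norm (qq x ^ 4) \<le> (1 / gap)\<^sup>2 * (1 / (1 + (x$1)\<^sup>2) * (1 / (1 + (x$2)\<^sup>2)))" .
qed

lemma qq_measurable: "qq \<in> borel_measurable borel"
proof -
  have "zc \<in> borel_measurable borel" by (intro borel_measurable_continuous_onI linear_continuous_on linear_zc)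
  then show ?thesis unfolding qq_def[abs_def] by (intro borel_measurable_inverse borel_measurable_add borel_measurable_const)
qed

text \<open>On W the power 4 + p of \<open>Q\<close> is (n+1)^(4+p) times a dilated fixed kernel,
  and the dilation costs (n+1)^2 in the integral. The rate (n+1)^(2+p) remains.\<close>

lemma Q_power_limit:
  obtains I where "\<And>f (P :: real^3 \<Rightarrow> complex) K. edge_regular f \<Longrightarrow> tf K P \<Longrightarrow> K \<subseteq> N \<Longrightarrow>
    (\<lambda>n. sreg f (\<lambda>x. P x * Q (real (Suc n)) x ^ (4 + p)) / complex_of_real (real (Suc n)) ^ (2 + p))
      \<longlonglongrightarrow> I * (LINT t|lborel. trace0 f t * P (ept t))"
proof -
  have m: "(\<lambda>x. qq x ^ (4 + p)) \<in> borel_measurable borel" by (intro borel_measurable_power qq_measurable)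
  have b: "norm (qq x ^ (4 + p)) \<le> ((1 / gap) ^ p * (1 / gap)\<^sup>2) * (1 / (1 + (x$1)\<^sup>2) * (1 / (1 + (x$2)\<^sup>2)))" if "x \<in> W" for x
  proof -
    have "norm (qq x ^ (4 + p)) = norm (qq x) ^ p * norm (qq x ^ 4)" by (simp only: power_add norm_mult norm_power mult.commute)
    also have "\<dots> \<le> (1 / gap) ^ p * ((1 / gap)\<^sup>2 * (1 / (1 + (x$1)\<^sup>2) * (1 / (1 + (x$2)\<^sup>2))))"
      using gap(1) by (intro mult_mono power_mono qq_bound that) auto
    finally show ?thesis by (simp only: mult.assoc)
  qed
  have hz: "qq x ^ (4 + p) = qq y ^ (4 + p)" if "x$1 = y$1" "x$2 = y$2" for x y using that by (simp add: qq_def zc_def)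
  have bb: "\<forall>x\<in>W. norm (qq x ^ (4 + p)) \<le> ((1 / gap) ^ p * (1 / gap)\<^sup>2) * (1 / (1 + (x$1)\<^sup>2) * (1 / (1 + (x$2)\<^sup>2)))"
    by (intro ballI b)
  have hh: "\<forall>x y. x$1 = y$1 \<longrightarrow> x$2 = y$2 \<longrightarrow> qq x ^ (4 + p) = qq y ^ (4 + p)" by (intro allI impI hz)
  obtain I where I: "edge_limit (\<lambda>x. qq x ^ (4 + p)) I" using edge_limit_ex[OF m bb hh] ..
  show thesis
  proof (rule that)
    fix f K and P :: "real^3 \<Rightarrow> complex" assume f: "edge_regular f" and P: "tf K P" "K \<subseteq> N"
    have e: "sreg f (\<lambda>x. P x * Q (real (Suc n)) x ^ (4 + p)) / complex_of_real (real (Suc n)) ^ (2 + p)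
       = (LINT x|lborel. indicator W x *\<^sub>R (hat f x * P x * qq (hscale (real (Suc n)) x) ^ (4 + p))) * complex_of_real ((real (Suc n))\<^sup>2)" for n
    proof -
      define k where "k = real (Suc n)"
      have k: "k > 0" by (simp add: k_def)
      have "sreg f (\<lambda>x. P x * Q k x ^ (4 + p)) = (LINT x|lborel. complex_of_real k ^ (4 + p) * (indicator W x *\<^sub>R (hat f x * P x * qq (hscale k x) ^ (4 + p))))"
        unfolding sreg_W[OF f tf_mult_Q_power[OF P(1)] P(2)]
        by (intro Bochner_Integration.integral_cong) (auto simp: indicator_def Q_W(3)[OF k] power_mult_distrib)
      then have hS: "sreg f (\<lambda>x. P x * Q k x ^ (4 + p)) = complex_of_real k ^ (4 + p) * (LINT x|lborel. indicator W x *\<^sub>R (hat f x * P x * qq (hscale k x) ^ (4 + p)))"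
        by (simp only: integral_mult_right_zero)
      have kp: "complex_of_real k ^ (4 + p) = complex_of_real k ^ (2 + p) * complex_of_real (k\<^sup>2)"
      proof -
        have e4: "4 + p = (2 + p) + 2" by simp
        show ?thesis unfolding e4 of_real_power by (rule power_add)
      qed
      have k0: "complex_of_real k ^ (2 + p) \<noteq> 0" using k by simp
      show ?thesis unfolding k_def[symmetric] hS kp by (rule mult_divide_swap[OF k0])
    qed
    show "(\<lambda>n. sreg f (\<lambda>x. P x * Q (real (Suc n)) x ^ (4 + p)) / complex_of_real (real (Suc n)) ^ (2 + p))
      \<longlonglongrightarrow> I * (LINT t|lborel. trace0 f t * P (ept t))"
      unfolding e using edge_limitD[OF I f P] .
  qed
qed

text \<open>The powers 4 and 5 grow at the rates 2 and 3 and are negligible against the fourth power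
  of n+1, the rate of the sixth power of \<open>Q\<close>.\<close>

lemma Q_power_limit_low:
  assumes "edge_regular f" "tf K P" "K \<subseteq> N" "m \<in> {4, 5}"
  shows "(\<lambda>n. sreg f (\<lambda>x. P x * Q (real (Suc n)) x ^ m) / complex_of_real (real (Suc n)) ^ 4) \<longlonglongrightarrow> 0"
proof -
  define p where "p = m - 4"
  have p: "m = 4 + p" "2 + p < 4" using assms(4) by (auto simp: p_def)
  obtain I where I: "\<And>f (P :: real^3 \<Rightarrow> complex) K. edge_regular f \<Longrightarrow> tf K P \<Longrightarrow> K \<subseteq> N \<Longrightarrow>
    (\<lambda>n. sreg f (\<lambda>x. P x * Q (real (Suc n)) x ^ (4 + p)) / complex_of_real (real (Suc n)) ^ (2 + p))
      \<longlonglongrightarrow> I * (LINT t|lborel. trace0 f t * P (ept t))"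
    by (rule Q_power_limit[of p]) (rule that)
  from tendsto_divide_higher_power[OF I[OF assms(1-3)] p(2)] show ?thesis unfolding p(1) .
qed

text \<open>The seventh power alone would grow at rate 5. As P vanishes near the edge, a factor rho
  can be split off P; under dilation it yields (n+1)^(-2) and brings the rate down to 3, while rho
  times \<open>qq ^ 7\<close> is still dominated.\<close>

lemma Q_power_limit_7:
  assumes f: "edge_regular f" and P: "tf K P" "K \<subseteq> N" and s: "s > 0" "\<And>x. rho x < s \<Longrightarrow> P x = 0"
  shows "(\<lambda>n. sreg f (\<lambda>x. P x * Q (real (Suc n)) x ^ 7) / complex_of_real (real (Suc n)) ^ 4) \<longlonglongrightarrow> 0"
proof -
  \<comment> \<open>The quotient of P by rho, smooth because \<open>posext\<close> replaces rho / s
    near the edge, where P vanishes.\<close>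
  define P' where "P' x = P x * complex_of_real (1 / posext ((1 / s) * rho x + 0) * (1 / s))" for x
  have "smooth (\<lambda>x. 1 / posext ((1 / s) * rho x + 0))"
    by (rule smooth_affine_compose[where g="\<lambda>t. 1 / posext t", OF C1k_inverse_posext smooth_rho])
  then have P': "tf K P'" unfolding P'_def
    by (intro tf_mult_smooth P smooth_of_real smooth_mult smooth_const)
  have PP': "P x = complex_of_real (rho x) * P' x" for x
  proof (cases "rho x < s")
    case False
    then have "posext ((1 / s) * rho x + 0) = rho x / s" using s(1) by (simp add: posext_eq)
    then have "P' x = P x * complex_of_real (1 / rho x)" unfolding P'_def using s(1) by simp
    then show ?thesis using False s(1) by simp
  qed (simp add: s(2) P'_def)
  define \<phi> where "\<phi> x = complex_of_real (rho x) * qq x ^ 7" for x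
  have m: "\<phi> \<in> borel_measurable borel"
    unfolding \<phi>_def[abs_def]
    by (intro borel_measurable_times borel_measurable_power qq_measurable borel_measurable_continuous_onI
        continuous_on_of_real smooth_continuous smooth_rho)
  have b: "norm (\<phi> x) \<le> ((1 / gap) * (1 / gap) * (1 / gap)\<^sup>2) * (1 / (1 + (x$1)\<^sup>2) * (1 / (1 + (x$2)\<^sup>2)))" if "x \<in> W" for x
  proof -
    have r0: "rho x \<ge> 0" by (simp add: rho_def)
    have "norm (qq x) ^ 7 = (norm (qq x))\<^sup>2 * norm (qq x) * norm (qq x) ^ 4" by (simp add: numeral_eq_Suc)
    then have "norm (\<phi> x) = (rho x * (norm (qq x))\<^sup>2) * norm (qq x) * norm (qq x ^ 4)"
      using r0 by (simp add: \<phi>_def norm_mult norm_power)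
    also have "\<dots> \<le> (1 / gap) * (1 / gap) * ((1 / gap)\<^sup>2 * (1 / (1 + (x$1)\<^sup>2) * (1 / (1 + (x$2)\<^sup>2))))"
      using gap(1) by (intro mult_mono qq_bound that mult_nonneg_nonneg) (auto simp: rho_def)
    finally show ?thesis by (simp only: mult.assoc)
  qed
  have hz: "\<phi> x = \<phi> y" if "x$1 = y$1" "x$2 = y$2" for x y using that by (simp add: \<phi>_def qq_def zc_def rho_def)
  have bb: "\<forall>x\<in>W. norm (\<phi> x) \<le> ((1 / gap) * (1 / gap) * (1 / gap)\<^sup>2) * (1 / (1 + (x$1)\<^sup>2) * (1 / (1 + (x$2)\<^sup>2)))"
    by (intro ballI b)
  have hh: "\<forall>x y. x$1 = y$1 \<longrightarrow> x$2 = y$2 \<longrightarrow> \<phi> x = \<phi> y" by (intro allI impI hz)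
  obtain I where I: "edge_limit \<phi> I" using edge_limit_ex[OF m bb hh] ..
  have e: "sreg f (\<lambda>x. P x * Q (real (Suc n)) x ^ 7) / complex_of_real (real (Suc n)) ^ 3
       = (LINT x|lborel. indicator W x *\<^sub>R (hat f x * P' x * \<phi> (hscale (real (Suc n)) x))) * complex_of_real ((real (Suc n))\<^sup>2)" for n
  proof -
    define k where "k = real (Suc n)"
    have k: "k > 0" by (simp add: k_def)
    have rk: "rho (hscale k x) = k\<^sup>2 * rho x" for x by (simp add: rho_def power_mult_distrib algebra_simps)
    have k7: "complex_of_real k ^ 7 = complex_of_real k ^ 5 * complex_of_real (k\<^sup>2)"
      by (simp only: of_real_power flip: power_add) simp
    have "P x * Q k x ^ 7 = complex_of_real k ^ 5 * (P' x * \<phi> (hscale k x))" if "x \<in> W" for x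
    proof -
      have "(complex_of_real (rho x) * P' x) * (complex_of_real k * qq (hscale k x)) ^ 7
          = complex_of_real k ^ 5 * (P' x * (complex_of_real (k\<^sup>2 * rho x) * qq (hscale k x) ^ 7))"
        unfolding power_mult_distrib k7 of_real_mult by (simp only: ac_simps)
      then show ?thesis unfolding PP'[of x, symmetric] Q_W(3)[OF k that, symmetric] \<phi>_def rk .
    qed
    then have "sreg f (\<lambda>x. P x * Q k x ^ 7) = (LINT x|lborel. complex_of_real k ^ 5 * (indicator W x *\<^sub>R (hat f x * P' x * \<phi> (hscale k x))))"
      unfolding sreg_W[OF f tf_mult_Q_power[OF P(1)] P(2)]
      by (intro Bochner_Integration.integral_cong) (auto simp: indicator_def)
    then have hS: "sreg f (\<lambda>x. P x * Q k x ^ 7) = complex_of_real k ^ 5 * (LINT x|lborel. indicator W x *\<^sub>R (hat f x * P' x * \<phi> (hscale k x)))"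
      by (simp only: integral_mult_right_zero)
    have kp: "complex_of_real k ^ 5 = complex_of_real k ^ 3 * complex_of_real (k\<^sup>2)"
      by (simp only: of_real_power flip: power_add) simp
    have k0: "complex_of_real k ^ 3 \<noteq> 0" using k by simp
    show ?thesis unfolding k_def[symmetric] hS kp by (rule mult_divide_swap[OF k0])
  qed
  have "(\<lambda>n. sreg f (\<lambda>x. P x * Q (real (Suc n)) x ^ 7) / complex_of_real (real (Suc n)) ^ 3)
      \<longlonglongrightarrow> I * (LINT t|lborel. trace0 f t * P' (ept t))"
    unfolding e using edge_limitD[OF I f P' P(2)] .
  from tendsto_divide_higher_power[OF this] show ?thesis by simp
qed

lemma edge_regular_1: "edge_regular (\<lambda>x. 1)"
  using bounded_subset[of "{1 :: complex}" "(\<lambda>x. 1) ` (W \<inter> N)"] by (auto simp: edge_regular_def)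

text \<open>The constant is nonzero because the mixed derivative along the two faces of a multiple of
  \<open>Q\<^sup>4\<close>, whose leading term is a multiple of \<open>Q\<^sup>6\<close>, integrates to its values on the edge.\<close>

lemma Q_power_limit_6:
  obtains I where "I \<noteq> 0" "\<And>f (P :: real^3 \<Rightarrow> complex) K. edge_regular f \<Longrightarrow> tf K P \<Longrightarrow> K \<subseteq> N \<Longrightarrow>
    (\<lambda>n. sreg f (\<lambda>x. P x * Q (real (Suc n)) x ^ 6) / complex_of_real (real (Suc n)) ^ 4)
      \<longlonglongrightarrow> I * (LINT t|lborel. trace0 f t * P (ept t))"
proof -
  have e: "4 + 2 = (6::nat)" "2 + 2 = (4::nat)" by simp_all
  obtain I where I: "\<And>f (P :: real^3 \<Rightarrow> complex) K. edge_regular f \<Longrightarrow> tf K P \<Longrightarrow> K \<subseteq> N \<Longrightarrow>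
    (\<lambda>n. sreg f (\<lambda>x. P x * Q (real (Suc n)) x ^ 6) / complex_of_real (real (Suc n)) ^ 4)
      \<longlonglongrightarrow> I * (LINT t|lborel. trace0 f t * P (ept t))"
    by (rule Q_power_limit[of 2, unfolded e]) (rule that)
  let ?e1 = "T (1, 0, 0)" and ?e2 = "T (0, 1, 0)"
  have "I \<noteq> 0"
  proof
    assume I0: "I = 0"
    have "h / 8 > 0" "M / 4 > 0" "2 * (h / 8) < h" "\<bar>0::real\<bar> + 2 * (M / 4) < M" using h M by auto
    note tb = tf_bump[OF this]
    define P where "P x = complex_of_real (bump (h / 8) (M / 4) 0 x)" for x
    obtain K where K: "tf K P" "K \<subseteq> N" unfolding P_def using tf_of_real[OF tb(1)] tb(2) by blast
    have sP: "smooth P" using K by (simp add: tf_def)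
    \<comment> \<open>Two derivatives of P times the fourth power of \<open>Q\<close> give terms
      with the powers 4 and 5, which are of lower order, and 4 * 5 = 20 times the sixth power, whose
      limit carries the factor I.\<close>
    have lim: "(\<lambda>n. sreg (\<lambda>x. 1) (dird ?e1 (dird ?e2 (\<lambda>x. P x * Q (real (Suc n)) x ^ 4))) / complex_of_real (real (Suc n)) ^ 4) \<longlonglongrightarrow> 0 + 0 + 0"
    proof -
      have e: "sreg (\<lambda>x. 1) (dird ?e1 (dird ?e2 (\<lambda>x. P x * Q k x ^ 4))) =
          sreg (\<lambda>x. 1) (\<lambda>x. dird ?e1 (dird ?e2 P) x * Q k x ^ 4)
          + 1 * sreg (\<lambda>x. 1) (\<lambda>x. (0 + (- (4 * zc ?e1)) * dird ?e2 P x + (- (4 * zc ?e2)) * dird ?e1 P x) * Q k x ^ 5)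
          + (20 * zc ?e1 * zc ?e2) * sreg (\<lambda>x. 1) (\<lambda>x. P x * Q k x ^ 6)" if k: "k > 0" for k
      proof -
        have t0: "tf K (\<lambda>x. 0 :: complex)" using K by (auto simp: tf_def)
        note t5 = tf_linear_combination[OF tf_linear_combination[OF t0 tf_dird[OF K(1)]] tf_dird[OF K(1)],
            of "- (4 * zc ?e1)" ?e2 "- (4 * zc ?e2)" ?e1]
        note t = tf_linear_combination[OF tf_linear_combination[OF tf_mult_Q_power[OF tf_dird[OF tf_dird[OF K(1)]]] tf_mult_Q_power[OF t5]]
            tf_mult_Q_power[OF K(1)]]
        have "sreg (\<lambda>x. 1) (dird ?e1 (dird ?e2 (\<lambda>x. P x * Q k x ^ 4))) = sreg (\<lambda>x. 1) (\<lambda>x. (dird ?e1 (dird ?e2 P) x * Q k x ^ 4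
          + 1 * ((0 + (- (4 * zc ?e1)) * dird ?e2 P x + (- (4 * zc ?e2)) * dird ?e1 P x) * Q k x ^ 5))
          + (20 * zc ?e1 * zc ?e2) * (P x * Q k x ^ 6))"
        proof (rule sreg_cong_W[OF edge_regular_1 tf_dird[OF tf_dird[OF tf_mult_Q_power[OF K(1)]]] t K(2)])
          fix x assume x: "x \<in> W"
          have "dird ?e1 (dird ?e2 (\<lambda>x. P x * Q k x ^ 4)) x =
            dird ?e1 (\<lambda>x. dird ?e2 P x * Q k x ^ 4 + (- (of_nat 4 * zc ?e2)) * (P x * Q k x ^ Suc 4)) x"
            by (rule dird_cong_W[OF dird_mult_Q_power[OF sP k] x])
          also have "\<dots> = dird ?e1 (\<lambda>x. dird ?e2 P x * Q k x ^ 4) x + (- (of_nat 4 * zc ?e2)) * dird ?e1 (\<lambda>x. P x * Q k x ^ Suc 4) x"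
            by (intro dird_linear_combination smooth_mult smooth_power smooth_Q smooth_dird sP)
          finally show "dird ?e1 (dird ?e2 (\<lambda>x. P x * Q k x ^ 4)) x = (dird ?e1 (dird ?e2 P) x * Q k x ^ 4
          + 1 * ((0 + (- (4 * zc ?e1)) * dird ?e2 P x + (- (4 * zc ?e2)) * dird ?e1 P x) * Q k x ^ 5))
          + (20 * zc ?e1 * zc ?e2) * (P x * Q k x ^ 6)"
            unfolding dird_mult_Q_power[OF sP k x] dird_mult_Q_power[OF smooth_dird[OF sP] k x]
            by (simp add: numeral_eq_Suc algebra_simps)
        qed
        then show ?thesis
          by (simp only: sreg_linear_combination[OF edge_regular_1 tf_linear_combination[OF tf_mult_Q_power[OF tf_dird[OF tf_dird[OF K(1)]]] tf_mult_Q_power[OF t5]]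
            tf_mult_Q_power[OF K(1)] K(2)] sreg_linear_combination[OF edge_regular_1 tf_mult_Q_power[OF tf_dird[OF tf_dird[OF K(1)]]] tf_mult_Q_power[OF t5] K(2)])
      qed
      have t0: "tf K (\<lambda>x. 0 :: complex)" using K by (auto simp: tf_def)
      note t5 = tf_linear_combination[OF tf_linear_combination[OF t0 tf_dird[OF K(1)]] tf_dird[OF K(1)],
            of "- (4 * zc ?e1)" ?e2 "- (4 * zc ?e2)" ?e1]
      have l4: "(\<lambda>n. sreg (\<lambda>x. 1) (\<lambda>x. dird ?e1 (dird ?e2 P) x * Q (real (Suc n)) x ^ 4) / complex_of_real (real (Suc n)) ^ 4) \<longlonglongrightarrow> 0"
        by (rule Q_power_limit_low[OF edge_regular_1 tf_dird[OF tf_dird[OF K(1)]] K(2)]) simp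
      have l5: "(\<lambda>n. sreg (\<lambda>x. 1) (\<lambda>x. (0 + (- (4 * zc ?e1)) * dird ?e2 P x + (- (4 * zc ?e2)) * dird ?e1 P x) * Q (real (Suc n)) x ^ 5)
          / complex_of_real (real (Suc n)) ^ 4) \<longlonglongrightarrow> 0"
        by (rule Q_power_limit_low[OF edge_regular_1 t5 K(2)]) simp
      have l6: "(\<lambda>n. (20 * zc ?e1 * zc ?e2) * (sreg (\<lambda>x. 1) (\<lambda>x. P x * Q (real (Suc n)) x ^ 6) / complex_of_real (real (Suc n)) ^ 4))
          \<longlonglongrightarrow> (20 * zc ?e1 * zc ?e2) * (I * (LINT t|lborel. trace0 (\<lambda>x. 1) t * P (ept t)))"
        by (rule tendsto_mult_left[OF I[OF edge_regular_1 K]])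
      have k: "real (Suc n) > 0" for n by simp
      show ?thesis unfolding e[OF k] add_divide_distrib times_divide_eq_right[symmetric] mult_1_left
        using tendsto_add[OF tendsto_add[OF l4 l5] l6] unfolding I0 by simp
    qed
    \<comment> \<open>On the edge \<open>Q k\<close> equals k, so its fourth power is exactly the
      divisor. The quotient does not depend on k and is nonzero, against the limit 0 obtained from I
      = 0.\<close>
    have val: "sreg (\<lambda>x. 1) (dird ?e1 (dird ?e2 (\<lambda>x. P x * Q k x ^ 4))) / complex_of_real k ^ 4
        = complex_of_real ((sgn D / J) * (LINT c|lborel. vbump (M / 4) 0 c))" if k: "k > 0" for k
    proof -
      let ?\<psi> = "\<lambda>x. P x * Q k x ^ 4"
      note tt = tf_dird[OF tf_dird[OF tf_mult_Q_power[OF K(1)]]]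
      have "sreg (\<lambda>x. 1) (dird ?e1 (dird ?e2 ?\<psi>)) = (LINT x|lborel. indicator W x *\<^sub>R dird ?e1 (dird ?e2 ?\<psi>) x)"
        unfolding sreg_W[OF edge_regular_1 tt K(2)]
      proof (rule Bochner_Integration.integral_cong[OF refl])
        fix x
        show "indicator W x *\<^sub>R (hat (\<lambda>x. 1) x * dird ?e1 (dird ?e2 ?\<psi>) x) = indicator W x *\<^sub>R dird ?e1 (dird ?e2 ?\<psi>) x"
          using tt[of ?e1 ?e2 k 4] K(2) by (cases "x \<in> N") (auto simp: hat_def indicator_def tf_def)
      qed
      also have "\<dots> = (sgn D / J) *\<^sub>R (LINT c|lborel. ?\<psi> (T (0, 0, c)))"
        using edge_formula[OF tf_mult_Q_power[OF K(1)], of k 4] unfolding dird_def[abs_def] .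
      also have "(\<lambda>c. ?\<psi> (T (0, 0, c))) = (\<lambda>c. complex_of_real (vbump (M / 4) 0 c) * complex_of_real k ^ 4)"
        using h by (simp add: fun_eq_iff T_axes Q_ept[OF k] P_def bump_ept)
      also have "(LINT c|lborel. complex_of_real (vbump (M / 4) 0 c) * complex_of_real k ^ 4)
          = complex_of_real (LINT c|lborel. vbump (M / 4) 0 c) * complex_of_real k ^ 4"
        by (simp only: integral_mult_left_zero integral_complex_of_real)
      finally show ?thesis using k by (simp add: scaleR_conv_of_real)
    qed
    have pos: "real (Suc n) > 0" for n by simp
    have "complex_of_real ((sgn D / J) * (LINT c|lborel. vbump (M / 4) 0 c)) = 0 + 0 + 0"
      by (rule LIMSEQ_unique[OF tendsto_const lim[unfolded val[OF pos]]])
    then have "complex_of_real ((sgn D / J) * (LINT c|lborel. vbump (M / 4) 0 c)) = 0" by simp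
    moreover have "M / 4 > 0" using M by simp
    ultimately show False using D_neq_0 J_pos integral_vbump_pos[of "M / 4" 0] by (simp add: sgn_if split: if_splits)
  qed
  then show thesis using I that by blast
qed

end


section \<open>The curl equation and vanishing of the source on the edge\<close>

lemma holder_imp_continuous_on:
  assumes "holder a K f" "a > 0" shows "continuous_on K f"
  unfolding continuous_on
proof
  fix x assume x: "x \<in> K"
  obtain C where C: "\<And>x y. x \<in> K \<Longrightarrow> y \<in> K \<Longrightarrow> norm (f x - f y) \<le> C * norm (x - y) powr a"
    using assms(1) unfolding holder_def by blast
  have "((\<lambda>y. norm (y - x) powr a) \<longlongrightarrow> 0) (at x within K)"
    by (rule tendsto_zero_powrI[OF tendsto_norm_zero[OF LIM_zero[OF tendsto_ident_at]] tendsto_const _ assms(2)]) simp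
  then have "((\<lambda>y. C * norm (y - x) powr a) \<longlongrightarrow> C * 0) (at x within K)" by (rule tendsto_mult_left)
  then have "((\<lambda>y. C * norm (y - x) powr a) \<longlongrightarrow> 0) (at x within K)" by simp
  then have "((\<lambda>y. f y - f x) \<longlongrightarrow> 0) (at x within K)"
    by (rule Lim_null_comparison[rotated]) (use C x in \<open>auto simp: eventually_at_filter\<close>)
  then show "(f \<longlongrightarrow> f x) (at x within K)" by (rule LIM_zero_cancel)
qed

context wedge_domain
begin

lemma sreg_cnj: "sreg (\<lambda>x. cnj (f x)) \<Psi> = cnj (sreg f (\<lambda>x. cnj (\<Psi> x)))"
proof -
  have "cnj (sreg f (\<lambda>x. cnj (\<Psi> x))) = (LINT x|lebesgue_on \<Omega>. cnj (cnj (\<Psi> x) * f x))"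
    unfolding sreg_def by (rule integral_bounded_linear'[OF bounded_linear_cnj bounded_linear_cnj, symmetric]) simp
  then show ?thesis by (simp add: sreg_def)
qed

lemma edge_regular_cnj: "edge_regular f \<Longrightarrow> edge_regular (\<lambda>x. cnj (f x))"
proof -
  assume f: "edge_regular f"
  have "bounded (f ` (W \<inter> N))" using f by (simp add: edge_regular_def)
  then have "bounded (cnj ` f ` (W \<inter> N))" by (rule bounded_linear_image[OF _ bounded_linear_cnj])
  then show ?thesis using f unfolding edge_regular_def image_image
    by (intro conjI continuous_on_cnj ballI impI lim_cnj[THEN iffD2]) auto
qed

text \<open>Component i is tested with the k-th derivative of \<open>\<eta>\<close>, component k
  with the i-th. Both the lam-terms and the contributions of the transposed gradient are symmetric
  in i and k, since third derivatives commute, and cancel; the Laplacians remain.\<close>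

lemma weak_curl_real:
  assumes u: "L2 (lebesgue_on \<Omega>) u" and F: "L2 (lebesgue_on \<Omega>) F"
    and eq: "\<forall>K \<psi>. tf K \<psi> \<longrightarrow> K \<subseteq> N \<longrightarrow>
       regular_distr \<Omega> F \<psi> = (\<Sum>j\<in>UNIV. stress lam \<mu> j (\<lambda>l. regular_distr \<Omega> u (pd l (pd j \<psi>))))"
    and t: "tf K \<eta>" and K: "K \<subseteq> N"
  shows "sreg (\<lambda>x. F x $ i) (\<lambda>x. complex_of_real (pd k \<eta> x)) - sreg (\<lambda>x. F x $ k) (\<lambda>x. complex_of_real (pd i \<eta> x))
    = complex_of_real \<mu> * (\<Sum>j\<in>UNIV. sreg (\<lambda>x. u x $ i) (\<lambda>x. complex_of_real (pd j (pd j (pd k \<eta>)) x))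
        - sreg (\<lambda>x. u x $ k) (\<lambda>x. complex_of_real (pd j (pd j (pd i \<eta>)) x)))"
proof -
  define r where "r l \<psi> = regular_distr \<Omega> u \<psi> $ l" for l and \<psi> :: "real^3 \<Rightarrow> real"
  have c: "regular_distr \<Omega> F \<psi> $ i = lam *\<^sub>R (\<Sum>l\<in>UNIV. r l (pd l (pd i \<psi>)))
     + \<mu> *\<^sub>R ((\<Sum>j\<in>UNIV. r i (pd j (pd j \<psi>))) + (\<Sum>j\<in>UNIV. r j (pd i (pd j \<psi>))))" if "tf K \<psi>" for i \<psi>
    unfolding eq[rule_format, OF that K] r_def using exhaust_3[of i] by (auto simp: sum_3 stress_nth algebra_simps)
  have s: "smooth \<eta>" using t by (simp add: tf_def)
  have c1: "pd i (pd k \<eta>) = pd k (pd i \<eta>)" by (rule pd_commute[OF s])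
  have c2: "pd i (pd j (pd k \<eta>)) = pd k (pd j (pd i \<eta>))" for j
    by (rule trans[OF pd_commute[OF smooth_pd[OF s]] trans[OF arg_cong[OF c1, of "pd j"] pd_commute[OF smooth_pd[OF s]]]])
  have "regular_distr \<Omega> F (pd k \<eta>) $ i - regular_distr \<Omega> F (pd i \<eta>) $ k
    = \<mu> *\<^sub>R (\<Sum>j\<in>UNIV. r i (pd j (pd j (pd k \<eta>))) - r k (pd j (pd j (pd i \<eta>))))"
    unfolding c[OF tf_pd[OF t]] c1 c2 sum_subtractf by (simp add: algebra_simps)
  then show ?thesis
    unfolding r_def regular_distr_nth[OF F tf_pd[OF t]] regular_distr_nth[OF u tf_pd[OF tf_pd[OF tf_pd[OF t]]]]
    by (simp only: scaleR_conv_of_real)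
qed

text \<open>The curl removes the gradient part of the Lame operator, leaving a Laplacian.\<close>

lemma weak_curl:
  assumes u: "L2 (lebesgue_on \<Omega>) u" and F: "L2 (lebesgue_on \<Omega>) F"
    and eq: "\<forall>K \<psi>. tf K \<psi> \<longrightarrow> K \<subseteq> N \<longrightarrow>
       regular_distr \<Omega> F \<psi> = (\<Sum>j\<in>UNIV. stress lam \<mu> j (\<lambda>l. regular_distr \<Omega> u (pd l (pd j \<psi>))))"
    and eru: "\<And>i. edge_regular (\<lambda>x. u x $ i)" and erF: "\<And>i. edge_regular (\<lambda>x. F x $ i)"
    and t: "tf K \<Psi>" and K: "K \<subseteq> N"
  shows "sreg (\<lambda>x. F x $ i) (pd k \<Psi>) - sreg (\<lambda>x. F x $ k) (pd i \<Psi>)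
    = complex_of_real \<mu> * (\<Sum>j\<in>UNIV. sreg (\<lambda>x. u x $ i) (pd j (pd j (pd k \<Psi>))) - sreg (\<lambda>x. u x $ k) (pd j (pd j (pd i \<Psi>))))"
proof -
  have s: "smooth \<Psi>" using t by (simp add: tf_def)
  \<comment> \<open>The weak equation is stated for real tests. Complex ones are reached through
    real and imaginary parts, by linearity of the pairing.\<close>
  have split: "sreg f \<Phi> = sreg f (\<lambda>x. complex_of_real (Re (\<Phi> x))) + \<i> * sreg f (\<lambda>x. complex_of_real (Im (\<Phi> x)))"
    if f: "edge_regular f" and \<Phi>: "tf K \<Phi>" for f \<Phi>
  proof -
    have "(\<lambda>x. complex_of_real (Re (\<Phi> x)) + \<i> * complex_of_real (Im (\<Phi> x))) = \<Phi>" by (simp add: fun_eq_iff complex_eq_iff)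
    then show ?thesis
      using sreg_linear_combination[OF f tf_of_real[OF tf_Re_Im(1)[OF \<Phi>]] tf_of_real[OF tf_Re_Im(2)[OF \<Phi>]] K, of \<i>] by simp
  qed
  note re = weak_curl_real[OF u F eq tf_Re_Im(1)[OF t] K,
      unfolded pd_Re_Im(1)[OF s] pd_Re_Im(1)[OF smooth_pd[OF s]] pd_Re_Im(1)[OF smooth_pd[OF smooth_pd[OF s]]]]
  note im = weak_curl_real[OF u F eq tf_Re_Im(2)[OF t] K,
      unfolded pd_Re_Im(2)[OF s] pd_Re_Im(2)[OF smooth_pd[OF s]] pd_Re_Im(2)[OF smooth_pd[OF smooth_pd[OF s]]]]
  have g: "(a + \<i> * b) - (c + \<i> * d) = (a - c) + \<i> * (b - d)" for a b c d by (simp add: algebra_simps)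
  show ?thesis
    unfolding split[OF erF tf_pd[OF t]] split[OF eru tf_pd[OF tf_pd[OF tf_pd[OF t]]]] g re im
    by (simp add: sum_3 algebra_simps)
qed

text \<open>The test is P times the fifth power of \<open>Q\<close>, everything divided by (n+1)^4.
  On the left the sixth power leads and gives \<open>cdir\<close> times I times a moment of the
  source. On the right harmonicity leaves at most the seventh power: it carries a horizontal
  derivative of P that vanishes near the edge, the sixth power meets the edge values of U, which are
  0, and the fifth is of lower order. So the right side tends to 0.\<close>

lemma curl_edge_zero:
  fixes U F :: "3 \<Rightarrow> real^3 \<Rightarrow> complex"
  assumes U: "\<And>i. edge_regular (U i)" and F: "\<And>i. edge_regular (F i)"
    and U0: "\<And>i t. \<bar>t\<bar> < M \<Longrightarrow> U i (ept t) = 0"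
    and eq: "\<And>K \<Psi> i k. tf K \<Psi> \<Longrightarrow> K \<subseteq> N \<Longrightarrow> sreg (F i) (pd k \<Psi>) - sreg (F k) (pd i \<Psi>)
        = c * (\<Sum>j\<in>UNIV. sreg (U i) (pd j (pd j (pd k \<Psi>))) - sreg (U k) (pd j (pd j (pd i \<Psi>))))"
    and t0: "\<bar>t0\<bar> < M"
  shows "cdir k * F i (ept t0) = cdir i * F k (ept t0)"
proof -
  define f where "f t = cdir k * F i (ept t) - cdir i * F k (ept t)" for t
  have cF: "continuous_on {-M<..<M} (\<lambda>t. F i (ept t))" for i using F[of i] by (simp add: edge_regular_def)
  have "f t0 = 0"
  proof (rule vbump_moments_zero[OF _ t0])
    show "continuous_on {-M<..<M} f" unfolding f_def by (intro continuous_intros cF)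
    fix \<tau> assume \<tau>: "\<tau> > 0" "\<bar>t0\<bar> + 2 * \<tau> < M"
    define \<sigma> where "\<sigma> = h / 8"
    have \<sigma>: "\<sigma> > 0" "2 * \<sigma> < h" using h by (simp_all add: \<sigma>_def)
    note tb = tf_bump[OF \<sigma>(1) \<tau>(1) \<sigma>(2) \<tau>(2)]
    define P where "P x = complex_of_real (bump \<sigma> \<tau> t0 x)" for x
    obtain K where K: "tf K P" "K \<subseteq> N" unfolding P_def using tf_of_real[OF tb(1)] tb(2) by blast
    have sP: "smooth P" using K by (simp add: tf_def)
    have Pe: "P (ept t) = complex_of_real (vbump \<tau> t0 t)" for t using \<sigma> by (simp add: P_def bump_ept)
    obtain I where I: "I \<noteq> 0" "\<And>f (P :: real^3 \<Rightarrow> complex) K. edge_regular f \<Longrightarrow> tf K P \<Longrightarrow> K \<subseteq> N \<Longrightarrow>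
      (\<lambda>n. sreg f (\<lambda>x. P x * Q (real (Suc n)) x ^ 6) / complex_of_real (real (Suc n)) ^ 4)
      \<longlonglongrightarrow> I * (LINT t|lborel. trace0 f t * P (ept t))"
      by (rule Q_power_limit_6) (rule that)
    \<comment> \<open>The operator of first order that the product rule for the Laplacian produces
      next to a power of \<open>Q\<close>: the derivative in x$1 plus i times the derivative in
      x$2.\<close>
    define dc where "dc P x = (\<Sum>j\<in>UNIV. cdir j * pd j P x)" for P x
    define lap where "lap P x = (\<Sum>j\<in>UNIV. 1 * pd j (pd j P) x)" for P :: "real^3 \<Rightarrow> complex" and x
    have tdc: "tf K (dc P)" if "tf K P" for P unfolding dc_def[abs_def] by (intro tf_sum_3 tf_pd that)
    have tlap: "tf K (lap P)" if "tf K P" for P unfolding lap_def[abs_def] by (intro tf_sum_3 tf_pd that)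
    \<comment> \<open>Near the edge P depends on the height only, and \<open>cdir 3 = 0\<close>
      removes the vertical derivative.\<close>
    have dc0: "dc P x = 0" if x: "rho x < \<sigma>\<^sup>2" for x
    proof -
      define g where "g x = complex_of_real (vbump \<tau> t0 (x$3))" for x :: "real^3"
      have sg: "smooth g" unfolding g_def[abs_def] by (intro smooth_of_real smooth_vbump)
      have o: "open {x. rho x < \<sigma>\<^sup>2}"
        by (intro open_Collect_less smooth_continuous[OF smooth_rho] continuous_on_const)
      have "pd j P x = pd j g x" for j
        by (rule pd_cong_open[OF o]) (use x \<sigma> in \<open>auto simp: P_def g_def bump_def hbump_def plateau_1\<close>)
      moreover have "pd 1 g x = 0" "pd 2 g x = 0"
        by (rule pd_invariant[OF smooth_differentiable[OF sg]], simp add: axis_def g_def)+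
      ultimately show ?thesis by (simp add: dc_def sum_3)
    qed
    have pos: "real (Suc n) > 0" for n by simp
    have A: "(\<lambda>n. sreg g (pd l (\<lambda>x. P x * Q (real (Suc n)) x ^ 5)) / complex_of_real (real (Suc n)) ^ 4)
        \<longlonglongrightarrow> 0 + (- (5 * cdir l)) * (I * (LINT t|lborel. trace0 g t * P (ept t)))" if g: "edge_regular g" for g l
    proof -
      have e: "sreg g (pd l (\<lambda>x. P x * Q q x ^ 5)) = sreg g (\<lambda>x. pd l P x * Q q x ^ 5)
          + (- (5 * cdir l)) * sreg g (\<lambda>x. P x * Q q x ^ 6)" if q: "q > 0" for q
      proof -
        note t2 = tf_mult_Q_power[OF tf_pd[OF K(1)]] tf_mult_Q_power[OF K(1)]
        have "sreg g (pd l (\<lambda>x. P x * Q q x ^ 5)) = sreg g (\<lambda>x. pd l P x * Q q x ^ 5 + (- (5 * cdir l)) * (P x * Q q x ^ 6))"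
        proof (rule sreg_cong_W[OF g tf_pd[OF tf_mult_Q_power[OF K(1)]] tf_linear_combination[OF t2] K(2)])
          fix x assume "x \<in> W"
          from pd_mult_Q_power[OF sP q this, where m=5 and j=l]
          show "pd l (\<lambda>x. P x * Q q x ^ 5) x = pd l P x * Q q x ^ 5 + (- (5 * cdir l)) * (P x * Q q x ^ 6)" by simp
        qed
        then show ?thesis by (simp only: sreg_linear_combination[OF g t2 K(2)])
      qed
      show ?thesis unfolding e[OF pos] add_divide_distrib times_divide_eq_right[symmetric]
        by (rule tendsto_add[OF Q_power_limit_low[OF g tf_pd[OF K(1)] K(2)] tendsto_mult_left[OF I(2)[OF g K]]]) simp
    qed
    have B: "(\<lambda>n. (\<Sum>j\<in>UNIV. sreg (U i) (pd j (pd j (pd l (\<lambda>x. P x * Q (real (Suc n)) x ^ 5))))) / complex_of_real (real (Suc n)) ^ 4)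
        \<longlonglongrightarrow> 0 + 0 + (60 * cdir l) * 0" for i l
    proof -
      \<comment> \<open>Coefficient of the sixth power: -10 is -2 * 5 from the Laplacian of the term
        with the fifth power, -5 comes from the derivative in direction l. Likewise 60 below is (-5)
        * (-2 * 6).\<close>
      define P6 where "P6 x = (0 + (- 10) * dc (pd l P) x) + (- (5 * cdir l)) * lap P x" for x
      have tz: "tf K (\<lambda>x. 0 :: complex)" using K by (auto simp: tf_def)
      have tP6: "tf K P6" unfolding P6_def[abs_def]
        by (intro tf_linear_combination tz tdc tlap tf_pd K)
      have tP5: "tf K (lap (pd l P))" by (intro tlap tf_pd K)
      have e: "(\<Sum>j\<in>UNIV. sreg (U i) (pd j (pd j (pd l (\<lambda>x. P x * Q q x ^ 5))))) = sreg (U i) (\<lambda>x. lap (pd l P) x * Q q x ^ 5)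
          + 1 * sreg (U i) (\<lambda>x. P6 x * Q q x ^ 6) + (60 * cdir l) * sreg (U i) (\<lambda>x. dc P x * Q q x ^ 7)" if q: "q > 0" for q
      proof -
        let ?\<Phi> = "\<lambda>x. P x * Q q x ^ 5"
        note t5 = tf_mult_Q_power[OF tP5, of q 5] and t6 = tf_mult_Q_power[OF tP6, of q 6] and t7 = tf_mult_Q_power[OF tdc[OF K(1)], of q 7]
        have t\<Phi>: "tf K (\<lambda>x. \<Sum>j\<in>UNIV. pd j (pd j (pd l ?\<Phi>)) x)"
          using tlap[OF tf_pd[OF tf_mult_Q_power[OF K(1)]]] unfolding lap_def[abs_def] mult_1_left .
        have s1: "smooth (\<lambda>x. pd l P x * Q q x ^ 5)" and s2: "smooth (\<lambda>x. P x * Q q x ^ 6)"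
          by (intro smooth_mult smooth_power smooth_Q smooth_pd sP)+
        have 1: "pd l ?\<Phi> y = pd l P y * Q q y ^ 5 + (- (5 * cdir l)) * (P y * Q q y ^ 6)" if "y \<in> W" for y
          using pd_mult_Q_power[OF sP q that, where m=5 and j=l] by simp
        have 2: "pd j (pd l ?\<Phi>) y = pd j (\<lambda>x. pd l P x * Q q x ^ 5) y + (- (5 * cdir l)) * pd j (\<lambda>x. P x * Q q x ^ 6) y"
          if "y \<in> W" for y j
          by (rule trans[OF pd_cong_open[OF open_W that 1] pd_linear_combination[OF s1 s2]])
        have 3: "pd j (pd j (pd l ?\<Phi>)) y = pd j (pd j (\<lambda>x. pd l P x * Q q x ^ 5)) y + (- (5 * cdir l)) * pd j (pd j (\<lambda>x. P x * Q q x ^ 6)) y"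
          if "y \<in> W" for y j
          by (rule trans[OF pd_cong_open[OF open_W that 2] pd_linear_combination[OF smooth_pd[OF s1] smooth_pd[OF s2]]])
        have "(\<Sum>j\<in>UNIV. sreg (U i) (pd j (pd j (pd l ?\<Phi>)))) = sreg (U i) (\<lambda>x. \<Sum>j\<in>UNIV. pd j (pd j (pd l ?\<Phi>)) x)"
          by (rule sreg_sum_3[OF U tf_pd[OF tf_pd[OF tf_pd[OF tf_mult_Q_power[OF K(1)]]]] K(2)])
        also have "\<dots> = sreg (U i) (\<lambda>x. (lap (pd l P) x * Q q x ^ 5 + 1 * (P6 x * Q q x ^ 6)) + (60 * cdir l) * (dc P x * Q q x ^ 7))"
        proof (rule sreg_cong_W[OF U t\<Phi> tf_linear_combination[OF tf_linear_combination[OF t5 t6] t7] K(2)])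
          fix y assume y: "y \<in> W"
          have "(\<Sum>j\<in>UNIV. pd j (pd j (pd l ?\<Phi>)) y) = (\<Sum>j\<in>UNIV. pd j (pd j (\<lambda>x. pd l P x * Q q x ^ 5)) y)
              + (- (5 * cdir l)) * (\<Sum>j\<in>UNIV. pd j (pd j (\<lambda>x. P x * Q q x ^ 6)) y)"
            unfolding 3[OF y] by (simp only: sum.distrib sum_distrib_left)
          also have "\<dots> = (lap (pd l P) y * Q q y ^ 5 + 1 * (P6 y * Q q y ^ 6)) + (60 * cdir l) * (dc P y * Q q y ^ 7)"
            unfolding laplacian_mult_Q_power[OF smooth_pd[OF sP] q y] laplacian_mult_Q_power[OF sP q y]
              P6_def lap_def[symmetric] dc_def[symmetric] by (simp add: algebra_simps)
          finally show "(\<Sum>j\<in>UNIV. pd j (pd j (pd l ?\<Phi>)) y) = (lap (pd l P) y * Q q y ^ 5 + 1 * (P6 y * Q q y ^ 6)) + (60 * cdir l) * (dc P y * Q q y ^ 7)" .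
        qed
        also have "\<dots> = sreg (U i) (\<lambda>x. lap (pd l P) x * Q q x ^ 5)
          + 1 * sreg (U i) (\<lambda>x. P6 x * Q q x ^ 6) + (60 * cdir l) * sreg (U i) (\<lambda>x. dc P x * Q q x ^ 7)"
          by (simp only: sreg_linear_combination[OF U tf_linear_combination[OF t5 t6] t7 K(2)] sreg_linear_combination[OF U t5 t6 K(2)])
        finally show ?thesis .
      qed
      \<comment> \<open>The zero edge values enter here: without them the sixth power on the right
        would be of the same order as the left side.\<close>
      have z: "trace0 (U i) t * P6 (ept t) = 0" for t
        using U0[of t i] by (cases "\<bar>t\<bar> < M") (auto simp: trace0_def indicator_def)
      have l6: "(\<lambda>n. sreg (U i) (\<lambda>x. P6 x * Q (real (Suc n)) x ^ 6) / complex_of_real (real (Suc n)) ^ 4) \<longlonglongrightarrow> 0"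
        using I(2)[OF U[of i] tP6 K(2)] unfolding z by (simp only: Bochner_Integration.integral_zero mult_zero_right)
      have l5: "(\<lambda>n. sreg (U i) (\<lambda>x. lap (pd l P) x * Q (real (Suc n)) x ^ 5) / complex_of_real (real (Suc n)) ^ 4) \<longlonglongrightarrow> 0"
        by (rule Q_power_limit_low[OF U tP5 K(2)]) simp
      have s2: "\<sigma>\<^sup>2 > 0" using \<sigma>(1) by simp
      show ?thesis unfolding e[OF pos] add_divide_distrib times_divide_eq_right[symmetric] mult_1_left
        by (rule tendsto_add[OF tendsto_add[OF l5 l6] tendsto_mult_left[OF Q_power_limit_7[OF U tdc[OF K(1)] K(2) s2 dc0]]])
    qed
    define S where "S i = (LINT t|lborel. trace0 (F i) t * P (ept t))" for i
    let ?\<Phi> = "\<lambda>n x. P x * Q (real (Suc n)) x ^ 5" and ?\<kappa> = "\<lambda>n. complex_of_real (real (Suc n)) ^ 4"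
    have "sreg (F i) (pd k (?\<Phi> n)) / ?\<kappa> n - sreg (F k) (pd i (?\<Phi> n)) / ?\<kappa> n
       = c * ((\<Sum>j\<in>UNIV. sreg (U i) (pd j (pd j (pd k (?\<Phi> n))))) / ?\<kappa> n - (\<Sum>j\<in>UNIV. sreg (U k) (pd j (pd j (pd i (?\<Phi> n))))) / ?\<kappa> n)" for n
      unfolding diff_divide_distrib[symmetric] eq[OF tf_mult_Q_power[OF K(1)] K(2)] sum_subtractf times_divide_eq_right ..
    note e = this
    have "(0 + (- (5 * cdir k)) * (I * S i)) - (0 + (- (5 * cdir i)) * (I * S k)) = c * ((0 + 0 + (60 * cdir k) * 0) - (0 + 0 + (60 * cdir i) * 0))"
      using tendsto_diff[OF A[OF F, of i k] A[OF F, of k i]] unfolding e S_def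
      by (rule LIMSEQ_unique) (intro tendsto_mult_left tendsto_diff B)
    note H = this
    have "(5 * I) * (cdir k * S i - cdir i * S k) = - ((0 + (- (5 * cdir k)) * (I * S i)) - (0 + (- (5 * cdir i)) * (I * S k)))"
      by algebra
    also have "\<dots> = 0" unfolding H by simp
    finally have S0: "cdir k * S i - cdir i * S k = 0" using I(1) unfolding mult_eq_0_iff by simp
    have int: "integrable lborel (\<lambda>t. trace0 (F i) t * P (ept t))" for i
    proof -
      let ?I = "{t0 - 2*\<tau>..t0 + 2*\<tau>}"
      have cI: "continuous_on ?I (\<lambda>t. complex_of_real (vbump \<tau> t0 t) * F i (ept t))"
        using \<tau> by (intro continuous_intros continuous_vbump continuous_on_subset[OF cF]) auto
      have "set_integrable lborel ?I (\<lambda>t. complex_of_real (vbump \<tau> t0 t) * F i (ept t))"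
        by (rule borel_integrable_compact[OF _ cI, folded set_integrable_def]) simp
      moreover have "(\<lambda>t. trace0 (F i) t * P (ept t)) = (\<lambda>t. indicator ?I t *\<^sub>R (complex_of_real (vbump \<tau> t0 t) * F i (ept t)))"
      proof
        fix t
        show "trace0 (F i) t * P (ept t) = indicator ?I t *\<^sub>R (complex_of_real (vbump \<tau> t0 t) * F i (ept t))"
          using vbump_0[OF \<tau>(1), of t t0] \<tau> by (cases "\<bar>t - t0\<bar> < 2 * \<tau>") (auto simp: indicator_def trace0_def Pe)
      qed
      ultimately show ?thesis by (simp add: set_integrable_def)
    qed
    have "(LINT t|lborel. indicator {-M<..<M} t *\<^sub>R (complex_of_real (vbump \<tau> t0 t) * f t))
       = (LINT t|lborel. cdir k * (trace0 (F i) t * P (ept t)) - cdir i * (trace0 (F k) t * P (ept t)))"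
      by (intro Bochner_Integration.integral_cong) (auto simp: f_def trace0_def Pe indicator_def algebra_simps)
    also have "\<dots> = cdir k * S i - cdir i * S k"
      unfolding S_def
      by (simp only: Bochner_Integration.integral_diff[OF integrable_mult_right[OF int] integrable_mult_right[OF int]] integral_mult_right_zero)
    finally show "(LINT t|lborel. indicator {-M<..<M} t *\<^sub>R (complex_of_real (vbump \<tau> t0 t) * f t)) = 0" by (simp add: S0)
  qed
  then show ?thesis by (simp add: f_def)
qed

text \<open>The first application gives F3 = 0 and F2 = i F1. The weak equation has real
  coefficients, so the conjugated fields satisfy it as well, which gives F2 = -i F1; together all
  components vanish.\<close>

lemma edge_source_zero:
  assumes u: "L2 (lebesgue_on \<Omega>) u" and F: "L2 (lebesgue_on \<Omega>) F"
    and eq: "\<forall>K \<psi>. tf K \<psi> \<longrightarrow> K \<subseteq> N \<longrightarrow>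
       regular_distr \<Omega> F \<psi> = (\<Sum>j\<in>UNIV. stress lam \<mu> j (\<lambda>l. regular_distr \<Omega> u (pd l (pd j \<psi>))))"
    and eru: "\<And>i. edge_regular (\<lambda>x. u x $ i)" and erF: "\<And>i. edge_regular (\<lambda>x. F x $ i)"
    and u0: "\<And>t. \<bar>t\<bar> < M \<Longrightarrow> u (ept t) = 0" and t0: "\<bar>t0\<bar> < M"
  shows "F (ept t0) = 0"
proof -
  have c: "cdir k * F (ept t0) $ i = cdir i * F (ept t0) $ k" for i k
  proof (rule curl_edge_zero[where U="\<lambda>i x. u x $ i" and F="\<lambda>i x. F x $ i" and c="complex_of_real \<mu>", OF eru erF _ _ t0])
    show "u (ept t) $ i = 0" if "\<bar>t\<bar> < M" for i t by (simp add: u0[OF that])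
  qed (rule weak_curl[OF u F eq eru erF])
  have c': "cdir k * cnj (F (ept t0) $ i) = cdir i * cnj (F (ept t0) $ k)" for i k
  proof (rule curl_edge_zero[where U="\<lambda>i x. cnj (u x $ i)" and F="\<lambda>i x. cnj (F x $ i)" and c="complex_of_real \<mu>",
        OF edge_regular_cnj[OF eru] edge_regular_cnj[OF erF] _ _ t0])
    show "cnj (u (ept t) $ i) = 0" if "\<bar>t\<bar> < M" for i t by (simp add: u0[OF that])
    fix K \<Psi> and i k :: 3 assume t: "tf K (\<Psi> :: real^3 \<Rightarrow> complex)" and K: "K \<subseteq> N"
    have s: "smooth \<Psi>" using t by (simp add: tf_def)
    note w = weak_curl[OF u F eq eru erF tf_Re_Im(3)[OF t] K, where i=i and k=k,
      unfolded pd_Re_Im(3)[OF s] pd_Re_Im(3)[OF smooth_pd[OF s]] pd_Re_Im(3)[OF smooth_pd[OF smooth_pd[OF s]]]]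
    show "sreg (\<lambda>x. cnj (F x $ i)) (pd k \<Psi>) - sreg (\<lambda>x. cnj (F x $ k)) (pd i \<Psi>)
      = complex_of_real \<mu> * (\<Sum>j\<in>UNIV. sreg (\<lambda>x. cnj (u x $ i)) (pd j (pd j (pd k \<Psi>))) - sreg (\<lambda>x. cnj (u x $ k)) (pd j (pd j (pd i \<Psi>))))"
      unfolding sreg_cnj using arg_cong[OF w, where f=cnj] by (simp add: cnj_sum)
  qed
  have "F (ept t0) $ 3 = 0" using c[of 1 3] by simp
  moreover have "F (ept t0) $ 2 = \<i> * F (ept t0) $ 1" using c[of 1 2] by simp
  moreover have "F (ept t0) $ 2 = - (\<i> * F (ept t0) $ 1)" using arg_cong[OF c'[of 1 2], where f=cnj] by simp
  ultimately have "F (ept t0) $ 1 = 0" "F (ept t0) $ 2 = 0" "F (ept t0) $ 3 = 0" by simp_all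
  then show ?thesis by (simp add: vec_eq_iff forall_3)
qed

section \<open>From the hypotheses of the transmission problem to the edge argument\<close>

text \<open>On a face a sine vanishes, so the polar angle is the angle of a ray up to a multiple of
  pi. The opposite ray is excluded because the oblique coordinate along the face would be negative
  there.\<close>

lemma rays_contain_faces:
  assumes "x \<in> N" "x \<in> faces" "x \<notin> edge"
  shows "x \<in> cyl (ray \<alpha> \<inter> ball 0 h) {-M<..<M} \<union> cyl (ray \<beta> \<inter> ball 0 h) {-M<..<M}"
proof -
  let ?p = "Arg (Complex (x$1) (x$2))"
  have h0: "horiz x \<noteq> 0" using assms(3) by (simp add: edge_iff)
  obtain r where r: "r > 0" "A x = r * sin (\<beta> - ?p)" "B x = r * sin (?p - \<alpha>)" using polar[OF h0] by blast
  have p: "- pi < ?p" "?p \<le> pi" using Arg_bounded by auto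
  have sz: "y = 0 \<or> y = pi \<or> y = - pi" if "sin y = 0" "\<bar>y\<bar> < 2 * pi" for y :: real
  proof -
    obtain i :: int where i: "y = of_int i * pi" using \<open>sin y = 0\<close> unfolding sin_zero_iff_int2 by blast
    then have "\<bar>of_int i :: real\<bar> * pi < 2 * pi" using that(2) by (simp add: abs_mult)
    then have "\<bar>of_int i :: real\<bar> < 2" by simp
    then have "\<bar>i\<bar> < 2" by linarith
    then have "i = 0 \<or> i = 1 \<or> i = -1" by arith
    then show ?thesis using i by auto
  qed
  have sp: "sin (y - pi) = - sin y" "sin (y + pi) = - sin y" for y :: real by (simp_all add: sin_diff sin_add)
  have D2: "r * (D * D) > 0" using r(1) D_neq_0 by (simp add: zero_less_mult_iff) (metis linorder_neq_iff)
  have "?p = \<alpha> \<or> ?p = \<beta>"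
  proof (cases "A x = 0")
    case True
    then have "sin (\<beta> - ?p) = 0" using r by simp
    then have 1: "\<beta> - ?p = 0 \<or> \<beta> - ?p = pi \<or> \<beta> - ?p = - pi" using p angles by (intro sz) auto
    have "\<not> (\<beta> - ?p = pi \<or> \<beta> - ?p = - pi)"
    proof
      assume "\<beta> - ?p = pi \<or> \<beta> - ?p = - pi"
      then have "?p - \<alpha> = (\<beta> - \<alpha>) - pi \<or> ?p - \<alpha> = (\<beta> - \<alpha>) + pi" by auto
      then have "sin (?p - \<alpha>) = - D" by (elim disjE) (simp_all only: sp D_def)
      then have "B x * D = - (r * (D * D))" using r(3) by simp
      moreover have "B x * D \<ge> 0" using assms(2,3) True by (auto simp: faces_def edge_def)
      ultimately show False using D2 by linarith
    qed
    then show ?thesis using 1 by auto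
  next
    case False
    then have B0: "B x = 0" "A x * D \<ge> 0" using assms(2) by (auto simp: faces_def)
    then have "sin (?p - \<alpha>) = 0" using r by simp
    then have 1: "?p - \<alpha> = 0 \<or> ?p - \<alpha> = pi \<or> ?p - \<alpha> = - pi" using p angles by (intro sz) auto
    have "\<not> (?p - \<alpha> = pi \<or> ?p - \<alpha> = - pi)"
    proof
      assume "?p - \<alpha> = pi \<or> ?p - \<alpha> = - pi"
      then have "\<beta> - ?p = (\<beta> - \<alpha>) - pi \<or> \<beta> - ?p = (\<beta> - \<alpha>) + pi" by auto
      then have "sin (\<beta> - ?p) = - D" by (elim disjE) (simp_all only: sp D_def)
      then have "A x * D = - (r * (D * D))" using r(2) by simp
      then show False using D2 B0(2) by linarith
    qed
    then show ?thesis using 1 by auto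
  qed
  then show ?thesis using h0 assms(1) by (auto simp: cyl_def ray_def N_iff)
qed

text \<open>A point of the wedge at height 0 is contracted horizontally to the edge and stays in the
  wedge. Thus the Hoelder conditions on the closed cylinder include the edge values.\<close>

lemma edge_in_closure: "0 \<in> closure (sector \<alpha> \<beta> \<inter> ball 0 h)"
proof -
  obtain x where x: "x \<in> W" "x$3 = 0"
  proof (cases "D > 0")
    case True
    then show ?thesis by (intro that[of "T (1, 1, 0)"]) (auto simp: W_def)
  next
    case False
    then have "D < 0" using D_neq_0 by linarith
    then show ?thesis by (intro that[of "T (-1, 0, 0)"]) (auto simp: W_def)
  qed
  have e: "horiz (ept (x$3)) = 0" by (simp add: vec_eq_iff forall_2)
  have l: "(\<lambda>n. horiz (hscale (1 / real (Suc n)) x)) \<longlonglongrightarrow> horiz (ept (x$3))"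
    by (rule bounded_linear.tendsto[OF linear_horiz hscale_tendsto])
  have ev: "\<forall>\<^sub>F n in sequentially. horiz (hscale (1 / real (Suc n)) x) \<in> closure (sector \<alpha> \<beta> \<inter> ball 0 h)"
  proof -
    have "\<bar>x$3\<bar> < M" using x(2) M by simp
    from eventually_hscale_N[OF this] show ?thesis
    proof eventually_elim
      case (elim n)
      have "hscale (1 / real (Suc n)) x \<in> W" using x(1) by (simp add: W_hscale)
      then have "horiz (hscale (1 / real (Suc n)) x) \<in> sector \<alpha> \<beta> \<inter> ball 0 h"
        using elim by (auto simp: sector_iff_W N_iff)
      then show ?case by (rule subsetD[OF closure_subset])
    qed
  qed
  show ?thesis using Lim_in_closed_set[OF closed_closure ev sequentially_bot l] unfolding e .
qed

text \<open>The closed cylinder contains \<open>W \<inter> N\<close>, the edge and the tails of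
  horizontal contractions towards the edge, so continuity and boundedness on it yield all four
  conditions.\<close>

lemma edge_regular_component:
  assumes c: "continuous_on (cyl (closure (sector \<alpha> \<beta> \<inter> ball 0 h)) {-M..M}) f"
    and b: "bounded (f ` cyl (closure (sector \<alpha> \<beta> \<inter> ball 0 h)) {-M..M})"
  shows "edge_regular (\<lambda>x. f x $ i)"
proof -
  let ?K = "cyl (closure (sector \<alpha> \<beta> \<inter> ball 0 h)) {-M..M}"
  have WK: "W \<inter> N \<subseteq> ?K"
  proof
    fix x assume x: "x \<in> W \<inter> N"
    then have "horiz x \<in> sector \<alpha> \<beta> \<inter> ball 0 h" by (auto simp: sector_iff_W N_iff)
    then have "horiz x \<in> closure (sector \<alpha> \<beta> \<inter> ball 0 h)" by (rule subsetD[OF closure_subset])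
    then show "x \<in> ?K" using x by (auto simp: cyl_def N_iff)
  qed
  have eK: "ept t \<in> ?K" if "\<bar>t\<bar> < M" for t
  proof -
    have "horiz (ept t) = 0" by (simp add: vec_eq_iff forall_2)
    then show ?thesis using that edge_in_closure by (auto simp: cyl_def)
  qed
  have c': "continuous_on ?K (\<lambda>x. f x $ i)" by (intro continuous_intros c)
  have "bounded ((\<lambda>z. z $ i) ` f ` ?K)" by (rule bounded_linear_image[OF b bounded_linear_vec_nth])
  then have b': "bounded ((\<lambda>x. f x $ i) ` ?K)" by (simp only: image_image)
  show ?thesis unfolding edge_regular_def
  proof (intro conjI ballI impI)
    show "continuous_on (W \<inter> N) (\<lambda>x. f x $ i)" by (rule continuous_on_subset[OF c' WK])
    show "bounded ((\<lambda>x. f x $ i) ` (W \<inter> N))" by (rule bounded_subset[OF b' image_mono[OF WK]])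
    show "continuous_on {-M<..<M} (\<lambda>t. f (ept t) $ i)"
      by (rule continuous_on_compose2[OF c' continuous_ept]) (auto intro!: eK)
    fix x assume x: "x \<in> W" "\<bar>x$3\<bar> < M"
    have "\<forall>\<^sub>F n in sequentially. hscale (1 / real (Suc n)) x \<in> ?K"
      using eventually_hscale_N[OF x(2)]
    proof eventually_elim
      case (elim n)
      then show ?case using WK x(1) W_hscale[of "1 / real (Suc n)" x] by auto
    qed
    then show "(\<lambda>n. f (hscale (1 / real (Suc n)) x) $ i) \<longlonglongrightarrow> f (ept (x$3)) $ i"
      by (rule continuous_on_tendsto_compose[OF c' hscale_tendsto eK[OF x(2)]])
  qed
qed

lemma edge_vanishing:
  assumes V: "Linfty (lebesgue_on \<Omega>) V" and v: "H1 \<Omega> v" and w: "H1 \<Omega> w"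
    and eqv: "distr_eq_on \<Omega>
           (\<lambda>\<phi>. distr_lame lam \<mu> (regular_distr \<Omega> v) \<phi> + regular_distr \<Omega> (\<lambda>x. \<omega>\<^sup>2 *\<^sub>R v x) \<phi>) (\<lambda>\<phi>. 0)"
    and eqw: "distr_eq_on \<Omega>
           (\<lambda>\<phi>. distr_lame lam \<mu> (regular_distr \<Omega> w) \<phi> + regular_distr \<Omega> (\<lambda>x. (\<omega>\<^sup>2 * (1 + V x)) *\<^sub>R w x) \<phi>) (\<lambda>\<phi>. 0)"
    and \<Gamma>: "cyl (ray \<alpha> \<inter> ball 0 h) {-M<..<M} \<subseteq> \<Gamma>" "cyl (ray \<beta> \<inter> ball 0 h) {-M<..<M} \<subseteq> \<Gamma>"
    and trace: "trace_eq_on \<Omega> \<Gamma> w v" and traction: "traction_eq_on \<Omega> \<Gamma> lam \<mu> v w" and a: "0 < a"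
    and hv: "holder a (cyl (closure (sector \<alpha> \<beta> \<inter> ball 0 h)) {-M..M}) v"
    and hw: "holder a (cyl (closure (sector \<alpha> \<beta> \<inter> ball 0 h)) {-M..M}) (\<lambda>x. (1 + V x) *\<^sub>R w x)"
    and hu: "holder1 a (cyl (closure (sector \<alpha> \<beta> \<inter> ball 0 h)) {-M..M}) (\<lambda>x. v x - w x)"
    and xc: "x\<^sub>c \<in> {-M<..<M}" and \<omega>: "\<omega> > 0" and V0: "V (ept x\<^sub>c) \<noteq> 0"
  shows "v (ept x\<^sub>c) = 0 \<and> w (ept x\<^sub>c) = 0"
proof -
  let ?K = "cyl (closure (sector \<alpha> \<beta> \<inter> ball 0 h)) {-M..M}"
  let ?u = "\<lambda>x. v x - w x" and ?F = "\<lambda>x. (\<omega>\<^sup>2 * (1 + V x)) *\<^sub>R w x - \<omega>\<^sup>2 *\<^sub>R v x"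
  have v2: "L2 (lebesgue_on \<Omega>) v" and w2: "L2 (lebesgue_on \<Omega>) w" using v w by (auto simp: H1_def)
  have Fw: "L2 (lebesgue_on \<Omega>) (\<lambda>x. (\<omega>\<^sup>2 * (1 + V x)) *\<^sub>R w x)"
  proof -
    obtain C where C: "AE x in lebesgue_on \<Omega>. \<bar>V x\<bar> \<le> C" using V by (auto simp: Linfty_def)
    have m: "(\<lambda>x. (\<omega>\<^sup>2 * (1 + V x)) *\<^sub>R w x) \<in> borel_measurable (lebesgue_on \<Omega>)"
      using V L2_measurable[OF w2] by (intro borel_measurable_scaleR borel_measurable_times borel_measurable_add borel_measurable_const) (auto simp: Linfty_def)
    have "integrable (lebesgue_on \<Omega>) (\<lambda>x. (norm ((\<omega>\<^sup>2 * (1 + V x)) *\<^sub>R w x))\<^sup>2)"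
    proof (rule Bochner_Integration.integrable_bound)
      show "integrable (lebesgue_on \<Omega>) (\<lambda>x. (\<omega>\<^sup>2 * (1 + C))\<^sup>2 * (norm (w x))\<^sup>2)"
        by (rule integrable_mult_right[OF L2_square_integrable[OF w2]])
      show "(\<lambda>x. (norm ((\<omega>\<^sup>2 * (1 + V x)) *\<^sub>R w x))\<^sup>2) \<in> borel_measurable (lebesgue_on \<Omega>)"
        by (rule measurable_compose[OF m, where g="\<lambda>y. (norm y)\<^sup>2"])
          (intro borel_measurable_continuous_onI continuous_intros)
      show "AE x in lebesgue_on \<Omega>. norm ((norm ((\<omega>\<^sup>2 * (1 + V x)) *\<^sub>R w x))\<^sup>2) \<le> norm ((\<omega>\<^sup>2 * (1 + C))\<^sup>2 * (norm (w x))\<^sup>2)"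
        using C
      proof eventually_elim
        case (elim x)
        then have "\<bar>1 + V x\<bar> \<le> 1 + C" by linarith
        then have "\<omega>\<^sup>2 * \<bar>1 + V x\<bar> \<le> \<omega>\<^sup>2 * (1 + C)" by (rule mult_left_mono) simp
        then have "(\<omega>\<^sup>2 * \<bar>1 + V x\<bar>)\<^sup>2 \<le> (\<omega>\<^sup>2 * (1 + C))\<^sup>2" by (rule power_mono) simp
        then have "(\<omega>\<^sup>2 * \<bar>1 + V x\<bar>)\<^sup>2 * (norm (w x))\<^sup>2 \<le> (\<omega>\<^sup>2 * (1 + C))\<^sup>2 * (norm (w x))\<^sup>2" by (rule mult_right_mono) simp
        then have "(\<omega>\<^sup>2 * \<bar>1 + V x\<bar> * norm (w x))\<^sup>2 \<le> (\<omega>\<^sup>2 * (1 + C))\<^sup>2 * (norm (w x))\<^sup>2"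
          by (simp only: power_mult_distrib[of "\<omega>\<^sup>2 * \<bar>1 + V x\<bar>" "norm (w x)"])
        moreover have "norm ((\<omega>\<^sup>2 * (1 + V x)) *\<^sub>R w x) = \<omega>\<^sup>2 * \<bar>1 + V x\<bar> * norm (w x)" by (simp add: abs_mult)
        ultimately show ?case by (simp only: real_norm_def abs_of_nonneg zero_le_power2 mult_nonneg_nonneg)
      qed
    qed
    then show ?thesis unfolding L2_def using m by (intro conjI)
  qed
  have f\<Gamma>: "N \<inter> faces - edge \<subseteq> \<Gamma>"
  proof
    fix x assume "x \<in> N \<inter> faces - edge"
    then show "x \<in> \<Gamma>" using rays_contain_faces[of x] \<Gamma> by auto
  qed
  have Fv: "L2 (lebesgue_on \<Omega>) (\<lambda>x. \<omega>\<^sup>2 *\<^sub>R v x)" by (rule L2_scaleR[OF v2])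
  have "\<exists>G. (\<forall>i. L2 (lebesgue_on \<Omega>) (G i)) \<and>
     (\<forall>K \<psi> i. tf K \<psi> \<longrightarrow> K \<subseteq> N \<longrightarrow> regular_distr \<Omega> (G i) \<psi> = - regular_distr \<Omega> ?u (pd i \<psi>)) \<and>
     (\<forall>K \<psi>. tf K \<psi> \<longrightarrow> K \<subseteq> N \<longrightarrow>
       regular_distr \<Omega> ?F \<psi> = (\<Sum>j\<in>UNIV. stress lam \<mu> j (\<lambda>l. regular_distr \<Omega> ?u (pd l (pd j \<psi>)))))"
  proof (rule weak_transmission_equation[OF v2 w2 Fw Fv eqv eqw f\<Gamma> trace traction])
    fix G
    assume G: "\<And>i. L2 (lebesgue_on \<Omega>) (G i)"
      and Geq: "\<And>K \<psi> i. tf K \<psi> \<Longrightarrow> K \<subseteq> N \<Longrightarrow> regular_distr \<Omega> (G i) \<psi> = - regular_distr \<Omega> ?u (pd i \<psi>)"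
      and Feq: "\<And>K \<psi>. tf K \<psi> \<Longrightarrow> K \<subseteq> N \<Longrightarrow>
       regular_distr \<Omega> ?F \<psi> = (\<Sum>j\<in>UNIV. stress lam \<mu> j (\<lambda>l. regular_distr \<Omega> ?u (pd l (pd j \<psi>))))"
    show ?thesis
    proof (rule exI[of _ G], intro conjI allI impI)
      show "L2 (lebesgue_on \<Omega>) (G i)" for i by (rule G)
      show "regular_distr \<Omega> (G i) \<psi> = - regular_distr \<Omega> ?u (pd i \<psi>)" if "tf K \<psi>" "K \<subseteq> N" for K \<psi> i by (rule Geq[OF that])
      show "regular_distr \<Omega> ?F \<psi> = (\<Sum>j\<in>UNIV. stress lam \<mu> j (\<lambda>l. regular_distr \<Omega> ?u (pd l (pd j \<psi>))))"
        if "tf K \<psi>" "K \<subseteq> N" for K \<psi> by (rule Feq[OF that])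
    qed
  qed
  then obtain G where G: "\<forall>i. L2 (lebesgue_on \<Omega>) (G i)"
    and Geq: "\<forall>K \<psi> i. tf K \<psi> \<longrightarrow> K \<subseteq> N \<longrightarrow> regular_distr \<Omega> (G i) \<psi> = - regular_distr \<Omega> ?u (pd i \<psi>)"
    and Feq: "\<forall>K \<psi>. tf K \<psi> \<longrightarrow> K \<subseteq> N \<longrightarrow>
       regular_distr \<Omega> ?F \<psi> = (\<Sum>j\<in>UNIV. stress lam \<mu> j (\<lambda>l. regular_distr \<Omega> ?u (pd l (pd j \<psi>))))"
    by (elim exE conjE)
  note cv = holder_imp_continuous_on[OF hv a] holder_imp_continuous_on[OF hw a]
  note bv = hv[unfolded holder_def, THEN conjunct1] hw[unfolded holder_def, THEN conjunct1]
  have eru: "edge_regular (\<lambda>x. ?u x $ i)" for i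
    by (rule edge_regular_component[OF hu[unfolded holder1_def, THEN conjunct2, THEN conjunct1] hu[unfolded holder1_def, THEN conjunct1]])
  have F: "?F = (\<lambda>x. \<omega>\<^sup>2 *\<^sub>R ((1 + V x) *\<^sub>R w x) - \<omega>\<^sup>2 *\<^sub>R v x)" by (simp only: scaleR_scaleR)
  have erF: "edge_regular (\<lambda>x. ?F x $ i)" for i
  proof (rule edge_regular_component)
    show "continuous_on ?K ?F" unfolding F by (intro continuous_on_diff continuous_on_scaleR continuous_on_const cv)
    show "bounded (?F ` ?K)" unfolding F by (intro bounded_minus_comp bounded_scaleR_comp bv)
  qed
  have u2: "L2 (lebesgue_on \<Omega>) ?u" by (rule L2_diff[OF v2 w2])
  have F2: "L2 (lebesgue_on \<Omega>) ?F" by (rule L2_diff[OF Fw Fv])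
  \<comment> \<open>The curl argument integrates along the edge, so the values of the difference are
    needed on the whole edge and not only at the given point.\<close>
  have u0: "?u (ept t) = 0" if "\<bar>t\<bar> < M" for t by (rule edge_value_zero[OF u2 G[rule_format] _ eru that]) (rule Geq[rule_format])
  have xM: "\<bar>x\<^sub>c\<bar> < M" using xc by auto
  have F0: "(\<omega>\<^sup>2 * (1 + V (ept x\<^sub>c))) *\<^sub>R w (ept x\<^sub>c) - \<omega>\<^sup>2 *\<^sub>R v (ept x\<^sub>c) = 0"
    by (rule edge_source_zero[OF u2 F2 Feq eru erF u0 xM])
  have vw: "v (ept x\<^sub>c) = w (ept x\<^sub>c)" using u0[OF xM] by simp
  have "(\<omega>\<^sup>2 * V (ept x\<^sub>c)) *\<^sub>R w (ept x\<^sub>c) = (\<omega>\<^sup>2 * (1 + V (ept x\<^sub>c))) *\<^sub>R w (ept x\<^sub>c) - \<omega>\<^sup>2 *\<^sub>R w (ept x\<^sub>c)"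
    by (simp only: distrib_left scaleR_add_left mult_1_right add_diff_cancel_left')
  also have "\<dots> = 0" using F0 by (simp only: vw)
  finally have "(\<omega>\<^sup>2 * V (ept x\<^sub>c)) *\<^sub>R w (ept x\<^sub>c) = 0" .
  then have "w (ept x\<^sub>c) = 0" using \<omega> V0 by simp
  then show ?thesis using vw by simp
qed

end

theorem corollary3p3:
  fixes lam \<mu> \<omega> h M \<theta>\<^sub>m \<theta>\<^sub>M \<alpha> x\<^sub>c :: real
    and \<Omega> \<Gamma> :: "(real^3) set"
    and V :: "real^3 \<Rightarrow> real"
    and v w :: "real^3 \<Rightarrow> complex^3"
  assumes "\<mu> > 0" and "3 * lam + 2 * \<mu> > 0"
    and "lipschitz_domain \<Omega>" and "bounded \<Omega>" and "connected (- closure \<Omega>)" and "0 \<in> frontier \<Omega>"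
    and "h > 0" and "M > 0"
    and "- pi < \<theta>\<^sub>m" and "\<theta>\<^sub>m < \<theta>\<^sub>M" and "\<theta>\<^sub>M < pi" and "\<theta>\<^sub>M - \<theta>\<^sub>m \<noteq> pi"
    and "cyl (ball 0 h) {-M<..<M} \<inter> \<Omega> = cyl (sector \<theta>\<^sub>m \<theta>\<^sub>M \<inter> ball 0 h) {-M<..<M}"
    and "\<omega> > 0"
    and "Linfty (lebesgue_on \<Omega>) V" and "\<not> (AE x in lebesgue_on \<Omega>. V x = 0)"
    and "H1 \<Omega> v" and "H1 \<Omega> w"
    and "distr_eq_on \<Omega>
           (\<lambda>\<phi>. distr_lame lam \<mu> (regular_distr \<Omega> v) \<phi>
                + regular_distr \<Omega> (\<lambda>x. \<omega>\<^sup>2 *\<^sub>R v x) \<phi>) (\<lambda>\<phi>. 0)"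
    and "distr_eq_on \<Omega>
           (\<lambda>\<phi>. distr_lame lam \<mu> (regular_distr \<Omega> w) \<phi>
                + regular_distr \<Omega> (\<lambda>x. (\<omega>\<^sup>2 * (1 + V x)) *\<^sub>R w x) \<phi>) (\<lambda>\<phi>. 0)"
    and "openin (top_of_set (frontier \<Omega>)) \<Gamma>"
    and "cyl (ray \<theta>\<^sub>m \<inter> ball 0 h) {-M<..<M} \<subseteq> \<Gamma>"
    and "cyl (ray \<theta>\<^sub>M \<inter> ball 0 h) {-M<..<M} \<subseteq> \<Gamma>"
    and "trace_eq_on \<Omega> \<Gamma> w v"
    and "traction_eq_on \<Omega> \<Gamma> lam \<mu> v w"
    and "0 < \<alpha>" and "\<alpha> < 1"
    and "holder \<alpha> (cyl (closure (sector \<theta>\<^sub>m \<theta>\<^sub>M \<inter> ball 0 h)) {-M..M}) v"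
    and "holder \<alpha> (cyl (closure (sector \<theta>\<^sub>m \<theta>\<^sub>M \<inter> ball 0 h)) {-M..M}) (\<lambda>x. (1 + V x) *\<^sub>R w x)"
    and "holder1 \<alpha> (cyl (closure (sector \<theta>\<^sub>m \<theta>\<^sub>M \<inter> ball 0 h)) {-M..M}) (\<lambda>x. v x - w x)"
    and "x\<^sub>c \<in> {-M<..<M}"
    and "\<exists>\<epsilon>>0. continuous_on
           (cyl (closure (sector \<theta>\<^sub>m \<theta>\<^sub>M \<inter> ball 0 h)) {-M..M} \<inter> ball (vector [0, 0, x\<^sub>c]) \<epsilon>) V"
    and "V (vector [0, 0, x\<^sub>c]) \<noteq> 0"
  shows "v (vector [0, 0, x\<^sub>c]) = 0 \<and> w (vector [0, 0, x\<^sub>c]) = 0"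
proof -
  have "open \<Omega>" using assms(3) by (simp add: lipschitz_domain_def)
  then have "wedge_domain \<theta>\<^sub>m \<theta>\<^sub>M \<Omega> h M"
    by (intro wedge_domain.intro wedge.intro wedge_domain_axioms.intro assms(4,7-13))
  from wedge_domain.edge_vanishing[OF this assms(15,17-20,22-26,28-31,14)] show ?thesis
    using assms(33) unfolding ept_def by blast
qed

end
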